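(* There exist absolute constants $C_1>0$ and $C_2>0$ such that the following holds. Let $r\ge 2$ and let $p=d_0,\ d_1,\dots,d_{r-1},\ d_r=q$ be positive integers with $d_{r-1}=d_1$ and $d_i\ge \max\{p,q\}$ for all $i=1,\dots,r-1$. Let $G_1,\dots,G_r$ be independent Gaussian random matrices, where $G_i$ is a $d_{i-1}\times d_i$ matrix with i.i.d. $N(0,1)$ entries, and let $$A_r=\left(\frac{1}{\sqrt{d_1}}G_1\right)\left(\frac{1}{\sqrt{d_2}}G_2\right)\cdots\left(\frac{1}{\sqrt{d_{r-1}}}G_{r-1}\right)\left(\frac{1}{\sqrt{d_1}}G_r\right),\qquad A_1=\frac{1}{\sqrt{d_1}}G',$$ where $G'$ is a $p\times q$ matrix with i.i.d. $N(0,1)$ entries. (a) It holds that $$d_{TV}(A_r,A_1)\le C_1\sum_{i=1}^{r-1}\sqrt{\frac{pq}{d_i}}.$$ (b) If moreover $$\sum_{j=1}^{r-1}\frac{1}{d_j}\ \ge\ \frac{C_2^{\,r}}{\max\{p,q\}^{1/2}\,\min\{p,q\}^{3/2}},$$ then $d_{TV}(A_r,A_1)\ge \frac23$.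
   Context: For random matrices $X,Y$ of the same size, $d_{TV}(X,Y)=\sup_S|\Pr(X\in S)-\Pr(Y\in S)|$, the supremum being over Borel sets $S$, denotes the total variation distance between their distributions. "Absolute constant" means a constant independent of $r,p,q$ and all the $d_i$. *)

theory Defs
  imports "HOL-Probability.Probability" "Jordan_Normal_Form.Matrix"
begin

text \<open>
  The Borel sets of \<open>p \<times> q\<close> real matrices: matrices are identified with functions on the finite
  set of index pairs, and the Borel sets of that finite-dimensional real space are the sets of the
  product of the Borel sigma-algebras of the coordinates. (As a measure, this is the zero measure;
  only its space and its sigma-algebra are used.)
\<close>

definition mat_borel :: "nat \<Rightarrow> nat \<Rightarrow> real mat measure" where
  "mat_borel p q = vimage_algebra (carrier_mat p q)
     (\<lambda>A. \<lambda>x\<in>{..<p} \<times> {..<q}. A $$ x) (\<Pi>\<^sub>M x\<in>{..<p} \<times> {..<q}. borel)"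

text \<open>
  Total variation distance between a random variable \<open>X\<close> on \<open>M\<close> and a random variable \<open>Y\<close> on \<open>N\<close>,
  both with values in the measurable space \<open>B\<close>.
\<close>

definition tv_dist :: "'c measure \<Rightarrow> 'a measure \<Rightarrow> ('a \<Rightarrow> 'c) \<Rightarrow> 'b measure \<Rightarrow> ('b \<Rightarrow> 'c) \<Rightarrow> real" where
  "tv_dist B M X N Y =
     (SUP S\<in>sets B. \<bar>measure M (X -` S \<inter> space M) - measure N (Y -` S \<inter> space N)\<bar>)"

text \<open>
  The canonical probability space of a family of independent \<open>N(0,1)\<close> variables indexed by \<open>I\<close>;
  the variable with index \<open>i\<close> is the coordinate \<open>\<lambda>\<omega>. \<omega> i\<close>. The total variation distance depends
  only on the distributions, so nothing depends on this choice of the sample space: see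
  \<open>tv_dist_gaussian_chain\<close> below, which covers arbitrary probability spaces.
\<close>

definition std_gaussian :: "'i set \<Rightarrow> ('i \<Rightarrow> real) measure" where
  "std_gaussian I = (\<Pi>\<^sub>M i\<in>I. density lborel (\<lambda>x. ennreal (std_normal_density x)))"

text \<open>The index \<open>(i, a, b)\<close> stands for the entry \<open>(a, b)\<close> of the \<open>i\<close>-th factor (\<open>i\<close> from 1; rows and columns from 0).\<close>

definition chain_index :: "nat \<Rightarrow> (nat \<Rightarrow> nat) \<Rightarrow> (nat \<times> nat \<times> nat) set" where
  "chain_index r d = (SIGMA i:{1..r}. {..<d (i - 1)} \<times> {..<d i})"

definition chain_factor :: "(nat \<Rightarrow> nat) \<Rightarrow> (nat \<times> nat \<times> nat \<Rightarrow> real) \<Rightarrow> nat \<Rightarrow> real mat" where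
  "chain_factor d \<omega> i = mat (d (i - 1)) (d i) (\<lambda>(a, b). \<omega> (i, a, b))"

text \<open>
  The last factor is scaled with \<open>d 1\<close> (not with \<open>d r\<close>):
  \<open>(G\<^sub>1 / \<surd>d\<^sub>1) (G\<^sub>2 / \<surd>d\<^sub>2) \<dots> (G\<^bsub>r-1\<^esub> / \<surd>d\<^bsub>r-1\<^esub>) (G\<^sub>r / \<surd>d\<^sub>1)\<close>.
\<close>

definition chain_product :: "nat \<Rightarrow> (nat \<Rightarrow> nat) \<Rightarrow> (nat \<Rightarrow> real mat) \<Rightarrow> real mat" where
  "chain_product r d G =
     foldr (\<lambda>i B. ((1 / sqrt (real (d i))) \<cdot>\<^sub>m G i) * B) [1..<r] ((1 / sqrt (real (d 1))) \<cdot>\<^sub>m G r)"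

definition scaled_gaussian :: "nat \<Rightarrow> nat \<Rightarrow> nat \<Rightarrow> (nat \<times> nat \<Rightarrow> real) \<Rightarrow> real mat" where
  "scaled_gaussian p q n \<omega> = (1 / sqrt (real n)) \<cdot>\<^sub>m mat p q \<omega>"


section \<open>Independence of the sample space\<close>

lemma space_mat_borel [simp]: "space (mat_borel p q) = carrier_mat p q"
  by (simp add: mat_borel_def)

lemma measurable_mat_borelI:
  assumes "\<And>\<omega>. \<omega> \<in> space M \<Longrightarrow> f \<omega> \<in> carrier_mat p q"
    and "\<And>a b. a < p \<Longrightarrow> b < q \<Longrightarrow> (\<lambda>\<omega>. f \<omega> $$ (a, b)) \<in> borel_measurable M"
  shows "f \<in> measurable M (mat_borel p q)"
  unfolding mat_borel_def
proof (rule measurable_vimage_algebra2)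
  show "f \<in> space M \<rightarrow> carrier_mat p q" using assms(1) by auto
  show "(\<lambda>\<omega>. \<lambda>x\<in>{..<p} \<times> {..<q}. f \<omega> $$ x) \<in> measurable M (\<Pi>\<^sub>M x\<in>{..<p} \<times> {..<q}. borel)"
    using assms(2) by (intro measurable_restrict) auto
qed

lemma measurable_mat_borel_entry:
  assumes f: "f \<in> measurable M (mat_borel p q)" and ab: "a < p" "b < q"
  shows "(\<lambda>\<omega>. f \<omega> $$ (a, b)) \<in> borel_measurable M"
proof -
  let ?h = "\<lambda>A::real mat. \<lambda>x\<in>{..<p} \<times> {..<q}. A $$ x"
  have h: "?h \<in> measurable (mat_borel p q) (\<Pi>\<^sub>M x\<in>{..<p} \<times> {..<q}. borel)"
    unfolding mat_borel_def by (rule measurable_vimage_algebra1) (auto simp: space_PiM)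
  have "(\<lambda>\<omega>. ?h (f \<omega>) (a, b)) \<in> borel_measurable M"
    using ab by (intro measurable_compose[OF measurable_compose[OF f h]] measurable_component_singleton) auto
  then show ?thesis using ab by simp
qed

lemma measurable_mat_borel_carrier:
  assumes "f \<in> measurable M (mat_borel p q)" "\<omega> \<in> space M"
  shows "f \<omega> \<in> carrier_mat p q"
  using measurable_space[OF assms] by simp

lemma measurable_mat_borel_mult:
  assumes f: "f \<in> measurable M (mat_borel p n)" and g: "g \<in> measurable M (mat_borel n q)"
  shows "(\<lambda>\<omega>. f \<omega> * g \<omega>) \<in> measurable M (mat_borel p q)"
proof (rule measurable_mat_borelI)
  fix \<omega> assume "\<omega> \<in> space M"
  then show "f \<omega> * g \<omega> \<in> carrier_mat p q"
    using measurable_mat_borel_carrier[OF f] measurable_mat_borel_carrier[OF g]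
    by (intro mult_carrier_mat) auto
next
  fix a b assume ab: "a < p" "b < q"
  have eq: "(f \<omega> * g \<omega>) $$ (a, b) = (\<Sum>k<n. f \<omega> $$ (a, k) * g \<omega> $$ (k, b))" if "\<omega> \<in> space M" for \<omega>
    using measurable_mat_borel_carrier[OF f that] measurable_mat_borel_carrier[OF g that] ab
    by (auto simp: scalar_prod_def lessThan_atLeast0)
  have "(\<lambda>\<omega>. \<Sum>k<n. f \<omega> $$ (a, k) * g \<omega> $$ (k, b)) \<in> borel_measurable M"
    using ab measurable_mat_borel_entry[OF f] measurable_mat_borel_entry[OF g]
    by (intro borel_measurable_sum borel_measurable_times) auto
  then show "(\<lambda>\<omega>. (f \<omega> * g \<omega>) $$ (a, b)) \<in> borel_measurable M"
    by (subst measurable_cong[OF eq])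
qed

lemma measurable_mat_borel_smult:
  assumes f: "f \<in> measurable M (mat_borel p q)"
  shows "(\<lambda>\<omega>. c \<cdot>\<^sub>m f \<omega>) \<in> measurable M (mat_borel p q)"
proof (rule measurable_mat_borelI)
  fix \<omega> assume "\<omega> \<in> space M"
  then show "c \<cdot>\<^sub>m f \<omega> \<in> carrier_mat p q"
    using measurable_mat_borel_carrier[OF f] by auto
next
  fix a b assume ab: "a < p" "b < q"
  have eq: "(c \<cdot>\<^sub>m f \<omega>) $$ (a, b) = c * f \<omega> $$ (a, b)" if "\<omega> \<in> space M" for \<omega>
    using measurable_mat_borel_carrier[OF f that] ab by auto
  have "(\<lambda>\<omega>. c * f \<omega> $$ (a, b)) \<in> borel_measurable M"
    using measurable_mat_borel_entry[OF f ab] by simp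
  then show "(\<lambda>\<omega>. (c \<cdot>\<^sub>m f \<omega>) $$ (a, b)) \<in> borel_measurable M"
    by (subst measurable_cong[OF eq])
qed

lemma measurable_chain_product:
  assumes r: "r \<ge> 1"
    and G: "\<And>i. 1 \<le> i \<Longrightarrow> i \<le> r \<Longrightarrow> (\<lambda>\<omega>. G \<omega> i) \<in> measurable M (mat_borel (d (i - 1)) (d i))"
  shows "(\<lambda>\<omega>. chain_product r d (G \<omega>)) \<in> measurable M (mat_borel (d 0) (d r))"
proof -
  let ?F = "\<lambda>m \<omega>. foldr (\<lambda>i B. ((1 / sqrt (real (d i))) \<cdot>\<^sub>m G \<omega> i) * B) [m..<r]
      ((1 / sqrt (real (d 1))) \<cdot>\<^sub>m G \<omega> r)"
  have "1 \<le> m \<Longrightarrow> ?F m \<in> measurable M (mat_borel (d (m - 1)) (d r))" if "m \<le> r" for m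
    using that
  proof (induction m rule: inc_induct)
    case base
    then show ?case using G[of r] by (simp add: measurable_mat_borel_smult)
  next
    case (step m)
    have "?F (Suc m) \<in> measurable M (mat_borel (d m) (d r))" using step by simp
    moreover have "(\<lambda>\<omega>. (1 / sqrt (real (d m))) \<cdot>\<^sub>m G \<omega> m) \<in> measurable M (mat_borel (d (m - 1)) (d m))"
      using G[of m] step by (intro measurable_mat_borel_smult) auto
    ultimately show ?case
      using measurable_mat_borel_mult step by (simp add: upt_conv_Cons)
  qed
  from this[of 1] r show ?thesis by (simp add: chain_product_def)
qed

lemma measurable_chain_std_gaussian:
  assumes r: "r \<ge> 1"
  shows "(\<lambda>\<omega>. chain_product r d (chain_factor d \<omega>))
    \<in> measurable (std_gaussian (chain_index r d)) (mat_borel (d 0) (d r))"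
proof (rule measurable_chain_product[OF r])
  fix i assume i: "1 \<le> i" "i \<le> r"
  show "(\<lambda>\<omega>. chain_factor d \<omega> i)
      \<in> measurable (std_gaussian (chain_index r d)) (mat_borel (d (i - 1)) (d i))"
  proof (rule measurable_mat_borelI)
    fix a b assume ab: "a < d (i - 1)" "b < d i"
    have "(\<lambda>\<omega>. \<omega> (i, a, b)) \<in> borel_measurable (std_gaussian (chain_index r d))"
      unfolding std_gaussian_def
      using i ab measurable_component_singleton[of "(i, a, b)" "chain_index r d"
          "\<lambda>_. density lborel (\<lambda>x. ennreal (std_normal_density x))"]
      by (simp add: chain_index_def)
    then show "(\<lambda>\<omega>. chain_factor d \<omega> i $$ (a, b)) \<in> borel_measurable (std_gaussian (chain_index r d))"
      using ab by (simp add: chain_factor_def)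
  qed (simp add: chain_factor_def)
qed

lemma measurable_scaled_std_gaussian:
  "scaled_gaussian p q n \<in> measurable (std_gaussian ({..<p} \<times> {..<q})) (mat_borel p q)"
proof -
  have "mat p q \<in> measurable (std_gaussian ({..<p} \<times> {..<q})) (mat_borel p q)"
  proof (rule measurable_mat_borelI)
    fix a b assume ab: "a < p" "b < q"
    have "(\<lambda>\<omega>. \<omega> (a, b)) \<in> borel_measurable (std_gaussian ({..<p} \<times> {..<q}))"
      unfolding std_gaussian_def
      using ab measurable_component_singleton[of "(a, b)" "{..<p} \<times> {..<q}"
          "\<lambda>_. density lborel (\<lambda>x. ennreal (std_normal_density x))"]
      by simp
    then show "(\<lambda>\<omega>. mat p q \<omega> $$ (a, b)) \<in> borel_measurable (std_gaussian ({..<p} \<times> {..<q}))"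
      using ab by simp
  qed simp
  from measurable_mat_borel_smult[OF this] show ?thesis
    unfolding scaled_gaussian_def .
qed

lemma (in prob_space) indep_std_normal_distr:
  assumes I: "I \<noteq> {}"
    and indep: "indep_vars (\<lambda>_. borel) X I"
    and X: "\<And>i. i \<in> I \<Longrightarrow> distributed M lborel (X i) (\<lambda>x. ennreal (std_normal_density x))"
  shows "(\<lambda>\<omega>. \<lambda>i\<in>I. X i \<omega>) \<in> measurable M (std_gaussian I)"
    and "distr M (std_gaussian I) (\<lambda>\<omega>. \<lambda>i\<in>I. X i \<omega>) = std_gaussian I"
proof -
  have rv: "X i \<in> borel_measurable M" if "i \<in> I" for i
    using distributed_measurable[OF X[OF that]] by simp
  have S: "sets (std_gaussian I) = sets (\<Pi>\<^sub>M i\<in>I. borel)"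
    unfolding std_gaussian_def by (intro sets_PiM_cong) auto
  show "(\<lambda>\<omega>. \<lambda>i\<in>I. X i \<omega>) \<in> measurable M (std_gaussian I)"
    unfolding measurable_cong_sets[OF refl S] using rv by (intro measurable_restrict) auto
  have "distr M (std_gaussian I) (\<lambda>\<omega>. \<lambda>i\<in>I. X i \<omega>) = distr M (\<Pi>\<^sub>M i\<in>I. borel) (\<lambda>\<omega>. \<lambda>i\<in>I. X i \<omega>)"
    using S by (intro distr_cong) auto
  also have "\<dots> = (\<Pi>\<^sub>M i\<in>I. distr M borel (X i))"
    using indep_vars_iff_distr_eq_PiM'[OF I, where M' = "\<lambda>_. borel" and X = X] rv indep by auto
  also have "\<dots> = std_gaussian I"
    unfolding std_gaussian_def
  proof (rule PiM_cong)
    fix i assume "i \<in> I"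
    have "distr M borel (X i) = distr M lborel (X i)" by (intro distr_cong) auto
    then show "distr M borel (X i) = density lborel (\<lambda>x. ennreal (std_normal_density x))"
      using distributed_distr_eq_density[OF X[OF \<open>i \<in> I\<close>]] by simp
  qed simp
  finally show "distr M (std_gaussian I) (\<lambda>\<omega>. \<lambda>i\<in>I. X i \<omega>) = std_gaussian I" .
qed

lemma (in prob_space) indep_std_normal_measure_vimage:
  assumes I: "I \<noteq> {}"
    and indep: "indep_vars (\<lambda>_. borel) X I"
    and X: "\<And>i. i \<in> I \<Longrightarrow> distributed M lborel (X i) (\<lambda>x. ennreal (std_normal_density x))"
    and f: "f \<in> measurable (std_gaussian I) B"
    and g: "\<And>\<omega>. g \<omega> = f (\<lambda>i\<in>I. X i \<omega>)"
    and S: "S \<in> sets B"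
  shows "measure M (g -` S \<inter> space M) = measure (std_gaussian I) (f -` S \<inter> space (std_gaussian I))"
proof -
  note m = indep_std_normal_distr[OF I indep X, simplified]
  have "measure (std_gaussian I) (f -` S \<inter> space (std_gaussian I)) =
      measure (distr M (std_gaussian I) (\<lambda>\<omega>. \<lambda>i\<in>I. X i \<omega>)) (f -` S \<inter> space (std_gaussian I))"
    using m by simp
  also have "\<dots> = measure M ((\<lambda>\<omega>. \<lambda>i\<in>I. X i \<omega>) -` (f -` S \<inter> space (std_gaussian I)) \<inter> space M)"
    using m(1) measurable_sets[OF f S] by (rule measure_distr)
  also have "(\<lambda>\<omega>. \<lambda>i\<in>I. X i \<omega>) -` (f -` S \<inter> space (std_gaussian I)) \<inter> space M = g -` S \<inter> space M"
    using measurable_space[OF m(1)] by (auto simp: g)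
  finally show ?thesis by simp
qed

text \<open>
  Whatever the underlying probability spaces, i.i.d. standard normal entries give the same total
  variation distance as the canonical sample spaces.
\<close>

lemma tv_dist_gaussian_chain:
  fixes X :: "nat \<times> nat \<times> nat \<Rightarrow> 'a \<Rightarrow> real" and Y :: "nat \<times> nat \<Rightarrow> 'b \<Rightarrow> real"
  assumes M: "prob_space M" and N: "prob_space N"
    and r: "r \<ge> 1" and pos: "\<And>i. i \<le> r \<Longrightarrow> d i > 0"
    and X: "prob_space.indep_vars M (\<lambda>_. borel) X (chain_index r d)"
      "\<And>i. i \<in> chain_index r d \<Longrightarrow> distributed M lborel (X i) (\<lambda>x. ennreal (std_normal_density x))"
    and Y: "prob_space.indep_vars N (\<lambda>_. borel) Y ({..<d 0} \<times> {..<d r})"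
      "\<And>i. i \<in> {..<d 0} \<times> {..<d r} \<Longrightarrow>
         distributed N lborel (Y i) (\<lambda>x. ennreal (std_normal_density x))"
  shows "tv_dist (mat_borel (d 0) (d r))
      M (\<lambda>\<omega>. chain_product r d (\<lambda>i. mat (d (i - 1)) (d i) (\<lambda>(a, b). X (i, a, b) \<omega>)))
      N (\<lambda>\<omega>. (1 / sqrt (real (d 1))) \<cdot>\<^sub>m mat (d 0) (d r) (\<lambda>x. Y x \<omega>)) =
    tv_dist (mat_borel (d 0) (d r))
      (std_gaussian (chain_index r d)) (\<lambda>\<omega>. chain_product r d (chain_factor d \<omega>))
      (std_gaussian ({..<d 0} \<times> {..<d r})) (scaled_gaussian (d 0) (d r) (d 1))"
proof -
  have ne1: "chain_index r d \<noteq> {}"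
  proof -
    have "(1, 0, 0) \<in> chain_index r d" using r pos[of 0] pos[of 1] by (auto simp: chain_index_def)
    then show ?thesis by auto
  qed
  have ne2: "{..<d 0} \<times> {..<d r} \<noteq> {}" using pos[of 0] pos[of r] by auto
  have g1: "chain_product r d (\<lambda>i. mat (d (i - 1)) (d i) (\<lambda>(a, b). X (i, a, b) \<omega>)) =
      chain_product r d (chain_factor d (\<lambda>i\<in>chain_index r d. X i \<omega>))" for \<omega>
  proof -
    have "mat (d (i - 1)) (d i) (\<lambda>(a, b). X (i, a, b) \<omega>) =
        chain_factor d (\<lambda>i\<in>chain_index r d. X i \<omega>) i" if "1 \<le> i" "i \<le> r" for i
      using that by (intro eq_matI) (auto simp: chain_factor_def chain_index_def)
    then show ?thesis
      unfolding chain_product_def using r by (intro foldr_cong) auto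
  qed
  have g2: "(1 / sqrt (real (d 1))) \<cdot>\<^sub>m mat (d 0) (d r) (\<lambda>x. Y x \<omega>) =
      scaled_gaussian (d 0) (d r) (d 1) (\<lambda>x\<in>{..<d 0} \<times> {..<d r}. Y x \<omega>)" for \<omega>
    unfolding scaled_gaussian_def by (rule eq_matI) auto
  note e1 = prob_space.indep_std_normal_measure_vimage[OF M ne1 X measurable_chain_std_gaussian[OF r] g1]
  note e2 = prob_space.indep_std_normal_measure_vimage[OF N ne2 Y measurable_scaled_std_gaussian g2]
  show ?thesis
    unfolding tv_dist_def by (intro SUP_cong refl) (simp only: e1 e2)
qed

end

theory Submission
  imports Defs
begin

text \<open>
  All random matrices live on one Gaussian space \<open>gauss\<close>, and a bound in total variation is a bound for
  \<open>E f (A\<^sub>r) - E f (A\<^sub>1)\<close>, uniformly in measurable \<open>f\<close> with values in \<open>[0, 1]\<close> (\<open>tv_dist_chain\<close>).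

  \<^bold>\<open>Upper bound.\<close> The factors are removed one at a time, at the cost \<open>O(\<surd>(pq/d\<^sub>i))\<close> each. Two ideas are needed.

  First, comparing the whole \<open>d\<^sub>1 \<times> q\<close> matrix \<open>G\<^sub>2 \<cdots> G\<^sub>r\<close> with a Gaussian matrix would be far too expensive. By
  rotational invariance (\<open>bartlett_decomposition\<close>), \<open>G\<^sub>1\<close> may be replaced by a lower triangular matrix, and a triangular
  matrix with \<open>p\<close> rows only reads the first \<open>p\<close> rows of the other factors. So every comparison is between \<open>p \<times> q\<close>
  matrices (\<open>chain_close\<close>).

  Secondly, the product \<open>W\<close> of a triangular and a Gaussian matrix has to be compared with a Gaussian matrix \<open>Z\<close>, with
  \<open>p \<le> q\<close> after transposition. This is done by bounding the relative entropy. To avoid densities, the bound is stated in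
  its dual form \<open>E f(W) \<le> ln E exp f(Z) + \<kappa>\<close> for bounded \<open>f\<close>, which applied to small multiples of indicators yields the total
  variation bound \<open>O(\<surd>\<kappa>)\<close> (\<open>triangular_close\<close>). Row by row, \<open>W\<close> is a Gaussian vector plus a random combination of the
  earlier rows. The map that adds this combination is completed to a nearly orthogonal transformation of the Gaussian
  space; the first order terms of the change of the Gaussian density then cancel against the Jacobian determinant
  (\<open>gaussian_mixture_gibbs\<close>), and \<open>\<kappa> = O(pq/d)\<close> remains.

  \<^bold>\<open>Lower bound.\<close> Let \<open>S\<close> be the Gram matrix of the first \<open>p\<close> rows of \<open>X = G\<^sub>1 \<cdots> G\<^bsub>r-1\<^esub>\<close>, scaled. Its off-diagonal
  entries have second moment at least \<open>\<sigma> = \<Sum> 1/d\<^sub>i\<close>, whereas a single Gaussian factor corresponds to the identity matrix. The test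
  statistic \<open>cross_stat\<close> is an unbiased estimate of \<open>N\<^sup>2 \<Sum> S\<^sub>i\<^sub>j\<^sup>2\<close> over about \<open>(p/2)\<^sup>2\<close> pairs, where \<open>N\<close> is about \<open>q/2\<close>: each \<open>S\<^sub>i\<^sub>j\<close> is
  estimated from two disjoint groups of \<open>N\<close> columns, and the two estimates are multiplied. Chebyshev's inequality separates the
  two distributions (\<open>second_moment_test\<close>) once the fourth moments of \<open>S\<close> are controlled. The delicate one is
  \<open>E S\<^sub>a\<^sub>b\<^sup>2 S\<^sub>c\<^sub>e\<^sup>2\<close> with four distinct indices: it must not exceed the product of the lower bounds of \<open>E S\<^sub>a\<^sub>b\<^sup>2\<close> and \<open>E S\<^sub>c\<^sub>e\<^sup>2\<close> by more
  than a small relative error. This follows from recursions along the chain, which lose a constant factor in the error terms per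
  step (\<open>prefix_gram_mixed\<close>); hence the factor \<open>C\<^sub>2\<^sup>r\<close> in the condition.
\<close>

section \<open>The Gaussian product space\<close>

text \<open>
  Every index of the type carries a coordinate. Hence no extensionality side conditions arise, and any
  injection between index types transports the measure; matrices and chains of matrices are read off as blocks
  of coordinates.
\<close>

definition gauss :: "('i \<Rightarrow> real) measure" where
  "gauss = (\<Pi>\<^sub>M i\<in>UNIV. std_normal_distribution)"

lemma prob_space_std_normal: "prob_space std_normal_distribution"
  using real_dist_normal_dist by (simp add: real_distribution_def)

lemma sets_gauss [measurable_cong]: "sets (gauss :: ('i \<Rightarrow> real) measure) = sets (\<Pi>\<^sub>M i\<in>UNIV. borel)"
  unfolding gauss_def by (intro sets_PiM_cong) auto

lemma space_gauss [simp]: "space gauss = UNIV"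
  unfolding gauss_def by (simp add: space_PiM)

lemma prob_space_gauss: "prob_space gauss"
  unfolding gauss_def by (intro prob_space_PiM prob_space_std_normal)

interpretation G: prob_space "gauss :: ('i \<Rightarrow> real) measure"
  by (rule prob_space_gauss)

interpretation GG: pair_prob_space "gauss :: ('i \<Rightarrow> real) measure" "gauss :: ('j \<Rightarrow> real) measure" ..

lemma measurable_gauss_coord [measurable]: "(\<lambda>\<omega>. \<omega> i) \<in> borel_measurable gauss"
  using measurable_component_singleton[of i UNIV "\<lambda>_. borel"]
  by (simp add: measurable_cong_sets[OF sets_gauss refl])

lemma measurable_into_gauss:
  assumes "\<And>i. (\<lambda>x. f x i) \<in> borel_measurable M"
  shows "f \<in> measurable M gauss"
proof -
  have "(\<lambda>x. \<lambda>i\<in>UNIV. f x i) \<in> measurable M (\<Pi>\<^sub>M i\<in>UNIV. borel)"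
    using assms by (intro measurable_restrict) auto
  then show ?thesis by (simp add: measurable_cong_sets[OF refl sets_gauss] restrict_def)
qed

text \<open>
  Conditioning on all coordinates outside the range of \<open>h\<close> is expressed by overwriting the
  coordinates in that range with a second, independent sample.
\<close>

definition graft :: "('j \<Rightarrow> 'i) \<Rightarrow> ('i \<Rightarrow> real) \<Rightarrow> ('j \<Rightarrow> real) \<Rightarrow> 'i \<Rightarrow> real" where
  "graft h \<omega> \<zeta> = (\<lambda>i. if i \<in> range h then \<zeta> (inv_into UNIV h i) else \<omega> i)"

lemma graft_image [simp]: "inj h \<Longrightarrow> graft h \<omega> \<zeta> (h j) = \<zeta> j"
  by (simp add: graft_def)

lemma graft_other: "i \<notin> range h \<Longrightarrow> graft h \<omega> \<zeta> i = \<omega> i"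
  by (simp add: graft_def)

lemma measurable_graft [measurable]:
  "(\<lambda>(\<omega>, \<zeta>). graft h \<omega> \<zeta>) \<in> measurable (gauss \<Otimes>\<^sub>M gauss) gauss"
proof (rule measurable_into_gauss)
  fix i
  show "(\<lambda>x. (case x of (\<omega>, \<zeta>) \<Rightarrow> graft h \<omega> \<zeta>) i) \<in> borel_measurable (gauss \<Otimes>\<^sub>M gauss)"
    by (cases "i \<in> range h") (simp_all add: graft_def split_beta)
qed

lemma emeasure_gauss_box:
  assumes "finite J" "\<And>i. i \<in> J \<Longrightarrow> A i \<in> sets borel"
  shows "emeasure gauss {\<omega>. \<forall>i\<in>J. \<omega> i \<in> A i} = (\<Prod>i\<in>J. emeasure std_normal_distribution (A i))"
proof -
  have "prod_emb UNIV (\<lambda>_. std_normal_distribution) J (Pi\<^sub>E J A) = {\<omega>. \<forall>i\<in>J. \<omega> i \<in> A i}"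
    by (auto simp: prod_emb_def space_PiM PiE_iff restrict_def extensional_def)
  then show ?thesis
    unfolding gauss_def using emeasure_PiM_emb[of UNIV "\<lambda>_. std_normal_distribution" J A] assms
    by (simp add: prob_space_std_normal)
qed

lemma sets_gauss_box [measurable]:
  assumes "finite J" "\<And>i. i \<in> J \<Longrightarrow> A i \<in> sets borel"
  shows "{\<omega>. \<forall>i\<in>J. \<omega> i \<in> A i} \<in> sets gauss"
proof -
  have "{\<omega> \<in> space gauss. \<forall>i\<in>J. \<omega> i \<in> A i} \<in> sets gauss"
    using assms by measurable
  then show ?thesis by simp
qed

lemma gauss_eqI:
  fixes P :: "('i \<Rightarrow> real) measure"
  assumes sets: "sets P = sets gauss"
    and eq: "\<And>J A. finite J \<Longrightarrow> (\<And>i. i \<in> J \<Longrightarrow> A i \<in> sets borel) \<Longrightarrow>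
      emeasure P {\<omega>. \<forall>i\<in>J. \<omega> i \<in> A i} = (\<Prod>i\<in>J. emeasure std_normal_distribution (A i))"
  shows "P = gauss"
proof -
  have *: "prod_emb UNIV (\<lambda>_. std_normal_distribution) J (Pi\<^sub>E J A) = {\<omega>. \<forall>i\<in>J. \<omega> i \<in> A i}" for J :: "'i set" and A
    by (auto simp: prod_emb_def space_PiM PiE_iff restrict_def extensional_def)
  have "gauss = P"
    using sets unfolding gauss_def
  proof (intro measure_eqI_PiM_infinite[where M = "\<lambda>_. std_normal_distribution" and I = UNIV])
    fix A :: "'i \<Rightarrow> real set" and J :: "'i set"
    assume "finite J" "\<And>i. i \<in> J \<Longrightarrow> A i \<in> sets std_normal_distribution"
    then show "(\<Pi>\<^sub>M i\<in>UNIV. std_normal_distribution) (prod_emb UNIV (\<lambda>_. std_normal_distribution) J (Pi\<^sub>E J A)) =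
      P (prod_emb UNIV (\<lambda>_. std_normal_distribution) J (Pi\<^sub>E J A))"
      using eq[of J A] emeasure_gauss_box[of J A] unfolding * gauss_def by simp
  next
    show "finite_measure (\<Pi>\<^sub>M i\<in>(UNIV::'i set). std_normal_distribution)"
      using G.finite_measure_axioms unfolding gauss_def .
  qed auto
  then show ?thesis ..
qed

text \<open>
  Both measures agree on finite boxes: the coordinates of a box split into those taken from the first and
  those taken from the second sample.
\<close>

lemma distr_graft:
  fixes h :: "'j \<Rightarrow> 'i"
  assumes h: "inj h"
  shows "distr (gauss \<Otimes>\<^sub>M gauss) gauss (\<lambda>(\<omega>, \<zeta>). graft h \<omega> \<zeta>) = gauss"
proof (rule gauss_eqI)
  fix J :: "'i set" and A :: "'i \<Rightarrow> real set"
  assume J: "finite J" and A: "\<And>i. i \<in> J \<Longrightarrow> A i \<in> sets borel"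
  define J1 where "J1 = J - range h"
  define J2 where "J2 = h -` J"
  have fin: "finite J1" "finite J2"
    using J h unfolding J1_def J2_def by (auto intro: finite_vimageI)
  have J12: "J = J1 \<union> h ` J2" "J1 \<inter> h ` J2 = {}" by (auto simp: J1_def J2_def)
  have B1: "{\<omega>. \<forall>i\<in>J1. \<omega> i \<in> A i} \<in> sets gauss" using A by (intro sets_gauss_box fin) (auto simp: J1_def)
  have B2: "{\<zeta>. \<forall>j\<in>J2. \<zeta> j \<in> A (h j)} \<in> sets gauss" using A by (intro sets_gauss_box fin) (auto simp: J2_def)
  have "emeasure (distr (gauss \<Otimes>\<^sub>M gauss) gauss (\<lambda>(\<omega>, \<zeta>). graft h \<omega> \<zeta>)) {\<omega>. \<forall>i\<in>J. \<omega> i \<in> A i} =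
    emeasure (gauss \<Otimes>\<^sub>M gauss) ((\<lambda>(\<omega>, \<zeta>). graft h \<omega> \<zeta>) -` {\<omega>. \<forall>i\<in>J. \<omega> i \<in> A i} \<inter> space (gauss \<Otimes>\<^sub>M gauss))"
    using J A by (intro emeasure_distr) (auto intro!: sets_gauss_box)
  also have "(\<lambda>(\<omega>, \<zeta>). graft h \<omega> \<zeta>) -` {\<omega>. \<forall>i\<in>J. \<omega> i \<in> A i} \<inter> space (gauss \<Otimes>\<^sub>M gauss) =
      {\<omega>. \<forall>i\<in>J1. \<omega> i \<in> A i} \<times> {\<zeta>. \<forall>j\<in>J2. \<zeta> j \<in> A (h j)}"
  proof -
    have "(\<forall>i\<in>J. graft h \<omega> \<zeta> i \<in> A i) \<longleftrightarrow> (\<forall>i\<in>J1. \<omega> i \<in> A i) \<and> (\<forall>j\<in>J2. \<zeta> j \<in> A (h j))" for \<omega> \<zeta>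
    proof -
      have "(\<forall>i\<in>J. graft h \<omega> \<zeta> i \<in> A i) \<longleftrightarrow>
          (\<forall>i\<in>J1. graft h \<omega> \<zeta> i \<in> A i) \<and> (\<forall>j\<in>J2. graft h \<omega> \<zeta> (h j) \<in> A (h j))"
        unfolding J12(1) by blast
      moreover have "graft h \<omega> \<zeta> i = \<omega> i" if "i \<in> J1" for i
        using that by (auto simp: J1_def graft_other)
      ultimately show ?thesis using h by simp
    qed
    then show ?thesis by (simp add: set_eq_iff space_pair_measure)
  qed
  also have "emeasure (gauss \<Otimes>\<^sub>M gauss) \<dots> =
      (\<Prod>i\<in>J1. emeasure std_normal_distribution (A i)) * (\<Prod>j\<in>J2. emeasure std_normal_distribution (A (h j)))"
  proof -
    have "emeasure gauss {\<omega>. \<forall>i\<in>J1. \<omega> i \<in> A i} = (\<Prod>i\<in>J1. emeasure std_normal_distribution (A i))"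
      using A J12(1) by (intro emeasure_gauss_box fin) auto
    moreover have "emeasure gauss {\<zeta>. \<forall>j\<in>J2. \<zeta> j \<in> A (h j)} = (\<Prod>j\<in>J2. emeasure std_normal_distribution (A (h j)))"
      using A J12(1) by (intro emeasure_gauss_box fin) auto
    ultimately show ?thesis by (simp only: G.emeasure_pair_measure_Times[OF B1 B2])
  qed
  also have "(\<Prod>j\<in>J2. emeasure std_normal_distribution (A (h j))) = (\<Prod>i\<in>h ` J2. emeasure std_normal_distribution (A i))"
    using h by (subst prod.reindex) (auto intro: inj_on_subset)
  also have "(\<Prod>i\<in>J1. emeasure std_normal_distribution (A i)) * \<dots> = (\<Prod>i\<in>J. emeasure std_normal_distribution (A i))"
    unfolding J12(1) using fin J12(2) by (intro prod.union_disjoint[symmetric]) auto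
  finally show "emeasure (distr (gauss \<Otimes>\<^sub>M gauss) gauss (\<lambda>(\<omega>, \<zeta>). graft h \<omega> \<zeta>)) {\<omega>. \<forall>i\<in>J. \<omega> i \<in> A i} =
    (\<Prod>i\<in>J. emeasure std_normal_distribution (A i))" .
qed simp

lemma integrable_graft:
  fixes F :: "('i \<Rightarrow> real) \<Rightarrow> real" and h :: "'j \<Rightarrow> 'i"
  assumes h: "inj h" and F: "integrable gauss F"
  shows "integrable (gauss \<Otimes>\<^sub>M gauss) (\<lambda>(\<omega>, \<zeta>). F (graft h \<omega> \<zeta>))"
proof -
  have "integrable (distr (gauss \<Otimes>\<^sub>M gauss) gauss (\<lambda>(\<omega>, \<zeta>). graft h \<omega> \<zeta>)) F"
    using F by (simp add: distr_graft[OF h])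
  then show ?thesis
    by (subst (asm) integrable_distr_eq) (use F in \<open>auto simp: split_beta'\<close>)
qed

text \<open>
  Fubini's theorem for a block of coordinates, the form in which all conditional expectations are computed.
\<close>

lemma integral_graft:
  fixes F :: "('i \<Rightarrow> real) \<Rightarrow> real" and h :: "'j \<Rightarrow> 'i"
  assumes h: "inj h" and F: "integrable gauss F"
  shows "(\<integral>\<omega>. F \<omega> \<partial>gauss) = (\<integral>\<omega>. (\<integral>\<zeta>. F (graft h \<omega> \<zeta>) \<partial>gauss) \<partial>gauss)" (is ?eq)
    and "integrable gauss (\<lambda>\<omega>. \<integral>\<zeta>. F (graft h \<omega> \<zeta>) \<partial>gauss)" (is ?int)
proof -
  have i: "integrable (gauss \<Otimes>\<^sub>M gauss) (\<lambda>(\<omega>, \<zeta>). F (graft h \<omega> \<zeta>))" by (rule integrable_graft[OF h F])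
  have "(\<integral>\<omega>. F \<omega> \<partial>gauss) = (\<integral>\<omega>. F \<omega> \<partial>distr (gauss \<Otimes>\<^sub>M gauss) gauss (\<lambda>(\<omega>, \<zeta>). graft h \<omega> \<zeta>))"
    by (simp add: distr_graft[OF h])
  also have "\<dots> = (\<integral>x. (case x of (\<omega>, \<zeta>) \<Rightarrow> F (graft h \<omega> \<zeta>)) \<partial>(gauss \<Otimes>\<^sub>M gauss))"
    by (subst integral_distr) (use F in \<open>auto simp: split_beta'\<close>)
  also have "\<dots> = (\<integral>\<omega>. (\<integral>\<zeta>. F (graft h \<omega> \<zeta>) \<partial>gauss) \<partial>gauss)"
    by (rule GG.integral_fst'[OF i, symmetric, simplified])
  finally show ?eq .
  show ?int by (rule GG.integrable_fst'[OF i, simplified])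
qed

lemma distr_reindex:
  fixes h :: "'j \<Rightarrow> 'i"
  assumes h: "inj h"
  shows "distr gauss gauss (\<lambda>\<omega> j. \<omega> (h j)) = gauss"
  using distr_PiM_reindex[of UNIV "\<lambda>_. std_normal_distribution" h UNIV] h prob_space_std_normal
  unfolding gauss_def by (simp add: restrict_def)

lemma measurable_reindex:
  "(\<lambda>\<omega> j. \<omega> (h j)) \<in> measurable gauss gauss"
  by (rule measurable_into_gauss) simp

lemma integral_reindex:
  fixes F :: "('j \<Rightarrow> real) \<Rightarrow> real"
  assumes h: "inj h" and F [measurable]: "F \<in> borel_measurable gauss"
  shows "(\<integral>\<omega>. F (\<lambda>j. \<omega> (h j)) \<partial>gauss) = (\<integral>\<zeta>. F \<zeta> \<partial>gauss)"
  using integral_distr[OF measurable_reindex F, of h] by (simp add: distr_reindex[OF h])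

lemma nn_integral_resample:
  fixes h :: "('i \<Rightarrow> real) \<Rightarrow> ennreal"
  assumes [measurable]: "h \<in> borel_measurable gauss"
  shows "(\<integral>\<^sup>+\<omega>. h \<omega> \<partial>gauss) = (\<integral>\<^sup>+\<omega>. (\<integral>\<^sup>+x. h (fun_upd \<omega> i x) \<partial>std_normal_distribution) \<partial>gauss)"
proof -
  interpret N: prob_space std_normal_distribution by (rule prob_space_std_normal)
  interpret GN: pair_prob_space std_normal_distribution "gauss :: ('i \<Rightarrow> real) measure" ..
  have m: "(\<lambda>(x, \<omega>). fun_upd \<omega> i x) \<in> measurable (std_normal_distribution \<Otimes>\<^sub>M gauss) gauss"
  proof (rule measurable_into_gauss)
    fix j show "(\<lambda>xa. (case xa of (x, \<omega>) \<Rightarrow> fun_upd \<omega> i x) j) \<in> borel_measurable (std_normal_distribution \<Otimes>\<^sub>M gauss)"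
      by (cases "j = i") (simp_all add: split_beta)
  qed
  have "distr (std_normal_distribution \<Otimes>\<^sub>M gauss) gauss (\<lambda>(x, \<omega>). fun_upd \<omega> i x) = gauss"
    using distr_pair_PiM_eq_PiM[of UNIV "\<lambda>_. std_normal_distribution" i] prob_space_std_normal
    unfolding gauss_def by simp
  then have "(\<integral>\<^sup>+\<omega>. h \<omega> \<partial>gauss) = (\<integral>\<^sup>+\<omega>. h \<omega> \<partial>distr (std_normal_distribution \<Otimes>\<^sub>M gauss) gauss (\<lambda>(x, \<omega>). fun_upd \<omega> i x))"
    by simp
  also have "\<dots> = (\<integral>\<^sup>+z. h ((\<lambda>(x, \<omega>). fun_upd \<omega> i x) z) \<partial>(std_normal_distribution \<Otimes>\<^sub>M gauss))"
    by (rule nn_integral_distr[OF m]) simp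
  also have "\<dots> = (\<integral>\<^sup>+\<omega>. (\<integral>\<^sup>+x. h ((\<lambda>(x, \<omega>). fun_upd \<omega> i x) (x, \<omega>)) \<partial>std_normal_distribution) \<partial>gauss)"
    by (rule GN.nn_integral_snd[OF measurable_compose[OF m assms], symmetric])
  finally show ?thesis by simp
qed

section \<open>Functions with moments of all orders\<close>

text \<open>
  The functions with moments of all orders form an algebra, so that polynomials in the coordinates are
  integrable by mere introduction rules.
\<close>

definition all_moments :: "'a measure \<Rightarrow> ('a \<Rightarrow> real) \<Rightarrow> bool" where
  "all_moments M f \<longleftrightarrow> f \<in> borel_measurable M \<and> (\<forall>n. integrable M (\<lambda>x. \<bar>f x\<bar> ^ n))"

lemma all_momentsI:
  "f \<in> borel_measurable M \<Longrightarrow> (\<And>n. integrable M (\<lambda>x. \<bar>f x\<bar> ^ n)) \<Longrightarrow> all_moments M f"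
  unfolding all_moments_def by blast

lemma all_moments_measurable: "all_moments M f \<Longrightarrow> f \<in> borel_measurable M"
  unfolding all_moments_def by blast

lemma all_moments_integrable_power: "all_moments M f \<Longrightarrow> integrable M (\<lambda>x. \<bar>f x\<bar> ^ n)"
  unfolding all_moments_def by blast

lemma all_moments_integrable:
  assumes "all_moments M f"
  shows "integrable M f"
proof (rule Bochner_Integration.integrable_bound[OF all_moments_integrable_power[OF assms, of 1]])
  show "f \<in> borel_measurable M" by (rule all_moments_measurable[OF assms])
qed simp

named_theorems all_moments_intros

lemma power_add_le: "\<bar>a + b\<bar> ^ n \<le> 2 ^ n * (\<bar>a\<bar> ^ n + \<bar>b\<bar> ^ n)" for a b :: real
proof -
  have "\<bar>a + b\<bar> \<le> 2 * max \<bar>a\<bar> \<bar>b\<bar>" by auto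
  then have "\<bar>a + b\<bar> ^ n \<le> (2 * max \<bar>a\<bar> \<bar>b\<bar>) ^ n" by (intro power_mono) auto
  also have "\<dots> \<le> 2 ^ n * (\<bar>a\<bar> ^ n + \<bar>b\<bar> ^ n)"
    by (auto simp: power_mult_distrib max_def)
  finally show ?thesis .
qed

lemma all_moments_add [all_moments_intros]:
  assumes "all_moments M f" "all_moments M g"
  shows "all_moments M (\<lambda>x. f x + g x)"
proof (rule all_momentsI)
  note [measurable] = all_moments_measurable[OF assms(1)] all_moments_measurable[OF assms(2)]
  show "(\<lambda>x. f x + g x) \<in> borel_measurable M" by simp
  fix n
  have "integrable M (\<lambda>x. 2 ^ n * (\<bar>f x\<bar> ^ n + \<bar>g x\<bar> ^ n))"
    by (intro integrable_mult_right Bochner_Integration.integrable_add all_moments_integrable_power assms)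
  then show "integrable M (\<lambda>x. \<bar>f x + g x\<bar> ^ n)"
    by (rule Bochner_Integration.integrable_bound) (simp_all add: power_add_le)
qed

lemma all_moments_mult [all_moments_intros]:
  assumes "all_moments M f" "all_moments M g"
  shows "all_moments M (\<lambda>x. f x * g x)"
proof (rule all_momentsI)
  note [measurable] = all_moments_measurable[OF assms(1)] all_moments_measurable[OF assms(2)]
  show "(\<lambda>x. f x * g x) \<in> borel_measurable M" by simp
  fix n
  have i: "integrable M (\<lambda>x. \<bar>f x\<bar> ^ (2 * n) + \<bar>g x\<bar> ^ (2 * n))"
    by (rule Bochner_Integration.integrable_add[OF all_moments_integrable_power all_moments_integrable_power, OF assms])
  have "\<bar>f x * g x\<bar> ^ n \<le> \<bar>f x\<bar> ^ (2 * n) + \<bar>g x\<bar> ^ (2 * n)" for x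
  proof -
    have "2 * (\<bar>f x\<bar> ^ n * \<bar>g x\<bar> ^ n) \<le> (\<bar>f x\<bar> ^ n)\<^sup>2 + (\<bar>g x\<bar> ^ n)\<^sup>2"
      using sum_squares_bound[of "\<bar>f x\<bar> ^ n" "\<bar>g x\<bar> ^ n"] by (simp add: mult.assoc)
    moreover have "0 \<le> \<bar>f x\<bar> ^ n * \<bar>g x\<bar> ^ n" by simp
    ultimately have "\<bar>f x\<bar> ^ n * \<bar>g x\<bar> ^ n \<le> (\<bar>f x\<bar> ^ n)\<^sup>2 + (\<bar>g x\<bar> ^ n)\<^sup>2" by linarith
    then show ?thesis by (simp add: abs_mult power_mult_distrib power_mult[symmetric] mult.commute)
  qed
  then show "integrable M (\<lambda>x. \<bar>f x * g x\<bar> ^ n)"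
    by (intro Bochner_Integration.integrable_bound[OF i]) auto
qed

lemma all_moments_uminus [all_moments_intros]:
  "all_moments M f \<Longrightarrow> all_moments M (\<lambda>x. - f x)"
  unfolding all_moments_def by simp

lemma all_moments_abs [all_moments_intros]:
  "all_moments M f \<Longrightarrow> all_moments M (\<lambda>x. \<bar>f x\<bar>)"
  unfolding all_moments_def by (simp add: borel_measurable_abs)

lemma all_moments_diff [all_moments_intros]:
  assumes "all_moments M f" "all_moments M g"
  shows "all_moments M (\<lambda>x. f x - g x)"
  using all_moments_add[OF assms(1) all_moments_uminus[OF assms(2)]] by simp

lemma all_moments_const [all_moments_intros]:
  "all_moments (gauss :: ('i \<Rightarrow> real) measure) (\<lambda>x. c)"
  by (rule all_momentsI) simp_all

lemma all_moments_sum [all_moments_intros]: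
  assumes "\<And>i. i \<in> I \<Longrightarrow> all_moments gauss (f i)"
  shows "all_moments (gauss :: ('i \<Rightarrow> real) measure) (\<lambda>x. \<Sum>i\<in>I. f i x)"
  using assms by (induction I rule: infinite_finite_induct) (auto intro!: all_moments_intros)

lemma all_moments_power [all_moments_intros]:
  "all_moments (gauss :: ('i \<Rightarrow> real) measure) f \<Longrightarrow> all_moments gauss (\<lambda>x. f x ^ n)"
  by (induction n) (auto intro!: all_moments_intros)

lemma all_moments_divide [all_moments_intros]:
  "all_moments (gauss :: ('i \<Rightarrow> real) measure) f \<Longrightarrow> all_moments gauss (\<lambda>x. f x / c)"
  using all_moments_mult[OF _ all_moments_const[of "1 / c"], of f] by simp

lemma distr_gauss_coord: "distr gauss std_normal_distribution (\<lambda>\<omega>. \<omega> i) = std_normal_distribution"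
proof -
  interpret product_prob_space "\<lambda>_::'a. std_normal_distribution" UNIV
    by (intro product_prob_spaceI prob_space_std_normal)
  show ?thesis unfolding gauss_def using PiM_component[of i] by simp
qed

lemma all_moments_coord [all_moments_intros]: "all_moments gauss (\<lambda>\<omega>. \<omega> i)"
proof (rule all_momentsI)
  fix n
  have "integrable std_normal_distribution (\<lambda>x. x ^ n)"
    by (rule integrable_std_normal_distribution_moment)
  then have "integrable std_normal_distribution (\<lambda>x. \<bar>x\<bar> ^ n)"
    by (subst integrable_abs_iff[symmetric]) (auto simp: power_abs[symmetric] intro: integrable_abs)
  then have "integrable (distr gauss std_normal_distribution (\<lambda>\<omega>. \<omega> i)) (\<lambda>x. \<bar>x\<bar> ^ n)"
    by (simp add: distr_gauss_coord)
  then show "integrable gauss (\<lambda>\<omega>. \<bar>\<omega> i\<bar> ^ n)"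
    by (subst (asm) integrable_distr_eq) auto
qed simp

lemma expectation_coord:
  fixes f :: "real \<Rightarrow> real"
  assumes [measurable]: "f \<in> borel_measurable borel"
  shows "(\<integral>\<omega>. f (\<omega> i) \<partial>gauss) = (\<integral>x. f x \<partial>std_normal_distribution)"
  by (subst distr_gauss_coord[of i, symmetric], subst integral_distr) auto

lemma moment_coord_even: "(\<integral>\<omega>. \<omega> i ^ (2 * k) \<partial>gauss) = fact (2 * k) / (2 ^ k * fact k)"
  by (subst expectation_coord) (auto simp: std_normal_distribution_even_moments(1))

lemma moment_coord_odd: "odd n \<Longrightarrow> (\<integral>\<omega>. \<omega> i ^ n \<partial>gauss) = 0"
  by (subst expectation_coord) (auto simp: integral_std_normal_distribution_moment_odd)

lemma moment_coord [simp]: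
  "(\<integral>\<omega>. \<omega> i \<partial>gauss) = 0" "(\<integral>\<omega>. \<omega> i ^ 2 \<partial>gauss) = 1" "(\<integral>\<omega>. \<omega> i ^ 3 \<partial>gauss) = 0"
  "(\<integral>\<omega>. \<omega> i ^ 4 \<partial>gauss) = 3" "(\<integral>\<omega>. \<omega> i ^ 5 \<partial>gauss) = 0" "(\<integral>\<omega>. \<omega> i ^ 6 \<partial>gauss) = 15"
  "(\<integral>\<omega>. \<omega> i ^ 7 \<partial>gauss) = 0" "(\<integral>\<omega>. \<omega> i ^ 8 \<partial>gauss) = 105"
  using moment_coord_odd[of 1 i] moment_coord_odd[of 3 i] moment_coord_odd[of 5 i] moment_coord_odd[of 7 i]
    moment_coord_even[of i 1] moment_coord_even[of i 2] moment_coord_even[of i 3] moment_coord_even[of i 4]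
  by (simp_all add: fact_numeral)

text \<open>
  The hypothesis on \<open>graft\<close> says that \<open>F\<close> does not read the coordinates in the range
  of \<open>h\<close>; the two factors are then independent.
\<close>

lemma expectation_indep:
  fixes F :: "('i \<Rightarrow> real) \<Rightarrow> real" and H :: "('j \<Rightarrow> real) \<Rightarrow> real"
  assumes h: "inj h" and F: "all_moments gauss F" and H: "all_moments gauss (\<lambda>\<omega>. H (\<lambda>j. \<omega> (h j)))"
    and Hm: "H \<in> borel_measurable gauss"
    and indep: "\<And>\<omega> \<zeta>. F (graft h \<omega> \<zeta>) = F \<omega>"
  shows "(\<integral>\<omega>. F \<omega> * H (\<lambda>j. \<omega> (h j)) \<partial>gauss) = (\<integral>\<omega>. F \<omega> \<partial>gauss) * (\<integral>\<omega>. H (\<lambda>j. \<omega> (h j)) \<partial>gauss)"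
proof -
  have "(\<integral>\<omega>. F \<omega> * H (\<lambda>j. \<omega> (h j)) \<partial>gauss) =
      (\<integral>\<omega>. (\<integral>\<zeta>. F (graft h \<omega> \<zeta>) * H (\<lambda>j. graft h \<omega> \<zeta> (h j)) \<partial>gauss) \<partial>gauss)"
    by (intro integral_graft(1)[OF h] all_moments_integrable all_moments_intros F H)
  also have "\<dots> = (\<integral>\<omega>. F \<omega> \<partial>gauss) * (\<integral>\<zeta>. H \<zeta> \<partial>gauss)"
    using h by (simp add: indep)
  also have "(\<integral>\<zeta>. H \<zeta> \<partial>gauss) = (\<integral>\<omega>. H (\<lambda>j. \<omega> (h j)) \<partial>gauss)"
    using integral_reindex[OF h Hm] by simp
  finally show ?thesis .
qed

lemma prob_gauss_UNIV [simp]: "measure gauss UNIV = 1"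
  using G.prob_space by simp

lemma moment_cross:
  assumes "i \<noteq> j"
  shows "(\<integral>\<omega>. \<omega> i * \<omega> j \<partial>gauss) = 0"
proof -
  have "inj (\<lambda>_::unit. j)" by (simp add: inj_on_def)
  from expectation_indep[OF this, of "\<lambda>\<omega>. \<omega> i" "\<lambda>\<zeta>. \<zeta> ()"] show ?thesis
    using assms by (simp add: all_moments_intros graft_other)
qed

lemma moment_cross_if: "(\<integral>\<omega>. \<omega> i * \<omega> j \<partial>gauss) = (if i = j then 1 else 0)"
  using moment_cross[of i j] moment_coord(2)[of i] by (cases "i = j") (simp_all add: power2_eq_square)

lemma expectation_linear_form_sq:
  assumes "finite F"
  shows "(\<integral>\<omega>. (\<Sum>n\<in>F. c n * \<omega> n)\<^sup>2 \<partial>gauss) = (\<Sum>n\<in>F. (c n)\<^sup>2)"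
proof -
  have "(\<integral>\<omega>. (\<Sum>n\<in>F. c n * \<omega> n)\<^sup>2 \<partial>gauss) = (\<integral>\<omega>. (\<Sum>n\<in>F. \<Sum>m\<in>F. (c n * c m) * (\<omega> n * \<omega> m)) \<partial>gauss)"
    by (intro Bochner_Integration.integral_cong refl)
      (simp add: power2_eq_square sum_product algebra_simps)
  also have "\<dots> = (\<Sum>n\<in>F. \<Sum>m\<in>F. (c n * c m) * (if n = m then 1 else 0))"
    by (subst Bochner_Integration.integral_sum, intro all_moments_integrable all_moments_intros,
        intro sum.cong refl, subst Bochner_Integration.integral_sum, intro all_moments_integrable all_moments_intros)
      (simp add: moment_cross_if)
  also have "\<dots> = (\<Sum>n\<in>F. (c n)\<^sup>2)"
    using assms by (simp add: power2_eq_square if_distrib sum.delta cong: if_cong)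
  finally show ?thesis .
qed

section \<open>Quasi-invariant maps\<close>

definition energy :: "'i set \<Rightarrow> ('i \<Rightarrow> real) \<Rightarrow> real" where
  "energy A \<omega> = (\<Sum>i\<in>A. (\<omega> i)\<^sup>2)"

lemma measurable_energy [measurable]: "energy A \<in> borel_measurable gauss"
  unfolding energy_def by measurable

text \<open>
  The change of variables formula relative to the Gaussian density. For a diffeomorphism of the coordinates in
  \<open>A\<close> whose Jacobian determinant has constant absolute value \<open>J\<close>, the weight is the
  determinant times the quotient of the Gaussian densities at \<open>T \<omega>\<close> and at
  \<open>\<omega>\<close>. Stated as an integral identity, the property needs no derivatives and is stable
  under composition.
\<close>

definition quasi_invariant :: "'i set \<Rightarrow> (('i \<Rightarrow> real) \<Rightarrow> ('i \<Rightarrow> real)) \<Rightarrow> real \<Rightarrow> bool" where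
  "quasi_invariant A T J \<longleftrightarrow> T \<in> measurable gauss gauss \<and> J > 0 \<and>
     (\<forall>h \<in> borel_measurable gauss.
        (\<integral>\<^sup>+\<omega>. h (T \<omega>) * ennreal (J * exp ((energy A \<omega> - energy A (T \<omega>)) / 2)) \<partial>gauss) =
        (\<integral>\<^sup>+\<omega>. (h \<omega> :: ennreal) \<partial>gauss))"

lemma quasi_invariant_id: "quasi_invariant A (\<lambda>\<omega>. \<omega>) 1"
  by (simp add: quasi_invariant_def)

lemma quasi_invariant_comp:
  assumes 1: "quasi_invariant A T1 J1" and 2: "quasi_invariant A T2 J2"
  shows "quasi_invariant A (\<lambda>\<omega>. T1 (T2 \<omega>)) (J1 * J2)"
  unfolding quasi_invariant_def
proof safe
  have m: "T1 \<in> measurable gauss gauss" "T2 \<in> measurable gauss gauss" and J: "J1 > 0" "J2 > 0"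
    using 1 2 by (auto simp: quasi_invariant_def)
  show "(\<lambda>\<omega>. T1 (T2 \<omega>)) \<in> measurable gauss gauss" using m by (rule measurable_compose[rotated])
  show "J1 * J2 > 0" using J by simp
  fix h :: "('a \<Rightarrow> real) \<Rightarrow> ennreal" assume h: "h \<in> borel_measurable gauss"
  define g where "g \<omega> = h (T1 \<omega>) * ennreal (J1 * exp ((energy A \<omega> - energy A (T1 \<omega>)) / 2))" for \<omega>
  note [measurable] = h measurable_compose[OF m(1) h] measurable_compose[OF m(1) measurable_energy]
  have g: "g \<in> borel_measurable gauss" unfolding g_def by measurable
  have "(\<integral>\<^sup>+\<omega>. h (T1 (T2 \<omega>)) * ennreal (J1 * J2 * exp ((energy A \<omega> - energy A (T1 (T2 \<omega>))) / 2)) \<partial>gauss) =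
      (\<integral>\<^sup>+\<omega>. g (T2 \<omega>) * ennreal (J2 * exp ((energy A \<omega> - energy A (T2 \<omega>)) / 2)) \<partial>gauss)"
  proof (intro nn_integral_cong)
    fix \<omega>
    have "J1 * J2 * exp ((energy A \<omega> - energy A (T1 (T2 \<omega>))) / 2) =
      (J1 * exp ((energy A (T2 \<omega>) - energy A (T1 (T2 \<omega>))) / 2)) * (J2 * exp ((energy A \<omega> - energy A (T2 \<omega>)) / 2))"
      by (simp add: mult_exp_exp add_divide_distrib[symmetric])
    then show "h (T1 (T2 \<omega>)) * ennreal (J1 * J2 * exp ((energy A \<omega> - energy A (T1 (T2 \<omega>))) / 2)) =
       g (T2 \<omega>) * ennreal (J2 * exp ((energy A \<omega> - energy A (T2 \<omega>)) / 2))"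
      unfolding g_def using J by (simp add: ennreal_mult ac_simps)
  qed
  also have "\<dots> = (\<integral>\<^sup>+\<omega>. g \<omega> \<partial>gauss)" using 2 g by (simp add: quasi_invariant_def)
  also have "\<dots> = (\<integral>\<^sup>+\<omega>. h \<omega> \<partial>gauss)" unfolding g_def using 1 h by (simp add: quasi_invariant_def)
  finally show "(\<integral>\<^sup>+\<omega>. h (T1 (T2 \<omega>)) * ennreal (J1 * J2 * exp ((energy A \<omega> - energy A (T1 (T2 \<omega>))) / 2)) \<partial>gauss) =
     (\<integral>\<^sup>+\<omega>. h \<omega> \<partial>gauss)" .
qed

lemma nn_integral_std_normal:
  assumes [measurable]: "g \<in> borel_measurable borel"
  shows "(\<integral>\<^sup>+x. g x \<partial>std_normal_distribution) = (\<integral>\<^sup>+x. g x * ennreal (std_normal_density x) \<partial>lborel)"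
  by (subst nn_integral_density) (auto simp: mult.commute)

lemma measurable_fun_upd_gauss:
  assumes [measurable]: "f \<in> measurable M gauss" "g \<in> borel_measurable M"
  shows "(\<lambda>x. fun_upd (f x) i (g x)) \<in> measurable M gauss"
proof (rule measurable_into_gauss)
  fix j
  have "(\<lambda>x. f x j) \<in> borel_measurable M"
    using measurable_compose[OF assms(1) measurable_gauss_coord] .
  then show "(\<lambda>x. fun_upd (f x) i (g x) j) \<in> borel_measurable M"
    by (cases "j = i") simp_all
qed

text \<open>
  The substitution rule on the real line, applied to one coordinate while all others are fixed. All
  transformations used later are composed of such updates.
\<close>

lemma quasi_invariant_update:
  assumes A: "finite A" "i \<in> A" and c: "c \<noteq> 0"
    and b [measurable]: "b \<in> borel_measurable gauss" and indep: "\<And>\<omega> x. b (fun_upd \<omega> i x) = b \<omega>"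
  shows "quasi_invariant A (\<lambda>\<omega>. fun_upd \<omega> i (c * \<omega> i + b \<omega>)) \<bar>c\<bar>"
  unfolding quasi_invariant_def
proof safe
  let ?U = "\<lambda>\<omega>. fun_upd \<omega> i (c * \<omega> i + b \<omega>)"
  show U: "?U \<in> measurable gauss gauss"
    by (intro measurable_fun_upd_gauss) simp_all
  show "\<bar>c\<bar> > 0" using c by simp
  fix h :: "('a \<Rightarrow> real) \<Rightarrow> ennreal" assume h [measurable]: "h \<in> borel_measurable gauss"
  note [measurable] = measurable_compose[OF U h]
  have E: "energy A \<omega> - energy A (?U \<omega>) = (\<omega> i)\<^sup>2 - (c * \<omega> i + b \<omega>)\<^sup>2" for \<omega>
    using A by (simp add: energy_def sum.remove[of A i])
  have "(\<integral>\<^sup>+\<omega>. h (?U \<omega>) * ennreal (\<bar>c\<bar> * exp ((energy A \<omega> - energy A (?U \<omega>)) / 2)) \<partial>gauss) =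
      (\<integral>\<^sup>+\<omega>. h (?U \<omega>) * ennreal (\<bar>c\<bar> * exp (((\<omega> i)\<^sup>2 - (c * \<omega> i + b \<omega>)\<^sup>2) / 2)) \<partial>gauss)"
    by (simp add: E)
  also have "\<dots> = (\<integral>\<^sup>+\<omega>. (\<integral>\<^sup>+x. h (?U (fun_upd \<omega> i x)) *
      ennreal (\<bar>c\<bar> * exp (((fun_upd \<omega> i x i)\<^sup>2 - (c * fun_upd \<omega> i x i + b (fun_upd \<omega> i x))\<^sup>2) / 2)) \<partial>std_normal_distribution) \<partial>gauss)"
    by (rule nn_integral_resample) measurable
  also have "\<dots> = (\<integral>\<^sup>+\<omega>. (\<integral>\<^sup>+x. h (fun_upd \<omega> i (c * x + b \<omega>)) *
      ennreal (\<bar>c\<bar> * exp ((x\<^sup>2 - (c * x + b \<omega>)\<^sup>2) / 2)) \<partial>std_normal_distribution) \<partial>gauss)"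
    by (simp add: indep)
  also have "\<dots> = (\<integral>\<^sup>+\<omega>. (\<integral>\<^sup>+x. h (fun_upd \<omega> i x) \<partial>std_normal_distribution) \<partial>gauss)"
  proof (rule nn_integral_cong)
    fix \<omega>
    have m: "(\<lambda>x. h (fun_upd \<omega> i x)) \<in> borel_measurable borel"
      by (intro measurable_compose[OF _ h] measurable_fun_upd_gauss) simp_all
    have m2: "(\<lambda>x. h (fun_upd \<omega> i (b \<omega> + c * x))) \<in> borel_measurable borel"
      by (rule measurable_compose[OF _ m]) simp
    have [measurable]: "std_normal_density \<in> borel_measurable borel" by simp
    note [measurable] = m m2[unfolded add.commute[of "b \<omega>"]]
    have "(\<integral>\<^sup>+x. h (fun_upd \<omega> i (c * x + b \<omega>)) *
        ennreal (\<bar>c\<bar> * exp ((x\<^sup>2 - (c * x + b \<omega>)\<^sup>2) / 2)) \<partial>std_normal_distribution) =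
      (\<integral>\<^sup>+x. h (fun_upd \<omega> i (c * x + b \<omega>)) *
        ennreal (\<bar>c\<bar> * exp ((x\<^sup>2 - (c * x + b \<omega>)\<^sup>2) / 2)) * ennreal (std_normal_density x) \<partial>lborel)"
      by (rule nn_integral_std_normal) measurable
    also have "\<dots> = (\<integral>\<^sup>+x. ennreal \<bar>c\<bar> * (h (fun_upd \<omega> i (b \<omega> + c * x)) * ennreal (std_normal_density (b \<omega> + c * x))) \<partial>lborel)"
    proof (intro nn_integral_cong)
      fix x
      have "\<bar>c\<bar> * exp ((x\<^sup>2 - (c * x + b \<omega>)\<^sup>2) / 2) * std_normal_density x = \<bar>c\<bar> * std_normal_density (b \<omega> + c * x)"
        by (simp add: std_normal_density_def add.commute mult_exp_exp diff_divide_distrib)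
      then have "ennreal (\<bar>c\<bar> * exp ((x\<^sup>2 - (c * x + b \<omega>)\<^sup>2) / 2)) * ennreal (std_normal_density x) =
          ennreal \<bar>c\<bar> * ennreal (std_normal_density (b \<omega> + c * x))"
        using c by (simp add: ennreal_mult[symmetric])
      then show "h (fun_upd \<omega> i (c * x + b \<omega>)) * ennreal (\<bar>c\<bar> * exp ((x\<^sup>2 - (c * x + b \<omega>)\<^sup>2) / 2)) * ennreal (std_normal_density x) =
         ennreal \<bar>c\<bar> * (h (fun_upd \<omega> i (b \<omega> + c * x)) * ennreal (std_normal_density (b \<omega> + c * x)))"
        by (simp add: mult.assoc mult.left_commute add.commute)
    qed
    also have "\<dots> = ennreal \<bar>c\<bar> * (\<integral>\<^sup>+x. (h (fun_upd \<omega> i (b \<omega> + c * x)) * ennreal (std_normal_density (b \<omega> + c * x))) \<partial>lborel)"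
    proof (rule nn_integral_cmult)
      have "(\<lambda>x. ennreal (std_normal_density (b \<omega> + c * x))) \<in> borel_measurable borel"
        by (intro measurable_compose[OF _ measurable_ennreal] measurable_compose[of "\<lambda>x. b \<omega> + c * x" borel borel std_normal_density]) simp_all
      with m2 show "(\<lambda>x. h (fun_upd \<omega> i (b \<omega> + c * x)) * ennreal (std_normal_density (b \<omega> + c * x))) \<in> borel_measurable lborel"
        by simp
    qed
    also have "\<dots> = (\<integral>\<^sup>+x. h (fun_upd \<omega> i x) * ennreal (std_normal_density x) \<partial>lborel)"
      using nn_integral_real_affine[of "\<lambda>x. h (fun_upd \<omega> i x) * ennreal (std_normal_density x)" c "b \<omega>"] c by simp
    also have "\<dots> = (\<integral>\<^sup>+x. h (fun_upd \<omega> i x) \<partial>std_normal_distribution)"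
      by (rule nn_integral_std_normal[symmetric]) measurable
    finally show "(\<integral>\<^sup>+x. h (fun_upd \<omega> i (c * x + b \<omega>)) *
        ennreal (\<bar>c\<bar> * exp ((x\<^sup>2 - (c * x + b \<omega>)\<^sup>2) / 2)) \<partial>std_normal_distribution) =
        (\<integral>\<^sup>+x. h (fun_upd \<omega> i x) \<partial>std_normal_distribution)" .
  qed
  also have "\<dots> = (\<integral>\<^sup>+\<omega>. h \<omega> \<partial>gauss)" by (rule nn_integral_resample[symmetric]) measurable
  finally show "(\<integral>\<^sup>+\<omega>. h (?U \<omega>) * ennreal (\<bar>c\<bar> * exp ((energy A \<omega> - energy A (?U \<omega>)) / 2)) \<partial>gauss) = (\<integral>\<^sup>+\<omega>. h \<omega> \<partial>gauss)" .
qed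

text \<open>
  An entropy bound without entropies: \<open>(E energy (T \<omega>) - E energy \<omega>) / 2 - ln J\<close>
  plays the role of the relative entropy of the law of \<open>T \<omega>\<close> with respect to the Gaussian
  measure, and the inequality is the easy half of the Gibbs variational principle. It is Jensen's inequality
  for the logarithm, applied to the density \<open>V / C\<close> below in the form \<open>ln x \<le> x -
  1\<close>.
\<close>

lemma gibbs_inequality:
  fixes f :: "('i \<Rightarrow> real) \<Rightarrow> real"
  assumes T: "quasi_invariant A T J" and A: "finite A"
    and f [measurable]: "f \<in> borel_measurable gauss" and bound: "\<And>\<omega>. \<bar>f \<omega>\<bar> \<le> c"
    and mom: "integrable gauss (\<lambda>\<omega>. energy A (T \<omega>))"
  shows "(\<integral>\<omega>. f (T \<omega>) \<partial>gauss) \<le> ln (\<integral>\<omega>. exp (f \<omega>) \<partial>gauss) - ln J +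
    ((\<integral>\<omega>. energy A (T \<omega>) \<partial>gauss) - real (card A)) / 2"
proof -
  have Tm: "T \<in> measurable gauss gauss" and J: "J > 0" using T by (auto simp: quasi_invariant_def)
  note [measurable] = measurable_compose[OF Tm f] measurable_compose[OF Tm measurable_energy]
  have iE: "integrable gauss (energy A)" and EE: "(\<integral>\<omega>. energy A \<omega> \<partial>gauss) = real (card A)"
  proof -
    show "integrable gauss (energy A)" unfolding energy_def
      by (intro all_moments_integrable all_moments_intros)
    show "(\<integral>\<omega>. energy A \<omega> \<partial>gauss) = real (card A)" unfolding energy_def
      by (subst Bochner_Integration.integral_sum) (intro all_moments_integrable all_moments_intros, simp)
  qed
  have ef: "integrable gauss (\<lambda>\<omega>. exp (f \<omega>))"
    by (rule G.integrable_const_bound[of _ "exp c"]) (use bound in \<open>auto simp: abs_le_iff\<close>)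
  define C where "C = (\<integral>\<omega>. exp (f \<omega>) \<partial>gauss)"
  have "exp (- c) \<le> C"
  proof -
    have "(\<integral>\<omega>. exp (- c) \<partial>(gauss :: ('i \<Rightarrow> real) measure)) \<le> C"
      unfolding C_def using ef bound by (intro integral_mono) (auto simp: abs_le_iff minus_le_iff)
    then show ?thesis by (simp add: G.prob_space)
  qed
  then have C: "C > 0" using exp_gt_zero[of "- c"] by linarith
  \<comment> \<open>The weighted exponential has the same total mass as \<open>exp f\<close>, by quasi-invariance.\<close>
  define V where "V \<omega> = exp (f (T \<omega>)) * (J * exp ((energy A \<omega> - energy A (T \<omega>)) / 2))" for \<omega>
  have Vm [measurable]: "V \<in> borel_measurable gauss" unfolding V_def by measurable
  have V: "V \<omega> > 0" for \<omega> using J by (simp add: V_def)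
  have "(\<integral>\<^sup>+\<omega>. ennreal (V \<omega>) \<partial>gauss) = (\<integral>\<^sup>+\<omega>. ennreal (exp (f (T \<omega>))) * ennreal (J * exp ((energy A \<omega> - energy A (T \<omega>)) / 2)) \<partial>gauss)"
    unfolding V_def using J by (simp add: ennreal_mult)
  also have "\<dots> = (\<integral>\<^sup>+\<omega>. ennreal (exp (f \<omega>)) \<partial>gauss)"
    using T unfolding quasi_invariant_def by (auto dest!: bspec[of _ _ "\<lambda>\<omega>. ennreal (exp (f \<omega>))"])
  also have "\<dots> = ennreal C" unfolding C_def by (rule nn_integral_eq_integral[OF ef]) simp
  finally have VC: "(\<integral>\<^sup>+\<omega>. ennreal (V \<omega>) \<partial>gauss) = ennreal C" .
  have iV: "integrable gauss V" using VC V by (intro integrableI_nn_integral_finite[of _ _ C]) (auto simp: less_imp_le)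
  have EV: "(\<integral>\<omega>. V \<omega> \<partial>gauss) = C"
    using VC V C by (subst integral_eq_nn_integral) (auto simp: less_imp_le)
  have ifT: "integrable gauss (\<lambda>\<omega>. f (T \<omega>))"
    by (rule G.integrable_const_bound[of _ c]) (use bound in auto)
  have le: "f (T \<omega>) \<le> ln C - ln J + (energy A (T \<omega>) - energy A \<omega>) / 2 + (V \<omega> / C - 1)" for \<omega>
  proof -
    have "ln (V \<omega> / C) \<le> V \<omega> / C - 1" using V C by (intro ln_le_minus_one) auto
    moreover have "ln (V \<omega> / C) = f (T \<omega>) + ln J + (energy A \<omega> - energy A (T \<omega>)) / 2 - ln C"
      unfolding V_def using J C by (simp add: ln_div ln_mult)
    ultimately show ?thesis by (simp add: field_simps)
  qed
  have "(\<integral>\<omega>. f (T \<omega>) \<partial>gauss) \<le> (\<integral>\<omega>. ln C - ln J + (energy A (T \<omega>) - energy A \<omega>) / 2 + (V \<omega> / C - 1) \<partial>gauss)"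
    using le by (intro integral_mono ifT Bochner_Integration.integrable_add Bochner_Integration.integrable_diff
        integrable_divide_zero mom iE iV) auto
  also have "\<dots> = ln C - ln J + ((\<integral>\<omega>. energy A (T \<omega>) \<partial>gauss) - real (card A)) / 2"
    using mom iE iV EV C by (simp add: G.prob_space EE)
  finally show ?thesis by (simp add: C_def)
qed

section \<open>Gaussian mixtures\<close>

lemma sum_lessThan_add: "(\<Sum>n<q + m. g n) = (\<Sum>n<q. g n) + (\<Sum>j<m. g (q + j))" for g :: "nat \<Rightarrow> real"
  by (induction m) (simp_all add: algebra_simps)

definition shear :: "nat \<Rightarrow> (nat \<Rightarrow> real) \<Rightarrow> nat \<Rightarrow> (nat \<Rightarrow> real) \<Rightarrow> nat \<Rightarrow> real" where
  "shear i b K \<omega> = (\<lambda>n. if n < K then \<omega> n + b n * \<omega> i else \<omega> n)"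

lemma quasi_invariant_shear:
  assumes "K \<le> i" "i < N"
  shows "quasi_invariant {..<N} (shear i b K) 1"
  using assms(1)
proof (induction K)
  case 0
  then show ?case using quasi_invariant_id[of "{..<N}"] by (simp add: shear_def)
next
  case (Suc K)
  have "quasi_invariant {..<N} (\<lambda>\<omega>. fun_upd \<omega> K (1 * \<omega> K + b K * \<omega> i)) 1"
    using quasi_invariant_update[of "{..<N}" K 1 "\<lambda>\<omega>. b K * \<omega> i"] Suc.prems assms(2) by simp
  from quasi_invariant_comp[OF this Suc.IH]
  have "quasi_invariant {..<N} (\<lambda>\<omega>. fun_upd (shear i b K \<omega>) K (shear i b K \<omega> K + b K * shear i b K \<omega> i)) 1"
    using Suc.prems by simp
  moreover have "(\<lambda>\<omega>. fun_upd (shear i b K \<omega>) K (shear i b K \<omega> K + b K * shear i b K \<omega> i)) = shear i b (Suc K)"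
    using Suc.prems by (auto simp: shear_def fun_eq_iff)
  ultimately show ?case by simp
qed

definition scale :: "real \<Rightarrow> nat \<Rightarrow> (nat \<Rightarrow> real) \<Rightarrow> nat \<Rightarrow> real" where
  "scale s K \<omega> = (\<lambda>n. if n < K then s * \<omega> n else \<omega> n)"

lemma quasi_invariant_scale:
  assumes "K \<le> N" "s \<noteq> 0"
  shows "quasi_invariant {..<N} (scale s K) (\<bar>s\<bar> ^ K)"
  using assms(1)
proof (induction K)
  case 0
  then show ?case using quasi_invariant_id[of "{..<N}"] by (simp add: scale_def)
next
  case (Suc K)
  have "quasi_invariant {..<N} (\<lambda>\<omega>. fun_upd \<omega> K (s * \<omega> K + (\<lambda>_. 0) \<omega>)) \<bar>s\<bar>"
    using Suc.prems assms(2) by (intro quasi_invariant_update) auto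
  from quasi_invariant_comp[OF this Suc.IH]
  have "quasi_invariant {..<N} (\<lambda>\<omega>. fun_upd (scale s K \<omega>) K (s * scale s K \<omega> K)) (\<bar>s\<bar> * \<bar>s\<bar> ^ K)"
    using Suc.prems by simp
  moreover have "(\<lambda>\<omega>. fun_upd (scale s K \<omega>) K (s * scale s K \<omega> K)) = scale s (Suc K)"
    using Suc.prems by (auto simp: scale_def fun_eq_iff)
  ultimately show ?case by simp
qed

text \<open>
  Coordinates below \<open>q\<close> form a vector \<open>x\<close>, coordinates \<open>q + l\<close> scalars
  \<open>y\<^sub>l\<close>. The map composes, for \<open>l = 0, \<dots>, j - 1\<close>, the steps \<open>(x,
  y\<^sub>l) \<mapsto> (x + y\<^sub>l B\<^sub>l, y\<^sub>l - \<langle>B\<^sub>l, x\<rangle>)\<close>, which to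
  first order in \<open>B\<^sub>l\<close> are rotations.
\<close>

definition exchange :: "nat \<Rightarrow> (nat \<Rightarrow> nat \<Rightarrow> real) \<Rightarrow> nat \<Rightarrow> (nat \<Rightarrow> real) \<Rightarrow> nat \<Rightarrow> real" where
  "exchange q B j \<omega> = (\<lambda>n. if n < q then \<omega> n + (\<Sum>l<j. \<omega> (q + l) * B l n)
     else if n < q + j then \<omega> n - (\<Sum>k<q. B (n - q) k * (\<omega> k + (\<Sum>l<n - q. \<omega> (q + l) * B l k)))
     else \<omega> n)"

text \<open>
  Each step is the shear \<open>x \<mapsto> x + y B\<close> followed by \<open>y \<mapsto> (1 + |B|\<^sup>2) y
  - \<langle>B, x\<rangle>\<close>. The factor \<open>1 + |B|\<^sup>2\<close> undoes the effect of the shear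
  on the inner product and is the Jacobian determinant.
\<close>

lemma quasi_invariant_exchange:
  assumes "j \<le> m"
  shows "quasi_invariant {..<q + m} (exchange q B j) (\<Prod>l<j. 1 + (\<Sum>k<q. (B l k)\<^sup>2))"
  using assms
proof (induction j)
  case 0
  have "exchange q B 0 = (\<lambda>\<omega>. \<omega>)" by (auto simp: exchange_def fun_eq_iff)
  then show ?case using quasi_invariant_id[of "{..<q + m}"] by simp
next
  case (Suc j)
  define s where "s = 1 + (\<Sum>k<q. (B j k)\<^sup>2)"
  have s: "s > 0" unfolding s_def by (intro add_pos_nonneg sum_nonneg) auto
  let ?U = "\<lambda>\<omega>. fun_upd \<omega> (q + j) (s * \<omega> (q + j) + - (\<Sum>k<q. B j k * \<omega> k))"
  have U: "quasi_invariant {..<q + m} ?U \<bar>s\<bar>"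
  proof (rule quasi_invariant_update)
    show "(\<lambda>\<omega>. - (\<Sum>k<q. B j k * \<omega> k)) \<in> borel_measurable gauss" by measurable
  qed (use Suc.prems s in auto)
  have "quasi_invariant {..<q + m} (shear (q + j) (B j) q) 1"
    using Suc.prems by (intro quasi_invariant_shear) auto
  from quasi_invariant_comp[OF U quasi_invariant_comp[OF this Suc.IH]]
  have "quasi_invariant {..<q + m} (\<lambda>\<omega>. ?U (shear (q + j) (B j) q (exchange q B j \<omega>)))
    (\<Prod>l<Suc j. 1 + (\<Sum>k<q. (B l k)\<^sup>2))"
    using Suc.prems s by (simp add: s_def mult.commute)
  moreover have "(\<lambda>\<omega>. ?U (shear (q + j) (B j) q (exchange q B j \<omega>))) = exchange q B (Suc j)"
  proof (intro ext)
    fix \<omega> :: "nat \<Rightarrow> real" and n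
    let ?X = "\<lambda>k. \<omega> k + (\<Sum>l<j. \<omega> (q + l) * B l k)"
    let ?e = "shear (q + j) (B j) q (exchange q B j \<omega>)"
    have e1: "?e k = ?X k + B j k * \<omega> (q + j)" if "k < q" for k
      using that by (simp add: shear_def exchange_def)
    have e2: "?e (q + j) = \<omega> (q + j)" by (simp add: shear_def exchange_def)
    have "(\<Sum>k<q. B j k * ?e k) = (\<Sum>k<q. B j k * ?X k) + (\<Sum>k<q. (B j k)\<^sup>2) * \<omega> (q + j)"
    proof -
      have "(\<Sum>k<q. B j k * ?e k) = (\<Sum>k<q. B j k * (?X k + B j k * \<omega> (q + j)))"
        by (intro sum.cong refl arg_cong2[where f = "(*)"] e1) simp
      then show ?thesis by (simp add: sum_distrib_right sum.distrib distrib_left power2_eq_square mult.assoc)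
    qed
    then have e3: "s * ?e (q + j) + - (\<Sum>k<q. B j k * ?e k) = \<omega> (q + j) - (\<Sum>k<q. B j k * ?X k)"
      unfolding e2 s_def by (simp add: algebra_simps)
    consider "n < q" | "q \<le> n" "n < q + j" | "n = q + j" | "n > q + j" by linarith
    then show "?U ?e n = exchange q B (Suc j) \<omega> n"
    proof cases
      case 1
      then have "?U ?e n = ?e n" by simp
      also have "\<dots> = ?X n + B j n * \<omega> (q + j)" using 1 by (rule e1)
      also have "\<dots> = exchange q B (Suc j) \<omega> n" using 1 by (simp add: exchange_def)
      finally show ?thesis .
    next
      case 2
      then have "?U ?e n = ?e n" by simp
      then show ?thesis using 2 by (simp add: shear_def exchange_def)
    next
      case 3
      then have "?U ?e n = \<omega> (q + j) - (\<Sum>k<q. B j k * ?X k)" using e3 by simp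
      then show ?thesis using 3 by (simp add: exchange_def)
    next
      case 4
      then have "?U ?e n = ?e n" by simp
      then show ?thesis using 4 by (simp add: shear_def exchange_def)
    qed
  qed
  ultimately show ?case by simp
qed

lemma ln_one_plus_lower: "s - s\<^sup>2 / 2 \<le> ln (1 + s)" if "s \<ge> 0" for s :: real
proof -
  have "\<exists>z. z > 0 \<and> z < s \<and> ln (1 + s) - s + s\<^sup>2 / 2 - (ln (1 + 0) - 0 + 0\<^sup>2 / 2) = (s - 0) * (1 / (1 + z) - 1 + z)" if "s > 0"
    using that by (intro MVT2[of 0 s "\<lambda>s. ln (1 + s) - s + s\<^sup>2 / 2" "\<lambda>z. 1 / (1 + z) - 1 + z"])
      (auto intro!: derivative_eq_intros)
  moreover have "1 / (1 + z) - 1 + z \<ge> 0" if "z > 0" for z :: real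
    using that by (simp add: field_simps)
  ultimately show ?thesis using that
    by (cases "s = 0") (auto simp: order_le_less, smt (verit) mult_nonneg_nonneg)
qed

text \<open>
  A standard Gaussian vector with a small random perturbation in the span of fixed vectors
  \<open>B\<^sub>l\<close>, all multiplied by \<open>s\<close>. As \<open>f\<close> reads only the first
  \<open>q\<close> coordinates, the transformation of the remaining ones is free. For \<open>exchange\<close>
  the terms \<open>\<Sum> |B\<^sub>l|\<^sup>2\<close> of the energy cancel against the logarithm of the
  Jacobian determinant, up to the factor \<open>a - 1\<close>, and only terms of fourth order in
  \<open>B\<close> and second order in \<open>a - 1\<close> remain.
\<close>

lemma gaussian_mixture_gibbs:
  fixes f :: "(nat \<Rightarrow> real) \<Rightarrow> real"
  assumes s: "s \<noteq> 0" and a: "a = s\<^sup>2"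
    and f: "f \<in> borel_measurable gauss" and bound: "\<And>\<omega>. \<bar>f \<omega>\<bar> \<le> c"
    and dep: "\<And>\<omega> \<omega>'. (\<And>k. k < q \<Longrightarrow> \<omega> k = \<omega>' k) \<Longrightarrow> f \<omega> = f \<omega>'"
  shows "(\<integral>\<omega>. f (\<lambda>k. s * (\<omega> k + (\<Sum>l<m. \<omega> (q + l) * B l k))) \<partial>gauss) \<le>
    ln (\<integral>\<omega>. exp (f \<omega>) \<partial>gauss) + real q * (a - 1 - ln a) / 2
     + (a - 1) / 2 * (\<Sum>j<m. \<Sum>k<q. (B j k)\<^sup>2)
     + (\<Sum>j<m. \<Sum>l<j. (\<Sum>k<q. B j k * B l k)\<^sup>2) / 2 + (\<Sum>j<m. (\<Sum>k<q. (B j k)\<^sup>2)\<^sup>2) / 2"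
proof -
  define T where "T \<omega> = scale (s) q (exchange q B m \<omega>)" for \<omega> :: "nat \<Rightarrow> real"
  define b where "b j = (\<Sum>k<q. (B j k)\<^sup>2)" for j
  define g where "g j l = (\<Sum>k<q. B j k * B l k)" for j l
  define J where "J = \<bar>s\<bar> ^ q * (\<Prod>l<m. 1 + b l)"
  have a0: "a > 0" using s a by simp
  have b0: "b j \<ge> 0" for j unfolding b_def by (intro sum_nonneg) auto
  have T: "quasi_invariant {..<q + m} T J"
    unfolding T_def J_def b_def using s
    by (intro quasi_invariant_comp quasi_invariant_scale quasi_invariant_exchange) auto
  have J: "J > 0" using T by (simp add: quasi_invariant_def)
  have fT: "f (\<lambda>k. s * (\<omega> k + (\<Sum>l<m. \<omega> (q + l) * B l k))) = f (T \<omega>)" for \<omega>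
    by (rule dep) (simp add: T_def scale_def exchange_def)
  \<comment> \<open>\<open>s X k\<close> and \<open>L j\<close> are the new coordinates, written as linear forms of the old ones.\<close>
  define X where "X k \<omega> = (\<Sum>n<q + m. (if n < q then (if n = k then 1 else 0) else B (n - q) k) * \<omega> n)"
    for k and \<omega> :: "nat \<Rightarrow> real"
  define L where "L j \<omega> = (\<Sum>n<q + m. (if n < q then - B j n else if n = q + j then 1 else if n < q + j then - g j (n - q) else 0) * \<omega> n)"
    for j and \<omega> :: "nat \<Rightarrow> real"
  have TX: "T \<omega> k = s * X k \<omega>" if "k < q" for k \<omega>
  proof -
    have "(\<Sum>n<q. (if n < q then if n = k then 1 else 0 else B (n - q) k) * \<omega> n) = (\<Sum>n<q. if n = k then \<omega> n else 0)"
      by (intro sum.cong) auto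
    then have "X k \<omega> = \<omega> k + (\<Sum>l<m. B l k * \<omega> (q + l))"
      using that by (simp add: X_def sum_lessThan_add)
    then show ?thesis using that by (simp add: T_def scale_def exchange_def mult.commute)
  qed
  have TL: "T \<omega> (q + j) = L j \<omega>" if "j < m" for j \<omega>
  proof -
    have "(\<Sum>k<q. B j k * (\<omega> k + (\<Sum>l<j. \<omega> (q + l) * B l k))) =
        (\<Sum>k<q. B j k * \<omega> k) + (\<Sum>k<q. \<Sum>l<j. B j k * B l k * \<omega> (q + l))"
      by (simp add: sum_distrib_left sum.distrib[symmetric] algebra_simps)
    also have "(\<Sum>k<q. \<Sum>l<j. B j k * B l k * \<omega> (q + l)) = (\<Sum>l<j. g j l * \<omega> (q + l))"
      by (subst sum.swap) (simp add: g_def sum_distrib_right)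
    finally have 1: "T \<omega> (q + j) = \<omega> (q + j) - (\<Sum>k<q. B j k * \<omega> k) - (\<Sum>l<j. g j l * \<omega> (q + l))"
      using that by (simp add: T_def scale_def exchange_def)
    have "L j \<omega> = - (\<Sum>k<q. B j k * \<omega> k) + (\<Sum>l<m. (if l = j then \<omega> (q + l) else 0) + (if l < j then - (g j l * \<omega> (q + l)) else 0))"
      by (auto simp: L_def sum_lessThan_add sum_negf[symmetric] intro!: sum.cong)
    also have "(\<Sum>l<m. (if l = j then \<omega> (q + l) else 0) + (if l < j then - (g j l * \<omega> (q + l)) else 0)) =
       \<omega> (q + j) - (\<Sum>l<j. g j l * \<omega> (q + l))"
    proof -
      have "(\<Sum>l<m. (if l < j then - (g j l * \<omega> (q + l)) else 0)) = (\<Sum>l<j. - (g j l * \<omega> (q + l)))"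
        using that by (intro sum.mono_neutral_cong_right) auto
      then show ?thesis using that by (simp add: sum.distrib sum_negf)
    qed
    finally show ?thesis using 1 by simp
  qed
  have energy: "energy {..<q + m} (T \<omega>) = (\<Sum>k<q. a * (X k \<omega>)\<^sup>2) + (\<Sum>j<m. (L j \<omega>)\<^sup>2)" for \<omega>
    using a by (simp add: energy_def sum_lessThan_add TX TL power_mult_distrib)
  have am: "all_moments gauss (X k)" "all_moments gauss (L k)" for k
    unfolding X_def L_def by (intro all_moments_intros)+
  have EX: "(\<integral>\<omega>. (X k \<omega>)\<^sup>2 \<partial>gauss) = 1 + (\<Sum>j<m. (B j k)\<^sup>2)" if "k < q" for k
    unfolding X_def using that
    by (subst expectation_linear_form_sq) (simp_all add: sum_lessThan_add if_distrib[of "\<lambda>x. x ^ 2"] cong: if_cong)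
  have EL: "(\<integral>\<omega>. (L j \<omega>)\<^sup>2 \<partial>gauss) = 1 + b j + (\<Sum>l<j. (g j l)\<^sup>2)" if "j < m" for j
  proof -
    have "(\<integral>\<omega>. (L j \<omega>)\<^sup>2 \<partial>gauss) = (\<Sum>n<q + m. (if n < q then - B j n else if n = q + j then 1 else if n < q + j then - g j (n - q) else 0)\<^sup>2)"
      unfolding L_def by (rule expectation_linear_form_sq) simp
    also have "\<dots> = b j + (\<Sum>l<m. (if l = j then 1 else 0) + (if l < j then (g j l)\<^sup>2 else 0))"
      by (auto simp: sum_lessThan_add b_def intro!: sum.cong)
    also have "(\<Sum>l<m. (if l = j then 1 else 0) + (if l < j then (g j l)\<^sup>2 else 0)) = 1 + (\<Sum>l<j. (g j l)\<^sup>2)"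
    proof -
      have "(\<Sum>l<m. (if l < j then (g j l)\<^sup>2 else 0)) = (\<Sum>l<j. (g j l)\<^sup>2)"
        using that by (intro sum.mono_neutral_cong_right) auto
      then show ?thesis using that by (simp add: sum.distrib)
    qed
    finally show ?thesis by simp
  qed
  have int: "integrable gauss (\<lambda>\<omega>. energy {..<q + m} (T \<omega>))"
    unfolding energy by (intro all_moments_integrable all_moments_intros am)
  have "(\<integral>\<omega>. energy {..<q + m} (T \<omega>) \<partial>gauss) =
      (\<Sum>k<q. a * (\<integral>\<omega>. (X k \<omega>)\<^sup>2 \<partial>gauss)) + (\<Sum>j<m. (\<integral>\<omega>. (L j \<omega>)\<^sup>2 \<partial>gauss))"
    unfolding energy
    by (subst Bochner_Integration.integral_add, (intro all_moments_integrable all_moments_intros am)+,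
        subst Bochner_Integration.integral_sum, intro all_moments_integrable all_moments_intros am,
        subst Bochner_Integration.integral_sum, intro all_moments_integrable all_moments_intros am) simp
  also have "\<dots> = (\<Sum>k<q. a * (1 + (\<Sum>j<m. (B j k)\<^sup>2))) + (\<Sum>j<m. 1 + b j + (\<Sum>l<j. (g j l)\<^sup>2))"
    by (simp add: EX EL)
  also have "(\<Sum>k<q. a * (1 + (\<Sum>j<m. (B j k)\<^sup>2))) = a * q + a * (\<Sum>j<m. b j)"
    unfolding b_def by (subst sum.swap) (simp add: sum_distrib_left[symmetric] sum.distrib algebra_simps)
  finally have EE: "(\<integral>\<omega>. energy {..<q + m} (T \<omega>) \<partial>gauss) - real (card {..<q + m}) =
      q * (a - 1) + (a + 1) * (\<Sum>j<m. b j) + (\<Sum>j<m. \<Sum>l<j. (g j l)\<^sup>2)"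
    by (simp add: sum.distrib algebra_simps)
  have "ln J = q * ln a / 2 + (\<Sum>l<m. ln (1 + b l))"
  proof -
    have "ln (\<Prod>l<m. 1 + b l) = (\<Sum>l<m. ln (1 + b l))"
    proof (intro ln_prod)
      show "1 + b i \<noteq> 0" for i using b0[of i] by linarith
    qed simp
    moreover have "(\<Prod>l<m. 1 + b l) > 0" using b0 by (intro prod_pos) (auto intro: add_pos_nonneg)
    moreover have "ln J = ln (\<bar>s\<bar> ^ q) + ln (\<Prod>l<m. 1 + b l)"
      unfolding J_def using s calculation(2) by (intro ln_mult_pos) auto
    moreover have "ln a = 2 * ln \<bar>s\<bar>"
      unfolding a using ln_realpow[of "\<bar>s\<bar>" 2] s by simp
    ultimately show ?thesis using s by (simp add: ln_realpow)
  qed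
  moreover have "(\<Sum>l<m. b l) - (\<Sum>l<m. (b l)\<^sup>2) / 2 \<le> (\<Sum>l<m. ln (1 + b l))"
    unfolding sum_divide_distrib sum_subtractf[symmetric] using b0 by (intro sum_mono ln_one_plus_lower) auto
  ultimately have lnJ: "- ln J \<le> - (q * ln a / 2) - (\<Sum>l<m. b l) + (\<Sum>l<m. (b l)\<^sup>2) / 2" by simp
  have "(\<integral>\<omega>. f (\<lambda>k. s * (\<omega> k + (\<Sum>l<m. \<omega> (q + l) * B l k))) \<partial>gauss) \<le> ln (\<integral>\<omega>. exp (f \<omega>) \<partial>gauss) - ln J +
      ((\<integral>\<omega>. energy {..<q + m} (T \<omega>) \<partial>gauss) - real (card {..<q + m})) / 2"
    unfolding fT by (rule gibbs_inequality[OF T _ f bound int]) simp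
  also have "\<dots> \<le> ln (\<integral>\<omega>. exp (f \<omega>) \<partial>gauss) + (- (q * ln a / 2) - (\<Sum>l<m. b l) + (\<Sum>l<m. (b l)\<^sup>2) / 2) +
      (q * (a - 1) + (a + 1) * (\<Sum>j<m. b j) + (\<Sum>j<m. \<Sum>l<j. (g j l)\<^sup>2)) / 2"
    using lnJ unfolding EE by simp
  also have "\<dots> = ln (\<integral>\<omega>. exp (f \<omega>) \<partial>gauss) + real q * (a - 1 - ln a) / 2
     + (a - 1) / 2 * (\<Sum>j<m. b j) + (\<Sum>j<m. \<Sum>l<j. (g j l)\<^sup>2) / 2 + (\<Sum>j<m. (b j)\<^sup>2) / 2"
    by (simp add: field_simps)
  finally show ?thesis by (simp add: b_def g_def)
qed

section \<open>Moments of linear forms\<close>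

lemma expectation_mult_coord:
  fixes P :: "('i \<Rightarrow> real) \<Rightarrow> real"
  assumes P: "all_moments gauss P" and indep: "\<And>\<omega> x. P (fun_upd \<omega> i x) = P \<omega>"
  shows "(\<integral>\<omega>. P \<omega> * \<omega> i ^ k \<partial>gauss) = (\<integral>\<omega>. P \<omega> \<partial>gauss) * (\<integral>\<omega>. \<omega> i ^ k \<partial>gauss)"
proof -
  have h: "inj (\<lambda>_::unit. i)" by (simp add: inj_on_def)
  have g: "graft (\<lambda>_::unit. i) \<omega> \<zeta> = fun_upd \<omega> i (\<zeta> ())" for \<omega> \<zeta>
    by (auto simp: graft_def fun_eq_iff)
  show ?thesis
    using expectation_indep[OF h P, of "\<lambda>\<zeta>. \<zeta> () ^ k"] indep
    by (simp add: g all_moments_intros)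
qed

text \<open>
  Integrating out one coordinate uses only its first four moments, \<open>0, 1, 0, 3\<close>.
\<close>

lemma expectation_quartic:
  fixes P0 P1 P2 P3 P4 :: "('i \<Rightarrow> real) \<Rightarrow> real"
  assumes am: "all_moments gauss P0" "all_moments gauss P1" "all_moments gauss P2" "all_moments gauss P3" "all_moments gauss P4"
    and indep: "\<And>\<omega> x. P1 (fun_upd \<omega> i x) = P1 \<omega>"
      "\<And>\<omega> x. P2 (fun_upd \<omega> i x) = P2 \<omega>" "\<And>\<omega> x. P3 (fun_upd \<omega> i x) = P3 \<omega>" "\<And>\<omega> x. P4 (fun_upd \<omega> i x) = P4 \<omega>"
  shows "(\<integral>\<omega>. P0 \<omega> + P1 \<omega> * \<omega> i + P2 \<omega> * \<omega> i ^ 2 + P3 \<omega> * \<omega> i ^ 3 + P4 \<omega> * \<omega> i ^ 4 \<partial>gauss) =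
    (\<integral>\<omega>. P0 \<omega> \<partial>gauss) + (\<integral>\<omega>. P2 \<omega> \<partial>gauss) + 3 * (\<integral>\<omega>. P4 \<omega> \<partial>gauss)"
proof -
  have int: "integrable gauss P0" "integrable gauss (\<lambda>\<omega>. P1 \<omega> * \<omega> i)" "integrable gauss (\<lambda>\<omega>. P2 \<omega> * \<omega> i ^ 2)"
    "integrable gauss (\<lambda>\<omega>. P3 \<omega> * \<omega> i ^ 3)" "integrable gauss (\<lambda>\<omega>. P4 \<omega> * \<omega> i ^ 4)"
    by (intro all_moments_integrable all_moments_intros am)+
  have E: "(\<integral>\<omega>. P1 \<omega> * \<omega> i \<partial>gauss) = 0" "(\<integral>\<omega>. P2 \<omega> * \<omega> i ^ 2 \<partial>gauss) = (\<integral>\<omega>. P2 \<omega> \<partial>gauss)"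
    "(\<integral>\<omega>. P3 \<omega> * \<omega> i ^ 3 \<partial>gauss) = 0" "(\<integral>\<omega>. P4 \<omega> * \<omega> i ^ 4 \<partial>gauss) = 3 * (\<integral>\<omega>. P4 \<omega> \<partial>gauss)"
    using expectation_mult_coord[OF am(2) indep(1), of 1] expectation_mult_coord[OF am(3) indep(2), of 2]
      expectation_mult_coord[OF am(4) indep(3), of 3] expectation_mult_coord[OF am(5) indep(4), of 4] by simp_all
  show ?thesis using int E by simp
qed

lemma expand_four_factors:
  "(u1 + c1 * t) * (u2 + c2 * t) * (u3 + c3 * t) * (u4 + c4 * t) =
    u1 * u2 * u3 * u4
    + (c1 * (u2 * u3 * u4) + c2 * (u1 * u3 * u4) + c3 * (u1 * u2 * u4) + c4 * (u1 * u2 * u3)) * t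
    + ((c1 * c2) * (u3 * u4) + (c1 * c3) * (u2 * u4) + (c1 * c4) * (u2 * u3)
       + (c2 * c3) * (u1 * u4) + (c2 * c4) * (u1 * u3) + (c3 * c4) * (u1 * u2)) * t ^ 2
    + ((c1 * c2 * c3) * u4 + (c1 * c2 * c4) * u3 + (c1 * c3 * c4) * u2 + (c2 * c3 * c4) * u1) * t ^ 3
    + (c1 * c2 * c3 * c4) * t ^ 4" for t :: real
  by (simp add: algebra_simps power2_eq_square power3_eq_cube power4_eq_xxxx)

definition linear_form :: "'i set \<Rightarrow> ('i \<Rightarrow> real) \<Rightarrow> ('i \<Rightarrow> real) \<Rightarrow> real" where
  "linear_form F c \<omega> = (\<Sum>n\<in>F. c n * \<omega> n)"

lemma all_moments_linear_form [all_moments_intros]: "all_moments gauss (linear_form F c)"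
  unfolding linear_form_def by (intro all_moments_intros)

lemma linear_form_insert:
  "finite F \<Longrightarrow> x \<notin> F \<Longrightarrow> linear_form (insert x F) c \<omega> = linear_form F c \<omega> + c x * \<omega> x"
  by (simp add: linear_form_def)

lemma linear_form_upd [simp]: "x \<notin> F \<Longrightarrow> linear_form F c (fun_upd \<omega> x y) = linear_form F c \<omega>"
  unfolding linear_form_def by (intro sum.cong) auto

lemma expectation_linear_form_mult:
  assumes "finite F"
  shows "(\<integral>\<omega>. linear_form F a \<omega> * linear_form F b \<omega> \<partial>gauss) = (\<Sum>n\<in>F. a n * b n)"
  using assms
proof (induction F)
  case empty
  then show ?case by (simp add: linear_form_def)
next
  case (insert x F)
  let ?L = "linear_form F"
  have "(\<integral>\<omega>. linear_form (insert x F) a \<omega> * linear_form (insert x F) b \<omega> \<partial>gauss) =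
    (\<integral>\<omega>. ?L a \<omega> * ?L b \<omega> + (a x * ?L b \<omega> + b x * ?L a \<omega>) * \<omega> x + (a x * b x) * \<omega> x ^ 2 + 0 * \<omega> x ^ 3 + 0 * \<omega> x ^ 4 \<partial>gauss)"
    using insert.hyps by (intro Bochner_Integration.integral_cong refl) (simp add: linear_form_insert algebra_simps power2_eq_square)
  also have "\<dots> = (\<integral>\<omega>. ?L a \<omega> * ?L b \<omega> \<partial>gauss) + a x * b x"
    using insert.hyps by (subst expectation_quartic) (simp_all add: all_moments_intros)
  finally show ?case using insert by simp
qed

text \<open>
  Isserlis' formula. Induction on the support: removing one coordinate leaves linear forms on a smaller
  support, and \<open>expectation_quartic\<close> collects the terms.
\<close>

lemma expectation_linear_form_mult4:
  fixes F :: "'i set"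
  assumes "finite F"
  shows "(\<integral>\<omega>. linear_form F a \<omega> * linear_form F b \<omega> * linear_form F c \<omega> * linear_form F d \<omega> \<partial>gauss) =
    (\<Sum>n\<in>F. a n * b n) * (\<Sum>n\<in>F. c n * d n) + (\<Sum>n\<in>F. a n * c n) * (\<Sum>n\<in>F. b n * d n)
    + (\<Sum>n\<in>F. a n * d n) * (\<Sum>n\<in>F. b n * c n)"
  using assms
proof (induction F)
  case empty
  then show ?case by (simp add: linear_form_def)
next
  case (insert x F)
  let ?L = "linear_form F"
  let ?P0 = "\<lambda>\<omega>. ?L a \<omega> * ?L b \<omega> * ?L c \<omega> * ?L d \<omega>"
  let ?P1 = "\<lambda>\<omega>. a x * (?L b \<omega> * ?L c \<omega> * ?L d \<omega>) + b x * (?L a \<omega> * ?L c \<omega> * ?L d \<omega>) + c x * (?L a \<omega> * ?L b \<omega> * ?L d \<omega>) + d x * (?L a \<omega> * ?L b \<omega> * ?L c \<omega>)"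
  let ?P2 = "\<lambda>\<omega>. (a x * b x) * (?L c \<omega> * ?L d \<omega>) + (a x * c x) * (?L b \<omega> * ?L d \<omega>) + (a x * d x) * (?L b \<omega> * ?L c \<omega>)
     + (b x * c x) * (?L a \<omega> * ?L d \<omega>) + (b x * d x) * (?L a \<omega> * ?L c \<omega>) + (c x * d x) * (?L a \<omega> * ?L b \<omega>)"
  let ?P3 = "\<lambda>\<omega>. (a x * b x * c x) * ?L d \<omega> + (a x * b x * d x) * ?L c \<omega> + (a x * c x * d x) * ?L b \<omega> + (b x * c x * d x) * ?L a \<omega>"
  have "(\<integral>\<omega>. linear_form (insert x F) a \<omega> * linear_form (insert x F) b \<omega> * linear_form (insert x F) c \<omega> * linear_form (insert x F) d \<omega> \<partial>gauss) =
    (\<integral>\<omega>. ?P0 \<omega> + ?P1 \<omega> * \<omega> x + ?P2 \<omega> * \<omega> x ^ 2 + ?P3 \<omega> * \<omega> x ^ 3 + (a x * b x * c x * d x) * \<omega> x ^ 4 \<partial>gauss)"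
    using insert.hyps by (intro Bochner_Integration.integral_cong refl) (simp only: linear_form_insert[OF insert.hyps] expand_four_factors)
  also have "\<dots> = (\<integral>\<omega>. ?P0 \<omega> \<partial>gauss) + (\<integral>\<omega>. ?P2 \<omega> \<partial>gauss) + 3 * (\<integral>\<omega>. a x * b x * c x * d x \<partial>(gauss :: ('i \<Rightarrow> real) measure))"
    by (rule expectation_quartic[of ?P0 ?P1 ?P2 ?P3 "\<lambda>_. a x * b x * c x * d x" x]) (use insert.hyps in \<open>simp_all add: all_moments_intros\<close>)
  also have "(\<integral>\<omega>. ?P2 \<omega> \<partial>gauss) = (a x * b x) * (\<Sum>n\<in>F. c n * d n) + (a x * c x) * (\<Sum>n\<in>F. b n * d n) + (a x * d x) * (\<Sum>n\<in>F. b n * c n)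
     + (b x * c x) * (\<Sum>n\<in>F. a n * d n) + (b x * d x) * (\<Sum>n\<in>F. a n * c n) + (c x * d x) * (\<Sum>n\<in>F. a n * b n)"
  proof -
    have i: "integrable gauss (\<lambda>\<omega>. ?L u \<omega> * ?L v \<omega>)" for u v by (intro all_moments_integrable all_moments_intros)
    show ?thesis using insert.hyps(1)
      by (simp add: i expectation_linear_form_mult)
  qed
  finally show ?case using insert by (simp add: algebra_simps)
qed

lemma expectation_linear_form_even_power:
  fixes c :: "'i \<Rightarrow> real"
  assumes "finite F"
  defines "v \<equiv> \<lambda>F. \<Sum>n\<in>F. (c n)\<^sup>2"
  shows "(\<integral>\<omega>. linear_form F c \<omega> ^ 2 \<partial>gauss) = v F \<and> (\<integral>\<omega>. linear_form F c \<omega> ^ 4 \<partial>gauss) = 3 * v F ^ 2 \<and>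
    (\<integral>\<omega>. linear_form F c \<omega> ^ 6 \<partial>gauss) = 15 * v F ^ 3 \<and> (\<integral>\<omega>. linear_form F c \<omega> ^ 8 \<partial>gauss) = 105 * v F ^ 4"
  using assms(1)
proof (induction F)
  case empty
  then show ?case by (simp add: linear_form_def v_def)
next
  case (insert x F)
  let ?L = "linear_form F c"
  have u: "(\<integral>\<omega>. ?L \<omega> ^ m * \<omega> x ^ k \<partial>gauss) = (\<integral>\<omega>. ?L \<omega> ^ m \<partial>gauss) * (\<integral>\<omega>. \<omega> x ^ k \<partial>gauss)" for m k
    using insert.hyps by (intro expectation_mult_coord all_moments_intros) simp
  have i: "integrable gauss (\<lambda>\<omega>. ?L \<omega> ^ m * \<omega> x ^ k)" for m k
    by (intro all_moments_integrable all_moments_intros)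
  have expand: "(\<integral>\<omega>. linear_form (insert x F) c \<omega> ^ n \<partial>gauss) =
      (\<Sum>k\<le>n. (n choose k) * c x ^ (n - k) * ((\<integral>\<omega>. ?L \<omega> ^ k \<partial>gauss) * (\<integral>\<omega>. \<omega> x ^ (n - k) \<partial>gauss)))" for n
  proof -
    have "(\<integral>\<omega>. linear_form (insert x F) c \<omega> ^ n \<partial>gauss) =
        (\<integral>\<omega>. (\<Sum>k\<le>n. ((n choose k) * c x ^ (n - k)) * (?L \<omega> ^ k * \<omega> x ^ (n - k))) \<partial>gauss)"
      using insert.hyps
      by (intro Bochner_Integration.integral_cong refl) (simp add: linear_form_insert binomial_ring power_mult_distrib ac_simps)
    also have "\<dots> = (\<Sum>k\<le>n. (n choose k) * c x ^ (n - k) * (\<integral>\<omega>. ?L \<omega> ^ k * \<omega> x ^ (n - k) \<partial>gauss))"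
      using i by (subst Bochner_Integration.integral_sum) (auto intro!: integrable_mult_right)
    finally show ?thesis by (simp add: u)
  qed
  have v: "v (insert x F) = v F + (c x)\<^sup>2" using insert.hyps by (simp add: v_def)
  have s: "(\<Sum>k\<le>n. f k) = f n + (\<Sum>k\<le>n - 1. f k)" if "n > 0" for f :: "nat \<Rightarrow> real" and n
    using that by (cases n) simp_all
  define I where "I k = (\<integral>\<omega>. ?L \<omega> ^ k \<partial>gauss)" for k
  have I0: "I 0 = 1" and I: "I 2 = v F" "I 4 = 3 * v F ^ 2" "I 6 = 15 * v F ^ 3" "I 8 = 105 * v F ^ 4"
    using insert.IH by (simp_all add: I_def)
  have c: "c x ^ 4 = ((c x)\<^sup>2) ^ 2" "c x ^ 6 = ((c x)\<^sup>2) ^ 3" "c x ^ 8 = ((c x)\<^sup>2) ^ 4"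
    by (simp_all flip: power_mult)
  have bin: "(2::nat) choose 0 = 1" "(4::nat) choose 0 = 1" "(4::nat) choose 2 = 6" "(6::nat) choose 0 = 1"
    "(6::nat) choose 2 = 15" "(6::nat) choose 4 = 15" "(8::nat) choose 0 = 1" "(8::nat) choose 2 = 28" "(8::nat) choose 4 = 70" "(8::nat) choose 6 = 28"
    by (simp_all add: eval_nat_numeral)
  have e: "(\<integral>\<omega>. linear_form (insert x F) c \<omega> ^ 2 \<partial>gauss) = I 2 + (c x)\<^sup>2"
    "(\<integral>\<omega>. linear_form (insert x F) c \<omega> ^ 4 \<partial>gauss) = I 4 + 6 * (c x)\<^sup>2 * I 2 + 3 * c x ^ 4"
    "(\<integral>\<omega>. linear_form (insert x F) c \<omega> ^ 6 \<partial>gauss) = I 6 + 15 * (c x)\<^sup>2 * I 4 + 45 * c x ^ 4 * I 2 + 15 * c x ^ 6"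
    "(\<integral>\<omega>. linear_form (insert x F) c \<omega> ^ 8 \<partial>gauss) = I 8 + 28 * (c x)\<^sup>2 * I 6 + 210 * c x ^ 4 * I 4 + 420 * c x ^ 6 * I 2 + 105 * c x ^ 8"
    unfolding expand I_def[symmetric] using I0
    by (simp_all add: s bin)
  show ?case
    unfolding e I c v by (simp add: algebra_simps power2_eq_square power3_eq_cube power4_eq_xxxx)
qed

lemma isserlis_coord:
  "(\<integral>\<omega>. \<omega> a * \<omega> b * \<omega> c * \<omega> d \<partial>gauss) =
   (if a = b then 1 else 0) * (if c = d then 1 else 0) + (if a = c then 1 else 0) * (if b = d then 1 else 0)
   + (if a = d then 1 else 0) * (if b = c then 1 else 0 :: real)"
proof -
  define F where "F = {a, b, c, d}"
  define e where "e i j = (if j = i then 1 else 0 :: real)" for i j :: 'a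
  have F: "finite F" "a \<in> F" "b \<in> F" "c \<in> F" "d \<in> F" by (auto simp: F_def)
  have l: "linear_form F (e i) \<omega> = \<omega> i" if "i \<in> F" for i \<omega>
  proof -
    have "linear_form F (e i) \<omega> = (\<Sum>n\<in>F. if n = i then \<omega> n else 0)"
      unfolding linear_form_def by (intro sum.cong) (auto simp: e_def)
    then show ?thesis using that F(1) by simp
  qed
  have s: "(\<Sum>n\<in>F. e i n * e j n) = (if i = j then 1 else 0)" if "i \<in> F" for i j
  proof -
    have "(\<Sum>n\<in>F. e i n * e j n) = (\<Sum>n\<in>F. if n = i then e j n else 0)"
      by (intro sum.cong) (auto simp: e_def)
    then show ?thesis using that F(1) by (simp add: e_def)
  qed
  show ?thesis
    using expectation_linear_form_mult4[OF F(1), of "e a" "e b" "e c" "e d"]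
    by (simp only: l[OF F(2)] l[OF F(3)] l[OF F(4)] l[OF F(5)] s[OF F(2)] s[OF F(3)] s[OF F(4)] s[OF F(5)])
qed

section \<open>A triangular Gaussian product is close to Gaussian\<close>

text \<open>
  The product of a lower triangular matrix with a Gaussian matrix whose entries are the coordinates \<open>(i,
  k)\<close> with \<open>k < q\<close>. The diagonal \<open>s\<close> is prescribed; the entry \<open>(i,
  l)\<close> below it is the Gaussian coordinate \<open>(i, q + l)\<close> divided by \<open>\<surd>n\<close>.
\<close>

definition triangular_product :: "real \<Rightarrow> nat \<Rightarrow> (nat \<Rightarrow> real) \<Rightarrow> (nat \<times> nat \<Rightarrow> real) \<Rightarrow> nat \<times> nat \<Rightarrow> real" where
  "triangular_product n q s \<omega> = (\<lambda>(i, k). s i * \<omega> (i, k) + (\<Sum>l<i. \<omega> (i, q + l) * \<omega> (l, k)) / sqrt n)"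

lemma measurable_triangular_product: "triangular_product n q s \<in> measurable gauss gauss"
  by (rule measurable_into_gauss) (simp add: triangular_product_def split_beta)

abbreviation row_entry :: "nat \<Rightarrow> nat \<Rightarrow> nat \<times> nat" where "row_entry i \<equiv> (\<lambda>k. (i, k))"

lemma inj_row: "inj (row_entry i)" by (simp add: inj_on_def)

lemma graft_row: "graft (row_entry i) \<omega> \<zeta> (j, k) = (if j = i then \<zeta> k else \<omega> (j, k))"
  using graft_image[OF inj_row, of i \<omega> \<zeta> k] by (cases "j = i") (auto intro: graft_other)

lemma measurable_graft_right: "graft h \<omega> \<in> measurable gauss gauss"
  using measurable_compose[OF measurable_Pair1'[of \<omega> gauss gauss] measurable_graft, of h] by simp

lemma measurable_expectation_graft:
  fixes f :: "('i \<Rightarrow> real) \<Rightarrow> real"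
  assumes [measurable]: "f \<in> borel_measurable gauss"
  shows "(\<lambda>\<omega>. \<integral>\<zeta>. f (graft h \<omega> \<zeta>) \<partial>gauss) \<in> borel_measurable gauss"
proof -
  have "(\<lambda>(\<omega>, \<zeta>). f (graft h \<omega> \<zeta>)) \<in> borel_measurable (gauss \<Otimes>\<^sub>M gauss)"
    using measurable_compose[OF measurable_graft assms, of h] by (simp add: split_beta')
  then show ?thesis by (intro G.borel_measurable_lebesgue_integral) (simp add: split_beta')
qed

lemma expectation_dot_sq:
  fixes i j :: nat
  assumes "i \<noteq> j"
  shows "(\<integral>\<omega>. (\<Sum>k<q. \<omega> (i, k) * \<omega> (j, k :: nat))\<^sup>2 \<partial>gauss) = real q"
proof -
  have "(\<integral>\<omega>. (\<Sum>k<q. \<omega> (i, k) * \<omega> (j, k))\<^sup>2 \<partial>gauss) =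
     (\<integral>\<omega>. (\<Sum>k<q. \<Sum>l<q. \<omega> (i, k) * \<omega> (j, k) * \<omega> (i, l) * \<omega> (j, l)) \<partial>gauss)"
    by (simp add: power2_eq_square sum_product mult.assoc)
  also have "\<dots> = (\<Sum>k<q. \<Sum>l<q. (if k = l then 1 else 0) * (if k = l then 1 else 0))"
    by (subst Bochner_Integration.integral_sum, intro all_moments_integrable all_moments_intros,
        intro sum.cong refl, subst Bochner_Integration.integral_sum, intro all_moments_integrable all_moments_intros)
      (use assms in \<open>auto simp: isserlis_coord intro!: sum.cong split: if_splits\<close>)
  also have "\<dots> = (\<Sum>k<q. \<Sum>l<q. if k = l then 1 else 0)" by (intro sum.cong refl) simp
  finally show ?thesis by simp
qed

lemma expectation_norm4:
  fixes j :: nat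
  shows "(\<integral>\<omega>. (\<Sum>k<q. (\<omega> (j, k :: nat))\<^sup>2)\<^sup>2 \<partial>gauss) = real q ^ 2 + 2 * real q"
proof -
  have "(\<integral>\<omega>. (\<Sum>k<q. (\<omega> (j, k))\<^sup>2)\<^sup>2 \<partial>gauss) =
     (\<integral>\<omega>. (\<Sum>k<q. \<Sum>l<q. \<omega> (j, k) * \<omega> (j, k) * \<omega> (j, l) * \<omega> (j, l)) \<partial>gauss)"
    by (simp add: power2_eq_square sum_product mult.assoc)
  also have "\<dots> = (\<Sum>k<q. \<Sum>l<q. 1 + (if k = l then 2 else 0))"
    by (subst Bochner_Integration.integral_sum, intro all_moments_integrable all_moments_intros,
        intro sum.cong refl, subst Bochner_Integration.integral_sum, intro all_moments_integrable all_moments_intros)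
      (auto simp: isserlis_coord intro!: sum.cong)
  also have "\<dots> = real q ^ 2 + 2 * real q" by (simp add: sum.distrib power2_eq_square distrib_left)
  finally show ?thesis .
qed

text \<open>
  A bound for the relative entropy that row \<open>i\<close> contributes when its squared diagonal entry is
  \<open>a\<close>: the error of the diagonal, and the interaction with the \<open>i\<close> rows above.
\<close>

definition row_cost :: "real \<Rightarrow> nat \<Rightarrow> nat \<Rightarrow> real \<Rightarrow> real" where
  "row_cost n q i a = 3 / 2 * real q * (a - 1)\<^sup>2 + 3 / 2 * real q * (real i)\<^sup>2 / n\<^sup>2 + 6 * real i * (real q)\<^sup>2 / n\<^sup>2"

text \<open>
  The left-hand side is the expectation of the error terms of \<open>gaussian_mixture_gibbs\<close> for the
  vectors \<open>B\<^sub>l = \<xi>\<^sub>l / \<surd>(n a)\<close> with Gaussian \<open>\<xi>\<^sub>l\<close>.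
  For \<open>a \<ge> 1/2\<close>, powers of \<open>1 / a\<close> cost a constant only and \<open>a - 1 - ln a
  \<le> 2 (a - 1)\<^sup>2\<close>.
\<close>

lemma row_cost_bound:
  assumes a: "a \<ge> 1 / 2" and n: "n > 0" and q: "q \<ge> 1"
  shows "real q * (a - 1 - ln a) / 2 + (a - 1) / 2 * (real i * real q / (n * a))
     + (real i * (real i - 1) / 2 * real q / (n * a)\<^sup>2) / 2 + (real i * (real q ^ 2 + 2 * real q) / (n * a)\<^sup>2) / 2 \<le> row_cost n q i a"
proof -
  have "ln (1 / a) \<le> 1 / a - 1" using a by (intro ln_le_minus_one) auto
  then have "a - 1 - ln a \<le> a + 1 / a - 2" using a by (simp add: ln_div)
  also have "\<dots> = (a - 1)\<^sup>2 / a" using a by (simp add: field_simps power2_eq_square)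
  also have "\<dots> \<le> 2 * (a - 1)\<^sup>2"
  proof -
    have "1 / a \<le> 2" using a by (simp add: field_simps)
    from mult_left_mono[OF this, of "(a - 1)\<^sup>2"] show ?thesis by simp
  qed
  finally have 1: "real q * (a - 1 - ln a) / 2 \<le> real q * (a - 1)\<^sup>2"
    using mult_left_mono[of "a - 1 - ln a" "2 * (a - 1)\<^sup>2" "real q"] by simp
  have 2: "(a - 1) / 2 * (real i * real q / (n * a)) \<le> real q * ((a - 1)\<^sup>2 + (real i)\<^sup>2 / n\<^sup>2) / 2"
  proof -
    have "(a - 1) / a \<le> 2 * \<bar>a - 1\<bar>"
    proof (cases "a \<ge> 1")
      case True
      then have "(a - 1) / a \<le> (a - 1) / 1" by (intro divide_left_mono) auto
      then show ?thesis using True by simp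
    next
      case False
      then have "(a - 1) / a \<le> 0" using a by (simp add: divide_le_0_iff)
      then show ?thesis by (rule order_trans) simp
    qed
    then have "(a - 1) / a * (real i / n) \<le> 2 * \<bar>a - 1\<bar> * (real i / n)"
      using n by (intro mult_right_mono) auto
    also have "\<dots> \<le> (a - 1)\<^sup>2 + (real i / n)\<^sup>2"
      using sum_squares_bound[of "\<bar>a - 1\<bar>" "real i / n"] by simp
    finally have "(a - 1) / a * (real i / n) * (real q / 2) \<le> ((a - 1)\<^sup>2 + (real i / n)\<^sup>2) * (real q / 2)"
      by (rule mult_right_mono) simp
    then show ?thesis by (simp add: power_divide field_simps)
  qed
  have ia: "1 / (n * a)\<^sup>2 \<le> 4 / n\<^sup>2"
  proof -
    have "(1 / a)\<^sup>2 \<le> 2\<^sup>2" using a by (intro power_mono) (auto simp: field_simps)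
    then show ?thesis using n by (simp add: power_mult_distrib power_divide field_simps)
  qed
  have 3: "(real i * (real i - 1) / 2 * real q / (n * a)\<^sup>2) / 2 \<le> real q * (real i)\<^sup>2 / n\<^sup>2"
  proof -
    have "real i * (real i - 1) * real q \<le> real q * (real i)\<^sup>2"
      by (simp add: power2_eq_square algebra_simps)
    then have "real i * (real i - 1) * real q * (1 / (n * a)\<^sup>2) \<le> real q * (real i)\<^sup>2 * (4 / n\<^sup>2)"
      by (rule mult_mono[OF _ ia]) auto
    moreover have "(real i * (real i - 1) / 2 * real q / (n * a)\<^sup>2) / 2 = real i * (real i - 1) * real q * (1 / (n * a)\<^sup>2) / 4"
      by simp
    moreover have "real q * (real i)\<^sup>2 / n\<^sup>2 = real q * (real i)\<^sup>2 * (4 / n\<^sup>2) / 4" by simp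
    ultimately show ?thesis by (simp only: divide_right_mono)
  qed
  have 4: "(real i * (real q ^ 2 + 2 * real q) / (n * a)\<^sup>2) / 2 \<le> 6 * real i * (real q)\<^sup>2 / n\<^sup>2"
  proof -
    have "real q \<le> real q ^ 2" using q by (simp add: power2_eq_square)
    then have "real i * (real q ^ 2 + 2 * real q) \<le> real i * (3 * real q ^ 2)" by (intro mult_left_mono) auto
    then have "real i * (real q ^ 2 + 2 * real q) * (1 / (n * a)\<^sup>2) \<le> real i * (3 * real q ^ 2) * (4 / n\<^sup>2)"
      by (rule mult_mono[OF _ ia]) auto
    moreover have "(real i * (real q ^ 2 + 2 * real q) / (n * a)\<^sup>2) / 2 = real i * (real q ^ 2 + 2 * real q) * (1 / (n * a)\<^sup>2) / 2"
      by simp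
    moreover have "6 * real i * (real q)\<^sup>2 / n\<^sup>2 = real i * (3 * real q ^ 2) * (4 / n\<^sup>2) / 2" by simp
    ultimately show ?thesis by (simp only: divide_right_mono)
  qed
  have "real q * ((a - 1)\<^sup>2 + (real i)\<^sup>2 / n\<^sup>2) / 2 = real q * (a - 1)\<^sup>2 / 2 + real q * (real i)\<^sup>2 / n\<^sup>2 / 2"
    by (simp add: algebra_simps add_divide_distrib)
  moreover have "row_cost n q i a = 3 / 2 * (real q * (a - 1)\<^sup>2) + 3 / 2 * (real q * (real i)\<^sup>2 / n\<^sup>2) + 6 * real i * (real q)\<^sup>2 / n\<^sup>2"
    by (simp add: row_cost_def)
  ultimately show ?thesis using 1 2 3 4 by argo
qed

text \<open>
  The chain rule for relative entropy, starting from the last row. Given the other rows of the Gaussian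
  factor, the last row of the product is a Gaussian mixture; averaging over it replaces \<open>f\<close> by
  the functional \<open>g\<close> below of the rows above, to which the induction hypothesis applies. Nothing
  is lost at the end because \<open>E exp g = E exp f\<close>.
\<close>

lemma triangular_gibbs:
  fixes f :: "(nat \<times> nat \<Rightarrow> real) \<Rightarrow> real"
  assumes a: "\<And>i. i < p \<Longrightarrow> (s i)\<^sup>2 \<ge> 1 / 2" and n: "n > 0" and q: "q \<ge> 1"
    and f: "f \<in> borel_measurable gauss" and bound: "\<And>\<omega>. \<bar>f \<omega>\<bar> \<le> c"
    and dep: "\<And>\<omega> \<omega>'. (\<And>i k. i < p \<Longrightarrow> k < q \<Longrightarrow> \<omega> (i, k) = \<omega>' (i, k)) \<Longrightarrow> f \<omega> = f \<omega>'"
  shows "(\<integral>\<omega>. f (triangular_product n q s \<omega>) \<partial>gauss) \<le>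
    ln (\<integral>\<omega>. exp (f \<omega>) \<partial>gauss) + (\<Sum>i<p. row_cost n q i ((s i)\<^sup>2))"
  using a f bound dep
proof (induction p arbitrary: f)
  case 0
  have "f \<omega> = f (\<lambda>_. 0)" for \<omega> by (rule "0.prems") auto
  then have f: "f = (\<lambda>_. f (\<lambda>_. 0))" by (rule ext)
  show ?case by (subst f, subst (2) f) simp
next
  case (Suc p)
  note f [measurable] = Suc.prems(2)
  let ?W = "triangular_product n q s"
  let ?h = "row_entry p"
  note Wm = measurable_triangular_product[of n q s]
  have bf: "integrable gauss (\<lambda>\<omega>. f (X \<omega>))" if "X \<in> measurable gauss gauss" for X :: "('b \<Rightarrow> real) \<Rightarrow> _"
    using Suc.prems(3) by (intro G.integrable_const_bound[of _ c] measurable_compose[OF that f]) auto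
  have efm: "(\<lambda>\<omega>. exp (f \<omega>)) \<in> borel_measurable gauss" by measurable
  have bef: "integrable gauss (\<lambda>\<omega>. exp (f (X \<omega>)))" if "X \<in> measurable gauss gauss" for X :: "('b \<Rightarrow> real) \<Rightarrow> _"
    using Suc.prems(3) measurable_compose[OF that efm] by (intro G.integrable_const_bound[of _ "exp c"]) (auto simp: abs_le_iff)
  \<comment> \<open>The logarithm of the Laplace functional of \<open>f\<close> in the last row, a function of the rows above.\<close>
  define Z where "Z M = (\<integral>\<zeta>. exp (f (graft ?h M \<zeta>)) \<partial>gauss)" for M
  define g where "g M = ln (Z M)" for M
  have Zm: "Z \<in> borel_measurable gauss"
    unfolding Z_def by (rule measurable_expectation_graft[of "\<lambda>\<omega>. exp (f \<omega>)"]) measurable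
  have Zb: "exp (- c) \<le> Z M \<and> Z M \<le> exp c" for M
  proof -
    have i: "integrable gauss (\<lambda>\<zeta>. exp (f (graft ?h M \<zeta>)))" by (rule bef[OF measurable_graft_right])
    have "(\<integral>\<zeta>. exp (- c) \<partial>(gauss :: (nat \<Rightarrow> real) measure)) \<le> Z M"
      unfolding Z_def using i Suc.prems(3) by (intro integral_mono) (auto simp: abs_le_iff minus_le_iff)
    moreover have "Z M \<le> (\<integral>\<zeta>. exp c \<partial>(gauss :: (nat \<Rightarrow> real) measure))"
      unfolding Z_def using i Suc.prems(3) by (intro integral_mono) (auto simp: abs_le_iff)
    ultimately show ?thesis by simp
  qed
  have Z0: "Z M > 0" for M using Zb[of M] exp_gt_zero[of "- c"] by linarith
  have gm: "g \<in> borel_measurable gauss" unfolding g_def using Zm by measurable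
  have gb: "\<bar>g M\<bar> \<le> c" for M
  proof -
    have "ln (exp (- c)) \<le> g M" "g M \<le> ln (exp c)" unfolding g_def using Zb[of M] Z0[of M]
      by (auto simp only: ln_le_cancel_iff exp_gt_zero)
    then show ?thesis by simp
  qed
  have gdep: "g M = g M'" if "\<And>i k. i < p \<Longrightarrow> k < q \<Longrightarrow> M (i, k) = M' (i, k)" for M M'
  proof -
    have "f (graft ?h M \<zeta>) = f (graft ?h M' \<zeta>)" for \<zeta>
      using that by (intro Suc.prems(4)) (auto simp: graft_row)
    then show ?thesis by (simp add: g_def Z_def)
  qed
  define \<kappa> where "\<kappa> \<omega> = real q * ((s p)\<^sup>2 - 1 - ln ((s p)\<^sup>2)) / 2 + ((s p)\<^sup>2 - 1) / 2 * ((\<Sum>j<p. \<Sum>k<q. (\<omega> (j, k))\<^sup>2) / (n * (s p)\<^sup>2))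
     + ((\<Sum>j<p. \<Sum>l<j. (\<Sum>k<q. \<omega> (j, k) * \<omega> (l, k))\<^sup>2) / (n * (s p)\<^sup>2)\<^sup>2) / 2
     + ((\<Sum>j<p. (\<Sum>k<q. (\<omega> (j, k))\<^sup>2)\<^sup>2) / (n * (s p)\<^sup>2)\<^sup>2) / 2" for \<omega> :: "nat \<times> nat \<Rightarrow> real"
  have ap: "s p \<noteq> 0" using Suc.prems(1)[of p] by auto
  have step: "(\<integral>\<zeta>. f (?W (graft ?h \<omega> \<zeta>)) \<partial>gauss) \<le> g (?W \<omega>) + \<kappa> \<omega>" for \<omega>
  proof -
    define B where "B l k = \<omega> (l, k) / (s p * sqrt n)" for l k
    have eq: "f (?W (graft ?h \<omega> \<zeta>)) = f (graft ?h (?W \<omega>) (\<lambda>k. s p * (\<zeta> k + (\<Sum>l<p. \<zeta> (q + l) * B l k))))" for \<zeta>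
    proof (rule Suc.prems(4))
      fix i k assume ik: "i < Suc p" "k < q"
      show "?W (graft ?h \<omega> \<zeta>) (i, k) = graft ?h (?W \<omega>) (\<lambda>k. s p * (\<zeta> k + (\<Sum>l<p. \<zeta> (q + l) * B l k))) (i, k)"
      proof (cases "i = p")
        case True
        then show ?thesis using ap n
          by (simp add: graft_row triangular_product_def B_def sum_distrib_left sum_divide_distrib distrib_left)
      next
        case False
        then show ?thesis using ik by (simp add: graft_row triangular_product_def)
      qed
    qed
    have "(\<integral>\<zeta>. f (?W (graft ?h \<omega> \<zeta>)) \<partial>gauss) \<le>
        ln (\<integral>\<zeta>. exp (f (graft ?h (?W \<omega>) \<zeta>)) \<partial>gauss) + real q * ((s p)\<^sup>2 - 1 - ln ((s p)\<^sup>2)) / 2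
       + ((s p)\<^sup>2 - 1) / 2 * (\<Sum>j<p. \<Sum>k<q. (B j k)\<^sup>2)
       + (\<Sum>j<p. \<Sum>l<j. (\<Sum>k<q. B j k * B l k)\<^sup>2) / 2 + (\<Sum>j<p. (\<Sum>k<q. (B j k)\<^sup>2)\<^sup>2) / 2"
      unfolding eq
    proof (rule gaussian_mixture_gibbs[OF ap refl, where f = "\<lambda>\<zeta>. f (graft ?h (?W \<omega>) \<zeta>)"])
      show "(\<lambda>\<zeta>. f (graft ?h (?W \<omega>) \<zeta>)) \<in> borel_measurable gauss"
        by (rule measurable_compose[OF measurable_graft_right f])
      show "\<bar>f (graft ?h (?W \<omega>) \<zeta>)\<bar> \<le> c" for \<zeta> by (rule Suc.prems(3))
      show "f (graft ?h (?W \<omega>) \<zeta>) = f (graft ?h (?W \<omega>) \<zeta>')" if "\<And>k. k < q \<Longrightarrow> \<zeta> k = \<zeta>' k" for \<zeta> \<zeta>'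
        using that by (intro Suc.prems(4)) (auto simp: graft_row)
    qed
    moreover have BB: "B j k * B l k = \<omega> (j, k) * \<omega> (l, k) / (n * (s p)\<^sup>2)" for j l k
      using n by (simp add: B_def power2_eq_square mult.commute mult.left_commute)
    moreover have "(B j k)\<^sup>2 = (\<omega> (j, k))\<^sup>2 / (n * (s p)\<^sup>2)" for j k
      using BB[of j k j] by (simp add: power2_eq_square)
    ultimately have "(\<integral>\<zeta>. f (?W (graft ?h \<omega> \<zeta>)) \<partial>gauss) \<le>
        ln (\<integral>\<zeta>. exp (f (graft ?h (?W \<omega>) \<zeta>)) \<partial>gauss) + real q * ((s p)\<^sup>2 - 1 - ln ((s p)\<^sup>2)) / 2
       + ((s p)\<^sup>2 - 1) / 2 * ((\<Sum>j<p. \<Sum>k<q. (\<omega> (j, k))\<^sup>2) / (n * (s p)\<^sup>2))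
       + (\<Sum>j<p. \<Sum>l<j. ((\<Sum>k<q. \<omega> (j, k) * \<omega> (l, k)) / (n * (s p)\<^sup>2))\<^sup>2) / 2
       + (\<Sum>j<p. ((\<Sum>k<q. (\<omega> (j, k))\<^sup>2) / (n * (s p)\<^sup>2))\<^sup>2) / 2"
      by (simp only: sum_divide_distrib[symmetric])
    then show ?thesis
      by (simp only: \<kappa>_def g_def Z_def sum_divide_distrib[symmetric] power_divide)
  qed
  have \<kappa>m: "all_moments gauss \<kappa>"
    unfolding \<kappa>_def by (intro all_moments_intros)
  have E\<kappa>: "(\<integral>\<omega>. \<kappa> \<omega> \<partial>gauss) \<le> row_cost n q p ((s p)\<^sup>2)"
  proof -
    have e1: "(\<integral>\<omega>. (\<Sum>j<p. \<Sum>k<q. (\<omega> (j, k))\<^sup>2) \<partial>gauss) = real p * real q"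
      by (subst Bochner_Integration.integral_sum, intro all_moments_integrable all_moments_intros,
        subst Bochner_Integration.integral_sum, intro all_moments_integrable all_moments_intros) simp
    have e2: "(\<integral>\<omega>. (\<Sum>j<p. \<Sum>l<j. (\<Sum>k<q. \<omega> (j, k) * \<omega> (l, k))\<^sup>2) \<partial>gauss) = real p * (real p - 1) / 2 * real q"
    proof -
      have "(\<integral>\<omega>. (\<Sum>j<p. \<Sum>l<j. (\<Sum>k<q. \<omega> (j, k) * \<omega> (l, k))\<^sup>2) \<partial>gauss) = (\<Sum>j<p. \<Sum>l<j. real q)"
        by (subst Bochner_Integration.integral_sum, intro all_moments_integrable all_moments_intros,
          intro sum.cong refl, subst Bochner_Integration.integral_sum, intro all_moments_integrable all_moments_intros,
          intro sum.cong refl expectation_dot_sq) auto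
      also have "\<dots> = real q * (\<Sum>j<p. real j)" by (simp add: sum_distrib_left mult.commute)
      also have "(\<Sum>j<p. real j) = real p * (real p - 1) / 2"
        by (induction p) (simp_all add: field_simps)
      finally show ?thesis by simp
    qed
    have e3: "(\<integral>\<omega>. (\<Sum>j<p. (\<Sum>k<q. (\<omega> (j, k))\<^sup>2)\<^sup>2) \<partial>gauss) = real p * (real q ^ 2 + 2 * real q)"
      by (subst Bochner_Integration.integral_sum, intro all_moments_integrable all_moments_intros)
        (simp add: expectation_norm4)
    have i: "integrable gauss (\<lambda>\<omega>. (\<Sum>j<p. \<Sum>k<q. (\<omega> (j, k))\<^sup>2))"
      "integrable gauss (\<lambda>\<omega>. (\<Sum>j<p. \<Sum>l<j. (\<Sum>k<q. \<omega> (j, k) * \<omega> (l, k))\<^sup>2))"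
      "integrable gauss (\<lambda>\<omega>. (\<Sum>j<p. (\<Sum>k<q. (\<omega> (j, k))\<^sup>2)\<^sup>2))"
      by (intro all_moments_integrable all_moments_intros)+
    have "(\<integral>\<omega>. \<kappa> \<omega> \<partial>gauss) = real q * ((s p)\<^sup>2 - 1 - ln ((s p)\<^sup>2)) / 2 + ((s p)\<^sup>2 - 1) / 2 * (real p * real q / (n * (s p)\<^sup>2))
     + (real p * (real p - 1) / 2 * real q / (n * (s p)\<^sup>2)\<^sup>2) / 2 + (real p * (real q ^ 2 + 2 * real q) / (n * (s p)\<^sup>2)\<^sup>2) / 2"
      unfolding \<kappa>_def e1[symmetric] e2[symmetric] e3[symmetric] using i by simp
    also have "\<dots> \<le> row_cost n q p ((s p)\<^sup>2)"
      using Suc.prems(1)[of p] n q by (intro row_cost_bound) auto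
    finally show ?thesis .
  qed
  have ig: "integrable gauss (\<lambda>\<omega>. g (?W \<omega>))"
    using gb measurable_compose[OF Wm gm] by (intro G.integrable_const_bound[of _ c]) auto
  have "(\<integral>\<omega>. f (?W \<omega>) \<partial>gauss) = (\<integral>\<omega>. (\<integral>\<zeta>. f (?W (graft ?h \<omega> \<zeta>)) \<partial>gauss) \<partial>gauss)"
    by (rule integral_graft(1)[OF inj_row bf[OF Wm]])
  also have "\<dots> \<le> (\<integral>\<omega>. g (?W \<omega>) + \<kappa> \<omega> \<partial>gauss)"
    by (intro integral_mono integral_graft(2)[OF inj_row bf[OF Wm]] Bochner_Integration.integrable_add ig
        all_moments_integrable[OF \<kappa>m] step)
  also have "\<dots> = (\<integral>\<omega>. g (?W \<omega>) \<partial>gauss) + (\<integral>\<omega>. \<kappa> \<omega> \<partial>gauss)"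
    by (intro Bochner_Integration.integral_add ig all_moments_integrable[OF \<kappa>m])
  also have "\<dots> \<le> ln (\<integral>\<omega>. exp (g \<omega>) \<partial>gauss) + (\<Sum>i<p. row_cost n q i ((s i)\<^sup>2)) + row_cost n q p ((s p)\<^sup>2)"
    using Suc.IH[OF _ gm gb gdep] Suc.prems(1) E\<kappa> by (intro add_mono) auto
  also have "(\<integral>\<omega>. exp (g \<omega>) \<partial>gauss) = (\<integral>\<omega>. exp (f \<omega>) \<partial>gauss)"
    unfolding g_def using Z0 integral_graft(1)[OF inj_row[of p] bef[of "\<lambda>\<omega>. \<omega>"]] by (simp add: Z_def)
  finally show ?case by simp
qed

text \<open>
  The inequality of Pinsker type that turns the entropy bound into a bound in total variation. For \<open>0
  \<le> f \<le> 1\<close>, apply \<open>triangular_gibbs\<close> to \<open>l f\<close> and use \<open>ln E exp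
  (l f) \<le> l E f + l\<^sup>2\<close>; the other side follows from \<open>1 - f\<close>. The parameter
  \<open>l\<close> is left open, to be chosen of the order of the square root of the costs.
\<close>

lemma triangular_close:
  fixes f :: "(nat \<times> nat \<Rightarrow> real) \<Rightarrow> real"
  assumes s: "\<And>i. i < p \<Longrightarrow> (s i)\<^sup>2 \<ge> 1 / 2" and n: "n > 0" and q: "q \<ge> 1"
    and f: "f \<in> borel_measurable gauss" and f01: "\<And>\<omega>. 0 \<le> f \<omega>" "\<And>\<omega>. f \<omega> \<le> 1"
    and dep: "\<And>\<omega> \<omega>'. (\<And>i k. i < p \<Longrightarrow> k < q \<Longrightarrow> \<omega> (i, k) = \<omega>' (i, k)) \<Longrightarrow> f \<omega> = f \<omega>'"
    and l: "0 < l" "l \<le> 1"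
  shows "\<bar>(\<integral>\<omega>. f (triangular_product n q s \<omega>) \<partial>gauss) - (\<integral>\<omega>. f \<omega> \<partial>gauss)\<bar> \<le> l + (\<Sum>i<p. row_cost n q i ((s i)\<^sup>2)) / l"
proof -
  let ?K = "\<Sum>i<p. row_cost n q i ((s i)\<^sup>2)"
  have one_sided: "(\<integral>\<omega>. g (triangular_product n q s \<omega>) \<partial>gauss) - (\<integral>\<omega>. g \<omega> \<partial>gauss) \<le> l + ?K / l"
    if g [measurable]: "g \<in> borel_measurable gauss" and g01: "\<And>\<omega>. 0 \<le> g \<omega>" "\<And>\<omega>. g \<omega> \<le> 1"
     and gdep: "\<And>\<omega> \<omega>'. (\<And>i k. i < p \<Longrightarrow> k < q \<Longrightarrow> \<omega> (i, k) = \<omega>' (i, k)) \<Longrightarrow> g \<omega> = g \<omega>'"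
   for g :: "(nat \<times> nat \<Rightarrow> real) \<Rightarrow> real"
  proof -
    define e where "e = (\<integral>\<omega>. g \<omega> \<partial>gauss)"
    have ig: "integrable gauss g" using g01 by (intro G.integrable_const_bound[of _ 1]) auto
    have ieg: "integrable gauss (\<lambda>\<omega>. exp (l * g \<omega>))"
    proof (intro G.integrable_const_bound[of _ "exp 1"])
      have "l * g \<omega> \<le> 1" for \<omega> using mult_mono[of l 1 "g \<omega>" 1] g01 l by simp
      then show "AE x in gauss. norm (exp (l * g x)) \<le> exp 1" by simp
    qed measurable
    have e01: "0 \<le> e" "e \<le> 1"
    proof -
      show "0 \<le> e" unfolding e_def using g01 by simp
      have "e \<le> (\<integral>\<omega>. 1 \<partial>(gauss :: (nat \<times> nat \<Rightarrow> real) measure))"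
        unfolding e_def using g01 ig by (intro integral_mono) auto
      then show "e \<le> 1" by simp
    qed
    have "exp (l * g \<omega>) \<le> 1 + (l + l\<^sup>2) * g \<omega>" for \<omega>
    proof -
      have "0 \<le> l * g \<omega>" "l * g \<omega> \<le> 1" using mult_mono[of l 1 "g \<omega>" 1] g01 l by auto
      then have "exp (l * g \<omega>) \<le> 1 + l * g \<omega> + (l * g \<omega>)\<^sup>2" by (rule exp_bound)
      also have "(l * g \<omega>)\<^sup>2 \<le> l\<^sup>2 * g \<omega>"
      proof -
        have "g \<omega> * g \<omega> \<le> g \<omega> * 1" using g01 by (intro mult_left_mono) auto
        then have "l\<^sup>2 * (g \<omega> * g \<omega>) \<le> l\<^sup>2 * g \<omega>" by (intro mult_left_mono) auto
        then show ?thesis by (simp add: power2_eq_square ac_simps)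
      qed
      finally show ?thesis by (simp add: algebra_simps)
    qed
    then have "(\<integral>\<omega>. exp (l * g \<omega>) \<partial>gauss) \<le> (\<integral>\<omega>. 1 + (l + l\<^sup>2) * g \<omega> \<partial>gauss)"
      using ieg ig by (intro integral_mono) auto
    also have "\<dots> = 1 + (l + l\<^sup>2) * e" using ig by (simp add: e_def)
    finally have 1: "(\<integral>\<omega>. exp (l * g \<omega>) \<partial>gauss) \<le> 1 + (l + l\<^sup>2) * e" .
    have "(\<integral>\<omega>. 1 \<partial>(gauss :: (nat \<times> nat \<Rightarrow> real) measure)) \<le> (\<integral>\<omega>. exp (l * g \<omega>) \<partial>gauss)"
      using ieg g01 l by (intro integral_mono) auto
    then have pos: "(\<integral>\<omega>. exp (l * g \<omega>) \<partial>gauss) \<ge> 1" by simp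
    have "ln (\<integral>\<omega>. exp (l * g \<omega>) \<partial>gauss) \<le> (\<integral>\<omega>. exp (l * g \<omega>) \<partial>gauss) - 1"
      using pos by (intro ln_le_minus_one) auto
    also have "\<dots> \<le> l * e + l\<^sup>2 * e" using 1 by (simp add: algebra_simps)
    also have "l\<^sup>2 * e \<le> l\<^sup>2 * 1" using e01 by (intro mult_left_mono) auto
    finally have 2: "ln (\<integral>\<omega>. exp (l * g \<omega>) \<partial>gauss) \<le> l * e + l\<^sup>2" by simp
    have "(\<integral>\<omega>. l * g (triangular_product n q s \<omega>) \<partial>gauss) \<le> ln (\<integral>\<omega>. exp (l * g \<omega>) \<partial>gauss) + ?K"
    proof (rule triangular_gibbs[OF s n q, where c = 1 and f = "\<lambda>\<omega>. l * g \<omega>"])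
      show "\<bar>l * g \<omega>\<bar> \<le> 1" for \<omega> using mult_mono[of l 1 "g \<omega>" 1] g01 l by (simp add: abs_mult)
      show "l * g \<omega> = l * g \<omega>'" if "\<And>i k. i < p \<Longrightarrow> k < q \<Longrightarrow> \<omega> (i, k) = \<omega>' (i, k)" for \<omega> \<omega>'
        using gdep[of \<omega> \<omega>'] that by simp
    qed auto
    then have "l * (\<integral>\<omega>. g (triangular_product n q s \<omega>) \<partial>gauss) \<le> l * (e + l + ?K / l)"
      using 2 l by (simp add: algebra_simps power2_eq_square)
    then show ?thesis using l by (simp add: e_def)
  qed
  note m = measurable_compose[OF measurable_triangular_product[of n q s] f]
  have i: "integrable gauss f" "integrable gauss (\<lambda>\<omega>. f (triangular_product n q s \<omega>))"
    using f01 f m by (auto intro!: G.integrable_const_bound[of _ 1])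
  have "(\<integral>\<omega>. 1 - f (triangular_product n q s \<omega>) \<partial>gauss) - (\<integral>\<omega>. 1 - f \<omega> \<partial>gauss) \<le> l + ?K / l"
  proof (rule one_sided)
    show "1 - f \<omega> = 1 - f \<omega>'" if "\<And>i k. i < p \<Longrightarrow> k < q \<Longrightarrow> \<omega> (i, k) = \<omega>' (i, k)" for \<omega> \<omega>'
      using dep[of \<omega> \<omega>'] that by simp
  qed (use f f01 in auto)
  moreover have "(\<integral>\<omega>. f (triangular_product n q s \<omega>) \<partial>gauss) - (\<integral>\<omega>. f \<omega> \<partial>gauss) \<le> l + ?K / l"
    by (rule one_sided[OF f f01 dep])
  ultimately show ?thesis using i by simp
qed

section \<open>Rotations\<close>

definition preserves_gauss :: "(('i \<Rightarrow> real) \<Rightarrow> ('i \<Rightarrow> real)) \<Rightarrow> bool" where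
  "preserves_gauss R \<longleftrightarrow> R \<in> measurable gauss gauss \<and> distr gauss gauss R = gauss"

lemma preserves_gauss_id: "preserves_gauss (\<lambda>\<omega>. \<omega>)"
  by (simp add: preserves_gauss_def distr_id2)

lemma preserves_gauss_comp:
  assumes "preserves_gauss R" "preserves_gauss S"
  shows "preserves_gauss (\<lambda>\<omega>. R (S \<omega>))"
proof -
  have m: "R \<in> measurable gauss gauss" "S \<in> measurable gauss gauss" using assms by (auto simp: preserves_gauss_def)
  have "distr gauss gauss (\<lambda>\<omega>. R (S \<omega>)) = distr (distr gauss gauss S) gauss R"
    using m by (subst distr_distr) (auto simp: comp_def)
  then show ?thesis using assms measurable_compose[OF m(2,1)] by (simp add: preserves_gauss_def)
qed

lemma preserves_gauss_integral:
  fixes F :: "('i \<Rightarrow> real) \<Rightarrow> real"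
  assumes R: "preserves_gauss R" and F: "F \<in> borel_measurable gauss"
  shows "(\<integral>\<omega>. F (R \<omega>) \<partial>gauss) = (\<integral>\<omega>. F \<omega> \<partial>gauss)"
  using R integral_distr[of R gauss gauss F] F by (simp add: preserves_gauss_def)

lemma quasi_invariant_preserves:
  assumes T: "quasi_invariant A T 1" and e: "\<And>\<omega>. energy A (T \<omega>) = energy A \<omega>"
  shows "preserves_gauss T"
proof -
  have m: "T \<in> measurable gauss gauss" using T by (simp add: quasi_invariant_def)
  have "distr gauss gauss T = gauss"
  proof (rule measure_eqI)
    fix X assume "X \<in> sets (distr gauss gauss T)"
    then have X [measurable]: "X \<in> sets gauss" by simp
    have "emeasure (distr gauss gauss T) X = (\<integral>\<^sup>+\<omega>. indicator X \<omega> \<partial>distr gauss gauss T)" using X by simp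
    also have "\<dots> = (\<integral>\<^sup>+\<omega>. indicator X (T \<omega>) \<partial>gauss)" by (intro nn_integral_distr m) simp
    also have "\<dots> = (\<integral>\<^sup>+\<omega>. indicator X \<omega> \<partial>gauss)"
      using T unfolding quasi_invariant_def by (auto simp: e dest!: bspec[of _ _ "indicator X"])
    finally show "emeasure (distr gauss gauss T) X = emeasure gauss X" by simp
  qed simp
  then show ?thesis using m by (simp add: preserves_gauss_def)
qed

text \<open>
  The cosine and sine may themselves be random, provided that they do not read the two rotated coordinates.
\<close>

definition rotate_pair :: "'i \<Rightarrow> 'i \<Rightarrow> (('i \<Rightarrow> real) \<Rightarrow> real) \<Rightarrow> (('i \<Rightarrow> real) \<Rightarrow> real) \<Rightarrow> ('i \<Rightarrow> real) \<Rightarrow> 'i \<Rightarrow> real" where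
  "rotate_pair a b c s \<omega> = fun_upd (fun_upd \<omega> a (c \<omega> * \<omega> a + s \<omega> * \<omega> b)) b (c \<omega> * \<omega> b - s \<omega> * \<omega> a)"

text \<open>
  A plane rotation is a product of three shears, with \<open>t = s / (1 + c)\<close>, the tangent of half the
  angle, in the outer ones. Shears have determinant 1 and a rotation preserves the energy, so the weight in
  \<open>quasi_invariant\<close> is 1. The condition \<open>c \<ge> 0\<close> keeps \<open>t\<close> finite.
\<close>

lemma preserves_gauss_rotate_pair:
  assumes ab: "a \<noteq> b" and cm [measurable]: "c \<in> borel_measurable gauss" "s \<in> borel_measurable gauss"
    and cs: "\<And>\<omega>. (c \<omega>)\<^sup>2 + (s \<omega>)\<^sup>2 = 1" "\<And>\<omega>. c \<omega> \<ge> 0"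
    and indep: "\<And>\<omega> x y. c (fun_upd \<omega> a x) = c \<omega>" "\<And>\<omega> x y. c (fun_upd \<omega> b x) = c \<omega>"
      "\<And>\<omega> x y. s (fun_upd \<omega> a x) = s \<omega>" "\<And>\<omega> x y. s (fun_upd \<omega> b x) = s \<omega>"
  shows "preserves_gauss (rotate_pair a b c s)"
proof (rule quasi_invariant_preserves[of "{a, b}"])
  define t where "t \<omega> = s \<omega> / (1 + c \<omega>)" for \<omega>
  have tm [measurable]: "t \<in> borel_measurable gauss" unfolding t_def by measurable
  let ?U = "\<lambda>\<omega>. fun_upd \<omega> a (1 * \<omega> a + t \<omega> * \<omega> b)" and ?V = "\<lambda>\<omega>. fun_upd \<omega> b (1 * \<omega> b + - s \<omega> * \<omega> a)"
  have U: "quasi_invariant {a, b} ?U 1"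
    using quasi_invariant_update[of "{a, b}" a 1 "\<lambda>\<omega>. t \<omega> * \<omega> b"] ab by (simp add: t_def indep)
  have V: "quasi_invariant {a, b} ?V 1"
    using quasi_invariant_update[of "{a, b}" b 1 "\<lambda>\<omega>. - s \<omega> * \<omega> a"] ab by (simp add: indep)
  have "quasi_invariant {a, b} (\<lambda>\<omega>. ?U (?V (?U \<omega>))) (1 * (1 * 1))"
    by (rule quasi_invariant_comp[OF U quasi_invariant_comp[OF V U]])
  moreover have "?U (?V (?U \<omega>)) = rotate_pair a b c s \<omega>" for \<omega>
  proof -
    have c1: "1 + c \<omega> \<noteq> 0" using cs(2)[of \<omega>] by linarith
    have t1: "t \<omega> * (1 + c \<omega>) = s \<omega>" using c1 by (simp add: t_def)
    have "(1 + c \<omega>) * (t \<omega> * s \<omega>) = (s \<omega>)\<^sup>2" using t1 by (simp add: power2_eq_square mult.commute mult.left_commute)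
    also have "\<dots> = (1 + c \<omega>) * (1 - c \<omega>)" using cs(1)[of \<omega>] by (simp add: algebra_simps power2_eq_square)
    finally have t2: "t \<omega> * s \<omega> = 1 - c \<omega>" using c1 by simp
    have tt: "t (fun_upd \<omega>' a x) = t \<omega>'" "t (fun_upd \<omega>' b x) = t \<omega>'" for \<omega>' x by (simp_all add: t_def indep)
    have y: "\<omega> b - s \<omega> * (\<omega> a + t \<omega> * \<omega> b) = c \<omega> * \<omega> b - s \<omega> * \<omega> a"
    proof -
      have "\<omega> b - s \<omega> * (\<omega> a + t \<omega> * \<omega> b) = \<omega> b - s \<omega> * \<omega> a - (t \<omega> * s \<omega>) * \<omega> b" by (simp add: algebra_simps)
      then show ?thesis unfolding t2 by (simp add: algebra_simps)
    qed
    have x: "\<omega> a + t \<omega> * \<omega> b + t \<omega> * (c \<omega> * \<omega> b - s \<omega> * \<omega> a) = c \<omega> * \<omega> a + s \<omega> * \<omega> b"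
    proof -
      have "\<omega> a + t \<omega> * \<omega> b + t \<omega> * (c \<omega> * \<omega> b - s \<omega> * \<omega> a) = \<omega> a - (t \<omega> * s \<omega>) * \<omega> a + (t \<omega> * (1 + c \<omega>)) * \<omega> b"
        by (simp add: algebra_simps)
      then show ?thesis unfolding t1 t2 by (simp add: algebra_simps)
    qed
    have "?U (?V (?U \<omega>)) = fun_upd (fun_upd \<omega> a (\<omega> a + t \<omega> * \<omega> b + t \<omega> * (\<omega> b - s \<omega> * (\<omega> a + t \<omega> * \<omega> b)))) b (\<omega> b - s \<omega> * (\<omega> a + t \<omega> * \<omega> b))"
      using ab by (auto simp: fun_eq_iff tt indep)
    then show ?thesis unfolding y x rotate_pair_def .
  qed
  ultimately show "quasi_invariant {a, b} (rotate_pair a b c s) 1" by simp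
  fix \<omega>
  have "energy {a, b} (rotate_pair a b c s \<omega>) = ((c \<omega>)\<^sup>2 + (s \<omega>)\<^sup>2) * (\<omega> a)\<^sup>2 + ((c \<omega>)\<^sup>2 + (s \<omega>)\<^sup>2) * (\<omega> b)\<^sup>2"
    using ab by (simp add: energy_def rotate_pair_def power2_eq_square algebra_simps)
  then show "energy {a, b} (rotate_pair a b c s \<omega>) = energy {a, b} \<omega>" using ab by (simp add: cs energy_def)
qed

text \<open>
  One rotation applied in all planes spanned by the coordinates \<open>x\<close> and \<open>\<pi> x\<close>
  with \<open>x \<in> A\<close>; here \<open>\<pi>\<close> is an involution that maps \<open>A\<close> outside
  \<open>A\<close>.
\<close>

definition rotate_pairs :: "('i \<Rightarrow> 'i) \<Rightarrow> 'i set \<Rightarrow> (('i \<Rightarrow> real) \<Rightarrow> real) \<Rightarrow> (('i \<Rightarrow> real) \<Rightarrow> real) \<Rightarrow> ('i \<Rightarrow> real) \<Rightarrow> 'i \<Rightarrow> real" where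
  "rotate_pairs \<pi> A c s \<omega> = (\<lambda>x. if x \<in> A then c \<omega> * \<omega> x + s \<omega> * \<omega> (\<pi> x)
     else if \<pi> x \<in> A then c \<omega> * \<omega> x - s \<omega> * \<omega> (\<pi> x) else \<omega> x)"

lemma preserves_gauss_rotate_pairs:
  assumes A: "finite A" and pi: "\<And>x. \<pi> (\<pi> x) = x" and disj: "\<And>x. x \<in> A \<Longrightarrow> \<pi> x \<notin> A"
    and cm: "c \<in> borel_measurable gauss" "s \<in> borel_measurable gauss"
    and cs: "\<And>\<omega>. (c \<omega>)\<^sup>2 + (s \<omega>)\<^sup>2 = 1" "\<And>\<omega>. c \<omega> \<ge> 0"
    and indep: "\<And>\<omega> \<omega>'. (\<And>x. x \<notin> A \<Longrightarrow> \<pi> x \<notin> A \<Longrightarrow> \<omega> x = \<omega>' x) \<Longrightarrow> c \<omega> = c \<omega>' \<and> s \<omega> = s \<omega>'"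
  shows "preserves_gauss (rotate_pairs \<pi> A c s)"
proof -
  have "preserves_gauss (rotate_pairs \<pi> B c s)" if "B \<subseteq> A" for B
    using finite_subset[OF that A] that
  proof (induction B)
    case empty
    then show ?case using preserves_gauss_id by (simp add: rotate_pairs_def)
  next
    case (insert a B)
    have a: "a \<in> A" "\<pi> a \<notin> A" "a \<noteq> \<pi> a" using insert.prems disj[of a] by auto
    have upd: "c (fun_upd \<omega> a x) = c \<omega> \<and> s (fun_upd \<omega> a x) = s \<omega>" "c (fun_upd \<omega> (\<pi> a) x) = c \<omega> \<and> s (fun_upd \<omega> (\<pi> a) x) = s \<omega>" for \<omega> x
      using a pi by (auto intro!: indep)
    have R: "preserves_gauss (rotate_pair a (\<pi> a) c s)"
      using a cm cs upd by (intro preserves_gauss_rotate_pair) auto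
    have "rotate_pair a (\<pi> a) c s (rotate_pairs \<pi> B c s \<omega>) = rotate_pairs \<pi> (insert a B) c s \<omega>" for \<omega>
    proof -
      let ?\<omega> = "rotate_pairs \<pi> B c s \<omega>"
      have "c ?\<omega> = c \<omega> \<and> s ?\<omega> = s \<omega>" using insert.prems by (intro indep) (auto simp: rotate_pairs_def)
      moreover have "?\<omega> a = \<omega> a" "?\<omega> (\<pi> a) = \<omega> (\<pi> a)"
        using insert.hyps insert.prems a pi by (auto simp: rotate_pairs_def)
      moreover have "(\<pi> x = a) = (x = \<pi> a)" for x using pi by metis
      ultimately show ?thesis
        using a pi insert.hyps insert.prems unfolding rotate_pair_def
        by (intro ext) (auto simp: rotate_pairs_def)
    qed
    then show ?case using preserves_gauss_comp[OF R insert.IH] insert.prems by simp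
  qed
  then show ?thesis by simp
qed

section \<open>Bartlett decomposition\<close>

declare One_nat_def [simp del]

text \<open>
  Samples of a whole sequence of infinite matrices; the sizes enter only as the ranges of sums.
\<close>

type_synonym layers = "nat \<times> nat \<times> nat \<Rightarrow> real"

definition layer :: "nat \<Rightarrow> layers \<Rightarrow> nat \<times> nat \<Rightarrow> real" where
  "layer m \<omega> = (\<lambda>(i, k). \<omega> (m, i, k))"

definition mat_prod :: "nat \<Rightarrow> (nat \<times> nat \<Rightarrow> real) \<Rightarrow> (nat \<times> nat \<Rightarrow> real) \<Rightarrow> nat \<times> nat \<Rightarrow> real" where
  "mat_prod n A B = (\<lambda>(i, k). \<Sum>t<n. A (i, t) * B (t, k))"

text \<open>
  With the sign of the diagonal entry, \<open>signed_norm \<omega> i i\<close> is that entry itself, so that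
  the elimination below starts from the unchanged matrix.
\<close>

definition signed_norm :: "layers \<Rightarrow> nat \<Rightarrow> nat \<Rightarrow> real" where
  "signed_norm \<omega> i \<tau> = (if \<omega> (1, i, i) \<ge> 0 then 1 else -1) * sqrt (\<Sum>t=i..\<tau>. (\<omega> (1, i, t))\<^sup>2)"

text \<open>
  The triangular factor of the decomposition of the first layer into a lower triangular matrix and a rotation
  of the columns. Its rows are independent, and given the diagonal the entries below it are still Gaussian.
\<close>

definition bartlett :: "nat \<Rightarrow> layers \<Rightarrow> nat \<times> nat \<Rightarrow> real" where
  "bartlett n \<omega> = (\<lambda>(i, t). if t < i then \<omega> (1, i, t) else if t = i then signed_norm \<omega> i (n - 1) else 0)"

text \<open>
  The state of the elimination in which the rows before \<open>I\<close> are finished and, in row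
  \<open>I\<close>, the entries in the columns \<open>I + 1, \<dots>, \<tau>\<close> have been rotated into
  the diagonal.
\<close>

definition partial_bartlett :: "nat \<Rightarrow> nat \<Rightarrow> nat \<Rightarrow> layers \<Rightarrow> nat \<times> nat \<Rightarrow> real" where
  "partial_bartlett n I \<tau> \<omega> = (\<lambda>(i, t). if i < I then bartlett n \<omega> (i, t)
     else if i = I \<and> t = I then signed_norm \<omega> I \<tau>
     else if i = I \<and> I < t \<and> t \<le> \<tau> then 0
     else \<omega> (1, i, t))"

lemma signed_norm_self: "signed_norm \<omega> i i = \<omega> (1, i, i)"
  by (simp add: signed_norm_def)

lemma measurable_signed_norm [measurable]: "(\<lambda>\<omega>. signed_norm \<omega> i \<tau>) \<in> borel_measurable gauss"
  unfolding signed_norm_def by measurable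

lemma measurable_if_const: "f \<in> measurable M N \<Longrightarrow> g \<in> measurable M N \<Longrightarrow> (\<lambda>x. if b then f x else g x) \<in> measurable M N"
  by (cases b) simp_all

lemma measurable_partial_bartlett: "(\<lambda>\<omega>. partial_bartlett n I \<tau> \<omega> (i, t)) \<in> borel_measurable gauss"
  unfolding partial_bartlett_def bartlett_def prod.case
  by (intro measurable_if_const measurable_signed_norm measurable_gauss_coord borel_measurable_const)

lemma measurable_mat_prod:
  assumes "\<And>i t. (\<lambda>x. A x (i, t)) \<in> borel_measurable M" "\<And>t k. (\<lambda>x. B x (t, k)) \<in> borel_measurable M"
  shows "(\<lambda>x. mat_prod n (A x) (B x)) \<in> measurable M gauss"
proof (rule measurable_into_gauss)
  fix ik :: "nat \<times> nat"
  show "(\<lambda>x. mat_prod n (A x) (B x) ik) \<in> borel_measurable M"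
    unfolding mat_prod_def using assms by (cases ik) (simp add: borel_measurable_sum borel_measurable_times)
qed

text \<open>
  A Givens rotation. The rotation of the columns \<open>I\<close> and \<open>\<tau> + 1\<close> that moves the
  entry \<open>(I, \<tau> + 1)\<close> into the diagonal has an angle that depends on row \<open>I\<close>
  only. Applied to the rows below \<open>I\<close> of the first factor and to the rows \<open>I\<close> and
  \<open>\<tau> + 1\<close> of the second, it leaves the product unchanged; as these coordinates are
  independent of row \<open>I\<close>, it preserves the Gaussian measure.
\<close>

lemma bartlett_step:
  assumes I: "I \<le> \<tau>" "Suc \<tau> < n"
  obtains R where "preserves_gauss R"
    "\<And>\<omega> i k. i < p \<Longrightarrow> k < K \<Longrightarrow>
      mat_prod n (partial_bartlett n I (Suc \<tau>) (R \<omega>)) (layer 2 (R \<omega>)) (i, k) =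
      mat_prod n (partial_bartlett n I \<tau> \<omega>) (layer 2 \<omega>) (i, k)"
proof -
  define J where "J = Suc \<tau>"
  have IJ: "I < J" "J < n" using I by (auto simp: J_def)
  define c where "c \<omega> = (if signed_norm \<omega> I J = 0 then 1 else signed_norm \<omega> I \<tau> / signed_norm \<omega> I J)" for \<omega>
  define s where "s \<omega> = (if signed_norm \<omega> I J = 0 then 0 else \<omega> (1, I, J) / signed_norm \<omega> I J)" for \<omega>
  have sq: "(signed_norm \<omega> I u)\<^sup>2 = (\<Sum>t=I..u. (\<omega> (1, I, t))\<^sup>2)" for \<omega> u
    by (simp add: signed_norm_def power_mult_distrib sum_nonneg)
  have sq': "(signed_norm \<omega> I J)\<^sup>2 = (signed_norm \<omega> I \<tau>)\<^sup>2 + (\<omega> (1, I, J))\<^sup>2" for \<omega>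
    unfolding sq J_def using I by simp
  have cs1: "(c \<omega>)\<^sup>2 + (s \<omega>)\<^sup>2 = 1" for \<omega>
  proof (cases "signed_norm \<omega> I J = 0")
    case False
    then have "(c \<omega>)\<^sup>2 + (s \<omega>)\<^sup>2 = ((signed_norm \<omega> I \<tau>)\<^sup>2 + (\<omega> (1, I, J))\<^sup>2) / (signed_norm \<omega> I J)\<^sup>2"
      by (simp add: c_def s_def power_divide add_divide_distrib)
    also have "\<dots> = 1" unfolding sq'[symmetric] using False by simp
    finally show ?thesis .
  qed (simp add: c_def s_def)
  have c0: "c \<omega> \<ge> 0" for \<omega>
    by (simp add: c_def signed_norm_def sum_nonneg)
  have cn: "c \<omega> * signed_norm \<omega> I J = signed_norm \<omega> I \<tau>" and sn: "s \<omega> * signed_norm \<omega> I J = \<omega> (1, I, J)" for \<omega>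
  proof -
    have "signed_norm \<omega> I \<tau> = 0 \<and> \<omega> (1, I, J) = 0" if "signed_norm \<omega> I J = 0"
    proof -
      have "(signed_norm \<omega> I \<tau>)\<^sup>2 + (\<omega> (1, I, J))\<^sup>2 = 0" using sq'[of \<omega>] that by simp
      then show ?thesis by (rule sum_power2_eq_zero_iff[THEN iffD1])
    qed
    then show "c \<omega> * signed_norm \<omega> I J = signed_norm \<omega> I \<tau>" "s \<omega> * signed_norm \<omega> I J = \<omega> (1, I, J)"
      by (auto simp: c_def s_def)
  qed
  \<comment> \<open>\<open>\<pi>\<close> exchanges the columns \<open>I\<close> and \<open>J\<close> of the first factor and the rows \<open>I\<close> and \<open>J\<close> of the second; \<open>A\<close> selects the entries with index \<open>I\<close> that are rotated.\<close>
  define sw where "sw t = (if t = I then J else if t = J then I else t)" for t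
  have swsw: "sw (sw t) = t" for t using IJ by (simp add: sw_def)
  define \<pi> where "\<pi> x = (case x of (l, a, b) \<Rightarrow> if l = 2 then (l, sw a, b) else (l, a, sw b))" for x :: "nat \<times> nat \<times> nat"
  define A where "A = (\<lambda>j. (1::nat, j, I)) ` {Suc I..<p} \<union> (\<lambda>k. (2::nat, I, k)) ` {..<K}"
  have Afin: "finite A" by (simp add: A_def)
  have pp: "\<pi> (\<pi> x) = x" for x by (cases x) (simp add: \<pi>_def swsw)
  have disj: "\<pi> x \<notin> A" if "x \<in> A" for x
    using that IJ by (auto simp: A_def \<pi>_def sw_def)
  define R where "R = rotate_pairs \<pi> A c s"
  have row: "(1, I, t) \<notin> A" "\<pi> (1, I, t) \<notin> A" for t by (auto simp: A_def \<pi>_def)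
  have indep: "c \<omega> = c \<omega>' \<and> s \<omega> = s \<omega>'" if "\<And>x. x \<notin> A \<Longrightarrow> \<pi> x \<notin> A \<Longrightarrow> \<omega> x = \<omega>' x" for \<omega> \<omega>'
  proof -
    have "\<omega> (1, I, t) = \<omega>' (1, I, t)" for t by (rule that[OF row])
    then show ?thesis by (simp add: c_def s_def signed_norm_def)
  qed
  have cm: "c \<in> borel_measurable gauss" "s \<in> borel_measurable gauss"
    unfolding c_def s_def by measurable
  have R: "preserves_gauss R"
    unfolding R_def by (rule preserves_gauss_rotate_pairs[OF Afin pp disj cm cs1 c0 indep])
  have R1: "R \<omega> (1, i, t) = \<omega> (1, i, t)" if "i \<le> I" for \<omega> i t
    using that by (auto simp: R_def rotate_pairs_def A_def \<pi>_def)
  have R1o: "R \<omega> (1, i, t) = \<omega> (1, i, t)" if "t \<noteq> I" "t \<noteq> J" for \<omega> i t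
    using that by (auto simp: R_def rotate_pairs_def A_def \<pi>_def sw_def)
  have R1I: "R \<omega> (1, i, I) = c \<omega> * \<omega> (1, i, I) + s \<omega> * \<omega> (1, i, J)" if "I < i" "i < p" for \<omega> i
    using that by (auto simp: R_def rotate_pairs_def A_def \<pi>_def sw_def)
  have R1J: "R \<omega> (1, i, J) = c \<omega> * \<omega> (1, i, J) - s \<omega> * \<omega> (1, i, I)" if "I < i" "i < p" for \<omega> i
    using that IJ by (auto simp: R_def rotate_pairs_def A_def \<pi>_def sw_def)
  have R2o: "R \<omega> (2, t, k) = \<omega> (2, t, k)" if "t \<noteq> I" "t \<noteq> J" for \<omega> t k
    using that by (auto simp: R_def rotate_pairs_def A_def \<pi>_def sw_def)
  have R2I: "R \<omega> (2, I, k) = c \<omega> * \<omega> (2, I, k) + s \<omega> * \<omega> (2, J, k)" if "k < K" for \<omega> k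
    using that by (auto simp: R_def rotate_pairs_def A_def \<pi>_def sw_def)
  have R2J: "R \<omega> (2, J, k) = c \<omega> * \<omega> (2, J, k) - s \<omega> * \<omega> (2, I, k)" if "k < K" for \<omega> k
    using that IJ by (auto simp: R_def rotate_pairs_def A_def \<pi>_def sw_def)
  have norm: "signed_norm (R \<omega>) i u = signed_norm \<omega> i u" if "i \<le> I" for \<omega> i u
    using that by (simp add: signed_norm_def R1)
  have split: "(\<Sum>t<n. g t) = g I + g J + (\<Sum>t\<in>{..<n} - {I, J}. g t)" for g :: "nat \<Rightarrow> real"
  proof -
    have "(\<Sum>t<n. g t) = g I + (\<Sum>t\<in>{..<n} - {I}. g t)" using IJ by (intro sum.remove) auto
    also have "(\<Sum>t\<in>{..<n} - {I}. g t) = g J + (\<Sum>t\<in>{..<n} - {I} - {J}. g t)" using IJ by (intro sum.remove) auto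
    also have "{..<n} - {I} - {J} = {..<n} - {I, J}" by auto
    finally show ?thesis by simp
  qed
  have "mat_prod n (partial_bartlett n I J (R \<omega>)) (layer 2 (R \<omega>)) (i, k) =
      mat_prod n (partial_bartlett n I \<tau> \<omega>) (layer 2 \<omega>) (i, k)" if ik: "i < p" "k < K" for \<omega> i k
  proof -
    let ?P = "\<lambda>t. partial_bartlett n I J (R \<omega>) (i, t)" and ?Q = "\<lambda>t. partial_bartlett n I \<tau> \<omega> (i, t)"
    let ?Y = "\<lambda>t. \<omega> (2, t, k)" and ?Z = "\<lambda>t. R \<omega> (2, t, k)"
    have rest: "(\<Sum>t\<in>{..<n} - {I, J}. ?P t * ?Z t) = (\<Sum>t\<in>{..<n} - {I, J}. ?Q t * ?Y t)"
    proof (intro sum.cong refl)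
      fix t assume "t \<in> {..<n} - {I, J}"
      then have t: "t \<noteq> I" "t \<noteq> J" by auto
      have "?P t = ?Q t"
        using t by (auto simp: partial_bartlett_def bartlett_def R1o norm J_def)
      then show "?P t * ?Z t = ?Q t * ?Y t" by (simp add: R2o[OF t])
    qed
    have main: "?P I * ?Z I + ?P J * ?Z J = ?Q I * ?Y I + ?Q J * ?Y J"
    proof -
      consider "i < I" | "i = I" | "i > I" by linarith
      then show ?thesis
      proof cases
        case 1
        then show ?thesis using IJ by (simp add: partial_bartlett_def bartlett_def)
      next
        case 2
        have "?P I * ?Z I + ?P J * ?Z J = signed_norm \<omega> I J * (c \<omega> * ?Y I + s \<omega> * ?Y J)"
          using 2 IJ ik by (simp add: partial_bartlett_def norm R2I)
        also have "\<dots> = (c \<omega> * signed_norm \<omega> I J) * ?Y I + (s \<omega> * signed_norm \<omega> I J) * ?Y J" by (simp add: algebra_simps)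
        also have "\<dots> = ?Q I * ?Y I + ?Q J * ?Y J"
          unfolding cn sn using 2 IJ by (simp add: partial_bartlett_def J_def)
        finally show ?thesis .
      next
        case 3
        have "?P I * ?Z I + ?P J * ?Z J = (c \<omega> * \<omega> (1, i, I) + s \<omega> * \<omega> (1, i, J)) * (c \<omega> * ?Y I + s \<omega> * ?Y J) +
            (c \<omega> * \<omega> (1, i, J) - s \<omega> * \<omega> (1, i, I)) * (c \<omega> * ?Y J - s \<omega> * ?Y I)"
          using 3 ik by (simp add: partial_bartlett_def R1I R1J R2I R2J)
        also have "\<dots> = ((c \<omega>)\<^sup>2 + (s \<omega>)\<^sup>2) * (\<omega> (1, i, I) * ?Y I + \<omega> (1, i, J) * ?Y J)"
          by (simp add: algebra_simps power2_eq_square)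
        also have "\<dots> = ?Q I * ?Y I + ?Q J * ?Y J" using 3 by (simp add: cs1 partial_bartlett_def)
        finally show ?thesis .
      qed
    qed
    show ?thesis
      using rest main unfolding mat_prod_def layer_def by (simp only: prod.case split)
  qed
  then show thesis using that[OF R] by (simp add: J_def)
qed

lemma bartlett_decomposition:
  fixes F :: "(nat \<times> nat \<Rightarrow> real) \<Rightarrow> real"
  assumes p: "p \<le> n" and F: "F \<in> borel_measurable gauss"
    and dep: "\<And>\<omega> \<omega>'. (\<And>i k. i < p \<Longrightarrow> k < K \<Longrightarrow> \<omega> (i, k) = \<omega>' (i, k)) \<Longrightarrow> F \<omega> = F \<omega>'"
  shows "(\<integral>\<omega>. F (mat_prod n (layer 1 \<omega>) (layer 2 \<omega>)) \<partial>gauss) = (\<integral>\<omega>. F (mat_prod n (bartlett n \<omega>) (layer 2 \<omega>)) \<partial>gauss)"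
proof -
  define E where "E I \<tau> = (\<integral>\<omega>. F (mat_prod n (partial_bartlett n I \<tau> \<omega>) (layer 2 \<omega>)) \<partial>gauss)" for I \<tau>
  have m: "(\<lambda>\<omega>. F (mat_prod n (partial_bartlett n I \<tau> \<omega>) (layer 2 \<omega>))) \<in> borel_measurable gauss" for I \<tau>
    by (intro measurable_compose[OF measurable_mat_prod F] measurable_partial_bartlett) (simp add: layer_def)
  have row: "E I I = E I \<tau>" if "I \<le> \<tau>" "\<tau> < n" for I \<tau>
    using that
  proof (induction \<tau> rule: dec_induct)
    case (step \<tau>)
    obtain R where R: "preserves_gauss R" and eq: "\<And>\<omega> i k. i < p \<Longrightarrow> k < K \<Longrightarrow>
      mat_prod n (partial_bartlett n I (Suc \<tau>) (R \<omega>)) (layer 2 (R \<omega>)) (i, k) =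
      mat_prod n (partial_bartlett n I \<tau> \<omega>) (layer 2 \<omega>) (i, k)"
      using bartlett_step[of I \<tau> n p K] step by auto
    have "E I \<tau> = (\<integral>\<omega>. F (mat_prod n (partial_bartlett n I (Suc \<tau>) (R \<omega>)) (layer 2 (R \<omega>))) \<partial>gauss)"
      unfolding E_def using eq by (intro Bochner_Integration.integral_cong refl dep) simp
    also have "\<dots> = E I (Suc \<tau>)"
      unfolding E_def by (rule preserves_gauss_integral[OF R m])
    finally show ?case using step by simp
  qed simp
  have "E 0 0 = E I I" if "I \<le> p" for I
    using that
  proof (induction I)
    case (Suc I)
    have "partial_bartlett n I (n - 1) \<omega> (i, t) = partial_bartlett n (Suc I) (Suc I) \<omega> (i, t)" if "t < n" for \<omega> i t
      using that Suc.prems p by (auto simp: partial_bartlett_def bartlett_def signed_norm_self less_Suc_eq)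
    then have "E I (n - 1) = E (Suc I) (Suc I)"
      unfolding E_def mat_prod_def by (intro Bochner_Integration.integral_cong refl arg_cong[where f = F]) (auto simp: fun_eq_iff intro!: sum.cong)
    then show ?case using Suc row[of I "n - 1"] p by simp
  qed simp
  then have "E 0 0 = E p p" by simp
  moreover have "E 0 0 = (\<integral>\<omega>. F (mat_prod n (layer 1 \<omega>) (layer 2 \<omega>)) \<partial>gauss)"
  proof -
    have "partial_bartlett n 0 0 \<omega> = layer 1 \<omega>" for \<omega>
      by (auto simp: partial_bartlett_def layer_def signed_norm_self fun_eq_iff)
    then show ?thesis by (simp add: E_def)
  qed
  moreover have "E p p = (\<integral>\<omega>. F (mat_prod n (bartlett n \<omega>) (layer 2 \<omega>)) \<partial>gauss)"
    unfolding E_def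
    by (intro Bochner_Integration.integral_cong refl dep) (simp add: mat_prod_def partial_bartlett_def)
  ultimately show ?thesis by simp
qed

lemma expectation_energy_sq:
  assumes "finite A"
  shows "(\<integral>\<omega>. (energy A \<omega>)\<^sup>2 \<partial>gauss) = real (card A) ^ 2 + 2 * real (card A)"
proof -
  have "(\<integral>\<omega>. (energy A \<omega>)\<^sup>2 \<partial>gauss) = (\<integral>\<omega>. (\<Sum>k\<in>A. \<Sum>l\<in>A. \<omega> k * \<omega> k * \<omega> l * \<omega> l) \<partial>gauss)"
    by (simp add: energy_def power2_eq_square sum_product mult.assoc)
  also have "\<dots> = (\<Sum>k\<in>A. \<Sum>l\<in>A. 1 + (if k = l then 2 else 0))"
    by (subst Bochner_Integration.integral_sum, intro all_moments_integrable all_moments_intros,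
        intro sum.cong refl, subst Bochner_Integration.integral_sum, intro all_moments_integrable all_moments_intros)
      (auto simp: isserlis_coord intro!: sum.cong)
  also have "\<dots> = real (card A) ^ 2 + 2 * real (card A)"
    using assms by (simp add: sum.distrib power2_eq_square distrib_left)
  finally show ?thesis .
qed

lemma all_moments_energy [all_moments_intros]: "all_moments gauss (energy A)"
  unfolding energy_def by (intro all_moments_intros)

lemma expectation_energy: "finite A \<Longrightarrow> (\<integral>\<omega>. energy A \<omega> \<partial>gauss) = real (card A)"
  unfolding energy_def
  by (subst Bochner_Integration.integral_sum) (intro all_moments_integrable all_moments_intros, simp)

text \<open>
  A function of the upper left \<open>p \<times> q\<close> corner of an infinite matrix.
\<close>

definition block :: "nat \<Rightarrow> nat \<Rightarrow> ((nat \<times> nat \<Rightarrow> real) \<Rightarrow> 'a) \<Rightarrow> bool" where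
  "block p q f \<longleftrightarrow> (\<forall>\<omega> \<omega>'. (\<forall>i<p. \<forall>k<q. \<omega> (i, k) = \<omega>' (i, k)) \<longrightarrow> f \<omega> = f \<omega>')"

lemma blockD: "block p q f \<Longrightarrow> (\<And>i k. i < p \<Longrightarrow> k < q \<Longrightarrow> \<omega> (i, k) = \<omega>' (i, k)) \<Longrightarrow> f \<omega> = f \<omega>'"
  unfolding block_def by blast

definition mat_scale :: "real \<Rightarrow> (nat \<times> nat \<Rightarrow> real) \<Rightarrow> nat \<times> nat \<Rightarrow> real" where
  "mat_scale c A = (\<lambda>x. c * A x)"

lemma measurable_mat_scale: "mat_scale c \<in> measurable gauss gauss"
  by (rule measurable_into_gauss) (simp add: mat_scale_def)

text \<open>
  Given its diagonal, the Bartlett factor times a Gaussian matrix is a \<open>triangular_product\<close>. The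
  squared diagonal entries \<open>S i\<close> are chi-square averages with \<open>E (S i - 1)\<^sup>2 = O(1/n
  + p\<^sup>2/n\<^sup>2)\<close>, so for \<open>p \<le> q\<close> the total cost of the rows is of the order
  \<open>pq/n = e\<^sup>2\<close>, and \<open>l = e\<close> is the right choice in
  \<open>triangular_close\<close>.
\<close>

lemma bartlett_product_close:
  fixes f :: "(nat \<times> nat \<Rightarrow> real) \<Rightarrow> real"
  assumes pq: "1 \<le> p" "p \<le> q" and n: "p * q \<le> n"
    and f: "f \<in> borel_measurable gauss" and f01: "\<And>\<omega>. 0 \<le> f \<omega>" "\<And>\<omega>. f \<omega> \<le> 1" and dep: "block p q f"
  shows "\<bar>(\<integral>\<omega>. f (mat_scale (1 / sqrt n) (mat_prod n (bartlett n \<omega>) (layer 2 \<omega>))) \<partial>gauss) - (\<integral>\<omega>. f \<omega> \<partial>gauss)\<bar>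
    \<le> 25 * sqrt (real (p * q) / real n)"
proof -
  have "p * 1 \<le> p * q" using pq by (intro mult_left_mono) auto
  from order_trans[OF this n] have pn: "p \<le> n" by simp
  have n0: "n > 0" using pn pq by simp
  define e where "e = sqrt (real (p * q) / real n)"
  have e2: "e\<^sup>2 = real p * real q / real n" by (simp add: e_def)
  have e: "0 < e" "e \<le> 1"
  proof -
    show "0 < e" using pq n0 by (simp add: e_def)
    have "real (p * q) / real n \<le> 1" using n n0 by (simp del: of_nat_mult)
    then show "e \<le> 1" unfolding e_def by (simp del: of_nat_mult)
  qed
  define T where "T i = (\<lambda>t. (1::nat, i, t)) ` {i..<n}" for i :: nat
  define S where "S i \<omega> = energy (T i) \<omega> / n" for i \<omega>
  have cT: "card (T i) = n - i" "finite (T i)" for i by (simp_all add: T_def card_image inj_on_def)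
  have Tsum: "energy (T i) \<omega> = (\<Sum>t=i..<n. (\<omega> (1, i, t))\<^sup>2)" for i \<omega>
    unfolding energy_def T_def by (subst sum.reindex) (simp_all add: inj_on_def)
  define s where "s \<omega> i = signed_norm \<omega> i (n - 1) / sqrt n" for \<omega> i
  have sS: "(s \<omega> i)\<^sup>2 = S i \<omega>" for \<omega> i
  proof -
    have "{i..n - 1} = {i..<n}" using n0 by auto
    then have "(signed_norm \<omega> i (n - 1))\<^sup>2 = energy (T i) \<omega>"
      by (simp add: signed_norm_def power_mult_distrib sum_nonneg Tsum)
    then show ?thesis by (simp add: s_def S_def power_divide)
  qed
  have Sm: "all_moments gauss (S i)" for i unfolding S_def by (intro all_moments_intros)
  have ES: "(\<integral>\<omega>. (S i \<omega> - 1)\<^sup>2 \<partial>gauss) \<le> (real p)\<^sup>2 / (real n)\<^sup>2 + 2 / real n" if i: "i < p" for i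
  proof -
    have int: "integrable gauss (energy (T i))" "integrable gauss (\<lambda>\<omega>. (energy (T i) \<omega>)\<^sup>2)"
      by (intro all_moments_integrable all_moments_intros)+
    have "(S i \<omega> - 1)\<^sup>2 = ((energy (T i) \<omega>)\<^sup>2 - 2 * n * energy (T i) \<omega> + n\<^sup>2) / n\<^sup>2" for \<omega>
      using n0 by (simp add: S_def power2_eq_square field_simps)
    then have "(\<integral>\<omega>. (S i \<omega> - 1)\<^sup>2 \<partial>gauss) = ((\<integral>\<omega>. (energy (T i) \<omega>)\<^sup>2 \<partial>gauss) - 2 * n * (\<integral>\<omega>. energy (T i) \<omega> \<partial>gauss) + n\<^sup>2) / n\<^sup>2"
      using int by simp
    also have "\<dots> = ((real n - real i)\<^sup>2 + 2 * (real n - real i) - 2 * n * (real n - real i) + n\<^sup>2) / n\<^sup>2"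
      using i pn by (simp add: expectation_energy_sq expectation_energy cT of_nat_diff)
    also have "\<dots> = ((real i)\<^sup>2 + 2 * (real n - real i)) / n\<^sup>2" by (simp add: power2_eq_square algebra_simps)
    also have "\<dots> \<le> ((real p)\<^sup>2 + 2 * real n) / n\<^sup>2"
    proof -
      have "(real i)\<^sup>2 \<le> (real p)\<^sup>2" using i by (intro power_mono) auto
      then have "(real i)\<^sup>2 + 2 * (real n - real i) \<le> (real p)\<^sup>2 + 2 * real n" by (intro add_mono) auto
      then show ?thesis by (rule divide_right_mono) simp
    qed
    also have "\<dots> = (real p)\<^sup>2 / (real n)\<^sup>2 + 2 / real n" using n0 by (simp add: add_divide_distrib power2_eq_square)
    finally show ?thesis .
  qed
  \<comment> \<open>The coordinates that stay random when the diagonal is fixed: the second factor and the entries of the first below the diagonal. Indices without a meaning are sent to the unused layer 3 to keep the map injective.\<close>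
  define h where "h x = (case x of (i, m) \<Rightarrow> if m < q then (2::nat, i, m) else if m - q < i then (1, i, m - q) else (3, i, m))"
    for x :: "nat \<times> nat"
  have h: "inj h" unfolding h_def by (auto simp: inj_on_def split: if_splits)
  have gr1: "graft h \<omega> \<zeta> (1, i, t) = \<omega> (1, i, t)" if "t \<ge> i" for \<omega> \<zeta> i t
    using that by (intro graft_other) (auto simp: h_def split: if_splits)
  have gr2: "graft h \<omega> \<zeta> (2, i, k) = \<zeta> (i, k)" if "k < q" for \<omega> \<zeta> i k
    using graft_image[OF h, of \<omega> \<zeta> "(i, k)"] that by (simp add: h_def)
  have gr3: "graft h \<omega> \<zeta> (1, i, t) = \<zeta> (i, q + t)" if "t < i" for \<omega> \<zeta> i t
    using graft_image[OF h, of \<omega> \<zeta> "(i, q + t)"] that by (simp add: h_def)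
  let ?X = "\<lambda>\<omega>. mat_scale (1 / sqrt n) (mat_prod n (bartlett n \<omega>) (layer 2 \<omega>))"
  have Xm: "?X \<in> measurable gauss gauss"
  proof (intro measurable_compose[OF measurable_mat_prod measurable_mat_scale])
    show "(\<lambda>x. bartlett n x (i, t)) \<in> borel_measurable gauss" for i t
      using measurable_partial_bartlett[of n "Suc i" 0 i t] by (simp add: partial_bartlett_def)
  qed (simp add: layer_def)
  have inner: "f (?X (graft h \<omega> \<zeta>)) = f (triangular_product n q (s \<omega>) \<zeta>)" for \<omega> \<zeta>
  proof (rule blockD[OF dep])
    fix i k assume ik: "i < p" "k < q"
    have sn: "signed_norm (graft h \<omega> \<zeta>) i (n - 1) = signed_norm \<omega> i (n - 1)"
      by (simp add: signed_norm_def gr1)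
    have "(\<Sum>t<n. bartlett n (graft h \<omega> \<zeta>) (i, t) * layer 2 (graft h \<omega> \<zeta>) (t, k)) =
       (\<Sum>t<Suc i. bartlett n (graft h \<omega> \<zeta>) (i, t) * layer 2 (graft h \<omega> \<zeta>) (t, k))"
      using ik pn by (intro sum.mono_neutral_right) (auto simp: bartlett_def)
    also have "\<dots> = signed_norm \<omega> i (n - 1) * \<zeta> (i, k) + (\<Sum>t<i. \<zeta> (i, q + t) * \<zeta> (t, k))"
      using ik by (simp add: bartlett_def layer_def gr2 gr3 sn)
    finally show "?X (graft h \<omega> \<zeta>) (i, k) = triangular_product n q (s \<omega>) \<zeta> (i, k)"
      by (simp add: mat_scale_def mat_prod_def triangular_product_def s_def add_divide_distrib)
  qed
  have fX: "integrable gauss (\<lambda>\<omega>. f (?X \<omega>))"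
    using f01 measurable_compose[OF Xm f] by (intro G.integrable_const_bound[of _ 1]) auto
  define V where "V \<omega> = (\<integral>\<zeta>. f (triangular_product n q (s \<omega>) \<zeta>) \<partial>gauss)" for \<omega>
  define c where "c = (\<integral>\<omega>. f \<omega> \<partial>gauss)"
  \<comment> \<open>The last sum exceeds 1 if some \<open>S i\<close> is below 1/2, where \<open>triangular_close\<close> does not apply.\<close>
  define D where "D \<omega> = e + (\<Sum>i<p. row_cost n q i (S i \<omega>)) / e + 4 * (\<Sum>i<p. (S i \<omega> - 1)\<^sup>2)" for \<omega>
  have V: "(\<integral>\<omega>. f (?X \<omega>) \<partial>gauss) = (\<integral>\<omega>. V \<omega> \<partial>gauss)" "integrable gauss V"
    using integral_graft[OF h fX] unfolding V_def[abs_def] by (simp_all add: inner)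
  have V01: "0 \<le> V \<omega>" "V \<omega> \<le> 1" for \<omega>
  proof -
    show "0 \<le> V \<omega>" unfolding V_def using f01 by simp
    have "integrable gauss (\<lambda>\<zeta>. f (triangular_product n q (s \<omega>) \<zeta>))"
      using f01 measurable_compose[OF measurable_triangular_product f] by (intro G.integrable_const_bound[of _ 1]) auto
    then have "V \<omega> \<le> (\<integral>\<zeta>. 1 \<partial>(gauss :: (nat \<times> nat \<Rightarrow> real) measure))"
      unfolding V_def using f01 by (intro integral_mono) auto
    then show "V \<omega> \<le> 1" by simp
  qed
  have c01: "0 \<le> c" "c \<le> 1"
  proof -
    show "0 \<le> c" unfolding c_def using f01 by simp
    have "integrable gauss f" using f01 f by (intro G.integrable_const_bound[of _ 1]) auto
    then have "c \<le> (\<integral>\<zeta>. 1 \<partial>(gauss :: (nat \<times> nat \<Rightarrow> real) measure))"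
      unfolding c_def using f01 by (intro integral_mono) auto
    then show "c \<le> 1" by simp
  qed
  have rc0: "row_cost n q i x \<ge> 0" for i x unfolding row_cost_def by simp
  have VD: "\<bar>V \<omega> - c\<bar> \<le> D \<omega>" for \<omega>
  proof (cases "\<forall>i<p. S i \<omega> \<ge> 1 / 2")
    case True
    have "\<bar>V \<omega> - c\<bar> \<le> e + (\<Sum>i<p. row_cost n q i ((s \<omega> i)\<^sup>2)) / e"
      unfolding V_def c_def using True n0 pq e
      by (intro triangular_close f f01 blockD[OF dep]) (auto simp: sS)
    moreover have "0 \<le> (\<Sum>i<p. (S i \<omega> - 1)\<^sup>2)" by (intro sum_nonneg) simp
    ultimately show ?thesis unfolding D_def sS by simp
  next
    case False
    then obtain i where i: "i < p" "S i \<omega> < 1 / 2" by auto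
    have "(1 / 2)\<^sup>2 \<le> (1 - S i \<omega>)\<^sup>2" using i by (intro power_mono) auto
    then have "1 \<le> 4 * (1 - S i \<omega>)\<^sup>2" by (simp add: power2_eq_square)
    then have "1 \<le> 4 * (S i \<omega> - 1)\<^sup>2" by (simp only: power2_commute[of 1])
    also have "(S i \<omega> - 1)\<^sup>2 \<le> (\<Sum>i<p. (S i \<omega> - 1)\<^sup>2)" using i by (intro member_le_sum) auto
    finally have "1 \<le> 4 * (\<Sum>i<p. (S i \<omega> - 1)\<^sup>2)" by simp
    moreover have "0 \<le> (\<Sum>i<p. row_cost n q i (S i \<omega>)) / e" using e rc0 by (intro divide_nonneg_nonneg sum_nonneg) auto
    ultimately have "1 \<le> D \<omega>" unfolding D_def using e by simp
    then show ?thesis using V01[of \<omega>] c01 by linarith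
  qed
  have Dm: "all_moments gauss D"
    unfolding D_def row_cost_def by (intro all_moments_intros Sm)
  define w where "w = (real p)\<^sup>2 / (real n)\<^sup>2 + 2 / real n"
  have iS: "integrable gauss (\<lambda>\<omega>. (S i \<omega> - 1)\<^sup>2)" for i by (intro all_moments_integrable all_moments_intros Sm)
  have p2: "real p * real p * (real p * real q) / (real n)\<^sup>2 \<le> e\<^sup>2" "real p * real p * (real q * real q) / (real n)\<^sup>2 \<le> e\<^sup>2"
    "real p / real n \<le> e\<^sup>2" "real p * (real p * real p) / (real n)\<^sup>2 \<le> e\<^sup>2"
  proof -
    have b: "real p * real q \<le> real n" using n by (metis of_nat_le_iff of_nat_mult)
    have pq': "real p \<le> real q" "1 \<le> real p" "1 \<le> real q" using pq by auto
    have e4: "(real p * real q) * (real p * real q) / (real n)\<^sup>2 \<le> e\<^sup>2"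
    proof -
      have "(real p * real q) * (real p * real q) \<le> (real p * real q) * real n" using b by (intro mult_left_mono) auto
      then have "(real p * real q) * (real p * real q) / (real n)\<^sup>2 \<le> (real p * real q) * real n / (real n)\<^sup>2" by (rule divide_right_mono) simp
      also have "(real p * real q) * real n / (real n)\<^sup>2 = e\<^sup>2" using n0 unfolding e2 by (simp add: power2_eq_square)
      finally show ?thesis .
    qed
    have "real p * real p * (real p * real q) \<le> (real p * real q) * (real p * real q)" using pq' by (intro mult_right_mono mult_left_mono) auto
    from divide_right_mono[OF this, of "(real n)\<^sup>2"] e4 show "real p * real p * (real p * real q) / (real n)\<^sup>2 \<le> e\<^sup>2" by simp
    show "real p * real p * (real q * real q) / (real n)\<^sup>2 \<le> e\<^sup>2" using e4 by (simp add: mult.assoc mult.left_commute)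
    have "real p * 1 \<le> real p * real q" using pq' by (intro mult_left_mono) auto
    then show pn': "real p / real n \<le> e\<^sup>2" unfolding e2 by (intro divide_right_mono) auto
    have "real p * real p \<le> real p * real q" using pq' by (intro mult_left_mono) auto
    also note b
    finally have "real p * real p \<le> real n" .
    then have "real p * (real p * real p) \<le> real p * real n" by (intro mult_left_mono) auto
    then have "real p * (real p * real p) / (real n)\<^sup>2 \<le> real p * real n / (real n)\<^sup>2" by (rule divide_right_mono) simp
    also have "\<dots> = real p / real n" using n0 by (simp add: power2_eq_square)
    finally show "real p * (real p * real p) / (real n)\<^sup>2 \<le> e\<^sup>2" using pn' by simp
  qed
  have sumS: "(\<Sum>i<p. (\<integral>\<omega>. (S i \<omega> - 1)\<^sup>2 \<partial>gauss)) \<le> 3 * e\<^sup>2"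
  proof -
    have "(\<Sum>i<p. (\<integral>\<omega>. (S i \<omega> - 1)\<^sup>2 \<partial>gauss)) \<le> (\<Sum>i<p. w)" unfolding w_def by (intro sum_mono ES) auto
    also have "\<dots> = real p * (real p * real p) / (real n)\<^sup>2 + 2 * (real p / real n)" by (simp add: w_def distrib_left power2_eq_square)
    finally show ?thesis using p2 by linarith
  qed
  have sumK: "(\<Sum>i<p. (\<integral>\<omega>. row_cost n q i (S i \<omega>) \<partial>gauss)) \<le> 12 * e\<^sup>2"
  proof -
    have "(\<integral>\<omega>. row_cost n q i (S i \<omega>) \<partial>gauss) \<le> 3 * real q * (real p)\<^sup>2 / n\<^sup>2 + 3 * real q / n + 6 * real p * (real q)\<^sup>2 / n\<^sup>2" if i: "i < p" for i
    proof -
      have "(\<integral>\<omega>. row_cost n q i (S i \<omega>) \<partial>gauss) = 3 / 2 * real q * (\<integral>\<omega>. (S i \<omega> - 1)\<^sup>2 \<partial>gauss) + 3 / 2 * real q * (real i)\<^sup>2 / n\<^sup>2 + 6 * real i * (real q)\<^sup>2 / n\<^sup>2"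
        unfolding row_cost_def using iS by simp
      also have "\<dots> \<le> 3 / 2 * real q * ((real p)\<^sup>2 / (real n)\<^sup>2 + 2 / real n) + 3 / 2 * real q * (real p)\<^sup>2 / n\<^sup>2 + 6 * real p * (real q)\<^sup>2 / n\<^sup>2"
        using i by (intro add_mono mult_left_mono divide_right_mono ES mult_right_mono power_mono) auto
      also have "\<dots> = 3 * real q * (real p)\<^sup>2 / n\<^sup>2 + 3 * real q / n + 6 * real p * (real q)\<^sup>2 / n\<^sup>2"
        by (simp add: distrib_left)
      finally show ?thesis .
    qed
    then have "(\<Sum>i<p. (\<integral>\<omega>. row_cost n q i (S i \<omega>) \<partial>gauss)) \<le> (\<Sum>i<p. 3 * real q * (real p)\<^sup>2 / n\<^sup>2 + 3 * real q / n + 6 * real p * (real q)\<^sup>2 / n\<^sup>2)"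
      by (intro sum_mono) auto
    also have "\<dots> = 3 * (real p * real p * (real p * real q) / (real n)\<^sup>2) + 3 * (real p * real q / real n) + 6 * (real p * real p * (real q * real q) / (real n)\<^sup>2)"
      by (simp add: distrib_left power2_eq_square mult.commute mult.left_commute)
    also have "\<dots> \<le> 3 * e\<^sup>2 + 3 * e\<^sup>2 + 6 * e\<^sup>2" using p2 unfolding e2[symmetric] by (intro add_mono mult_left_mono) auto
    finally show ?thesis by simp
  qed
  have iK: "integrable gauss (\<lambda>\<omega>. row_cost n q i (S i \<omega>))" for i
    unfolding row_cost_def by (intro all_moments_integrable all_moments_intros Sm)
  have "(\<integral>\<omega>. D \<omega> \<partial>gauss) = e + (\<Sum>i<p. (\<integral>\<omega>. row_cost n q i (S i \<omega>) \<partial>gauss)) / e + 4 * (\<Sum>i<p. (\<integral>\<omega>. (S i \<omega> - 1)\<^sup>2 \<partial>gauss))"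
    unfolding D_def using iK iS by simp
  also have "\<dots> \<le> e + (12 * e\<^sup>2) / e + 4 * (3 * e\<^sup>2)"
    using sumS sumK e by (intro add_mono mult_left_mono divide_right_mono) auto
  also have "\<dots> \<le> e + 12 * e + 12 * e"
  proof -
    have "e\<^sup>2 \<le> e" using e by (simp add: power2_eq_square mult_left_le)
    then show ?thesis using e by (simp add: power2_eq_square)
  qed
  finally have ED: "(\<integral>\<omega>. D \<omega> \<partial>gauss) \<le> 25 * e" by simp
  have "\<bar>(\<integral>\<omega>. V \<omega> \<partial>gauss) - c\<bar> = \<bar>(\<integral>\<omega>. V \<omega> - c \<partial>gauss)\<bar>" using V(2) by simp
  also have "\<dots> \<le> (\<integral>\<omega>. \<bar>V \<omega> - c\<bar> \<partial>gauss)" by (rule integral_abs_bound)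
  also have "\<dots> \<le> (\<integral>\<omega>. D \<omega> \<partial>gauss)"
    using V(2) VD by (intro integral_mono all_moments_integrable[OF Dm]) auto
  finally show ?thesis using ED by (simp add: V(1) c_def e_def)
qed

section \<open>Chains of Gaussian matrices\<close>

lemma measurable_layer: "layer m \<in> measurable gauss gauss"
  by (rule measurable_into_gauss) (simp add: layer_def split_beta)

lemma measurable_layer_entry: "(\<lambda>\<omega>. layer m \<omega> x) \<in> borel_measurable gauss"
  by (rule measurable_compose[OF measurable_layer measurable_gauss_coord])

lemma integral_layer:
  fixes F :: "(nat \<times> nat \<Rightarrow> real) \<Rightarrow> real"
  assumes "F \<in> borel_measurable gauss"
  shows "(\<integral>\<omega>. F (layer m \<omega>) \<partial>gauss) = (\<integral>\<zeta>. F \<zeta> \<partial>gauss)"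
proof -
  have "inj (\<lambda>(i, k). (m, i, k))" by (auto simp: inj_on_def)
  from integral_reindex[OF this assms] show ?thesis by (simp add: layer_def split_beta' cond_case_prod_eta)
qed

definition lower_tri :: "nat \<Rightarrow> (nat \<times> nat \<Rightarrow> real) \<Rightarrow> nat \<times> nat \<Rightarrow> real" where
  "lower_tri n M = bartlett n (\<lambda>(l, x). M x)"

lemma bartlett_eq_lower_tri: "bartlett n \<omega> = lower_tri n (layer 1 \<omega>)"
  by (auto simp: lower_tri_def bartlett_def signed_norm_def layer_def fun_eq_iff)

lemma lower_tri_zero: "i < t \<Longrightarrow> lower_tri n M (i, t) = 0"
  by (simp add: lower_tri_def bartlett_def)

lemma measurable_lower_tri: "(\<lambda>M. lower_tri n M x) \<in> borel_measurable gauss"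
proof -
  obtain i t where x: "x = (i, t)" by (cases x)
  have b: "(\<lambda>\<omega>. bartlett n \<omega> (i, t)) \<in> borel_measurable gauss"
    using measurable_partial_bartlett[of n "Suc i" 0 i t] by (simp add: partial_bartlett_def)
  have "(\<lambda>M (l :: nat, x). M x) \<in> measurable gauss gauss"
    by (rule measurable_into_gauss) (simp add: split_beta)
  from measurable_compose[OF this b] show ?thesis unfolding lower_tri_def x .
qed

lemma mat_scale_mat_prod: "mat_prod n A (mat_scale c B) = mat_scale c (mat_prod n A B)"
  by (auto simp: mat_prod_def mat_scale_def fun_eq_iff sum_distrib_left mult.left_commute)

lemma mat_prod_assoc: "mat_prod m (mat_prod n A B) C = mat_prod n A (mat_prod m B C)"
proof (intro ext, clarify)
  fix i k
  have "(\<Sum>t<m. (\<Sum>u<n. A (i, u) * B (u, t)) * C (t, k)) = (\<Sum>t<m. \<Sum>u<n. A (i, u) * (B (u, t) * C (t, k)))"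
    by (simp add: sum_distrib_right mult.assoc)
  also have "\<dots> = (\<Sum>u<n. A (i, u) * (\<Sum>t<m. B (u, t) * C (t, k)))"
    by (subst sum.swap) (simp add: sum_distrib_left)
  finally show "mat_prod m (mat_prod n A B) C (i, k) = mat_prod n A (mat_prod m B C) (i, k)"
    by (simp add: mat_prod_def)
qed

lemma Bernoulli_integrable:
  assumes "f \<in> borel_measurable gauss" "\<And>\<omega>. 0 \<le> f \<omega>" "\<And>\<omega>. f \<omega> \<le> (1::real)"
  shows "integrable (gauss :: ('i \<Rightarrow> real) measure) f"
  using assms by (intro G.integrable_const_bound[of _ 1]) auto

text \<open>
  Transposition exchanges the two factors, so \<open>p \<le> q\<close> may be assumed.
\<close>

lemma gaussian_product_close:
  fixes f :: "(nat \<times> nat \<Rightarrow> real) \<Rightarrow> real"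
  assumes pq: "1 \<le> p" "1 \<le> q" and n: "p * q \<le> n"
    and f: "f \<in> borel_measurable gauss" and f01: "\<And>\<omega>. 0 \<le> f \<omega>" "\<And>\<omega>. f \<omega> \<le> 1" and dep: "block p q f"
  shows "\<bar>(\<integral>\<omega>. f (mat_scale (1 / sqrt n) (mat_prod n (layer 1 \<omega>) (layer 2 \<omega>))) \<partial>gauss) - (\<integral>\<omega>. f \<omega> \<partial>gauss)\<bar>
    \<le> 25 * sqrt (real (p * q) / real n)"
proof -
  have wide: "\<bar>(\<integral>\<omega>. f (mat_scale (1 / sqrt n) (mat_prod n (layer 1 \<omega>) (layer 2 \<omega>))) \<partial>gauss) - (\<integral>\<omega>. f \<omega> \<partial>gauss)\<bar>
    \<le> 25 * sqrt (real (p * q) / real n)"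
    if pq: "1 \<le> p" "p \<le> q" and n: "p * q \<le> n"
    and f: "f \<in> borel_measurable gauss" and f01: "\<And>\<omega>. 0 \<le> f \<omega>" "\<And>\<omega>. f \<omega> \<le> 1" and dep: "block p q f"
    for p q and f :: "(nat \<times> nat \<Rightarrow> real) \<Rightarrow> real"
  proof -
    have "p * 1 \<le> p * q" using pq by (intro mult_left_mono) auto
    from order_trans[OF this n] have pn: "p \<le> n" by simp
    have "(\<integral>\<omega>. f (mat_scale (1 / sqrt n) (mat_prod n (layer 1 \<omega>) (layer 2 \<omega>))) \<partial>gauss) =
        (\<integral>\<omega>. f (mat_scale (1 / sqrt n) (mat_prod n (bartlett n \<omega>) (layer 2 \<omega>))) \<partial>gauss)"
      by (rule bartlett_decomposition[OF pn measurable_compose[OF measurable_mat_scale f], of q])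
        (rule blockD[OF dep], simp add: mat_scale_def)
    then show ?thesis using bartlett_product_close[OF pq n f f01 dep] by simp
  qed
  show ?thesis
  proof (cases "p \<le> q")
    case True
    then show ?thesis using wide[OF _ _ n f f01 dep] pq by blast
  next
    case False
    \<comment> \<open>The reindexing \<open>\<sigma>\<close> transposes both factors and exchanges them.\<close>
    define tr where "tr M = (\<lambda>(i, k). M (k, i))" for M :: "nat \<times> nat \<Rightarrow> real"
    have trm: "tr \<in> measurable gauss gauss" unfolding tr_def by (rule measurable_into_gauss) (simp add: split_beta)
    have fm: "(\<lambda>M. f (tr M)) \<in> borel_measurable gauss" by (rule measurable_compose[OF trm f])
    have bl: "block q p (\<lambda>M. f (tr M))"
      unfolding block_def by (intro allI impI blockD[OF dep]) (simp add: tr_def)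
    define \<sigma> where "\<sigma> x = (case x of (l, i, k) \<Rightarrow> (if l = 1 then 2 else if l = 2 then 1 else l, k, i))" for x :: "nat \<times> nat \<times> nat"
    have \<sigma>: "inj \<sigma>" by (auto simp: inj_on_def \<sigma>_def split: if_splits)
    have inj2: "inj (\<lambda>(i :: nat, k :: nat). (k, i))" by (auto simp: inj_on_def)
    have "(\<integral>\<omega>. f (tr \<omega>) \<partial>gauss) = (\<integral>\<omega>. f \<omega> \<partial>gauss)"
      using integral_reindex[OF inj2 f] by (simp add: tr_def split_beta')
    moreover have "(\<integral>\<omega>. f (tr (mat_scale (1 / sqrt n) (mat_prod n (layer 1 \<omega>) (layer 2 \<omega>)))) \<partial>gauss) =
        (\<integral>\<omega>. f (mat_scale (1 / sqrt n) (mat_prod n (layer 1 \<omega>) (layer 2 \<omega>))) \<partial>gauss)"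
    proof -
      define F where "F \<omega> = f (tr (mat_scale (1 / sqrt n) (mat_prod n (layer 1 \<omega>) (layer 2 \<omega>))))" for \<omega>
      have "(\<lambda>\<omega>. mat_scale (1 / sqrt n) (mat_prod n (layer 1 \<omega>) (layer 2 \<omega>))) \<in> measurable gauss gauss"
        by (intro measurable_compose[OF measurable_mat_prod measurable_mat_scale] measurable_layer_entry)
      from measurable_compose[OF this fm] have Fm: "F \<in> borel_measurable gauss" unfolding F_def .
      have "F (\<lambda>j. \<omega> (\<sigma> j)) = f (mat_scale (1 / sqrt n) (mat_prod n (layer 1 \<omega>) (layer 2 \<omega>)))" for \<omega>
        unfolding F_def
        by (rule arg_cong[where f = f]) (auto simp: fun_eq_iff tr_def mat_scale_def mat_prod_def layer_def \<sigma>_def mult.commute)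
      then show ?thesis using integral_reindex[OF \<sigma> Fm] by (simp add: F_def)
    qed
    ultimately show ?thesis
      using wide[of q p "\<lambda>M. f (tr M)", OF _ _ _ fm _ _ bl] False pq n f01 by (simp add: mult.commute)
  qed
qed

text \<open>
  The product of the layers \<open>m, \<dots>, m + j\<close>, in which layer \<open>i\<close> is divided by
  the square root of its number \<open>d i\<close> of columns, except for the last layer.
\<close>

primrec chain :: "(nat \<Rightarrow> nat) \<Rightarrow> nat \<Rightarrow> nat \<Rightarrow> layers \<Rightarrow> nat \<times> nat \<Rightarrow> real" where
  "chain d 0 m \<omega> = layer m \<omega>"
| "chain d (Suc j) m \<omega> = mat_scale (1 / sqrt (d m)) (mat_prod (d m) (layer m \<omega>) (chain d j (Suc m) \<omega>))"

lemma measurable_chain: "chain d j m \<in> measurable gauss gauss"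
proof (induction j arbitrary: m)
  case 0
  then show ?case using measurable_layer by simp
next
  case (Suc j)
  have "(\<lambda>\<omega>. chain d j (Suc m) \<omega> x) \<in> borel_measurable gauss" for x
    by (rule measurable_compose[OF Suc measurable_gauss_coord])
  then have "(\<lambda>\<omega>. mat_scale (1 / sqrt (d m)) (mat_prod (d m) (layer m \<omega>) (chain d j (Suc m) \<omega>))) \<in> measurable gauss gauss"
    by (intro measurable_compose[OF measurable_mat_prod measurable_mat_scale] measurable_layer_entry)
  then show ?case by simp
qed

lemma chain_cong:
  assumes "\<And>l i k. m \<le> l \<Longrightarrow> \<omega> (l, i, k) = \<omega>' (l, i, k)"
  shows "chain d j m \<omega> = chain d j m \<omega>'"
  using assms
proof (induction j arbitrary: m)
  case 0
  then show ?case by (auto simp: layer_def fun_eq_iff)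
next
  case (Suc j)
  have "chain d j (Suc m) \<omega> = chain d j (Suc m) \<omega>'" using Suc.prems by (intro Suc.IH) auto
  moreover have "layer m \<omega> = layer m \<omega>'" using Suc.prems by (auto simp: layer_def fun_eq_iff)
  ultimately show ?case by simp
qed

text \<open>
  The Bartlett decomposition of the first two layers of a chain. The layers after them form the map
  \<open>tail\<close>, which acts on the product of these two layers from the right.
\<close>

lemma lower_tri_chain:
  fixes F :: "(nat \<times> nat \<Rightarrow> real) \<Rightarrow> real"
  assumes m: "m \<ge> 1" and p: "p \<le> n" and F: "F \<in> borel_measurable gauss" and F01: "\<And>\<omega>. 0 \<le> F \<omega>" "\<And>\<omega>. F \<omega> \<le> 1" and dep: "block p q F"
  shows "(\<integral>\<omega>. F (mat_prod n (layer m \<omega>) (chain d j (Suc m) \<omega>)) \<partial>gauss) =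
    (\<integral>\<omega>. F (mat_prod n (lower_tri n (layer m \<omega>)) (chain d j (Suc m) \<omega>)) \<partial>gauss)"
proof -
  define tail where "tail \<omega> Y = (case j of 0 \<Rightarrow> Y | Suc j' \<Rightarrow> mat_scale (1 / sqrt (d (Suc m))) (mat_prod (d (Suc m)) Y (chain d j' (Suc (Suc m)) \<omega>)))" for \<omega> Y
  have tail: "chain d j (Suc m) \<omega> = tail \<omega> (layer (Suc m) \<omega>)" for \<omega>
    by (cases j) (simp_all add: tail_def)
  have tail_prod: "mat_prod n A (tail \<omega> Y) = tail \<omega> (mat_prod n A Y)" for A Y \<omega>
    by (cases j) (simp_all add: tail_def mat_scale_mat_prod mat_prod_assoc)
  \<comment> \<open>Indices of other layers are parked in layer 0, which no chain reads, to keep the map injective.\<close>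
  define h where "h x = (case x of (l, i, k) \<Rightarrow> if l = 1 then (m, i, k) else if l = 2 then (Suc m, i, k) else (0, l, prod_encode (i, k)))"
    for x :: "nat \<times> nat \<times> nat"
  have h: "inj h" using m by (auto simp: inj_on_def h_def split: if_splits)
  have g1: "layer m (graft h \<omega> \<zeta>) = layer 1 \<zeta>" for \<omega> \<zeta>
  proof (intro ext, clarify)
    fix i k show "layer m (graft h \<omega> \<zeta>) (i, k) = layer 1 \<zeta> (i, k)"
      using graft_image[OF h, of \<omega> \<zeta> "(1, i, k)"] by (simp add: h_def layer_def)
  qed
  have g2: "layer (Suc m) (graft h \<omega> \<zeta>) = layer 2 \<zeta>" for \<omega> \<zeta>
  proof (intro ext, clarify)
    fix i k show "layer (Suc m) (graft h \<omega> \<zeta>) (i, k) = layer 2 \<zeta> (i, k)"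
      using graft_image[OF h, of \<omega> \<zeta> "(2, i, k)"] by (simp add: h_def layer_def)
  qed
  have g3: "tail (graft h \<omega> \<zeta>) = tail \<omega>" for \<omega> \<zeta>
  proof -
    have "chain d j' (Suc (Suc m)) (graft h \<omega> \<zeta>) = chain d j' (Suc (Suc m)) \<omega>" for j'
      by (intro chain_cong graft_other) (auto simp: h_def split: if_splits)
    then show ?thesis by (cases j) (simp_all add: tail_def[abs_def])
  qed
  have ce: "(\<lambda>\<omega>. chain d j (Suc m) \<omega> x) \<in> borel_measurable gauss" for x
    by (rule measurable_compose[OF measurable_chain measurable_gauss_coord])
  have le: "(\<lambda>\<omega>. lower_tri n (layer m \<omega>) x) \<in> borel_measurable gauss" for x
    by (rule measurable_compose[OF measurable_layer measurable_lower_tri])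
  have int: "integrable gauss (\<lambda>\<omega>. F (mat_prod n (layer m \<omega>) (chain d j (Suc m) \<omega>)))"
    "integrable gauss (\<lambda>\<omega>. F (mat_prod n (lower_tri n (layer m \<omega>)) (chain d j (Suc m) \<omega>)))"
    by (intro Bernoulli_integrable F01 measurable_compose[OF measurable_mat_prod F] measurable_layer_entry ce le)+
  define K where "K = (case j of 0 \<Rightarrow> q | Suc j' \<Rightarrow> d (Suc m))"
  have inner: "(\<integral>\<zeta>. F (tail \<omega> (mat_prod n (layer 1 \<zeta>) (layer 2 \<zeta>))) \<partial>gauss) =
      (\<integral>\<zeta>. F (tail \<omega> (mat_prod n (bartlett n \<zeta>) (layer 2 \<zeta>))) \<partial>gauss)" for \<omega>
  proof (rule bartlett_decomposition[OF p, where F = "\<lambda>M. F (tail \<omega> M)" and K = K])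
    have "tail \<omega> \<in> measurable gauss gauss"
    proof (cases j)
      case 0
      then have "tail \<omega> = (\<lambda>Y. Y)" by (simp add: tail_def fun_eq_iff)
      then show ?thesis by simp
    next
      case (Suc j')
      have "(\<lambda>Y. mat_scale (1 / sqrt (d (Suc m))) (mat_prod (d (Suc m)) Y (chain d j' (Suc (Suc m)) \<omega>))) \<in> measurable gauss gauss"
        by (intro measurable_compose[OF measurable_mat_prod measurable_mat_scale] measurable_gauss_coord borel_measurable_const)
      then show ?thesis using Suc by (simp add: tail_def[abs_def])
    qed
    from measurable_compose[OF this F] show "(\<lambda>M. F (tail \<omega> M)) \<in> borel_measurable gauss" .
    fix M M' :: "nat \<times> nat \<Rightarrow> real"
    assume "\<And>i k. i < p \<Longrightarrow> k < K \<Longrightarrow> M (i, k) = M' (i, k)"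
    then show "F (tail \<omega> M) = F (tail \<omega> M')"
      by (intro blockD[OF dep]) (auto simp: tail_def K_def mat_scale_def mat_prod_def split: nat.splits)
  qed
  show ?thesis
    unfolding integral_graft(1)[OF h int(1)] integral_graft(1)[OF h int(2)]
    by (simp only: tail g1 g2 g3 tail_prod inner bartlett_eq_lower_tri)
qed

text \<open>
  Induction on the number of factors. The next factor has \<open>d m\<close> rows, and comparing it as a whole
  with a Gaussian matrix would cost \<open>d m\<close> in place of \<open>p\<close>. But once the first factor
  is lower triangular, its first \<open>p\<close> rows read only the first \<open>p\<close> rows of the rest
  of the chain. The induction hypothesis for \<open>p \<times> q\<close> corners replaces the rest by a
  Gaussian matrix, and \<open>gaussian_product_close\<close> treats the remaining product of two.
\<close>

lemma chain_close:
  fixes f :: "(nat \<times> nat \<Rightarrow> real) \<Rightarrow> real"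
  assumes m: "m \<ge> 1" and pq: "1 \<le> p" "1 \<le> q" and d: "\<And>i. m \<le> i \<Longrightarrow> i < m + j \<Longrightarrow> p * q \<le> d i"
    and f: "f \<in> borel_measurable gauss" and f01: "\<And>\<omega>. 0 \<le> f \<omega>" "\<And>\<omega>. f \<omega> \<le> 1" and dep: "block p q f"
  shows "\<bar>(\<integral>\<omega>. f (chain d j m \<omega>) \<partial>gauss) - (\<integral>\<omega>. f \<omega> \<partial>gauss)\<bar> \<le> 25 * (\<Sum>i=m..<m + j. sqrt (real (p * q) / real (d i)))"
  using m d f f01 dep
proof (induction j arbitrary: m f)
  case 0
  then show ?case using integral_layer[of f m] by simp
next
  case (Suc j)
  note f = Suc.prems(3) and f01 = Suc.prems(4,5) and dep = Suc.prems(6)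
  define n where "n = d m"
  have n: "p * q \<le> n" unfolding n_def using Suc.prems(2)[of m] by simp
  have "p * 1 \<le> p * q" using pq by (intro mult_left_mono) auto
  from order_trans[OF this n] have pn: "p \<le> n" by simp
  let ?s = "mat_scale (1 / sqrt n)"
  have fs: "(\<lambda>M. f (?s M)) \<in> borel_measurable gauss" by (rule measurable_compose[OF measurable_mat_scale f])
  have fsb: "block p q (\<lambda>M. f (?s M))" unfolding block_def by (intro allI impI blockD[OF dep]) (simp add: mat_scale_def)
  define g where "g A M = f (?s (mat_prod n (lower_tri n A) M))" for A M
  have gm: "g A \<in> borel_measurable gauss" for A
    unfolding g_def by (intro measurable_compose[OF measurable_mat_prod fs] borel_measurable_const measurable_gauss_coord)
  have g01: "0 \<le> g A M" "g A M \<le> 1" for A M unfolding g_def using f01 by auto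
  have gb: "block p q (g A)" for A
    unfolding block_def g_def
  proof (intro allI impI blockD[OF fsb])
    fix M M' :: "nat \<times> nat \<Rightarrow> real" and i k
    assume eq: "\<forall>i<p. \<forall>k<q. M (i, k) = M' (i, k)" and ik: "i < p" "k < q"
    show "mat_prod n (lower_tri n A) M (i, k) = mat_prod n (lower_tri n A) M' (i, k)"
      unfolding mat_prod_def prod.case
    proof (intro sum.cong refl)
      fix t show "lower_tri n A (i, t) * M (t, k) = lower_tri n A (i, t) * M' (t, k)"
        using eq ik by (cases "t \<le> i") (auto simp: lower_tri_zero)
    qed
  qed
  \<comment> \<open>Resampling of all layers after \<open>m\<close>; the other indices are parked in layer 0.\<close>
  define h where "h x = (case x of (l, i, k) \<Rightarrow> if m < l then (l, i, k) else (0, l, prod_encode (i, k)))" for x :: "nat \<times> nat \<times> nat"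
  have h: "inj h" by (auto simp: inj_on_def h_def split: if_splits)
  have h1: "layer m (graft h \<omega> \<zeta>) = layer m \<omega>" for \<omega> \<zeta>
    unfolding layer_def using Suc.prems(1) by (intro ext, clarify, intro graft_other) (auto simp: h_def split: if_splits)
  have h2: "chain d j (Suc m) (graft h \<omega> \<zeta>) = chain d j (Suc m) \<zeta>" for \<omega> \<zeta>
  proof (rule chain_cong)
    fix l i k assume "Suc m \<le> l"
    then show "graft h \<omega> \<zeta> (l, i, k) = \<zeta> (l, i, k)"
      using graft_image[OF h, of \<omega> \<zeta> "(l, i, k)"] by (simp add: h_def)
  qed
  have ce: "(\<lambda>\<omega>. chain d j (Suc m) \<omega> x) \<in> borel_measurable gauss" for x
    by (rule measurable_compose[OF measurable_chain measurable_gauss_coord])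
  have le: "(\<lambda>\<omega>. lower_tri n (layer l \<omega>) x) \<in> borel_measurable gauss" for x l
    by (rule measurable_compose[OF measurable_layer measurable_lower_tri])
  have int: "integrable gauss (\<lambda>\<omega>. g (layer m \<omega>) (chain d j (Suc m) \<omega>))"
    unfolding g_def by (intro Bernoulli_integrable f01 measurable_compose[OF measurable_mat_prod fs] ce le)
  define V where "V \<omega> = (\<integral>\<zeta>. g (layer m \<omega>) (chain d j (Suc m) \<zeta>) \<partial>gauss)" for \<omega>
  \<comment> \<open>The first factor is kept while the rest of the chain is replaced by a Gaussian matrix.\<close>
  define \<Phi> where "\<Phi> A = (\<integral>\<zeta>. g A \<zeta> \<partial>gauss)" for A
  have "(\<integral>\<omega>. f (chain d (Suc j) m \<omega>) \<partial>gauss) = (\<integral>\<omega>. f (?s (mat_prod n (layer m \<omega>) (chain d j (Suc m) \<omega>))) \<partial>gauss)"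
    by (simp add: n_def)
  also have "\<dots> = (\<integral>\<omega>. g (layer m \<omega>) (chain d j (Suc m) \<omega>) \<partial>gauss)"
    unfolding g_def using lower_tri_chain[OF Suc.prems(1) pn fs f01 fsb] .
  also have "\<dots> = (\<integral>\<omega>. V \<omega> \<partial>gauss)"
    unfolding V_def using integral_graft(1)[OF h int] by (simp add: h1 h2)
  finally have E1: "(\<integral>\<omega>. f (chain d (Suc j) m \<omega>) \<partial>gauss) = (\<integral>\<omega>. V \<omega> \<partial>gauss)" .
  have Vi: "integrable gauss V" unfolding V_def[abs_def] using integral_graft(2)[OF h int] by (simp add: h1 h2)
  have VP: "\<bar>V \<omega> - \<Phi> (layer m \<omega>)\<bar> \<le> 25 * (\<Sum>i=Suc m..<Suc m + j. sqrt (real (p * q) / real (d i)))" for \<omega>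
    unfolding V_def \<Phi>_def using Suc.prems(2) by (intro Suc.IH gm g01 gb) auto
  have \<Phi>m: "\<Phi> \<in> borel_measurable gauss"
  proof -
    have "(\<lambda>(A, M). g A M) \<in> borel_measurable (gauss \<Otimes>\<^sub>M gauss)"
      unfolding g_def split_beta'
      by (intro measurable_compose[OF measurable_mat_prod fs] measurable_compose[OF measurable_fst measurable_lower_tri]
         measurable_compose[OF measurable_snd measurable_gauss_coord])
    then show ?thesis unfolding \<Phi>_def by (intro G.borel_measurable_lebesgue_integral) simp
  qed
  have \<Phi>01: "0 \<le> \<Phi> A" "\<Phi> A \<le> 1" for A
  proof -
    show "0 \<le> \<Phi> A" unfolding \<Phi>_def using g01 by simp
    have "\<Phi> A \<le> (\<integral>\<zeta>. 1 \<partial>(gauss :: (nat \<times> nat \<Rightarrow> real) measure))"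
      unfolding \<Phi>_def using g01 by (intro integral_mono Bernoulli_integrable gm) auto
    then show "\<Phi> A \<le> 1" by simp
  qed
  have \<Phi>i: "integrable gauss (\<lambda>\<omega>. \<Phi> (layer m \<omega>))"
    by (intro Bernoulli_integrable \<Phi>01 measurable_compose[OF measurable_layer \<Phi>m])
  define h' where "h' x = (case x of (i, k) \<Rightarrow> (2::nat, i, k))" for x :: "nat \<times> nat"
  have h': "inj h'" by (auto simp: inj_on_def h'_def)
  have h1': "layer 1 (graft h' \<omega> \<zeta>) = layer 1 \<omega>" for \<omega> \<zeta>
    unfolding layer_def by (intro ext, clarify, intro graft_other) (auto simp: h'_def)
  have h2': "layer 2 (graft h' \<omega> \<zeta>) = \<zeta>" for \<omega> \<zeta>
  proof (intro ext, clarify)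
    fix i k show "layer 2 (graft h' \<omega> \<zeta>) (i, k) = \<zeta> (i, k)"
      using graft_image[OF h', of \<omega> \<zeta> "(i, k)"] by (simp add: h'_def layer_def)
  qed
  have int': "integrable gauss (\<lambda>\<omega>. g (layer 1 \<omega>) (layer 2 \<omega>))"
    unfolding g_def by (intro Bernoulli_integrable f01 measurable_compose[OF measurable_mat_prod fs] le measurable_layer_entry)
  have "(\<integral>\<omega>. \<Phi> (layer m \<omega>) \<partial>gauss) = (\<integral>\<omega>. \<Phi> (layer 1 \<omega>) \<partial>gauss)"
    unfolding integral_layer[OF \<Phi>m] ..
  also have "\<dots> = (\<integral>\<omega>. g (layer 1 \<omega>) (layer 2 \<omega>) \<partial>gauss)"
    using integral_graft(1)[OF h' int'] by (simp add: h1' h2' \<Phi>_def)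
  also have "\<dots> = (\<integral>\<omega>. f (?s (mat_prod n (layer 1 \<omega>) (layer 2 \<omega>))) \<partial>gauss)"
  proof -
    have "(\<integral>\<omega>. f (?s (mat_prod n (layer 1 \<omega>) (layer 2 \<omega>))) \<partial>gauss) = (\<integral>\<omega>. f (?s (mat_prod n (bartlett n \<omega>) (layer 2 \<omega>))) \<partial>gauss)"
      by (rule bartlett_decomposition[OF pn fs, of q]) (rule blockD[OF fsb])
    then show ?thesis by (simp add: g_def bartlett_eq_lower_tri)
  qed
  finally have E2: "\<bar>(\<integral>\<omega>. \<Phi> (layer m \<omega>) \<partial>gauss) - (\<integral>\<omega>. f \<omega> \<partial>gauss)\<bar> \<le> 25 * sqrt (real (p * q) / real n)"
    using gaussian_product_close[OF pq n f f01 dep] by simp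
  let ?b = "25 * (\<Sum>i=Suc m..<Suc m + j. sqrt (real (p * q) / real (d i)))"
  have "\<bar>(\<integral>\<omega>. V \<omega> \<partial>gauss) - (\<integral>\<omega>. \<Phi> (layer m \<omega>) \<partial>gauss)\<bar> = \<bar>(\<integral>\<omega>. V \<omega> - \<Phi> (layer m \<omega>) \<partial>gauss)\<bar>"
    using Vi \<Phi>i by simp
  also have "\<dots> \<le> (\<integral>\<omega>. \<bar>V \<omega> - \<Phi> (layer m \<omega>)\<bar> \<partial>gauss)" by (rule integral_abs_bound)
  also have "\<dots> \<le> (\<integral>\<omega>. ?b \<partial>(gauss :: layers measure))"
    using Vi \<Phi>i VP by (intro integral_mono) auto
  also have "\<dots> = ?b" by simp
  finally have "\<bar>(\<integral>\<omega>. V \<omega> \<partial>gauss) - (\<integral>\<omega>. \<Phi> (layer m \<omega>) \<partial>gauss)\<bar> \<le> ?b" .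
  moreover have "25 * (\<Sum>i=m..<m + Suc j. sqrt (real (p * q) / real (d i))) = 25 * sqrt (real (p * q) / real n) + ?b"
    by (simp add: n_def sum.atLeast_Suc_lessThan)
  ultimately show ?case using E1 E2 by linarith
qed

section \<open>The total variation distance in terms of the Gaussian space\<close>

lemma distr_restrict_gauss: "distr gauss (std_gaussian I) (\<lambda>\<omega>. restrict \<omega> I) = std_gaussian I"
  using distr_PiM_reindex[of UNIV "\<lambda>_. std_normal_distribution" "\<lambda>i. i" I] prob_space_std_normal
  unfolding gauss_def std_gaussian_def by (simp add: restrict_def)

lemma measurable_restrict_gauss: "(\<lambda>\<omega>. restrict \<omega> I) \<in> measurable gauss (std_gaussian I)"
proof -
  have S: "sets (std_gaussian I) = sets (\<Pi>\<^sub>M i\<in>I. borel)"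
    unfolding std_gaussian_def by (intro sets_PiM_cong) auto
  show ?thesis
    unfolding measurable_cong_sets[OF refl S] by (rule measurable_restrict) (rule measurable_gauss_coord)
qed

lemma measure_std_gaussian_vimage:
  assumes f: "f \<in> measurable (std_gaussian I) B" and S: "S \<in> sets B"
  shows "measure (std_gaussian I) (f -` S \<inter> space (std_gaussian I)) = (\<integral>\<omega>. indicator S (f (restrict \<omega> I)) \<partial>gauss)"
proof -
  have m: "(\<lambda>\<omega>. f (restrict \<omega> I)) \<in> measurable gauss B"
    by (rule measurable_compose[OF measurable_restrict_gauss f])
  have "measure (std_gaussian I) (f -` S \<inter> space (std_gaussian I)) =
      measure (distr gauss (std_gaussian I) (\<lambda>\<omega>. restrict \<omega> I)) (f -` S \<inter> space (std_gaussian I))"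
    by (simp only: distr_restrict_gauss)
  also have "\<dots> = measure gauss ((\<lambda>\<omega>. restrict \<omega> I) -` (f -` S \<inter> space (std_gaussian I)) \<inter> space gauss)"
    by (rule measure_distr[OF measurable_restrict_gauss measurable_sets[OF f S]])
  also have "(\<lambda>\<omega>. restrict \<omega> I) -` (f -` S \<inter> space (std_gaussian I)) \<inter> space gauss = (\<lambda>\<omega>. f (restrict \<omega> I)) -` S \<inter> space gauss"
    using measurable_space[OF measurable_restrict_gauss[of I]] by auto
  also have "measure gauss \<dots> = (\<integral>\<omega>. indicator ((\<lambda>\<omega>. f (restrict \<omega> I)) -` S \<inter> space gauss) \<omega> \<partial>gauss)"
    using measurable_sets[OF m S] by simp
  also have "\<dots> = (\<integral>\<omega>. indicator S (f (restrict \<omega> I)) \<partial>gauss)"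
    by (intro Bochner_Integration.integral_cong refl) (auto simp: indicator_def)
  finally show ?thesis .
qed

text \<open>
  The final scaling \<open>c = 1 / \<surd>d\<^sub>1\<close> is common to both matrices and is moved into the
  event.
\<close>

definition block_event :: "real \<Rightarrow> nat \<Rightarrow> nat \<Rightarrow> real mat set \<Rightarrow> (nat \<times> nat \<Rightarrow> real) \<Rightarrow> real" where
  "block_event c p q S M = indicator S (mat p q (mat_scale c M))"

lemma measurable_block_event:
  assumes "S \<in> sets (mat_borel p q)"
  shows "block_event c p q S \<in> borel_measurable gauss"
proof -
  have "(\<lambda>M. mat p q (mat_scale c M)) \<in> measurable gauss (mat_borel p q)"
    by (rule measurable_mat_borelI) (simp_all add: mat_scale_def)
  from measurable_compose[OF this borel_measurable_indicator[OF assms]]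
  show ?thesis unfolding block_event_def[abs_def] .
qed

lemma block_block_event: "block p q (block_event c p q S)"
  unfolding block_def block_event_def
proof (intro allI impI)
  fix M M' :: "nat \<times> nat \<Rightarrow> real"
  assume "\<forall>i<p. \<forall>k<q. M (i, k) = M' (i, k)"
  then have "mat p q (mat_scale c M) = mat p q (mat_scale c M')" by (intro eq_matI) (auto simp: mat_scale_def)
  then show "indicator S (mat p q (mat_scale c M)) = indicator S (mat p q (mat_scale c M'))" by simp
qed

lemma block_event_01: "0 \<le> block_event c p q S M" "block_event c p q S M \<le> 1"
  by (simp_all add: block_event_def indicator_def)

lemma chain_product_eq_chain:
  assumes r: "r \<ge> 1"
  shows "chain_product r d (chain_factor d (restrict \<omega> (chain_index r d))) =
    mat (d 0) (d r) (mat_scale (1 / sqrt (real (d 1))) (chain d (r - 1) 1 \<omega>))"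
proof -
  define G where "G = chain_factor d (restrict \<omega> (chain_index r d))"
  let ?c = "1 / sqrt (real (d 1))"
  have Gi: "G i = mat (d (i - 1)) (d i) (layer i \<omega>)" if "1 \<le> i" "i \<le> r" for i
    using that by (intro eq_matI) (auto simp: G_def chain_factor_def chain_index_def layer_def)
  have "1 \<le> m \<Longrightarrow> foldr (\<lambda>i B. ((1 / sqrt (real (d i))) \<cdot>\<^sub>m G i) * B) [m..<r] (?c \<cdot>\<^sub>m G r) =
      mat (d (m - 1)) (d r) (mat_scale ?c (chain d (r - m) m \<omega>))" if "m \<le> r" for m
    using that
  proof (induction m rule: inc_induct)
    case base
    then show ?case by (simp add: Gi) (rule eq_matI; simp add: mat_scale_def)
  next
    case (step m)
    have "r - m = Suc (r - Suc m)" using step by simp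
    then have c: "chain d (r - m) m \<omega> = mat_scale (1 / sqrt (d m)) (mat_prod (d m) (layer m \<omega>) (chain d (r - Suc m) (Suc m) \<omega>))"
      by simp
    have "foldr (\<lambda>i B. ((1 / sqrt (real (d i))) \<cdot>\<^sub>m G i) * B) [m..<r] (?c \<cdot>\<^sub>m G r) =
        ((1 / sqrt (real (d m))) \<cdot>\<^sub>m mat (d (m - 1)) (d m) (layer m \<omega>)) * mat (d m) (d r) (mat_scale ?c (chain d (r - Suc m) (Suc m) \<omega>))"
      using step by (simp add: upt_conv_Cons Gi)
    also have "\<dots> = mat (d (m - 1)) (d r) (mat_scale ?c (chain d (r - m) m \<omega>))"
      unfolding c
      by (rule eq_matI) (auto simp: scalar_prod_def mat_scale_def mat_prod_def lessThan_atLeast0 sum_divide_distrib ac_simps intro!: sum.cong)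
    finally show ?case .
  qed
  from this[of 1] r show ?thesis by (simp add: chain_product_def G_def)
qed

lemma tv_dist_chain:
  assumes r: "r \<ge> 1"
  shows "tv_dist (mat_borel (d 0) (d r)) (std_gaussian (chain_index r d)) (\<lambda>\<omega>. chain_product r d (chain_factor d \<omega>))
      (std_gaussian ({..<d 0} \<times> {..<d r})) (scaled_gaussian (d 0) (d r) (d 1)) =
    (SUP S\<in>sets (mat_borel (d 0) (d r)).
       \<bar>(\<integral>\<omega>. block_event (1 / sqrt (real (d 1))) (d 0) (d r) S (chain d (r - 1) 1 \<omega>) \<partial>gauss)
        - (\<integral>\<omega>. block_event (1 / sqrt (real (d 1))) (d 0) (d r) S \<omega> \<partial>gauss)\<bar>)"
  unfolding tv_dist_def
proof (intro SUP_cong refl arg_cong[where f = abs] arg_cong2[where f = "(-)"])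
  fix S assume S: "S \<in> sets (mat_borel (d 0) (d r))"
  show "measure (std_gaussian (chain_index r d)) ((\<lambda>\<omega>. chain_product r d (chain_factor d \<omega>)) -` S \<inter> space (std_gaussian (chain_index r d))) =
      (\<integral>\<omega>. block_event (1 / sqrt (real (d 1))) (d 0) (d r) S (chain d (r - 1) 1 \<omega>) \<partial>gauss)"
    unfolding measure_std_gaussian_vimage[OF measurable_chain_std_gaussian[OF r] S] chain_product_eq_chain[OF r] block_event_def ..
  have "scaled_gaussian (d 0) (d r) (d 1) (restrict \<omega> ({..<d 0} \<times> {..<d r})) = mat (d 0) (d r) (mat_scale (1 / sqrt (real (d 1))) \<omega>)" for \<omega>
    unfolding scaled_gaussian_def by (rule eq_matI) (auto simp: mat_scale_def)
  then show "measure (std_gaussian ({..<d 0} \<times> {..<d r})) (scaled_gaussian (d 0) (d r) (d 1) -` S \<inter> space (std_gaussian ({..<d 0} \<times> {..<d r}))) =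
      (\<integral>\<omega>. block_event (1 / sqrt (real (d 1))) (d 0) (d r) S \<omega> \<partial>gauss)"
    unfolding measure_std_gaussian_vimage[OF measurable_scaled_std_gaussian S] block_event_def by simp
qed

lemma expectation_01:
  assumes "f \<in> borel_measurable gauss" "\<And>\<omega>. 0 \<le> f \<omega>" "\<And>\<omega>. f \<omega> \<le> (1::real)"
  shows "0 \<le> (\<integral>\<omega>. f \<omega> \<partial>(gauss :: ('i \<Rightarrow> real) measure))" "(\<integral>\<omega>. f \<omega> \<partial>(gauss :: ('i \<Rightarrow> real) measure)) \<le> 1"
proof -
  show "0 \<le> (\<integral>\<omega>. f \<omega> \<partial>(gauss :: ('i \<Rightarrow> real) measure))" using assms by simp
  have "(\<integral>\<omega>. f \<omega> \<partial>(gauss :: ('i \<Rightarrow> real) measure)) \<le> (\<integral>\<omega>. 1 \<partial>(gauss :: ('i \<Rightarrow> real) measure))"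
    using assms by (intro integral_mono Bernoulli_integrable) auto
  then show "(\<integral>\<omega>. f \<omega> \<partial>(gauss :: ('i \<Rightarrow> real) measure)) \<le> 1" by simp
qed

lemma block_event_diff_le_1:
  assumes S: "S \<in> sets (mat_borel p q)"
  shows "\<bar>(\<integral>\<omega>. block_event c p q S (chain d j m \<omega>) \<partial>gauss) - (\<integral>\<omega>. block_event c p q S \<omega> \<partial>gauss)\<bar> \<le> 1"
proof -
  note e1 = expectation_01[OF measurable_compose[OF measurable_chain measurable_block_event[OF S]] block_event_01, of c d j m]
  note e2 = expectation_01[OF measurable_block_event[OF S] block_event_01, of c]
  show ?thesis using e1 e2 by linarith
qed

text \<open>
  If \<open>pq\<close> exceeds some \<open>d i\<close>, the right-hand side exceeds the trivial bound 1.
\<close>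

lemma tv_dist_upper_bound:
  assumes r: "r \<ge> 2" and pos: "\<And>i. i \<le> r \<Longrightarrow> d i > 0"
  shows "tv_dist (mat_borel (d 0) (d r)) (std_gaussian (chain_index r d)) (\<lambda>\<omega>. chain_product r d (chain_factor d \<omega>))
      (std_gaussian ({..<d 0} \<times> {..<d r})) (scaled_gaussian (d 0) (d r) (d 1))
    \<le> 25 * (\<Sum>i=1..r - 1. sqrt (real (d 0 * d r) / real (d i)))"
proof -
  have r1: "r \<ge> 1" using r by simp
  have ne: "sets (mat_borel (d 0) (d r)) \<noteq> {}" using sets.top by blast
  show ?thesis
    unfolding tv_dist_chain[OF r1]
  proof (rule cSUP_least[OF ne])
    fix S assume S: "S \<in> sets (mat_borel (d 0) (d r))"
    let ?f = "block_event (1 / sqrt (real (d 1))) (d 0) (d r) S"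
    show "\<bar>(\<integral>\<omega>. ?f (chain d (r - 1) 1 \<omega>) \<partial>gauss) - (\<integral>\<omega>. ?f \<omega> \<partial>gauss)\<bar> \<le> 25 * (\<Sum>i=1..r - 1. sqrt (real (d 0 * d r) / real (d i)))"
    proof (cases "\<forall>i\<in>{1..r - 1}. d 0 * d r \<le> d i")
      case True
      have "\<bar>(\<integral>\<omega>. ?f (chain d (r - 1) 1 \<omega>) \<partial>gauss) - (\<integral>\<omega>. ?f \<omega> \<partial>gauss)\<bar> \<le> 25 * (\<Sum>i=1..<1 + (r - 1). sqrt (real (d 0 * d r) / real (d i)))"
      proof (rule chain_close)
        show "1 \<le> d 0" "1 \<le> d r" using pos[of 0] pos[of r] by auto
        show "d 0 * d r \<le> d i" if "1 \<le> i" "i < 1 + (r - 1)" for i using True that by auto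
      qed (auto simp: measurable_block_event[OF S] block_block_event block_event_01)
      also have "{1..<1 + (r - 1)} = {1..r - 1}" using r by auto
      finally show ?thesis .
    next
      case False
      then obtain i where i: "i \<in> {1..r - 1}" "d i < d 0 * d r" by auto
      have "i \<le> r" using i(1) by auto
      then have di: "0 < real (d i)" using pos by simp
      have "real (d i) \<le> real (d 0 * d r)" using i(2) by (simp only: of_nat_le_iff less_imp_le)
      then have "1 \<le> real (d 0 * d r) / real (d i)" using di by (simp only: le_divide_eq_1_pos)
      then have "1 \<le> sqrt (real (d 0 * d r) / real (d i))" by (simp del: of_nat_mult)
      also have "\<dots> \<le> (\<Sum>i=1..r - 1. sqrt (real (d 0 * d r) / real (d i)))"
        using i by (intro member_le_sum) auto
      finally have "1 \<le> 25 * (\<Sum>i=1..r - 1. sqrt (real (d 0 * d r) / real (d i)))" by simp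
      then show ?thesis using block_event_diff_le_1[OF S, of "1 / sqrt (real (d 1))" d "r - 1" 1] by linarith
    qed
  qed
qed

section \<open>Sums over independent columns\<close>

lemma all_moments_reindex:
  fixes f :: "('j \<Rightarrow> real) \<Rightarrow> real" and h :: "'j \<Rightarrow> 'i"
  assumes h: "inj h" and f: "all_moments gauss f"
  shows "all_moments gauss (\<lambda>\<omega>. f (\<lambda>j. \<omega> (h j)))"
proof (rule all_momentsI)
  show "(\<lambda>\<omega>. f (\<lambda>j. \<omega> (h j))) \<in> borel_measurable gauss"
    by (rule measurable_compose[OF measurable_reindex all_moments_measurable[OF f]])
  fix n
  have "integrable (distr gauss gauss (\<lambda>\<omega> j. \<omega> (h j))) (\<lambda>x. \<bar>f x\<bar> ^ n)"
    unfolding distr_reindex[OF h] by (rule all_moments_integrable_power[OF f])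
  then show "integrable gauss (\<lambda>\<omega>. \<bar>f (\<lambda>j. \<omega> (h j))\<bar> ^ n)"
    using all_moments_measurable[OF f] by (subst (asm) integrable_distr_eq[OF measurable_reindex]) auto
qed

definition column :: "nat \<Rightarrow> (nat \<times> nat \<Rightarrow> real) \<Rightarrow> nat \<Rightarrow> real" where
  "column t \<eta> = (\<lambda>s. \<eta> (s, t))"

lemma inj_column: "inj (\<lambda>s. (s, t))" by (simp add: inj_on_def)

lemma all_moments_column: "all_moments gauss f \<Longrightarrow> all_moments gauss (\<lambda>\<eta>. f (column t \<eta>))"
  unfolding column_def by (rule all_moments_reindex[OF inj_column])

lemma expectation_column: "f \<in> borel_measurable gauss \<Longrightarrow> (\<integral>\<eta>. f (column t \<eta>) \<partial>gauss) = (\<integral>\<zeta>. f \<zeta> \<partial>gauss)" for f :: "(nat \<Rightarrow> real) \<Rightarrow> real"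
  unfolding column_def by (rule integral_reindex[OF inj_column])

lemma expectation_column_indep:
  fixes P :: "(nat \<times> nat \<Rightarrow> real) \<Rightarrow> real" and f :: "(nat \<Rightarrow> real) \<Rightarrow> real"
  assumes P: "all_moments gauss P" and f: "all_moments gauss f"
    and indep: "\<And>\<eta> \<zeta>. P (graft (\<lambda>s. (s, t)) \<eta> \<zeta>) = P \<eta>"
  shows "(\<integral>\<eta>. P \<eta> * f (column t \<eta>) \<partial>gauss) = (\<integral>\<eta>. P \<eta> \<partial>gauss) * (\<integral>\<zeta>. f \<zeta> \<partial>gauss)"
  using expectation_indep[OF inj_column P all_moments_reindex[OF inj_column f] all_moments_measurable[OF f] indep]
    expectation_column[OF all_moments_measurable[OF f], of t]
  by (simp add: column_def)

text \<open>
  Columns of a Gaussian matrix are independent and identically distributed, so for centred \<open>f\<close>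
  this is a random walk. Its mixed moments follow by adding one column at a time.
\<close>

definition column_sum :: "((nat \<Rightarrow> real) \<Rightarrow> real) \<Rightarrow> nat \<Rightarrow> (nat \<times> nat \<Rightarrow> real) \<Rightarrow> real" where
  "column_sum f d \<eta> = (\<Sum>t<d. f (column t \<eta>))"

lemma all_moments_column_sum: "all_moments gauss f \<Longrightarrow> all_moments gauss (column_sum f d)"
  unfolding column_sum_def[abs_def] by (intro all_moments_sum all_moments_column)

lemma column_sum_0 [simp]: "column_sum f 0 \<eta> = 0"
  by (simp add: column_sum_def)

lemma column_sum_Suc: "column_sum f (Suc d) \<eta> = column_sum f d \<eta> + f (column d \<eta>)"
  by (simp add: column_sum_def)

lemma column_sum_graft: "column_sum f d (graft (\<lambda>s. (s, d)) \<eta> \<zeta>) = column_sum f d \<eta>"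
proof -
  have "column t (graft (\<lambda>s. (s, d)) \<eta> \<zeta>) = column t \<eta>" if "t < d" for t
    unfolding column_def using that by (intro ext graft_other) auto
  then show ?thesis by (simp add: column_sum_def)
qed

lemma expectation_column_sum:
  assumes am: "all_moments gauss f" and centered: "(\<integral>\<zeta>. f \<zeta> \<partial>gauss) = 0"
  shows "(\<integral>\<eta>. column_sum f d \<eta> \<partial>gauss) = 0"
  unfolding column_sum_def
  by (subst Bochner_Integration.integral_sum)
    (simp_all add: all_moments_integrable[OF all_moments_column] am expectation_column all_moments_measurable centered)

lemma expectation_column_sum2:
  assumes am: "all_moments gauss f1" "all_moments gauss f2"
    and centered: "(\<integral>\<zeta>. f1 \<zeta> \<partial>gauss) = 0" "(\<integral>\<zeta>. f2 \<zeta> \<partial>gauss) = 0"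
  shows "(\<integral>\<eta>. column_sum f1 d \<eta> * column_sum f2 d \<eta> \<partial>gauss) = real d * (\<integral>\<zeta>. f1 \<zeta> * f2 \<zeta> \<partial>gauss)"
proof (induction d)
  case (Suc d)
  let ?A = "\<lambda>f. column_sum f d" and ?y = "\<lambda>f \<eta>. f (column d \<eta>)"
  note m = all_moments_column_sum[OF am(1)] all_moments_column_sum[OF am(2)]
  have E: "(\<integral>\<eta>. ?A f1 \<eta> * f2 (column d \<eta>) \<partial>gauss) = 0" "(\<integral>\<eta>. ?A f2 \<eta> * f1 (column d \<eta>) \<partial>gauss) = 0"
    using expectation_column_indep[OF m(1) am(2)] expectation_column_indep[OF m(2) am(1)]
    by (simp_all add: column_sum_graft centered)
  have Ey: "(\<integral>\<eta>. f1 (column d \<eta>) * f2 (column d \<eta>) \<partial>gauss) = (\<integral>\<zeta>. f1 \<zeta> * f2 \<zeta> \<partial>gauss)"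
    by (rule expectation_column[of "\<lambda>\<zeta>. f1 \<zeta> * f2 \<zeta>" d]) (intro all_moments_measurable all_moments_mult am)
  have i: "integrable gauss (\<lambda>\<eta>. ?A f1 \<eta> * ?A f2 \<eta>)" "integrable gauss (\<lambda>\<eta>. ?A f1 \<eta> * f2 (column d \<eta>))"
    "integrable gauss (\<lambda>\<eta>. ?A f2 \<eta> * f1 (column d \<eta>))" "integrable gauss (\<lambda>\<eta>. f1 (column d \<eta>) * f2 (column d \<eta>))"
    by (intro all_moments_integrable all_moments_mult all_moments_column m am)+
  have "(\<integral>\<eta>. column_sum f1 (Suc d) \<eta> * column_sum f2 (Suc d) \<eta> \<partial>gauss) =
    (\<integral>\<eta>. ?A f1 \<eta> * ?A f2 \<eta> + ?A f1 \<eta> * f2 (column d \<eta>) + ?A f2 \<eta> * f1 (column d \<eta>) + f1 (column d \<eta>) * f2 (column d \<eta>) \<partial>gauss)"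
    by (intro Bochner_Integration.integral_cong refl) (simp add: column_sum_Suc algebra_simps)
  also have "\<dots> = real d * (\<integral>\<zeta>. f1 \<zeta> * f2 \<zeta> \<partial>gauss) + (\<integral>\<zeta>. f1 \<zeta> * f2 \<zeta> \<partial>gauss)"
    using i by (simp add: E Ey Suc)
  finally show ?case by (simp add: algebra_simps)
qed simp

lemma expectation_column_sum3:
  fixes f1 f2 f3 :: "(nat \<Rightarrow> real) \<Rightarrow> real"
  assumes am: "all_moments gauss f1" "all_moments gauss f2" "all_moments gauss f3"
    and centered: "(\<integral>\<zeta>. f1 \<zeta> \<partial>gauss) = 0" "(\<integral>\<zeta>. f2 \<zeta> \<partial>gauss) = 0" "(\<integral>\<zeta>. f3 \<zeta> \<partial>gauss) = 0"
  shows "(\<integral>\<eta>. column_sum f1 d \<eta> * column_sum f2 d \<eta> * column_sum f3 d \<eta> \<partial>gauss) = real d * (\<integral>\<zeta>. f1 \<zeta> * f2 \<zeta> * f3 \<zeta> \<partial>gauss)"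
proof (induction d)
  case (Suc d)
  let ?A = "\<lambda>f. column_sum f d" and ?c = "column d"
  note m = all_moments_column_sum[OF am(1)] all_moments_column_sum[OF am(2)] all_moments_column_sum[OF am(3)]
  note mm = all_moments_mult all_moments_column m am
  have two: "(\<integral>\<eta>. (?A f \<eta> * ?A g \<eta>) * k (?c \<eta>) \<partial>gauss) = 0"
    if "all_moments gauss f" "all_moments gauss g" "all_moments gauss k" "(\<integral>\<zeta>. k \<zeta> \<partial>gauss) = 0" for f g k
    using expectation_column_indep[OF all_moments_mult[OF all_moments_column_sum[OF that(1)] all_moments_column_sum[OF that(2)]] that(3), of d d d] that(4)
    by (simp add: column_sum_graft)
  have one: "(\<integral>\<eta>. ?A f \<eta> * (g (?c \<eta>) * k (?c \<eta>)) \<partial>gauss) = 0"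
    if "all_moments gauss f" "all_moments gauss g" "all_moments gauss k" "(\<integral>\<zeta>. f \<zeta> \<partial>gauss) = 0" for f g k
    using expectation_column_indep[OF all_moments_column_sum[OF that(1)] all_moments_mult[OF that(2,3)], of d d]
      expectation_column_sum[OF that(1,4)]
    by (simp add: column_sum_graft)
  have Ey: "(\<integral>\<eta>. f1 (?c \<eta>) * f2 (?c \<eta>) * f3 (?c \<eta>) \<partial>gauss) = (\<integral>\<zeta>. f1 \<zeta> * f2 \<zeta> * f3 \<zeta> \<partial>gauss)"
    by (rule expectation_column[of "\<lambda>\<zeta>. f1 \<zeta> * f2 \<zeta> * f3 \<zeta>" d]) (intro all_moments_measurable all_moments_mult am)
  have i: "integrable gauss (\<lambda>\<eta>. ?A f1 \<eta> * ?A f2 \<eta> * ?A f3 \<eta>)"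
    "integrable gauss (\<lambda>\<eta>. (?A f1 \<eta> * ?A f2 \<eta>) * f3 (?c \<eta>))" "integrable gauss (\<lambda>\<eta>. (?A f1 \<eta> * ?A f3 \<eta>) * f2 (?c \<eta>))"
    "integrable gauss (\<lambda>\<eta>. (?A f2 \<eta> * ?A f3 \<eta>) * f1 (?c \<eta>))"
    "integrable gauss (\<lambda>\<eta>. ?A f1 \<eta> * (f2 (?c \<eta>) * f3 (?c \<eta>)))" "integrable gauss (\<lambda>\<eta>. ?A f2 \<eta> * (f1 (?c \<eta>) * f3 (?c \<eta>)))"
    "integrable gauss (\<lambda>\<eta>. ?A f3 \<eta> * (f1 (?c \<eta>) * f2 (?c \<eta>)))"
    "integrable gauss (\<lambda>\<eta>. f1 (?c \<eta>) * f2 (?c \<eta>) * f3 (?c \<eta>))"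
    by (intro all_moments_integrable mm)+
  have "(\<integral>\<eta>. column_sum f1 (Suc d) \<eta> * column_sum f2 (Suc d) \<eta> * column_sum f3 (Suc d) \<eta> \<partial>gauss) =
    (\<integral>\<eta>. ?A f1 \<eta> * ?A f2 \<eta> * ?A f3 \<eta> + (?A f1 \<eta> * ?A f2 \<eta>) * f3 (?c \<eta>) + (?A f1 \<eta> * ?A f3 \<eta>) * f2 (?c \<eta>)
      + (?A f2 \<eta> * ?A f3 \<eta>) * f1 (?c \<eta>) + ?A f1 \<eta> * (f2 (?c \<eta>) * f3 (?c \<eta>)) + ?A f2 \<eta> * (f1 (?c \<eta>) * f3 (?c \<eta>))
      + ?A f3 \<eta> * (f1 (?c \<eta>) * f2 (?c \<eta>)) + f1 (?c \<eta>) * f2 (?c \<eta>) * f3 (?c \<eta>) \<partial>gauss)"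
    by (intro Bochner_Integration.integral_cong refl) (simp add: column_sum_Suc algebra_simps)
  also have "\<dots> = real d * (\<integral>\<zeta>. f1 \<zeta> * f2 \<zeta> * f3 \<zeta> \<partial>gauss) + 0 + 0 + 0 + 0 + 0 + 0 + (\<integral>\<zeta>. f1 \<zeta> * f2 \<zeta> * f3 \<zeta> \<partial>gauss)"
    by (simp only: Bochner_Integration.integral_add Bochner_Integration.integrable_add i Suc Ey
       two[OF am(1) am(2) am(3) centered(3)] two[OF am(1) am(3) am(2) centered(2)] two[OF am(2) am(3) am(1) centered(1)]
       one[OF am(1) am(2) am(3) centered(1)] one[OF am(2) am(1) am(3) centered(2)] one[OF am(3) am(1) am(2) centered(3)])
  finally show ?case by (simp add: algebra_simps)
qed simp

text \<open>
  In the expansion, a column that occurs in exactly one factor contributes 0. There remain the terms with one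
  common column and those with two pairs of columns.
\<close>

lemma expectation_column_sum4:
  fixes f1 f2 f3 f4 :: "(nat \<Rightarrow> real) \<Rightarrow> real"
  assumes am: "all_moments gauss f1" "all_moments gauss f2" "all_moments gauss f3" "all_moments gauss f4"
    and centered: "(\<integral>\<zeta>. f1 \<zeta> \<partial>gauss) = 0" "(\<integral>\<zeta>. f2 \<zeta> \<partial>gauss) = 0" "(\<integral>\<zeta>. f3 \<zeta> \<partial>gauss) = 0" "(\<integral>\<zeta>. f4 \<zeta> \<partial>gauss) = 0"
  defines "\<kappa> \<equiv> \<lambda>f g. \<integral>\<zeta>. f \<zeta> * g \<zeta> \<partial>(gauss :: (nat \<Rightarrow> real) measure)"
  shows "(\<integral>\<eta>. column_sum f1 d \<eta> * column_sum f2 d \<eta> * column_sum f3 d \<eta> * column_sum f4 d \<eta> \<partial>gauss) =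
    real d * (\<integral>\<zeta>. f1 \<zeta> * f2 \<zeta> * f3 \<zeta> * f4 \<zeta> \<partial>gauss)
    + real d * (real d - 1) * (\<kappa> f1 f2 * \<kappa> f3 f4 + \<kappa> f1 f3 * \<kappa> f2 f4 + \<kappa> f1 f4 * \<kappa> f2 f3)"
proof (induction d)
  case (Suc d)
  let ?A = "\<lambda>f. column_sum f d" and ?c = "column d"
  note m = all_moments_column_sum[OF am(1)] all_moments_column_sum[OF am(2)] all_moments_column_sum[OF am(3)] all_moments_column_sum[OF am(4)]
  note mm = all_moments_mult all_moments_column m am
  have three: "(\<integral>\<eta>. (?A f \<eta> * ?A g \<eta> * ?A h \<eta>) * k (?c \<eta>) \<partial>gauss) = 0"
    if "all_moments gauss f" "all_moments gauss g" "all_moments gauss h" "all_moments gauss k" "(\<integral>\<zeta>. k \<zeta> \<partial>gauss) = 0" for f g h k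
    using expectation_column_indep[OF all_moments_mult[OF all_moments_mult[OF all_moments_column_sum[OF that(1)] all_moments_column_sum[OF that(2)]] all_moments_column_sum[OF that(3)]] that(4), of d d d d] that(5)
    by (simp add: column_sum_graft)
  have two: "(\<integral>\<eta>. (?A f \<eta> * ?A g \<eta>) * (h (?c \<eta>) * k (?c \<eta>)) \<partial>gauss) = real d * \<kappa> f g * \<kappa> h k"
    if "all_moments gauss f" "all_moments gauss g" "all_moments gauss h" "all_moments gauss k" "(\<integral>\<zeta>. f \<zeta> \<partial>gauss) = 0" "(\<integral>\<zeta>. g \<zeta> \<partial>gauss) = 0" for f g h k
    using expectation_column_indep[OF all_moments_mult[OF all_moments_column_sum[OF that(1)] all_moments_column_sum[OF that(2)]] all_moments_mult[OF that(3,4)], of d d d]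
     expectation_column_sum2[OF that(1,2,5,6)]
    by (simp add: column_sum_graft \<kappa>_def)
  have one: "(\<integral>\<eta>. ?A f \<eta> * (g (?c \<eta>) * h (?c \<eta>) * k (?c \<eta>)) \<partial>gauss) = 0"
    if "all_moments gauss f" "all_moments gauss g" "all_moments gauss h" "all_moments gauss k" "(\<integral>\<zeta>. f \<zeta> \<partial>gauss) = 0" for f g h k
    using expectation_column_indep[OF all_moments_column_sum[OF that(1)] all_moments_mult[OF all_moments_mult[OF that(2,3)] that(4)], of d d]
      expectation_column_sum[OF that(1,5)]
    by (simp add: column_sum_graft)
  have Ey: "(\<integral>\<eta>. f1 (?c \<eta>) * f2 (?c \<eta>) * f3 (?c \<eta>) * f4 (?c \<eta>) \<partial>gauss) = (\<integral>\<zeta>. f1 \<zeta> * f2 \<zeta> * f3 \<zeta> * f4 \<zeta> \<partial>gauss)"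
    by (rule expectation_column[of "\<lambda>\<zeta>. f1 \<zeta> * f2 \<zeta> * f3 \<zeta> * f4 \<zeta>" d]) (intro all_moments_measurable all_moments_mult am)
  let ?t0 = "\<lambda>\<eta>. ?A f1 \<eta> * ?A f2 \<eta> * ?A f3 \<eta> * ?A f4 \<eta>"
  have i: "integrable gauss ?t0"
    "integrable gauss (\<lambda>\<eta>. (?A f1 \<eta> * ?A f2 \<eta> * ?A f3 \<eta>) * f4 (?c \<eta>))"
    "integrable gauss (\<lambda>\<eta>. (?A f1 \<eta> * ?A f2 \<eta> * ?A f4 \<eta>) * f3 (?c \<eta>))"
    "integrable gauss (\<lambda>\<eta>. (?A f1 \<eta> * ?A f3 \<eta> * ?A f4 \<eta>) * f2 (?c \<eta>))"
    "integrable gauss (\<lambda>\<eta>. (?A f2 \<eta> * ?A f3 \<eta> * ?A f4 \<eta>) * f1 (?c \<eta>))"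
    "integrable gauss (\<lambda>\<eta>. (?A f1 \<eta> * ?A f2 \<eta>) * (f3 (?c \<eta>) * f4 (?c \<eta>)))"
    "integrable gauss (\<lambda>\<eta>. (?A f1 \<eta> * ?A f3 \<eta>) * (f2 (?c \<eta>) * f4 (?c \<eta>)))"
    "integrable gauss (\<lambda>\<eta>. (?A f1 \<eta> * ?A f4 \<eta>) * (f2 (?c \<eta>) * f3 (?c \<eta>)))"
    "integrable gauss (\<lambda>\<eta>. (?A f2 \<eta> * ?A f3 \<eta>) * (f1 (?c \<eta>) * f4 (?c \<eta>)))"
    "integrable gauss (\<lambda>\<eta>. (?A f2 \<eta> * ?A f4 \<eta>) * (f1 (?c \<eta>) * f3 (?c \<eta>)))"
    "integrable gauss (\<lambda>\<eta>. (?A f3 \<eta> * ?A f4 \<eta>) * (f1 (?c \<eta>) * f2 (?c \<eta>)))"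
    "integrable gauss (\<lambda>\<eta>. ?A f1 \<eta> * (f2 (?c \<eta>) * f3 (?c \<eta>) * f4 (?c \<eta>)))"
    "integrable gauss (\<lambda>\<eta>. ?A f2 \<eta> * (f1 (?c \<eta>) * f3 (?c \<eta>) * f4 (?c \<eta>)))"
    "integrable gauss (\<lambda>\<eta>. ?A f3 \<eta> * (f1 (?c \<eta>) * f2 (?c \<eta>) * f4 (?c \<eta>)))"
    "integrable gauss (\<lambda>\<eta>. ?A f4 \<eta> * (f1 (?c \<eta>) * f2 (?c \<eta>) * f3 (?c \<eta>)))"
    "integrable gauss (\<lambda>\<eta>. f1 (?c \<eta>) * f2 (?c \<eta>) * f3 (?c \<eta>) * f4 (?c \<eta>))"
    by (intro all_moments_integrable mm)+
  have "(\<integral>\<eta>. column_sum f1 (Suc d) \<eta> * column_sum f2 (Suc d) \<eta> * column_sum f3 (Suc d) \<eta> * column_sum f4 (Suc d) \<eta> \<partial>gauss) =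
    (\<integral>\<eta>. ?t0 \<eta> + (?A f1 \<eta> * ?A f2 \<eta> * ?A f3 \<eta>) * f4 (?c \<eta>) + (?A f1 \<eta> * ?A f2 \<eta> * ?A f4 \<eta>) * f3 (?c \<eta>)
      + (?A f1 \<eta> * ?A f3 \<eta> * ?A f4 \<eta>) * f2 (?c \<eta>) + (?A f2 \<eta> * ?A f3 \<eta> * ?A f4 \<eta>) * f1 (?c \<eta>)
      + (?A f1 \<eta> * ?A f2 \<eta>) * (f3 (?c \<eta>) * f4 (?c \<eta>)) + (?A f1 \<eta> * ?A f3 \<eta>) * (f2 (?c \<eta>) * f4 (?c \<eta>))
      + (?A f1 \<eta> * ?A f4 \<eta>) * (f2 (?c \<eta>) * f3 (?c \<eta>)) + (?A f2 \<eta> * ?A f3 \<eta>) * (f1 (?c \<eta>) * f4 (?c \<eta>))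
      + (?A f2 \<eta> * ?A f4 \<eta>) * (f1 (?c \<eta>) * f3 (?c \<eta>)) + (?A f3 \<eta> * ?A f4 \<eta>) * (f1 (?c \<eta>) * f2 (?c \<eta>))
      + ?A f1 \<eta> * (f2 (?c \<eta>) * f3 (?c \<eta>) * f4 (?c \<eta>)) + ?A f2 \<eta> * (f1 (?c \<eta>) * f3 (?c \<eta>) * f4 (?c \<eta>))
      + ?A f3 \<eta> * (f1 (?c \<eta>) * f2 (?c \<eta>) * f4 (?c \<eta>)) + ?A f4 \<eta> * (f1 (?c \<eta>) * f2 (?c \<eta>) * f3 (?c \<eta>))
      + f1 (?c \<eta>) * f2 (?c \<eta>) * f3 (?c \<eta>) * f4 (?c \<eta>) \<partial>gauss)"
    by (intro Bochner_Integration.integral_cong refl) (simp add: column_sum_Suc algebra_simps)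
  also have "\<dots> = (\<integral>\<eta>. ?t0 \<eta> \<partial>gauss) + 0 + 0 + 0 + 0 + real d * \<kappa> f1 f2 * \<kappa> f3 f4 + real d * \<kappa> f1 f3 * \<kappa> f2 f4 + real d * \<kappa> f1 f4 * \<kappa> f2 f3
     + real d * \<kappa> f2 f3 * \<kappa> f1 f4 + real d * \<kappa> f2 f4 * \<kappa> f1 f3 + real d * \<kappa> f3 f4 * \<kappa> f1 f2 + 0 + 0 + 0 + 0 + (\<integral>\<zeta>. f1 \<zeta> * f2 \<zeta> * f3 \<zeta> * f4 \<zeta> \<partial>gauss)"
    by (simp only: Bochner_Integration.integral_add Bochner_Integration.integrable_add i Ey
       three[OF am(1) am(2) am(3) am(4) centered(4)] three[OF am(1) am(2) am(4) am(3) centered(3)]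
       three[OF am(1) am(3) am(4) am(2) centered(2)] three[OF am(2) am(3) am(4) am(1) centered(1)]
       two[OF am(1) am(2) am(3) am(4) centered(1,2)] two[OF am(1) am(3) am(2) am(4) centered(1,3)] two[OF am(1) am(4) am(2) am(3) centered(1,4)]
       two[OF am(2) am(3) am(1) am(4) centered(2,3)] two[OF am(2) am(4) am(1) am(3) centered(2,4)] two[OF am(3) am(4) am(1) am(2) centered(3,4)]
       one[OF am(1) am(2) am(3) am(4) centered(1)] one[OF am(2) am(1) am(3) am(4) centered(2)]
       one[OF am(3) am(1) am(2) am(4) centered(3)] one[OF am(4) am(1) am(2) am(3) centered(4)])
  finally show ?case using Suc by (simp add: algebra_simps)
qed simp

text \<open>
  The case needed for Gram matrices: means \<open>m\<^sub>i\<close>, covariances of order \<open>1/d\<close>,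
  and third and fourth order effects of order \<open>1/d\<^sup>2\<close>.
\<close>

lemma expectation_column_average4:
  fixes f1 f2 f3 f4 :: "(nat \<Rightarrow> real) \<Rightarrow> real"
  assumes d: "d > 0"
    and am: "all_moments gauss f1" "all_moments gauss f2" "all_moments gauss f3" "all_moments gauss f4"
    and centered: "(\<integral>\<zeta>. f1 \<zeta> \<partial>gauss) = 0" "(\<integral>\<zeta>. f2 \<zeta> \<partial>gauss) = 0" "(\<integral>\<zeta>. f3 \<zeta> \<partial>gauss) = 0" "(\<integral>\<zeta>. f4 \<zeta> \<partial>gauss) = 0"
  defines "A \<equiv> \<lambda>f \<eta>. column_sum f d \<eta> / real d"
    and "\<kappa> \<equiv> \<lambda>f g. \<integral>\<zeta>. f \<zeta> * g \<zeta> \<partial>(gauss :: (nat \<Rightarrow> real) measure)"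
    and "\<kappa>3 \<equiv> \<lambda>f g h. \<integral>\<zeta>. f \<zeta> * g \<zeta> * h \<zeta> \<partial>(gauss :: (nat \<Rightarrow> real) measure)"
  shows "(\<integral>\<eta>. (m1 + A f1 \<eta>) * (m2 + A f2 \<eta>) * (m3 + A f3 \<eta>) * (m4 + A f4 \<eta>) \<partial>gauss) =
     m1 * m2 * m3 * m4
     + (m1 * m2 * \<kappa> f3 f4 + m1 * m3 * \<kappa> f2 f4 + m1 * m4 * \<kappa> f2 f3 + m2 * m3 * \<kappa> f1 f4 + m2 * m4 * \<kappa> f1 f3 + m3 * m4 * \<kappa> f1 f2) / real d
     + (m1 * \<kappa>3 f2 f3 f4 + m2 * \<kappa>3 f1 f3 f4 + m3 * \<kappa>3 f1 f2 f4 + m4 * \<kappa>3 f1 f2 f3) / (real d)\<^sup>2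
     + (\<integral>\<zeta>. f1 \<zeta> * f2 \<zeta> * f3 \<zeta> * f4 \<zeta> \<partial>gauss) / (real d) ^ 3
     + (real d - 1) / (real d) ^ 3 * (\<kappa> f1 f2 * \<kappa> f3 f4 + \<kappa> f1 f3 * \<kappa> f2 f4 + \<kappa> f1 f4 * \<kappa> f2 f3)"
proof -
  have Am: "all_moments gauss (A f)" if "all_moments gauss f" for f
    unfolding A_def using all_moments_divide[OF all_moments_column_sum[OF that]] .
  note mm = all_moments_mult Am am
  have E1: "(\<integral>\<eta>. A f \<eta> \<partial>gauss) = 0" if "all_moments gauss f" "(\<integral>\<zeta>. f \<zeta> \<partial>gauss) = 0" for f
    unfolding A_def using expectation_column_sum[OF that] by simp
  have E2: "(\<integral>\<eta>. A f \<eta> * A g \<eta> \<partial>gauss) = \<kappa> f g / real d"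
    if "all_moments gauss f" "all_moments gauss g" "(\<integral>\<zeta>. f \<zeta> \<partial>gauss) = 0" "(\<integral>\<zeta>. g \<zeta> \<partial>gauss) = 0" for f g
    unfolding A_def \<kappa>_def using expectation_column_sum2[OF that] d by simp
  have E3: "(\<integral>\<eta>. A f \<eta> * A g \<eta> * A h \<eta> \<partial>gauss) = \<kappa>3 f g h / (real d)\<^sup>2"
    if "all_moments gauss f" "all_moments gauss g" "all_moments gauss h"
      "(\<integral>\<zeta>. f \<zeta> \<partial>gauss) = 0" "(\<integral>\<zeta>. g \<zeta> \<partial>gauss) = 0" "(\<integral>\<zeta>. h \<zeta> \<partial>gauss) = 0" for f g h
    unfolding A_def \<kappa>3_def using expectation_column_sum3[OF that] d by (simp add: power2_eq_square)
  have E4: "(\<integral>\<eta>. A f1 \<eta> * A f2 \<eta> * A f3 \<eta> * A f4 \<eta> \<partial>gauss) = (\<integral>\<zeta>. f1 \<zeta> * f2 \<zeta> * f3 \<zeta> * f4 \<zeta> \<partial>gauss) / (real d) ^ 3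
     + (real d - 1) / (real d) ^ 3 * (\<kappa> f1 f2 * \<kappa> f3 f4 + \<kappa> f1 f3 * \<kappa> f2 f4 + \<kappa> f1 f4 * \<kappa> f2 f3)"
  proof -
    have "(\<integral>\<eta>. A f1 \<eta> * A f2 \<eta> * A f3 \<eta> * A f4 \<eta> \<partial>gauss) =
       (\<integral>\<eta>. column_sum f1 d \<eta> * column_sum f2 d \<eta> * column_sum f3 d \<eta> * column_sum f4 d \<eta> \<partial>gauss) / (real d) ^ 4"
      unfolding A_def by (simp add: power4_eq_xxxx mult.assoc)
    also have "\<dots> = (real d * (\<integral>\<zeta>. f1 \<zeta> * f2 \<zeta> * f3 \<zeta> * f4 \<zeta> \<partial>gauss)
       + real d * ((real d - 1) * (\<kappa> f1 f2 * \<kappa> f3 f4 + \<kappa> f1 f3 * \<kappa> f2 f4 + \<kappa> f1 f4 * \<kappa> f2 f3))) / (real d) ^ 4"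
      unfolding \<kappa>_def expectation_column_sum4[OF am centered] by (simp only: mult.assoc)
    also have "\<dots> = ((\<integral>\<zeta>. f1 \<zeta> * f2 \<zeta> * f3 \<zeta> * f4 \<zeta> \<partial>gauss) + (real d - 1) * (\<kappa> f1 f2 * \<kappa> f3 f4 + \<kappa> f1 f3 * \<kappa> f2 f4 + \<kappa> f1 f4 * \<kappa> f2 f3)) / (real d) ^ 3"
      unfolding distrib_left[symmetric] using d by (simp add: power4_eq_xxxx power3_eq_cube)
    finally show ?thesis by (simp add: add_divide_distrib)
  qed
  let ?P = "\<lambda>\<eta>. m1 * m2 * m3 * m4 + (m1 * m2 * m3) * A f4 \<eta> + (m1 * m2 * m4) * A f3 \<eta> + (m1 * m3 * m4) * A f2 \<eta> + (m2 * m3 * m4) * A f1 \<eta>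
     + (m1 * m2) * (A f3 \<eta> * A f4 \<eta>) + (m1 * m3) * (A f2 \<eta> * A f4 \<eta>) + (m1 * m4) * (A f2 \<eta> * A f3 \<eta>)
     + (m2 * m3) * (A f1 \<eta> * A f4 \<eta>) + (m2 * m4) * (A f1 \<eta> * A f3 \<eta>) + (m3 * m4) * (A f1 \<eta> * A f2 \<eta>)
     + m1 * (A f2 \<eta> * A f3 \<eta> * A f4 \<eta>) + m2 * (A f1 \<eta> * A f3 \<eta> * A f4 \<eta>) + m3 * (A f1 \<eta> * A f2 \<eta> * A f4 \<eta>) + m4 * (A f1 \<eta> * A f2 \<eta> * A f3 \<eta>)
     + A f1 \<eta> * A f2 \<eta> * A f3 \<eta> * A f4 \<eta>"
  have i1: "integrable gauss (A f)" if "all_moments gauss f" for f by (intro all_moments_integrable mm that)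
  have i2: "integrable gauss (\<lambda>\<eta>. A f \<eta> * A g \<eta>)" if "all_moments gauss f" "all_moments gauss g" for f g
    by (intro all_moments_integrable mm that)
  have i3: "integrable gauss (\<lambda>\<eta>. A f \<eta> * A g \<eta> * A h \<eta>)" if "all_moments gauss f" "all_moments gauss g" "all_moments gauss h" for f g h
    by (intro all_moments_integrable mm that)
  have i4: "integrable gauss (\<lambda>\<eta>. A f1 \<eta> * A f2 \<eta> * A f3 \<eta> * A f4 \<eta>)"
    by (intro all_moments_integrable mm)
  have "(\<integral>\<eta>. (m1 + A f1 \<eta>) * (m2 + A f2 \<eta>) * (m3 + A f3 \<eta>) * (m4 + A f4 \<eta>) \<partial>gauss) = (\<integral>\<eta>. ?P \<eta> \<partial>gauss)"
    by (intro Bochner_Integration.integral_cong refl) (simp add: algebra_simps)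
  also have "\<dots> = m1 * m2 * m3 * m4 + (m1 * m2) * (\<kappa> f3 f4 / real d) + (m1 * m3) * (\<kappa> f2 f4 / real d) + (m1 * m4) * (\<kappa> f2 f3 / real d)
     + (m2 * m3) * (\<kappa> f1 f4 / real d) + (m2 * m4) * (\<kappa> f1 f3 / real d) + (m3 * m4) * (\<kappa> f1 f2 / real d)
     + m1 * (\<kappa>3 f2 f3 f4 / (real d)\<^sup>2) + m2 * (\<kappa>3 f1 f3 f4 / (real d)\<^sup>2) + m3 * (\<kappa>3 f1 f2 f4 / (real d)\<^sup>2) + m4 * (\<kappa>3 f1 f2 f3 / (real d)\<^sup>2)
     + (\<integral>\<eta>. A f1 \<eta> * A f2 \<eta> * A f3 \<eta> * A f4 \<eta> \<partial>gauss)"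
    by (simp add: i1 i2 i3 i4 am centered E1 E2 E3)
  finally show ?thesis unfolding E4 by (simp add: add_divide_distrib)
qed

section \<open>Gram matrices of Gaussian products\<close>

definition gram :: "nat \<Rightarrow> (nat \<times> nat \<Rightarrow> real) \<Rightarrow> nat \<Rightarrow> nat \<Rightarrow> real" where
  "gram n B i j = (\<Sum>s<n. B (i, s) * B (j, s))"

lemma gram_commute: "gram n B i j = gram n B j i"
  by (simp add: gram_def mult.commute)

lemma gram_nonneg: "0 \<le> gram n B i i"
  unfolding gram_def by (intro sum_nonneg) simp

lemma gram_abs_le: "2 * \<bar>gram n B i j\<bar> \<le> gram n B i i + gram n B j j"
proof -
  have "\<bar>gram n B i j\<bar> \<le> (\<Sum>s<n. \<bar>B (i, s) * B (j, s)\<bar>)" unfolding gram_def by (rule sum_abs)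
  also have "\<dots> \<le> (\<Sum>s<n. (B (i, s) * B (i, s) + B (j, s) * B (j, s)) / 2)"
  proof (intro sum_mono)
    fix s show "\<bar>B (i, s) * B (j, s)\<bar> \<le> (B (i, s) * B (i, s) + B (j, s) * B (j, s)) / 2"
      using sum_squares_bound[of "\<bar>B (i, s)\<bar>" "\<bar>B (j, s)\<bar>"] by (simp add: abs_mult power2_eq_square)
  qed
  also have "\<dots> = (gram n B i i + gram n B j j) / 2" by (simp add: gram_def sum.distrib sum_divide_distrib[symmetric])
  finally show ?thesis by simp
qed

abbreviation row_form :: "nat \<Rightarrow> (nat \<times> nat \<Rightarrow> real) \<Rightarrow> nat \<Rightarrow> (nat \<Rightarrow> real) \<Rightarrow> real" where
  "row_form n B i \<equiv> linear_form {..<n} (\<lambda>s. B (i, s))"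

definition centered_product :: "nat \<Rightarrow> (nat \<times> nat \<Rightarrow> real) \<Rightarrow> nat \<Rightarrow> nat \<Rightarrow> (nat \<Rightarrow> real) \<Rightarrow> real" where
  "centered_product n B i j \<zeta> = row_form n B i \<zeta> * row_form n B j \<zeta> - gram n B i j"

text \<open>
  The covariance of \<open>L\<^sub>i L\<^sub>j\<close> and \<open>L\<^sub>k L\<^sub>l\<close>, where
  \<open>L\<^sub>i\<close> is the linear form with the coefficients of row \<open>i\<close>.
\<close>

definition gram_cov :: "nat \<Rightarrow> (nat \<times> nat \<Rightarrow> real) \<Rightarrow> nat \<Rightarrow> nat \<Rightarrow> nat \<Rightarrow> nat \<Rightarrow> real" where
  "gram_cov n B i j k l = gram n B i k * gram n B j l + gram n B i l * gram n B j k"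

lemma all_moments_centered_product: "all_moments gauss (centered_product n B i j)"
  unfolding centered_product_def[abs_def] by (intro all_moments_intros)

lemma expectation_row_form_mult: "(\<integral>\<zeta>. row_form n B i \<zeta> * row_form n B j \<zeta> \<partial>gauss) = gram n B i j"
  by (simp add: expectation_linear_form_mult gram_def)

lemma expectation_centered_product: "(\<integral>\<zeta>. centered_product n B i j \<zeta> \<partial>gauss) = 0"
proof -
  have "integrable gauss (\<lambda>\<zeta>. row_form n B i \<zeta> * row_form n B j \<zeta>)" by (intro all_moments_integrable all_moments_intros)
  then show ?thesis unfolding centered_product_def by (simp add: expectation_row_form_mult)
qed

lemma expectation_centered_product2:
  "(\<integral>\<zeta>. centered_product n B i j \<zeta> * centered_product n B k l \<zeta> \<partial>gauss) = gram_cov n B i j k l"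
proof -
  let ?L = "row_form n B" and ?S = "gram n B"
  have i: "integrable gauss (\<lambda>\<zeta>. ?L i \<zeta> * ?L j \<zeta>)" for i j by (intro all_moments_integrable all_moments_intros)
  have i4: "integrable gauss (\<lambda>\<zeta>. ?L i \<zeta> * ?L j \<zeta> * ?L k \<zeta> * ?L l \<zeta>)" by (intro all_moments_integrable all_moments_intros)
  have "(\<integral>\<zeta>. centered_product n B i j \<zeta> * centered_product n B k l \<zeta> \<partial>gauss) =
      (\<integral>\<zeta>. ?L i \<zeta> * ?L j \<zeta> * ?L k \<zeta> * ?L l \<zeta> - ?S k l * (?L i \<zeta> * ?L j \<zeta>) - ?S i j * (?L k \<zeta> * ?L l \<zeta>) + ?S i j * ?S k l \<partial>gauss)"
    by (intro Bochner_Integration.integral_cong refl) (simp add: centered_product_def algebra_simps)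
  also have "\<dots> = (?S i j * ?S k l + ?S i k * ?S j l + ?S i l * ?S j k) - ?S k l * ?S i j - ?S i j * ?S k l + ?S i j * ?S k l"
    using i i4 by (simp add: expectation_row_form_mult expectation_linear_form_mult4 gram_def)
  finally show ?thesis by (simp add: gram_cov_def)
qed

text \<open>
  A common bound for all Gram entries with indices among \<open>a, b, c, e\<close>.
\<close>

definition diag_sum :: "nat \<Rightarrow> (nat \<times> nat \<Rightarrow> real) \<Rightarrow> nat \<Rightarrow> nat \<Rightarrow> nat \<Rightarrow> nat \<Rightarrow> real" where
  "diag_sum n B a b c e = gram n B a a + gram n B b b + gram n B c c + gram n B e e"

lemma diag_sum_nonneg: "0 \<le> diag_sum n B a b c e"
  unfolding diag_sum_def by (intro add_nonneg_nonneg gram_nonneg)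

lemma gram_le_diag_sum:
  assumes "i \<in> {a, b, c, e}" "j \<in> {a, b, c, e}"
  shows "\<bar>gram n B i j\<bar> \<le> diag_sum n B a b c e"
proof -
  have d: "gram n B i i \<le> diag_sum n B a b c e" if "i \<in> {a, b, c, e}" for i
    using that gram_nonneg[of n B a] gram_nonneg[of n B b] gram_nonneg[of n B c] gram_nonneg[of n B e]
    by (auto simp: diag_sum_def)
  show ?thesis using gram_abs_le[of n B i j] d[OF assms(1)] d[OF assms(2)] by linarith
qed

lemma four_power_le: "\<bar>a + b + c + d\<bar> ^ k \<le> 4 ^ k * (\<bar>a\<bar> ^ k + \<bar>b\<bar> ^ k + \<bar>c\<bar> ^ k + \<bar>d\<bar> ^ k)" for a b c d :: real
proof -
  have "\<bar>(a + b) + (c + d)\<bar> ^ k \<le> 2 ^ k * (\<bar>a + b\<bar> ^ k + \<bar>c + d\<bar> ^ k)" by (rule power_add_le)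
  also have "\<dots> \<le> 2 ^ k * (2 ^ k * (\<bar>a\<bar> ^ k + \<bar>b\<bar> ^ k) + 2 ^ k * (\<bar>c\<bar> ^ k + \<bar>d\<bar> ^ k))"
    by (intro mult_left_mono add_mono power_add_le) simp
  also have "\<dots> = (2 * 2) ^ k * (\<bar>a\<bar> ^ k + \<bar>b\<bar> ^ k + \<bar>c\<bar> ^ k + \<bar>d\<bar> ^ k)"
    unfolding power_mult_distrib by (simp add: algebra_simps)
  finally show ?thesis by (simp add: add.assoc)
qed

lemma sum4_power_le:
  assumes "0 \<le> a" "0 \<le> b" "0 \<le> c" "0 \<le> (d :: real)" "k > 0"
  shows "a ^ k + b ^ k + c ^ k + d ^ k \<le> (a + b + c + d) ^ k"
proof -
  have two: "x ^ k + y ^ k \<le> (x + y) ^ k" if "0 \<le> x" "0 \<le> y" for x y :: real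
    using that
  proof -
    obtain m where k: "k = Suc m" using assms(5) by (cases k) auto
    have "x * x ^ m + y * y ^ m \<le> x * (x + y) ^ m + y * (x + y) ^ m"
      using that by (intro add_mono mult_left_mono power_mono) auto
    then show ?thesis by (simp add: k algebra_simps)
  qed
  have "a ^ k + b ^ k + c ^ k + d ^ k \<le> (a + b) ^ k + (c + d) ^ k" using two[of a b] two[of c d] assms by simp
  also have "\<dots> \<le> ((a + b) + (c + d)) ^ k" using assms by (intro two) auto
  finally show ?thesis by (simp add: add.assoc)
qed

text \<open>
  These moments enter with the factors \<open>1/d\<^sup>2\<close> and \<open>1/d\<^sup>3\<close>, so that only
  their homogeneity in the Gram matrix matters. All factors are dominated by \<open>Z + M\<close>, with
  \<open>Z\<close> the sum of the squares of the four linear forms.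
\<close>

lemma centered_product_moments:
  fixes n :: nat and B :: "nat \<times> nat \<Rightarrow> real" and a b c e :: nat
  defines "M \<equiv> diag_sum n B a b c e"
  assumes e1: "i1 \<in> {a, b, c, e}" "j1 \<in> {a, b, c, e}" and e2: "i2 \<in> {a, b, c, e}" "j2 \<in> {a, b, c, e}"
    and e3: "i3 \<in> {a, b, c, e}" "j3 \<in> {a, b, c, e}"
  shows "\<bar>\<integral>\<zeta>. centered_product n B i1 j1 \<zeta> * centered_product n B i2 j2 \<zeta> * centered_product n B i3 j3 \<zeta> \<partial>gauss\<bar> \<le> 10 ^ 4 * M ^ 3" (is ?third)
    and "i4 \<in> {a, b, c, e} \<Longrightarrow> j4 \<in> {a, b, c, e} \<Longrightarrow>
      \<bar>\<integral>\<zeta>. centered_product n B i1 j1 \<zeta> * centered_product n B i2 j2 \<zeta> * centered_product n B i3 j3 \<zeta> * centered_product n B i4 j4 \<zeta> \<partial>gauss\<bar> \<le> 10 ^ 6 * M ^ 4"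
      (is "_ \<Longrightarrow> _ \<Longrightarrow> ?fourth")
proof -
  let ?L = "row_form n B" and ?S = "gram n B" and ?y = "centered_product n B"
  have M0: "M \<ge> 0" unfolding M_def by (rule diag_sum_nonneg)
  define Z where "Z \<zeta> = (?L a \<zeta>)\<^sup>2 + (?L b \<zeta>)\<^sup>2 + (?L c \<zeta>)\<^sup>2 + (?L e \<zeta>)\<^sup>2" for \<zeta>
  have Z0: "Z \<zeta> \<ge> 0" for \<zeta> unfolding Z_def by simp
  have Zm: "all_moments gauss Z" unfolding Z_def by (intro all_moments_intros)
  have y: "\<bar>?y i j \<zeta>\<bar> \<le> Z \<zeta> + M" if "i \<in> {a, b, c, e}" "j \<in> {a, b, c, e}" for i j \<zeta>
  proof -
    have "(?L i \<zeta>)\<^sup>2 \<le> Z \<zeta>" if "i \<in> {a, b, c, e}" for i using that by (auto simp: Z_def)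
    then have "(?L i \<zeta>)\<^sup>2 \<le> Z \<zeta>" "(?L j \<zeta>)\<^sup>2 \<le> Z \<zeta>" using that by auto
    moreover have "2 * \<bar>?L i \<zeta> * ?L j \<zeta>\<bar> \<le> (?L i \<zeta>)\<^sup>2 + (?L j \<zeta>)\<^sup>2"
      using sum_squares_bound[of "\<bar>?L i \<zeta>\<bar>" "\<bar>?L j \<zeta>\<bar>"] by (simp add: abs_mult mult.assoc)
    moreover have "\<bar>?S i j\<bar> \<le> M" unfolding M_def by (rule gram_le_diag_sum[OF that])
    moreover have "\<bar>?y i j \<zeta>\<bar> \<le> \<bar>?L i \<zeta> * ?L j \<zeta>\<bar> + \<bar>?S i j\<bar>" unfolding centered_product_def by (rule abs_triangle_ineq4)
    ultimately show ?thesis by argo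
  qed
  have even: "(\<integral>\<zeta>. (?L i \<zeta>) ^ 6 \<partial>gauss) = 15 * ?S i i ^ 3" "(\<integral>\<zeta>. (?L i \<zeta>) ^ 8 \<partial>gauss) = 105 * ?S i i ^ 4" for i
    using expectation_linear_form_even_power[of "{..<n}" "\<lambda>s. B (i, s)"] by (simp_all add: gram_def power2_eq_square)
  have Zk: "(\<integral>\<zeta>. (Z \<zeta> + M) ^ k \<partial>gauss) \<le> C * M ^ k"
    if k: "k > 0" and ev: "\<And>i. (\<integral>\<zeta>. (?L i \<zeta>) ^ (2 * k) \<partial>gauss) = u * ?S i i ^ k" and u: "u \<ge> 0" and C: "2 ^ k * (4 ^ k * u + 1) \<le> C"
    for k :: nat and u C
  proof -
    have le: "(Z \<zeta> + M) ^ k \<le> 2 ^ k * (4 ^ k * ((?L a \<zeta>) ^ (2 * k) + (?L b \<zeta>) ^ (2 * k) + (?L c \<zeta>) ^ (2 * k) + (?L e \<zeta>) ^ (2 * k)) + M ^ k)" for \<zeta>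
    proof -
      have "(Z \<zeta> + M) ^ k \<le> 2 ^ k * (Z \<zeta> ^ k + M ^ k)" using power_add_le[of "Z \<zeta>" M k] Z0[of \<zeta>] M0 by simp
      moreover have "Z \<zeta> ^ k \<le> 4 ^ k * ((?L a \<zeta>) ^ (2 * k) + (?L b \<zeta>) ^ (2 * k) + (?L c \<zeta>) ^ (2 * k) + (?L e \<zeta>) ^ (2 * k))"
        using four_power_le[of "(?L a \<zeta>)\<^sup>2" "(?L b \<zeta>)\<^sup>2" "(?L c \<zeta>)\<^sup>2" "(?L e \<zeta>)\<^sup>2" k] Z0[of \<zeta>]
        by (simp add: Z_def power_mult)
      ultimately show ?thesis by (meson add_right_mono mult_left_mono order_trans zero_le_numeral zero_le_power)
    qed
    have i: "integrable gauss (\<lambda>\<zeta>. (?L i \<zeta>) ^ (2 * k))" for i by (intro all_moments_integrable all_moments_intros)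
    have "(\<integral>\<zeta>. (Z \<zeta> + M) ^ k \<partial>gauss) \<le> (\<integral>\<zeta>. 2 ^ k * (4 ^ k * ((?L a \<zeta>) ^ (2 * k) + (?L b \<zeta>) ^ (2 * k) + (?L c \<zeta>) ^ (2 * k) + (?L e \<zeta>) ^ (2 * k)) + M ^ k) \<partial>gauss)"
      using le by (intro integral_mono all_moments_integrable all_moments_intros Zm) auto
    also have "\<dots> = 2 ^ k * (4 ^ k * (u * ?S a a ^ k + u * ?S b b ^ k + u * ?S c c ^ k + u * ?S e e ^ k) + M ^ k)"
      using i by (simp add: ev)
    also have "\<dots> = 2 ^ k * (4 ^ k * u * (?S a a ^ k + ?S b b ^ k + ?S c c ^ k + ?S e e ^ k) + M ^ k)"
      by (simp add: distrib_left mult.assoc)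
    also have "\<dots> \<le> 2 ^ k * (4 ^ k * u * M ^ k + M ^ k)"
      using u k by (intro mult_left_mono add_mono) (auto simp: M_def diag_sum_def intro!: sum4_power_le gram_nonneg)
    also have "\<dots> = (2 ^ k * (4 ^ k * u + 1)) * M ^ k" by (simp add: algebra_simps)
    also have "\<dots> \<le> C * M ^ k" using C M0 by (intro mult_right_mono) auto
    finally show ?thesis .
  qed
  have Zi: "integrable gauss (\<lambda>\<zeta>. (Z \<zeta> + M) ^ k)" for k by (intro all_moments_integrable all_moments_intros Zm)
  note ym = all_moments_mult all_moments_centered_product
  have "\<bar>\<integral>\<zeta>. ?y i1 j1 \<zeta> * ?y i2 j2 \<zeta> * ?y i3 j3 \<zeta> \<partial>gauss\<bar> \<le> (\<integral>\<zeta>. \<bar>?y i1 j1 \<zeta> * ?y i2 j2 \<zeta> * ?y i3 j3 \<zeta>\<bar> \<partial>gauss)"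
    by (rule integral_abs_bound)
  also have "\<dots> \<le> (\<integral>\<zeta>. (Z \<zeta> + M) ^ 3 \<partial>gauss)"
  proof (intro integral_mono Zi all_moments_integrable[OF all_moments_abs] ym)
    fix \<zeta>
    have "\<bar>?y i1 j1 \<zeta>\<bar> * \<bar>?y i2 j2 \<zeta>\<bar> * \<bar>?y i3 j3 \<zeta>\<bar> \<le> (Z \<zeta> + M) * (Z \<zeta> + M) * (Z \<zeta> + M)"
      using Z0[of \<zeta>] M0 by (intro mult_mono y assms) auto
    then show "\<bar>?y i1 j1 \<zeta> * ?y i2 j2 \<zeta> * ?y i3 j3 \<zeta>\<bar> \<le> (Z \<zeta> + M) ^ 3" by (simp add: abs_mult power3_eq_cube)
  qed
  also have "\<dots> \<le> 10 ^ 4 * M ^ 3" by (rule Zk[where u = 15]) (simp_all add: even)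
  finally show ?third .
  assume e4: "i4 \<in> {a, b, c, e}" "j4 \<in> {a, b, c, e}"
  have "\<bar>\<integral>\<zeta>. ?y i1 j1 \<zeta> * ?y i2 j2 \<zeta> * ?y i3 j3 \<zeta> * ?y i4 j4 \<zeta> \<partial>gauss\<bar> \<le> (\<integral>\<zeta>. \<bar>?y i1 j1 \<zeta> * ?y i2 j2 \<zeta> * ?y i3 j3 \<zeta> * ?y i4 j4 \<zeta>\<bar> \<partial>gauss)"
    by (rule integral_abs_bound)
  also have "\<dots> \<le> (\<integral>\<zeta>. (Z \<zeta> + M) ^ 4 \<partial>gauss)"
  proof (intro integral_mono Zi all_moments_integrable[OF all_moments_abs] ym)
    fix \<zeta>
    have "\<bar>?y i1 j1 \<zeta>\<bar> * \<bar>?y i2 j2 \<zeta>\<bar> * \<bar>?y i3 j3 \<zeta>\<bar> * \<bar>?y i4 j4 \<zeta>\<bar> \<le> (Z \<zeta> + M) * (Z \<zeta> + M) * (Z \<zeta> + M) * (Z \<zeta> + M)"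
      using Z0[of \<zeta>] M0 by (intro mult_mono y assms e4) auto
    then show "\<bar>?y i1 j1 \<zeta> * ?y i2 j2 \<zeta> * ?y i3 j3 \<zeta> * ?y i4 j4 \<zeta>\<bar> \<le> (Z \<zeta> + M) ^ 4" by (simp add: abs_mult power4_eq_xxxx mult.assoc)
  qed
  also have "\<dots> \<le> 10 ^ 6 * M ^ 4" by (rule Zk[where u = 105]) (simp_all add: even)
  finally show ?fourth .
qed

text \<open>
  The Gram matrix after one more Gaussian factor. Given \<open>B\<close>, it is the average of
  \<open>d\<close> independent rank one matrices with mean \<open>gram n B\<close>.
\<close>

abbreviation next_gram :: "nat \<Rightarrow> nat \<Rightarrow> (nat \<times> nat \<Rightarrow> real) \<Rightarrow> (nat \<times> nat \<Rightarrow> real) \<Rightarrow> nat \<Rightarrow> nat \<Rightarrow> real" where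
  "next_gram d n B \<eta> i j \<equiv> gram d (mat_scale (1 / sqrt d) (mat_prod n B \<eta>)) i j"

lemma next_gram_eq:
  assumes "d > 0"
  shows "next_gram d n B \<eta> i j = gram n B i j + column_sum (centered_product n B i j) d \<eta> / real d"
proof -
  have 1: "mat_prod n B \<eta> (i, t) = row_form n B i (column t \<eta>)" for i t
    by (simp add: mat_prod_def linear_form_def column_def)
  have "next_gram d n B \<eta> i j = (\<Sum>t<d. row_form n B i (column t \<eta>) * row_form n B j (column t \<eta>)) / real d"
    using assms by (simp add: gram_def mat_scale_def 1 sum_divide_distrib)
  also have "\<dots> = gram n B i j + column_sum (centered_product n B i j) d \<eta> / real d"
    using assms by (simp add: column_sum_def centered_product_def sum_subtractf diff_divide_distrib)
  finally show ?thesis .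
qed

lemma expectation_next_gram2:
  assumes d: "d > 0"
  shows "(\<integral>\<eta>. next_gram d n B \<eta> i j * next_gram d n B \<eta> k l \<partial>gauss) = gram n B i j * gram n B k l + gram_cov n B i j k l / real d"
proof -
  let ?c = "\<lambda>i j. column_sum (centered_product n B i j) d" and ?S = "gram n B"
  note am = all_moments_column_sum[OF all_moments_centered_product]
  note E0 = expectation_column_sum[OF all_moments_centered_product expectation_centered_product]
  note E2 = expectation_column_sum2[OF all_moments_centered_product all_moments_centered_product expectation_centered_product expectation_centered_product]
  have "(\<integral>\<eta>. next_gram d n B \<eta> i j * next_gram d n B \<eta> k l \<partial>gauss) =
    (\<integral>\<eta>. ?S i j * ?S k l + ?S i j * ?c k l \<eta> / d + ?S k l * ?c i j \<eta> / d + ?c i j \<eta> * ?c k l \<eta> / (real d * real d) \<partial>gauss)"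
    unfolding next_gram_eq[OF d] by (intro Bochner_Integration.integral_cong refl) (simp add: algebra_simps)
  also have "\<dots> = ?S i j * ?S k l + real d * gram_cov n B i j k l / (real d * real d)"
    by (simp add: all_moments_integrable am all_moments_mult E0 E2 expectation_centered_product2)
  finally show ?thesis using d by simp
qed

lemma expectation_next_gram4:
  fixes n :: nat and B :: "nat \<times> nat \<Rightarrow> real"
  assumes d: "d > 0"
  defines "S \<equiv> gram n B" and "y \<equiv> centered_product n B" and "\<kappa> \<equiv> gram_cov n B"
  shows "(\<integral>\<eta>. next_gram d n B \<eta> i1 j1 * next_gram d n B \<eta> i2 j2 * next_gram d n B \<eta> i3 j3 * next_gram d n B \<eta> i4 j4 \<partial>gauss) =
    S i1 j1 * S i2 j2 * S i3 j3 * S i4 j4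
     + (S i1 j1 * S i2 j2 * \<kappa> i3 j3 i4 j4 + S i1 j1 * S i3 j3 * \<kappa> i2 j2 i4 j4 + S i1 j1 * S i4 j4 * \<kappa> i2 j2 i3 j3
        + S i2 j2 * S i3 j3 * \<kappa> i1 j1 i4 j4 + S i2 j2 * S i4 j4 * \<kappa> i1 j1 i3 j3 + S i3 j3 * S i4 j4 * \<kappa> i1 j1 i2 j2) / real d
     + (S i1 j1 * (\<integral>\<zeta>. y i2 j2 \<zeta> * y i3 j3 \<zeta> * y i4 j4 \<zeta> \<partial>gauss) + S i2 j2 * (\<integral>\<zeta>. y i1 j1 \<zeta> * y i3 j3 \<zeta> * y i4 j4 \<zeta> \<partial>gauss)
        + S i3 j3 * (\<integral>\<zeta>. y i1 j1 \<zeta> * y i2 j2 \<zeta> * y i4 j4 \<zeta> \<partial>gauss) + S i4 j4 * (\<integral>\<zeta>. y i1 j1 \<zeta> * y i2 j2 \<zeta> * y i3 j3 \<zeta> \<partial>gauss)) / (real d)\<^sup>2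
     + (\<integral>\<zeta>. y i1 j1 \<zeta> * y i2 j2 \<zeta> * y i3 j3 \<zeta> * y i4 j4 \<zeta> \<partial>gauss) / (real d) ^ 3
     + (real d - 1) / (real d) ^ 3 * (\<kappa> i1 j1 i2 j2 * \<kappa> i3 j3 i4 j4 + \<kappa> i1 j1 i3 j3 * \<kappa> i2 j2 i4 j4 + \<kappa> i1 j1 i4 j4 * \<kappa> i2 j2 i3 j3)"
  unfolding next_gram_eq[OF d] S_def y_def \<kappa>_def
  by (subst expectation_column_average4[OF d all_moments_centered_product all_moments_centered_product all_moments_centered_product all_moments_centered_product
    expectation_centered_product expectation_centered_product expectation_centered_product expectation_centered_product])
   (simp only: expectation_centered_product2)

section \<open>One step of the chain of Gram matrices\<close>

lemma abs_mult4_le: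
  fixes M :: real
  assumes "\<bar>x\<bar> \<le> M" "\<bar>y\<bar> \<le> M" "\<bar>z\<bar> \<le> M" "\<bar>w\<bar> \<le> M"
  shows "\<bar>x * y * z * w\<bar> \<le> M ^ 4"
proof -
  have "0 \<le> M" using assms(1) by linarith
  then have "\<bar>x\<bar> * \<bar>y\<bar> * \<bar>z\<bar> * \<bar>w\<bar> \<le> M * M * M * M" using assms by (intro mult_mono) auto
  then show ?thesis by (simp add: abs_mult power4_eq_xxxx mult.assoc)
qed

lemma prod4_le_sum_power4: "\<bar>x * y * z * w\<bar> \<le> x ^ 4 + y ^ 4 + z ^ 4 + w ^ 4" for x y z w :: real
proof -
  define M where "M = max (max \<bar>x\<bar> \<bar>y\<bar>) (max \<bar>z\<bar> \<bar>w\<bar>)"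
  have "\<bar>x * y * z * w\<bar> \<le> M ^ 4" by (rule abs_mult4_le) (auto simp: M_def le_max_iff_disj)
  also have "M ^ 4 \<le> \<bar>x\<bar> ^ 4 + \<bar>y\<bar> ^ 4 + \<bar>z\<bar> ^ 4 + \<bar>w\<bar> ^ 4"
    unfolding M_def by (auto simp: max_def)
  finally show ?thesis by simp
qed

text \<open>
  The shape of \<open>expectation_next_gram4\<close>; as \<open>(d - 1) / d\<^sup>3 \<le> 1 /
  d\<^sup>2\<close>, the products of covariances join the terms of second order.
\<close>

lemma inverse_expansion_bound:
  fixes d :: real
  assumes d: "d \<ge> 1" and "P \<le> P'" "Q \<le> Q'" "R \<le> R'" "K \<le> K'" "0 \<le> K'"
  shows "P / d + Q / d\<^sup>2 + R / d ^ 3 + (d - 1) / d ^ 3 * K \<le> P' / d + (Q' + K') / d\<^sup>2 + R' / d ^ 3"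
proof -
  have "(d - 1) / d ^ 3 * K \<le> (d - 1) / d ^ 3 * K'" using assms by (intro mult_left_mono) auto
  also have "\<dots> \<le> d / d ^ 3 * K'" using assms by (intro mult_right_mono divide_right_mono) auto
  also have "\<dots> = K' / d\<^sup>2" using d by (simp add: power2_eq_square power3_eq_cube)
  finally have "(d - 1) / d ^ 3 * K \<le> K' / d\<^sup>2" .
  moreover have "P / d \<le> P' / d" "Q / d\<^sup>2 \<le> Q' / d\<^sup>2" "R / d ^ 3 \<le> R' / d ^ 3"
    using assms by (auto intro!: divide_right_mono)
  ultimately show ?thesis by (simp add: add_divide_distrib)
qed

lemma gram_cov_bound:
  assumes "{i, j, k, l} \<subseteq> {a, b, c, e}"
  shows "\<bar>gram_cov n B i j k l\<bar> \<le> 2 * (diag_sum n B a b c e)\<^sup>2"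
proof -
  let ?M = "diag_sum n B a b c e"
  have S: "\<bar>gram n B x z\<bar> \<le> ?M" if "x \<in> {i, j, k, l}" "z \<in> {i, j, k, l}" for x z
    using that assms by (intro gram_le_diag_sum) auto
  have "\<bar>gram_cov n B i j k l\<bar> \<le> \<bar>gram n B i k\<bar> * \<bar>gram n B j l\<bar> + \<bar>gram n B i l\<bar> * \<bar>gram n B j k\<bar>"
    unfolding gram_cov_def abs_mult[symmetric] by (rule abs_triangle_ineq)
  also have "\<dots> \<le> ?M * ?M + ?M * ?M"
    using diag_sum_nonneg[of n B a b c e] by (intro add_mono mult_mono S) auto
  finally show ?thesis by (simp add: power2_eq_square)
qed

context
  fixes d n :: nat and B :: "nat \<times> nat \<Rightarrow> real"
  assumes d: "d > 0"
begin

text \<open>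
  The term \<open>6 m\<^sup>2 \<kappa> / d\<close> is split by the arithmetic-geometric mean inequality as
  \<open>2 m\<^sup>2 \<kappa> / d \<le> m\<^sup>4 + \<kappa>\<^sup>2 / d\<^sup>2\<close>. Losing a constant
  factor in front of \<open>m\<^sup>4\<close> is harmless; what matters is that the diagonal entries appear
  with \<open>1/d\<^sup>2\<close>.
\<close>

lemma next_gram_power4:
  "(\<integral>\<eta>. next_gram d n B \<eta> i j ^ 4 \<partial>gauss) \<le> 4 * gram n B i j ^ 4 + 10 ^ 9 * (gram n B i i ^ 4 + gram n B j j ^ 4) / (real d)\<^sup>2"
proof -
  let ?S = "gram n B" and ?D = "real d"
  define M where "M = diag_sum n B i j i j"
  define m where "m = ?S i j"
  define \<kappa> where "\<kappa> = gram_cov n B i j i j"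
  let ?y = "centered_product n B i j"
  define t3 where "t3 = (\<integral>\<zeta>. ?y \<zeta> * ?y \<zeta> * ?y \<zeta> \<partial>gauss)"
  define t4 where "t4 = (\<integral>\<zeta>. ?y \<zeta> * ?y \<zeta> * ?y \<zeta> * ?y \<zeta> \<partial>gauss)"
  have D: "?D \<ge> 1" using d by simp
  have M0: "M \<ge> 0" unfolding M_def by (rule diag_sum_nonneg)
  have mM: "\<bar>m\<bar> \<le> M" unfolding m_def M_def by (rule gram_le_diag_sum) auto
  have k: "\<bar>\<kappa>\<bar> \<le> 2 * M\<^sup>2" unfolding \<kappa>_def M_def by (rule gram_cov_bound) auto
  have t3: "\<bar>t3\<bar> \<le> 10 ^ 4 * M ^ 3" unfolding t3_def M_def by (rule centered_product_moments(1)) auto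
  have t4: "\<bar>t4\<bar> \<le> 10 ^ 6 * M ^ 4" unfolding t4_def M_def by (rule centered_product_moments(2)) auto
  have k2: "\<kappa>\<^sup>2 \<le> 4 * M ^ 4"
  proof -
    have "\<bar>\<kappa>\<bar>\<^sup>2 \<le> (2 * M\<^sup>2)\<^sup>2" using k by (intro power_mono) auto
    then show ?thesis by (simp add: power_mult_distrib flip: power_mult)
  qed
  have "(\<integral>\<eta>. next_gram d n B \<eta> i j ^ 4 \<partial>gauss) = m ^ 4 + (6 * m\<^sup>2 * \<kappa> / ?D + 4 * m * t3 / ?D\<^sup>2 + t4 / ?D ^ 3 + (?D - 1) / ?D ^ 3 * (3 * \<kappa>\<^sup>2))"
    using expectation_next_gram4[OF d, of n B i j i j i j i j]
    by (simp add: m_def \<kappa>_def t3_def t4_def power4_eq_xxxx power2_eq_square mult.assoc)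
  also have "\<dots> \<le> m ^ 4 + ((3 * m ^ 4 * ?D + 12 * M ^ 4 / ?D) / ?D + (4 * 10 ^ 4 * M ^ 4 + 12 * M ^ 4) / ?D\<^sup>2 + 10 ^ 6 * M ^ 4 / ?D ^ 3)"
  proof (intro add_left_mono inverse_expansion_bound[OF D])
    have "2 * (m\<^sup>2 * ?D) * \<kappa> \<le> (m\<^sup>2 * ?D)\<^sup>2 + \<kappa>\<^sup>2" by (rule sum_squares_bound)
    also have "\<dots> \<le> m ^ 4 * ?D\<^sup>2 + 4 * M ^ 4" using k2 by (simp add: power_mult_distrib flip: power_mult)
    finally have "2 * (m\<^sup>2 * ?D) * \<kappa> / ?D \<le> (m ^ 4 * ?D\<^sup>2 + 4 * M ^ 4) / ?D" by (rule divide_right_mono) simp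
    then have "2 * (m\<^sup>2 * \<kappa>) \<le> m ^ 4 * ?D + 4 * M ^ 4 / ?D" using d by (simp add: add_divide_distrib power2_eq_square)
    then show "6 * m\<^sup>2 * \<kappa> \<le> 3 * m ^ 4 * ?D + 12 * M ^ 4 / ?D" by simp
    have "m * t3 \<le> \<bar>m\<bar> * \<bar>t3\<bar>" unfolding abs_mult[symmetric] by (rule abs_ge_self)
    also have "\<dots> \<le> M * (10 ^ 4 * M ^ 3)" using mM t3 M0 by (intro mult_mono) auto
    finally show "4 * m * t3 \<le> 4 * 10 ^ 4 * M ^ 4" by (simp add: power4_eq_xxxx power3_eq_cube)
    show "t4 \<le> 10 ^ 6 * M ^ 4" using t4 by simp
    show "3 * \<kappa>\<^sup>2 \<le> 12 * M ^ 4" using k2 by simp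
    show "0 \<le> 12 * M ^ 4" using M0 by simp
  qed
  also have "\<dots> = 4 * m ^ 4 + (12 * M ^ 4 + 4 * 10 ^ 4 * M ^ 4 + 12 * M ^ 4) / ?D\<^sup>2 + 10 ^ 6 * M ^ 4 / ?D ^ 3"
    using d by (simp add: add_divide_distrib power2_eq_square)
  also have "\<dots> \<le> 4 * m ^ 4 + (12 * M ^ 4 + 4 * 10 ^ 4 * M ^ 4 + 12 * M ^ 4) / ?D\<^sup>2 + 10 ^ 6 * M ^ 4 / ?D\<^sup>2"
    using D M0 by (intro add_left_mono divide_left_mono power_increasing) auto
  also have "\<dots> = 4 * m ^ 4 + 1040024 * M ^ 4 / ?D\<^sup>2" by (simp add: add_divide_distrib[symmetric])
  also have "\<dots> \<le> 4 * m ^ 4 + 10 ^ 9 * (?S i i ^ 4 + ?S j j ^ 4) / ?D\<^sup>2"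
  proof -
    have "M = 2 * (?S i i + ?S j j)" by (simp add: M_def diag_sum_def)
    then have "M ^ 4 = 2 ^ 4 * (?S i i + ?S j j) ^ 4" by (simp only: power_mult_distrib)
    then have "M ^ 4 = 16 * \<bar>?S i i + ?S j j\<bar> ^ 4" by simp
    also have "\<dots> \<le> 16 * (2 ^ 4 * (\<bar>?S i i\<bar> ^ 4 + \<bar>?S j j\<bar> ^ 4))" by (intro mult_left_mono power_add_le) simp
    finally have "M ^ 4 \<le> 256 * (?S i i ^ 4 + ?S j j ^ 4)" by simp
    then have "1040024 * M ^ 4 \<le> 1040024 * (256 * (?S i i ^ 4 + ?S j j ^ 4))" by (rule mult_left_mono) simp
    also have "\<dots> \<le> 10 ^ 9 * (?S i i ^ 4 + ?S j j ^ 4)" by (simp add: add_mono)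
    finally show ?thesis by (intro add_left_mono divide_right_mono) auto
  qed
  finally show ?thesis by (simp add: m_def)
qed

text \<open>
  The terms of order \<open>1/d\<close> and the products of covariances are left to the caller, since their
  exact form decides the outcome; the others are bounded crudely.
\<close>

lemma next_gram4_le:
  fixes a b c e :: nat
  defines "S \<equiv> gram n B" and "\<kappa> \<equiv> gram_cov n B" and "M \<equiv> diag_sum n B a b c e"
  assumes L: "{i1, j1, i2, j2, i3, j3, i4, j4} \<subseteq> {a, b, c, e}"
    and P: "S i1 j1 * S i2 j2 * \<kappa> i3 j3 i4 j4 + S i1 j1 * S i3 j3 * \<kappa> i2 j2 i4 j4 + S i1 j1 * S i4 j4 * \<kappa> i2 j2 i3 j3
        + S i2 j2 * S i3 j3 * \<kappa> i1 j1 i4 j4 + S i2 j2 * S i4 j4 * \<kappa> i1 j1 i3 j3 + S i3 j3 * S i4 j4 * \<kappa> i1 j1 i2 j2 \<le> P'"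
    and K: "\<kappa> i1 j1 i2 j2 * \<kappa> i3 j3 i4 j4 + \<kappa> i1 j1 i3 j3 * \<kappa> i2 j2 i4 j4 + \<kappa> i1 j1 i4 j4 * \<kappa> i2 j2 i3 j3 \<le> K'" "0 \<le> K'"
  shows "(\<integral>\<eta>. next_gram d n B \<eta> i1 j1 * next_gram d n B \<eta> i2 j2 * next_gram d n B \<eta> i3 j3 * next_gram d n B \<eta> i4 j4 \<partial>gauss) \<le>
    S i1 j1 * S i2 j2 * S i3 j3 * S i4 j4 + (P' / real d
      + (10 ^ 4 * M ^ 3 * (\<bar>S i1 j1\<bar> + \<bar>S i2 j2\<bar> + \<bar>S i3 j3\<bar> + \<bar>S i4 j4\<bar>) + K') / (real d)\<^sup>2 + 10 ^ 6 * M ^ 4 / (real d) ^ 3)"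
proof -
  let ?y = "centered_product n B"
  have D: "real d \<ge> 1" using d by simp
  have t: "m * (\<integral>\<zeta>. ?y x1 z1 \<zeta> * ?y x2 z2 \<zeta> * ?y x3 z3 \<zeta> \<partial>gauss) \<le> 10 ^ 4 * M ^ 3 * \<bar>m\<bar>"
    if "{x1, z1, x2, z2, x3, z3} \<subseteq> {a, b, c, e}" for m x1 z1 x2 z2 x3 z3
  proof -
    let ?t = "\<integral>\<zeta>. ?y x1 z1 \<zeta> * ?y x2 z2 \<zeta> * ?y x3 z3 \<zeta> \<partial>gauss"
    have 3: "\<bar>?t\<bar> \<le> 10 ^ 4 * M ^ 3"
      unfolding M_def using that by (intro centered_product_moments(1)) (simp_all only: insert_subset)
    have "m * ?t \<le> \<bar>m\<bar> * \<bar>?t\<bar>" unfolding abs_mult[symmetric] by (rule abs_ge_self)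
    also have "\<dots> \<le> \<bar>m\<bar> * (10 ^ 4 * M ^ 3)" using 3 by (rule mult_left_mono) simp
    finally show ?thesis by (simp add: mult.commute)
  qed
  have t4: "(\<integral>\<zeta>. ?y i1 j1 \<zeta> * ?y i2 j2 \<zeta> * ?y i3 j3 \<zeta> * ?y i4 j4 \<zeta> \<partial>gauss) \<le> 10 ^ 6 * M ^ 4"
    unfolding M_def using L
    by (intro order_trans[OF abs_ge_self centered_product_moments(2)]) (simp_all only: insert_subset)
  define Q where "Q = S i1 j1 * (\<integral>\<zeta>. ?y i2 j2 \<zeta> * ?y i3 j3 \<zeta> * ?y i4 j4 \<zeta> \<partial>gauss) + S i2 j2 * (\<integral>\<zeta>. ?y i1 j1 \<zeta> * ?y i3 j3 \<zeta> * ?y i4 j4 \<zeta> \<partial>gauss)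
        + S i3 j3 * (\<integral>\<zeta>. ?y i1 j1 \<zeta> * ?y i2 j2 \<zeta> * ?y i4 j4 \<zeta> \<partial>gauss) + S i4 j4 * (\<integral>\<zeta>. ?y i1 j1 \<zeta> * ?y i2 j2 \<zeta> * ?y i3 j3 \<zeta> \<partial>gauss)"
  have Q: "Q \<le> 10 ^ 4 * M ^ 3 * (\<bar>S i1 j1\<bar> + \<bar>S i2 j2\<bar> + \<bar>S i3 j3\<bar> + \<bar>S i4 j4\<bar>)"
    unfolding Q_def distrib_left using L by (intro add_mono t) (simp_all only: insert_subset)
  note bound = inverse_expansion_bound[OF D P Q t4 K]
  show ?thesis
    unfolding expectation_next_gram4[OF d]
    unfolding S_def[symmetric] \<kappa>_def[symmetric] Q_def[symmetric]
    using bound by (simp only: add.assoc add_le_cancel_left)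
qed

lemma next_gram_diag4:
  "(\<integral>\<eta>. next_gram d n B \<eta> a a * next_gram d n B \<eta> b b * next_gram d n B \<eta> c c * next_gram d n B \<eta> e e \<partial>gauss) \<le>
     gram n B a a * gram n B b b * gram n B c c * gram n B e e + 2 * 10 ^ 6 * diag_sum n B a b c e ^ 4 / real d"
proof -
  let ?S = "gram n B" and ?D = "real d" and ?k = "gram_cov n B"
  define M where "M = diag_sum n B a b c e"
  have D: "?D \<ge> 1" using d by simp
  have M0: "M \<ge> 0" unfolding M_def by (rule diag_sum_nonneg)
  have S: "\<bar>?S x x\<bar> \<le> M" if "x \<in> {a, b, c, e}" for x unfolding M_def using that by (intro gram_le_diag_sum)
  have k: "\<bar>?k x x z z\<bar> \<le> 2 * M\<^sup>2" if "x \<in> {a, b, c, e}" "z \<in> {a, b, c, e}" for x z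
    unfolding M_def using that by (intro gram_cov_bound) (simp only: insert_subset empty_subsetI simp_thms)
  have p: "?S x x * ?S z z * ?k u u v v \<le> 2 * M ^ 4"
    if "x \<in> {a, b, c, e}" "z \<in> {a, b, c, e}" "u \<in> {a, b, c, e}" "v \<in> {a, b, c, e}" for x z u v
  proof -
    have "?S x x * ?S z z * ?k u u v v \<le> \<bar>?S x x\<bar> * \<bar>?S z z\<bar> * \<bar>?k u u v v\<bar>"
      unfolding abs_mult[symmetric] by (rule abs_ge_self)
    also have "\<dots> \<le> M * M * (2 * M\<^sup>2)"
      by (intro mult_mono S[OF that(1)] S[OF that(2)] k[OF that(3,4)] mult_nonneg_nonneg M0 abs_ge_zero)
    finally show ?thesis by (simp add: power4_eq_xxxx power2_eq_square)
  qed
  have kk: "?k x x z z * ?k u u v v \<le> 4 * M ^ 4"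
    if "x \<in> {a, b, c, e}" "z \<in> {a, b, c, e}" "u \<in> {a, b, c, e}" "v \<in> {a, b, c, e}" for x z u v
  proof -
    have "?k x x z z * ?k u u v v \<le> \<bar>?k x x z z\<bar> * \<bar>?k u u v v\<bar>"
      unfolding abs_mult[symmetric] by (rule abs_ge_self)
    also have "\<dots> \<le> (2 * M\<^sup>2) * (2 * M\<^sup>2)"
      using M0 by (intro mult_mono k[OF that(1,2)] k[OF that(3,4)]) auto
    finally show ?thesis by (simp add: power4_eq_xxxx power2_eq_square)
  qed
  have six: "x1 + x2 + x3 + x4 + x5 + x6 \<le> 6 * y" if "x1 \<le> y" "x2 \<le> y" "x3 \<le> y" "x4 \<le> y" "x5 \<le> y" "x6 \<le> y" for x1 x2 x3 x4 x5 x6 y :: real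
    using that by linarith
  have three: "x1 + x2 + x3 \<le> 3 * y" if "x1 \<le> y" "x2 \<le> y" "x3 \<le> y" for x1 x2 x3 y :: real
    using that by linarith
  have P: "?S a a * ?S b b * ?k c c e e + ?S a a * ?S c c * ?k b b e e + ?S a a * ?S e e * ?k b b c c
      + ?S b b * ?S c c * ?k a a e e + ?S b b * ?S e e * ?k a a c c + ?S c c * ?S e e * ?k a a b b \<le> 6 * (2 * M ^ 4)"
    by (rule six; rule p; simp)
  have K: "?k a a b b * ?k c c e e + ?k a a c c * ?k b b e e + ?k a a e e * ?k b b c c \<le> 3 * (4 * M ^ 4)"
    by (rule three; rule kk; simp)
  have K0: "0 \<le> 3 * (4 * M ^ 4)" using M0 by simp
  have "(\<integral>\<eta>. next_gram d n B \<eta> a a * next_gram d n B \<eta> b b * next_gram d n B \<eta> c c * next_gram d n B \<eta> e e \<partial>gauss) \<le>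
     ?S a a * ?S b b * ?S c c * ?S e e + (6 * (2 * M ^ 4) / ?D
      + (10 ^ 4 * M ^ 3 * (\<bar>?S a a\<bar> + \<bar>?S b b\<bar> + \<bar>?S c c\<bar> + \<bar>?S e e\<bar>) + 3 * (4 * M ^ 4)) / ?D\<^sup>2 + 10 ^ 6 * M ^ 4 / ?D ^ 3)"
    unfolding M_def by (rule next_gram4_le[OF _ P[unfolded M_def] K[unfolded M_def] K0[unfolded M_def]]) simp
  also have "\<dots> \<le> ?S a a * ?S b b * ?S c c * ?S e e + (12 * M ^ 4 / ?D
      + (10 ^ 4 * M ^ 3 * (M + M + M + M) + 12 * M ^ 4) / ?D + 10 ^ 6 * M ^ 4 / ?D)"
  proof (intro add_left_mono add_mono)
    show "6 * (2 * M ^ 4) / ?D \<le> 12 * M ^ 4 / ?D" by simp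
    have D2: "?D \<le> ?D\<^sup>2" "?D \<le> ?D ^ 3" using D power_increasing[of 1 2 ?D] power_increasing[of 1 3 ?D] by auto
    show "(10 ^ 4 * M ^ 3 * (\<bar>?S a a\<bar> + \<bar>?S b b\<bar> + \<bar>?S c c\<bar> + \<bar>?S e e\<bar>) + 3 * (4 * M ^ 4)) / ?D\<^sup>2
      \<le> (10 ^ 4 * M ^ 3 * (M + M + M + M) + 12 * M ^ 4) / ?D"
      using D D2 M0 by (intro frac_le add_mono mult_left_mono S add_nonneg_nonneg mult_nonneg_nonneg) auto
    show "10 ^ 6 * M ^ 4 / ?D ^ 3 \<le> 10 ^ 6 * M ^ 4 / ?D"
      using D D2 M0 by (intro frac_le) auto
  qed
  also have "\<dots> = ?S a a * ?S b b * ?S c c * ?S e e + 1040024 * M ^ 4 / ?D"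
    by (simp add: add_divide_distrib[symmetric] power4_eq_xxxx power3_eq_cube)
  also have "\<dots> \<le> ?S a a * ?S b b * ?S c c * ?S e e + 2 * 10 ^ 6 * M ^ 4 / ?D"
    using D M0 by (intro add_left_mono divide_right_mono mult_right_mono) auto
  finally show ?thesis by (simp add: M_def)
qed

text \<open>
  The constant 1 in front of the diagonal product over \<open>d\<close> is essential: this product drives the
  recursion for the second moment of an off-diagonal entry.
\<close>

lemma next_gram_mixed4:
  "(\<integral>\<eta>. next_gram d n B \<eta> a b * next_gram d n B \<eta> a b * next_gram d n B \<eta> c c * next_gram d n B \<eta> e e \<partial>gauss) \<le>
     gram n B a b * gram n B a b * gram n B c c * gram n B e e
     + ((gram n B a a * gram n B b b + gram n B a b * gram n B a b) * (gram n B c c * gram n B e e) + 10 * \<bar>gram n B a b\<bar> * diag_sum n B a b c e ^ 3) / real d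
     + 2 * 10 ^ 6 * diag_sum n B a b c e ^ 4 / (real d)\<^sup>2"
proof -
  let ?S = "gram n B" and ?D = "real d" and ?k = "gram_cov n B"
  define M where "M = diag_sum n B a b c e"
  have D: "?D \<ge> 1" using d by simp
  have M0: "M \<ge> 0" unfolding M_def by (rule diag_sum_nonneg)
  have S: "\<bar>?S x z\<bar> \<le> M" if "x \<in> {a, b, c, e}" "z \<in> {a, b, c, e}" for x z unfolding M_def using that by (rule gram_le_diag_sum)
  have Sabc: "\<bar>?S a b\<bar> \<le> M" "\<bar>?S c c\<bar> \<le> M" "\<bar>?S e e\<bar> \<le> M" by (rule S; simp)+
  have k: "\<bar>?k a b c c\<bar> \<le> 2 * M\<^sup>2" "\<bar>?k a b e e\<bar> \<le> 2 * M\<^sup>2" "\<bar>?k c c e e\<bar> \<le> 2 * M\<^sup>2" "\<bar>?k a b a b\<bar> \<le> 2 * M\<^sup>2"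
    unfolding M_def by (rule gram_cov_bound; simp)+
  have p: "?S a b * y * z \<le> 2 * \<bar>?S a b\<bar> * M ^ 3" if "\<bar>y\<bar> \<le> M" "\<bar>z\<bar> \<le> 2 * M\<^sup>2" for y z
  proof -
    have "?S a b * y * z \<le> \<bar>?S a b\<bar> * \<bar>y\<bar> * \<bar>z\<bar>" unfolding abs_mult[symmetric] by (rule abs_ge_self)
    also have "\<dots> \<le> \<bar>?S a b\<bar> * M * (2 * M\<^sup>2)" using that M0 by (intro mult_mono) auto
    finally show ?thesis by (simp add: power3_eq_cube power2_eq_square)
  qed
  have kk: "y * z \<le> 4 * M ^ 4" if "\<bar>y\<bar> \<le> 2 * M\<^sup>2" "\<bar>z\<bar> \<le> 2 * M\<^sup>2" for y z
  proof -
    have "y * z \<le> \<bar>y\<bar> * \<bar>z\<bar>" unfolding abs_mult[symmetric] by (rule abs_ge_self)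
    also have "\<dots> \<le> (2 * M\<^sup>2) * (2 * M\<^sup>2)" using that M0 by (intro mult_mono) auto
    finally show ?thesis by (simp add: power4_eq_xxxx power2_eq_square)
  qed
  let ?P = "(?S a a * ?S b b + ?S a b * ?S a b) * (?S c c * ?S e e) + 10 * \<bar>?S a b\<bar> * M ^ 3"
  have P: "?S a b * ?S a b * ?k c c e e + ?S a b * ?S c c * ?k a b e e + ?S a b * ?S e e * ?k a b c c
        + ?S a b * ?S c c * ?k a b e e + ?S a b * ?S e e * ?k a b c c + ?S c c * ?S e e * ?k a b a b \<le> ?P"
  proof -
    have eq: "?S c c * ?S e e * ?k a b a b = (?S a a * ?S b b + ?S a b * ?S a b) * (?S c c * ?S e e)"
      by (simp add: gram_cov_def gram_commute[of n B b a] mult.commute)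
    have "x1 + x2 + x3 + x2 + x3 + t \<le> t + 5 * y" if "x1 \<le> y" "x2 \<le> y" "x3 \<le> y" for x1 x2 x3 t y :: real
      using that by linarith
    from this[OF p[OF Sabc(1) k(3)] p[OF Sabc(2) k(2)] p[OF Sabc(3) k(1)]]
    have "?S a b * ?S a b * ?k c c e e + ?S a b * ?S c c * ?k a b e e + ?S a b * ?S e e * ?k a b c c
        + ?S a b * ?S c c * ?k a b e e + ?S a b * ?S e e * ?k a b c c + ?S c c * ?S e e * ?k a b a b
        \<le> ?S c c * ?S e e * ?k a b a b + 5 * (2 * \<bar>?S a b\<bar> * M ^ 3)" .
    also have "5 * (2 * \<bar>?S a b\<bar> * M ^ 3) = 10 * \<bar>?S a b\<bar> * M ^ 3" by simp
    finally show ?thesis by (simp only: eq)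
  qed
  have K: "?k a b a b * ?k c c e e + ?k a b c c * ?k a b e e + ?k a b e e * ?k a b c c \<le> 12 * M ^ 4"
    using add_mono[OF add_mono[OF kk[OF k(4) k(3)] kk[OF k(1) k(2)]] kk[OF k(2) k(1)]] by simp
  have "(\<integral>\<eta>. next_gram d n B \<eta> a b * next_gram d n B \<eta> a b * next_gram d n B \<eta> c c * next_gram d n B \<eta> e e \<partial>gauss) \<le>
     ?S a b * ?S a b * ?S c c * ?S e e + (?P / ?D
      + (10 ^ 4 * M ^ 3 * (\<bar>?S a b\<bar> + \<bar>?S a b\<bar> + \<bar>?S c c\<bar> + \<bar>?S e e\<bar>) + 12 * M ^ 4) / ?D\<^sup>2 + 10 ^ 6 * M ^ 4 / ?D ^ 3)"
    unfolding M_def using P K M0 by (intro next_gram4_le) (simp_all add: M_def)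
  also have "\<dots> \<le> ?S a b * ?S a b * ?S c c * ?S e e + (?P / ?D
      + (10 ^ 4 * M ^ 3 * (M + M + M + M) + 12 * M ^ 4) / ?D\<^sup>2 + 10 ^ 6 * M ^ 4 / ?D\<^sup>2)"
  proof (intro add_left_mono add_mono order_refl)
    have D2: "?D\<^sup>2 \<le> ?D ^ 3" using D by (intro power_increasing) auto
    show "(10 ^ 4 * M ^ 3 * (\<bar>?S a b\<bar> + \<bar>?S a b\<bar> + \<bar>?S c c\<bar> + \<bar>?S e e\<bar>) + 12 * M ^ 4) / ?D\<^sup>2
      \<le> (10 ^ 4 * M ^ 3 * (M + M + M + M) + 12 * M ^ 4) / ?D\<^sup>2"
      using D M0 by (intro divide_right_mono add_mono mult_left_mono Sabc) auto
    show "10 ^ 6 * M ^ 4 / ?D ^ 3 \<le> 10 ^ 6 * M ^ 4 / ?D\<^sup>2"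
      using D D2 M0 by (intro frac_le) auto
  qed
  also have "\<dots> = ?S a b * ?S a b * ?S c c * ?S e e + ?P / ?D + 1040012 * M ^ 4 / ?D\<^sup>2"
  proof -
    have "10 ^ 4 * M ^ 3 * (M + M + M + M) + 12 * M ^ 4 = 40012 * M ^ 4" by (simp add: power4_eq_xxxx power3_eq_cube)
    then show ?thesis by (simp add: add_divide_distrib[symmetric])
  qed
  also have "\<dots> \<le> ?S a b * ?S a b * ?S c c * ?S e e + ?P / ?D + 2 * 10 ^ 6 * M ^ 4 / ?D\<^sup>2"
    using D M0 by (intro add_left_mono divide_right_mono mult_right_mono) auto
  finally show ?thesis by (simp add: M_def)
qed

text \<open>
  Among the terms of order \<open>1/d\<close>, the mixed covariances are products of four off-diagonal entries
  and go into \<open>O4\<close>. The others keep the constant 1, so that the bound is the square of the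
  recursion for a single off-diagonal entry, up to smaller terms.
\<close>

lemma next_gram_off4:
  fixes a b c e :: nat
  defines "S \<equiv> gram n B"
  defines "O4 \<equiv> S a c ^ 4 + S a e ^ 4 + S b c ^ 4 + S b e ^ 4 + S a b ^ 4 + S c e ^ 4"
  shows "(\<integral>\<eta>. next_gram d n B \<eta> a b * next_gram d n B \<eta> a b * next_gram d n B \<eta> c e * next_gram d n B \<eta> c e \<partial>gauss) \<le>
     S a b * S a b * S c e * S c e
     + (S a b * S a b * (S c c * S e e + S c e * S c e) + S c e * S c e * (S a a * S b b + S a b * S a b) + 8 * O4) / real d
     + (2 * 10 ^ 4 * (\<bar>S a b\<bar> + \<bar>S c e\<bar>) * diag_sum n B a b c e ^ 3 + (S a a * S b b + S a b * S a b) * (S c c * S e e + S c e * S c e) + 2 * O4) / (real d)\<^sup>2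
     + 10 ^ 6 * diag_sum n B a b c e ^ 4 / (real d) ^ 3"
proof -
  let ?D = "real d" and ?k = "gram_cov n B"
  define M where "M = diag_sum n B a b c e"
  have M0: "M \<ge> 0" unfolding M_def by (rule diag_sum_nonneg)
  have k1: "?k a b a b = S a a * S b b + S a b * S a b" "?k c e c e = S c c * S e e + S c e * S c e"
    by (simp_all add: gram_cov_def S_def gram_commute[of n B b a] gram_commute[of n B e c])
  have k2: "?k a b c e = S a c * S b e + S a e * S b c" by (simp add: gram_cov_def S_def)
  have O: "0 \<le> O4" unfolding O4_def by simp
  have S0: "0 \<le> S x x" for x unfolding S_def by (rule gram_nonneg)
  have x1: "S a b * S c e * ?k a b c e \<le> 2 * O4"
  proof -
    have "S a b * S c e * S a c * S b e \<le> O4"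
      unfolding O4_def by (rule order_trans[OF abs_ge_self order_trans[OF prod4_le_sum_power4]]) simp
    moreover have "S a b * S c e * S a e * S b c \<le> O4"
      unfolding O4_def by (rule order_trans[OF abs_ge_self order_trans[OF prod4_le_sum_power4]]) simp
    ultimately show ?thesis unfolding k2 by (simp add: distrib_left mult.assoc)
  qed
  have x2: "?k a b c e * ?k a b c e \<le> O4"
  proof -
    have sq: "2 * (x * y) \<le> x * x + y * y" for x y :: real using sum_squares_bound[of x y] by (simp add: power2_eq_square mult.assoc)
    have "?k a b c e * ?k a b c e \<le> 2 * ((S a c * S b e) * (S a c * S b e)) + 2 * ((S a e * S b c) * (S a e * S b c))"
      using sq[of "S a c * S b e" "S a e * S b c"] unfolding k2 by (simp add: algebra_simps)
    also have "\<dots> \<le> (S a c ^ 4 + S b e ^ 4) + (S a e ^ 4 + S b c ^ 4)"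
      using sq[of "S a c * S a c" "S b e * S b e"] sq[of "S a e * S a e" "S b c * S b c"]
      by (simp add: power4_eq_xxxx ac_simps)
    also have "\<dots> \<le> O4" unfolding O4_def by simp
    finally show ?thesis .
  qed
  let ?P = "S a b * S a b * (S c c * S e e + S c e * S c e) + S c e * S c e * (S a a * S b b + S a b * S a b) + 8 * O4"
  let ?K = "(S a a * S b b + S a b * S a b) * (S c c * S e e + S c e * S c e) + 2 * O4"
  have P: "S a b * S a b * ?k c e c e + S a b * S c e * ?k a b c e + S a b * S c e * ?k a b c e
        + S a b * S c e * ?k a b c e + S a b * S c e * ?k a b c e + S c e * S c e * ?k a b a b \<le> ?P"
  proof -
    have "t + x + x + x + x + u \<le> t + u + 8 * y" if "x \<le> 2 * y" for t u x y :: real using that by linarith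
    from this[OF x1] show ?thesis unfolding k1 .
  qed
  have K: "?k a b a b * ?k c e c e + ?k a b c e * ?k a b c e + ?k a b c e * ?k a b c e \<le> ?K"
  proof -
    have "t + x + x \<le> t + 2 * y" if "x \<le> y" for t x y :: real using that by linarith
    from this[OF x2] show ?thesis unfolding k1 .
  qed
  have K0: "0 \<le> ?K" 
    by (intro add_nonneg_nonneg mult_nonneg_nonneg[OF add_nonneg_nonneg[OF mult_nonneg_nonneg[OF S0 S0] zero_le_square]
        add_nonneg_nonneg[OF mult_nonneg_nonneg[OF S0 S0] zero_le_square]]) (use O in simp)
  have "(\<integral>\<eta>. next_gram d n B \<eta> a b * next_gram d n B \<eta> a b * next_gram d n B \<eta> c e * next_gram d n B \<eta> c e \<partial>gauss) \<le>
     S a b * S a b * S c e * S c e + (?P / ?D + (10 ^ 4 * M ^ 3 * (\<bar>S a b\<bar> + \<bar>S a b\<bar> + \<bar>S c e\<bar> + \<bar>S c e\<bar>) + ?K) / ?D\<^sup>2 + 10 ^ 6 * M ^ 4 / ?D ^ 3)"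
    unfolding M_def S_def by (rule next_gram4_le[OF _ P[unfolded S_def] K[unfolded S_def] K0[unfolded S_def]]) simp
  also have "10 ^ 4 * M ^ 3 * (\<bar>S a b\<bar> + \<bar>S a b\<bar> + \<bar>S c e\<bar> + \<bar>S c e\<bar>) + ?K = 2 * 10 ^ 4 * (\<bar>S a b\<bar> + \<bar>S c e\<bar>) * M ^ 3 + (S a a * S b b + S a b * S a b) * (S c c * S e e + S c e * S c e) + 2 * O4"
    by (simp add: algebra_simps)
  finally show ?thesis by (simp only: M_def add.assoc)
qed

end

section \<open>Moment recursions along the chain\<close>

text \<open>
  The product of the first \<open>k\<close> scaled layers, starting from the identity matrix.
\<close>

primrec prefix_product :: "(nat \<Rightarrow> nat) \<Rightarrow> nat \<Rightarrow> layers \<Rightarrow> nat \<times> nat \<Rightarrow> real" where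
  "prefix_product d 0 \<omega> = (\<lambda>(i, t). if i = t then 1 else 0)"
| "prefix_product d (Suc k) \<omega> = mat_scale (1 / sqrt (d (Suc k))) (mat_prod (d k) (prefix_product d k \<omega>) (layer (Suc k) \<omega>))"

definition prefix_gram :: "(nat \<Rightarrow> nat) \<Rightarrow> nat \<Rightarrow> layers \<Rightarrow> nat \<Rightarrow> nat \<Rightarrow> real" where
  "prefix_gram d k \<omega> i j = gram (d k) (prefix_product d k \<omega>) i j"

lemma prefix_gram_Suc:
  "prefix_gram d (Suc k) \<omega> i j = next_gram (d (Suc k)) (d k) (prefix_product d k \<omega>) (layer (Suc k) \<omega>) i j"
  by (simp add: prefix_gram_def)

lemma prefix_gram_0: "i < d 0 \<Longrightarrow> prefix_gram d 0 \<omega> i j = (if i = j then 1 else 0)"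
proof -
  assume i: "i < d 0"
  have "prefix_gram d 0 \<omega> i j = (\<Sum>s<d 0. if s = i then (if j = s then 1 else 0) else 0)"
    unfolding prefix_gram_def gram_def by (intro sum.cong) auto
  then show ?thesis using i by simp
qed

lemma all_moments_layer: "all_moments gauss (\<lambda>\<omega>. layer m \<omega> x)"
  by (cases x) (simp add: layer_def all_moments_coord)

lemma all_moments_prefix_product: "all_moments gauss (\<lambda>\<omega>. prefix_product d k \<omega> x)"
proof (induction k arbitrary: x)
  case (Suc k)
  show ?case
    unfolding prefix_product.simps mat_scale_def mat_prod_def split_beta'
    by (intro all_moments_intros all_moments_layer Suc)
qed (simp add: all_moments_const split_beta)

lemma all_moments_prefix_gram: "all_moments gauss (\<lambda>\<omega>. prefix_gram d k \<omega> i j)"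
  unfolding prefix_gram_def gram_def by (intro all_moments_intros all_moments_prefix_product)

lemma all_moments_diag_sum: "all_moments gauss (\<lambda>\<omega>. diag_sum (d k) (prefix_product d k \<omega>) a b c e)"
  unfolding diag_sum_def prefix_gram_def[symmetric] by (intro all_moments_intros all_moments_prefix_gram)

lemma prefix_product_cong:
  assumes "\<And>l i t. l \<le> k \<Longrightarrow> \<omega> (l, i, t) = \<omega>' (l, i, t)"
  shows "prefix_product d k \<omega> = prefix_product d k \<omega>'"
  using assms
proof (induction k)
  case (Suc k)
  have "prefix_product d k \<omega> = prefix_product d k \<omega>'" using Suc.prems by (intro Suc.IH) auto
  moreover have "layer (Suc k) \<omega> = layer (Suc k) \<omega>'" using Suc.prems by (auto simp: layer_def fun_eq_iff)
  ultimately show ?case by simp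
qed simp

text \<open>
  Layer \<open>k + 1\<close> is independent of the product of the first \<open>k\<close> layers.
\<close>

lemma expectation_next_layer:
  fixes F :: "(nat \<times> nat \<Rightarrow> real) \<Rightarrow> (nat \<times> nat \<Rightarrow> real) \<Rightarrow> real"
  assumes int: "integrable gauss (\<lambda>\<omega>. F (prefix_product d k \<omega>) (layer (Suc k) \<omega>))"
  shows "(\<integral>\<omega>. F (prefix_product d k \<omega>) (layer (Suc k) \<omega>) \<partial>gauss) = (\<integral>\<omega>. (\<integral>\<eta>. F (prefix_product d k \<omega>) \<eta> \<partial>gauss) \<partial>gauss)"
    and "integrable gauss (\<lambda>\<omega>. \<integral>\<eta>. F (prefix_product d k \<omega>) \<eta> \<partial>gauss)"
proof -
  define h where "h x = (case x of (i, t) \<Rightarrow> (Suc k, i, t))" for x :: "nat \<times> nat"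
  have h: "inj h" by (auto simp: inj_on_def h_def)
  have p: "prefix_product d k (graft h \<omega> \<eta>) = prefix_product d k \<omega>" for \<omega> \<eta>
    by (intro prefix_product_cong graft_other) (auto simp: h_def)
  have l: "layer (Suc k) (graft h \<omega> \<eta>) = \<eta>" for \<omega> \<eta>
  proof (intro ext, clarify)
    fix i t show "layer (Suc k) (graft h \<omega> \<eta>) (i, t) = \<eta> (i, t)"
      using graft_image[OF h, of \<omega> \<eta> "(i, t)"] by (simp add: h_def layer_def)
  qed
  show "(\<integral>\<omega>. F (prefix_product d k \<omega>) (layer (Suc k) \<omega>) \<partial>gauss) = (\<integral>\<omega>. (\<integral>\<eta>. F (prefix_product d k \<omega>) \<eta> \<partial>gauss) \<partial>gauss)"
    "integrable gauss (\<lambda>\<omega>. \<integral>\<eta>. F (prefix_product d k \<omega>) \<eta> \<partial>gauss)"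
    using integral_graft[OF h int] by (simp_all add: p l)
qed

lemma expectation_next_layer_le:
  fixes F :: "(nat \<times> nat \<Rightarrow> real) \<Rightarrow> (nat \<times> nat \<Rightarrow> real) \<Rightarrow> real"
  assumes "all_moments gauss (\<lambda>\<omega>. F (prefix_product d k \<omega>) (layer (Suc k) \<omega>))" "all_moments gauss R"
    and "\<And>\<omega>. (\<integral>\<eta>. F (prefix_product d k \<omega>) \<eta> \<partial>gauss) \<le> R \<omega>"
  shows "(\<integral>\<omega>. F (prefix_product d k \<omega>) (layer (Suc k) \<omega>) \<partial>gauss) \<le> (\<integral>\<omega>. R \<omega> \<partial>gauss)"
  using assms expectation_next_layer[of F d k] by (simp add: all_moments_integrable integral_mono)

definition inv_sum :: "(nat \<Rightarrow> nat) \<Rightarrow> nat \<Rightarrow> real" where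
  "inv_sum d k = (\<Sum>i=1..k. 1 / real (d i))"

lemma inv_sum_0 [simp]: "inv_sum d 0 = 0"
  by (simp add: inv_sum_def)

lemma inv_sum_Suc: "inv_sum d (Suc k) = inv_sum d k + 1 / real (d (Suc k))"
  by (simp add: inv_sum_def)

lemma inv_sum_nonneg: "0 \<le> inv_sum d k"
  unfolding inv_sum_def by (intro sum_nonneg) simp

lemma inv_sum_mono: "k \<le> l \<Longrightarrow> inv_sum d k \<le> inv_sum d l"
  unfolding inv_sum_def by (intro sum_mono2) auto

text \<open>
  This is \<open>\<Prod>\<^bsub>i\<le>k\<^esub> (1 + 1/d\<^sub>i) - 1\<close>, the second moment of an
  off-diagonal Gram entry if every product of two diagonal entries had expectation 1.
\<close>

primrec off_level :: "(nat \<Rightarrow> nat) \<Rightarrow> nat \<Rightarrow> real" where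
  "off_level d 0 = 0"
| "off_level d (Suc k) = (1 + 1 / real (d (Suc k))) * off_level d k + 1 / real (d (Suc k))"

lemma inv_sum_le_off_level: "inv_sum d k \<le> off_level d k"
proof (induction k)
  case (Suc k)
  have "0 \<le> off_level d k" using Suc inv_sum_nonneg[of d k] by linarith
  then have "0 \<le> 1 / real (d (Suc k)) * off_level d k" by simp
  then show ?case using Suc by (simp add: inv_sum_Suc distrib_right)
qed simp

text \<open>
  A constant that absorbs the loss of the crude estimates in one step; the bounds after \<open>k\<close> steps
  carry \<open>growth ^ k\<close>.
\<close>

abbreviation growth :: real where "growth \<equiv> 10 ^ 10"

context
  fixes d :: "nat \<Rightarrow> nat" and K :: nat
  assumes pos: "\<And>i. i \<le> K \<Longrightarrow> d i > 0"
begin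

text \<open>
  Exact recursions: \<open>E S'\<^sub>i\<^sub>j\<^sup>2 = (1 + 1/d) E S\<^sub>i\<^sub>j\<^sup>2 + E
  S\<^sub>i\<^sub>i S\<^sub>j\<^sub>j / d\<close> and \<open>E S'\<^sub>i\<^sub>i S'\<^sub>j\<^sub>j = E
  S\<^sub>i\<^sub>i S\<^sub>j\<^sub>j + 2 E S\<^sub>i\<^sub>j\<^sup>2 / d\<close>.
\<close>

lemma prefix_gram_second:
  assumes "k \<le> K" "i < d 0" "j < d 0" "i \<noteq> j"
  shows "off_level d k \<le> (\<integral>\<omega>. prefix_gram d k \<omega> i j * prefix_gram d k \<omega> i j \<partial>gauss) \<and>
    1 \<le> (\<integral>\<omega>. prefix_gram d k \<omega> i i * prefix_gram d k \<omega> j j \<partial>gauss)"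
  using assms(1)
proof (induction k)
  case 0
  then show ?case using assms by (simp add: prefix_gram_0)
next
  case (Suc k)
  let ?D = "real (d (Suc k))" and ?G = "\<lambda>\<omega>. prefix_gram d k \<omega>"
  have D: "d (Suc k) > 0" using pos Suc.prems by simp
  have int: "integrable gauss (\<lambda>\<omega>. ?G \<omega> i j * ?G \<omega> k l)" for i j k l
    by (intro all_moments_integrable all_moments_mult all_moments_prefix_gram)
  have int': "integrable gauss (\<lambda>\<omega>. next_gram (d (Suc k)) (d k) (prefix_product d k \<omega>) (layer (Suc k) \<omega>) i j *
     next_gram (d (Suc k)) (d k) (prefix_product d k \<omega>) (layer (Suc k) \<omega>) l m)" for i j l m
    unfolding prefix_gram_Suc[symmetric] by (intro all_moments_integrable all_moments_mult all_moments_prefix_gram)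
  have step: "(\<integral>\<omega>. prefix_gram d (Suc k) \<omega> i j * prefix_gram d (Suc k) \<omega> l m \<partial>gauss) =
     (\<integral>\<omega>. ?G \<omega> i j * ?G \<omega> l m \<partial>gauss) + ((\<integral>\<omega>. ?G \<omega> i l * ?G \<omega> j m \<partial>gauss) + (\<integral>\<omega>. ?G \<omega> i m * ?G \<omega> j l \<partial>gauss)) / ?D" for i j l m
  proof -
    have "(\<integral>\<omega>. prefix_gram d (Suc k) \<omega> i j * prefix_gram d (Suc k) \<omega> l m \<partial>gauss) =
      (\<integral>\<omega>. ?G \<omega> i j * ?G \<omega> l m + (?G \<omega> i l * ?G \<omega> j m + ?G \<omega> i m * ?G \<omega> j l) / ?D \<partial>gauss)"
      unfolding prefix_gram_Suc
      by (subst expectation_next_layer(1)[OF int'], subst expectation_next_gram2[OF D])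
        (simp add: prefix_gram_def gram_cov_def)
    then show ?thesis using int by simp
  qed
  have sym: "(\<lambda>\<omega>. ?G \<omega> i j * ?G \<omega> j i) = (\<lambda>\<omega>. ?G \<omega> i j * ?G \<omega> i j)"
    by (simp add: prefix_gram_def gram_commute[of _ _ j i])
  define x y where "x = (\<integral>\<omega>. ?G \<omega> i j * ?G \<omega> i j \<partial>gauss)" and "y = (\<integral>\<omega>. ?G \<omega> i i * ?G \<omega> j j \<partial>gauss)"
  have IH: "off_level d k \<le> x" "1 \<le> y" unfolding x_def y_def using Suc by simp_all
  have x0: "0 \<le> x" unfolding x_def by simp
  have 1: "(\<integral>\<omega>. prefix_gram d (Suc k) \<omega> i j * prefix_gram d (Suc k) \<omega> i j \<partial>gauss) = x + (y + x) / ?D"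
    using step[of i j i j] sym by (simp add: x_def y_def)
  have 2: "(\<integral>\<omega>. prefix_gram d (Suc k) \<omega> i i * prefix_gram d (Suc k) \<omega> j j \<partial>gauss) = y + (x + x) / ?D"
    using step[of i i j j] by (simp add: x_def y_def)
  have "off_level d (Suc k) = off_level d k + (1 + off_level d k) / ?D" by (simp add: add_divide_distrib distrib_right)
  also have "\<dots> \<le> x + (y + x) / ?D" using IH by (intro add_mono divide_right_mono) auto
  finally have "off_level d (Suc k) \<le> x + (y + x) / ?D" .
  moreover have "1 + 0 \<le> y + (x + x) / ?D" using IH x0 by (intro add_mono) auto
  ultimately show ?case unfolding 1 2 by simp
qed

text \<open>
  Off-diagonal entries have the size \<open>\<surd>(inv_sum d k)\<close> of a random walk, also in the fourth
  moment: the increments of \<open>next_gram_power4\<close> carry \<open>1/d\<^sup>2\<close>, and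
  \<open>x\<^sup>2 + y\<^sup>2 \<le> (x + y)\<^sup>2\<close> sums them up.
\<close>

lemma prefix_gram_fourth:
  assumes "k \<le> K"
  shows "(\<forall>i<d 0. (\<integral>\<omega>. prefix_gram d k \<omega> i i ^ 4 \<partial>gauss) \<le> growth ^ k) \<and>
    (\<forall>i<d 0. \<forall>j<d 0. i \<noteq> j \<longrightarrow> (\<integral>\<omega>. prefix_gram d k \<omega> i j ^ 4 \<partial>gauss) \<le> growth ^ k * (inv_sum d k)\<^sup>2)"
  using assms
proof (induction k)
  case 0
  then show ?case by (simp add: prefix_gram_0)
next
  case (Suc k)
  let ?D = "real (d (Suc k))" and ?G = "\<lambda>\<omega>. prefix_gram d k \<omega>"
  define H where "H = growth ^ k"
  have H0: "H \<ge> 0" unfolding H_def by simp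
  have D: "d (Suc k) > 0" using pos Suc.prems by simp
  have int: "integrable gauss (\<lambda>\<omega>. ?G \<omega> i j ^ 4)" for i j
    by (intro all_moments_integrable all_moments_power all_moments_prefix_gram)
  have step: "(\<integral>\<omega>. prefix_gram d (Suc k) \<omega> i j ^ 4 \<partial>gauss) \<le>
     4 * (\<integral>\<omega>. ?G \<omega> i j ^ 4 \<partial>gauss) + 10 ^ 9 * ((\<integral>\<omega>. ?G \<omega> i i ^ 4 \<partial>gauss) + (\<integral>\<omega>. ?G \<omega> j j ^ 4 \<partial>gauss)) / ?D\<^sup>2" for i j
  proof -
    have "(\<integral>\<omega>. prefix_gram d (Suc k) \<omega> i j ^ 4 \<partial>gauss) \<le> (\<integral>\<omega>. 4 * ?G \<omega> i j ^ 4 + 10 ^ 9 * (?G \<omega> i i ^ 4 + ?G \<omega> j j ^ 4) / ?D\<^sup>2 \<partial>gauss)"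
      unfolding prefix_gram_Suc
    proof (rule expectation_next_layer_le)
      show "all_moments gauss (\<lambda>\<omega>. next_gram (d (Suc k)) (d k) (prefix_product d k \<omega>) (layer (Suc k) \<omega>) i j ^ 4)"
        unfolding prefix_gram_Suc[symmetric] by (intro all_moments_power all_moments_prefix_gram)
      show "all_moments gauss (\<lambda>\<omega>. 4 * ?G \<omega> i j ^ 4 + 10 ^ 9 * (?G \<omega> i i ^ 4 + ?G \<omega> j j ^ 4) / ?D\<^sup>2)"
        by (intro all_moments_intros all_moments_prefix_gram)
      show "(\<integral>\<eta>. next_gram (d (Suc k)) (d k) (prefix_product d k \<omega>) \<eta> i j ^ 4 \<partial>gauss) \<le>
        4 * ?G \<omega> i j ^ 4 + 10 ^ 9 * (?G \<omega> i i ^ 4 + ?G \<omega> j j ^ 4) / ?D\<^sup>2" for \<omega>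
        unfolding prefix_gram_def by (rule next_gram_power4[OF D])
    qed
    then show ?thesis using int by simp
  qed
  have IH: "i < d 0 \<Longrightarrow> (\<integral>\<omega>. ?G \<omega> i i ^ 4 \<partial>gauss) \<le> H"
    "i < d 0 \<Longrightarrow> j < d 0 \<Longrightarrow> i \<noteq> j \<Longrightarrow> (\<integral>\<omega>. ?G \<omega> i j ^ 4 \<partial>gauss) \<le> H * (inv_sum d k)\<^sup>2" for i j
    using Suc unfolding H_def by simp_all
  have D1: "1 \<le> ?D\<^sup>2" using D by simp
  show ?case
  proof (intro conjI allI impI)
    fix i assume i: "i < d 0"
    have "(\<integral>\<omega>. prefix_gram d (Suc k) \<omega> i i ^ 4 \<partial>gauss) \<le> 4 * H + 10 ^ 9 * (H + H) / ?D\<^sup>2"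
      using IH(1)[OF i] by (intro order_trans[OF step] add_mono mult_left_mono divide_right_mono) auto
    also have "10 ^ 9 * (H + H) / ?D\<^sup>2 \<le> 10 ^ 9 * (H + H) / 1"
      using H0 D1 D by (intro divide_left_mono) auto
    also have "4 * H + 10 ^ 9 * (H + H) / 1 \<le> growth * H" using H0 by simp
    finally show "(\<integral>\<omega>. prefix_gram d (Suc k) \<omega> i i ^ 4 \<partial>gauss) \<le> growth ^ Suc k" by (simp add: H_def)
  next
    fix i j assume ij: "i < d 0" "j < d 0" "i \<noteq> j"
    let ?s = "inv_sum d k"
    have "(\<integral>\<omega>. prefix_gram d (Suc k) \<omega> i j ^ 4 \<partial>gauss) \<le> 4 * (H * ?s\<^sup>2) + 10 ^ 9 * (H + H) / ?D\<^sup>2"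
      using IH ij by (intro order_trans[OF step] add_mono mult_left_mono divide_right_mono) auto
    also have "\<dots> = 4 * (H * ?s\<^sup>2) + (2 * 10 ^ 9) * (H * (1 / ?D)\<^sup>2)"
      by (simp add: power_divide)
    also have "\<dots> \<le> growth * (H * ?s\<^sup>2) + growth * (H * (1 / ?D)\<^sup>2)"
      using H0 by (intro add_mono mult_right_mono) auto
    also have "\<dots> = growth ^ Suc k * (?s\<^sup>2 + (1 / ?D)\<^sup>2)"
      unfolding H_def power_Suc by (simp only: distrib_left mult.assoc)
    also have "\<dots> \<le> growth ^ Suc k * (?s + 1 / ?D)\<^sup>2"
    proof (intro mult_left_mono)
      have "0 \<le> 2 * ?s * (1 / ?D)" using inv_sum_nonneg[of d k] by simp
      then show "?s\<^sup>2 + (1 / ?D)\<^sup>2 \<le> (?s + 1 / ?D)\<^sup>2" unfolding power2_sum by simp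
    qed simp
    finally show "(\<integral>\<omega>. prefix_gram d (Suc k) \<omega> i j ^ 4 \<partial>gauss) \<le> growth ^ Suc k * (inv_sum d (Suc k))\<^sup>2" by (simp only: inv_sum_Suc)
  qed
qed

lemma expectation_diag_sum4:
  assumes "k \<le> K" "a < d 0" "b < d 0" "c < d 0" "e < d 0"
  shows "(\<integral>\<omega>. diag_sum (d k) (prefix_product d k \<omega>) a b c e ^ 4 \<partial>gauss) \<le> 1024 * growth ^ k"
proof -
  let ?G = "\<lambda>\<omega>. prefix_gram d k \<omega>"
  have int: "integrable gauss (\<lambda>\<omega>. ?G \<omega> i j ^ 4)" for i j
    by (intro all_moments_integrable all_moments_power all_moments_prefix_gram)
  have ds: "diag_sum (d k) (prefix_product d k \<omega>) a b c e = ?G \<omega> a a + ?G \<omega> b b + ?G \<omega> c c + ?G \<omega> e e" for \<omega>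
    by (simp add: diag_sum_def prefix_gram_def)
  have "(\<integral>\<omega>. diag_sum (d k) (prefix_product d k \<omega>) a b c e ^ 4 \<partial>gauss) \<le>
      (\<integral>\<omega>. 256 * (?G \<omega> a a ^ 4 + ?G \<omega> b b ^ 4 + ?G \<omega> c c ^ 4 + ?G \<omega> e e ^ 4) \<partial>gauss)"
  proof (intro integral_mono)
    show "diag_sum (d k) (prefix_product d k \<omega>) a b c e ^ 4 \<le> 256 * (?G \<omega> a a ^ 4 + ?G \<omega> b b ^ 4 + ?G \<omega> c c ^ 4 + ?G \<omega> e e ^ 4)" for \<omega>
      using four_power_le[of "?G \<omega> a a" "?G \<omega> b b" "?G \<omega> c c" "?G \<omega> e e" 4] by (simp add: ds)
  qed (unfold ds, (intro all_moments_integrable all_moments_intros all_moments_prefix_gram)+)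
  also have "\<dots> = 256 * ((\<integral>\<omega>. ?G \<omega> a a ^ 4 \<partial>gauss) + (\<integral>\<omega>. ?G \<omega> b b ^ 4 \<partial>gauss) + (\<integral>\<omega>. ?G \<omega> c c ^ 4 \<partial>gauss) + (\<integral>\<omega>. ?G \<omega> e e ^ 4 \<partial>gauss))"
    using int by simp
  also have "\<dots> \<le> 256 * (growth ^ k + growth ^ k + growth ^ k + growth ^ k)"
    using prefix_gram_fourth[OF assms(1)] assms by (intro mult_left_mono add_mono) auto
  finally show ?thesis by simp
qed

text \<open>
  An off-diagonal entry has the size \<open>\<tau> = \<surd>\<sigma>\<close>; the inequality \<open>u
  v\<^sup>3 \<le> u\<^sup>4 + v\<^sup>4\<close> for \<open>u = |S\<^sub>x\<^sub>z| / \<tau>\<close> converts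
  this into a bound for the mixed moment.
\<close>

lemma expectation_off_diag3:
  assumes k: "k \<le> K" and l: "a < d 0" "b < d 0" "c < d 0" "e < d 0" "x < d 0" "z < d 0" "x \<noteq> z"
    and \<tau>: "\<tau> > 0" "inv_sum d K \<le> \<tau> * \<tau>"
  shows "(\<integral>\<omega>. \<bar>prefix_gram d k \<omega> x z\<bar> * diag_sum (d k) (prefix_product d k \<omega>) a b c e ^ 3 \<partial>gauss) \<le> 1025 * \<tau> * growth ^ k"
proof -
  let ?G = "\<lambda>\<omega>. prefix_gram d k \<omega> x z" and ?M = "\<lambda>\<omega>. diag_sum (d k) (prefix_product d k \<omega>) a b c e"
  have le: "\<bar>?G \<omega>\<bar> * ?M \<omega> ^ 3 \<le> \<tau> * ((1 / \<tau> ^ 4) * ?G \<omega> ^ 4 + ?M \<omega> ^ 4)" for \<omega>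
  proof -
    define u v where "u = \<bar>?G \<omega>\<bar> / \<tau>" and "v = ?M \<omega>"
    have uv: "u \<ge> 0" "v \<ge> 0" using \<tau> by (auto simp: u_def v_def diag_sum_nonneg)
    have "u * v ^ 3 \<le> u ^ 4 + v ^ 4"
    proof (cases "u \<le> v")
      case True
      then have "u * v ^ 3 \<le> v * v ^ 3" using uv by (intro mult_right_mono) auto
      then show ?thesis using uv by (simp add: power4_eq_xxxx power3_eq_cube add_increasing mult.assoc)
    next
      case False
      then have "u * v ^ 3 \<le> u * u ^ 3" using uv by (intro mult_left_mono power_mono) auto
      then show ?thesis using uv by (simp add: power4_eq_xxxx power3_eq_cube add_increasing2 mult.assoc)
    qed
    then have "\<tau> * (u * v ^ 3) \<le> \<tau> * (u ^ 4 + v ^ 4)" using \<tau> by (intro mult_left_mono) auto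
    then show ?thesis using \<tau> by (simp add: u_def v_def power_divide)
  qed
  have int: "integrable gauss (\<lambda>\<omega>. ?G \<omega> ^ 4)" "integrable gauss (\<lambda>\<omega>. ?M \<omega> ^ 4)"
    by (intro all_moments_integrable all_moments_power all_moments_prefix_gram all_moments_diag_sum)+
  have "(\<integral>\<omega>. \<bar>?G \<omega>\<bar> * ?M \<omega> ^ 3 \<partial>gauss) \<le> (\<integral>\<omega>. \<tau> * ((1 / \<tau> ^ 4) * ?G \<omega> ^ 4 + ?M \<omega> ^ 4) \<partial>gauss)"
    using le by (intro integral_mono all_moments_integrable all_moments_intros all_moments_prefix_gram all_moments_diag_sum)
  also have "\<dots> = \<tau> * ((1 / \<tau> ^ 4) * (\<integral>\<omega>. ?G \<omega> ^ 4 \<partial>gauss) + (\<integral>\<omega>. ?M \<omega> ^ 4 \<partial>gauss))"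
    using int by simp
  also have "\<dots> \<le> \<tau> * (growth ^ k + 1024 * growth ^ k)"
  proof (intro mult_left_mono add_mono)
    have "(inv_sum d k)\<^sup>2 \<le> (\<tau> * \<tau>)\<^sup>2"
      using inv_sum_mono[OF k, of d] \<tau>(2) inv_sum_nonneg[of d k] by (intro power_mono) auto
    also have "(\<tau> * \<tau>)\<^sup>2 = \<tau> ^ 4" by (simp add: power2_eq_square power4_eq_xxxx)
    finally have s: "(inv_sum d k)\<^sup>2 \<le> \<tau> ^ 4" .
    have "(\<integral>\<omega>. ?G \<omega> ^ 4 \<partial>gauss) \<le> growth ^ k * (inv_sum d k)\<^sup>2"
      using prefix_gram_fourth[OF k] l by auto
    also have "\<dots> \<le> growth ^ k * \<tau> ^ 4" using s by (intro mult_left_mono) auto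
    finally have "(1 / \<tau> ^ 4) * (\<integral>\<omega>. ?G \<omega> ^ 4 \<partial>gauss) \<le> (1 / \<tau> ^ 4) * (growth ^ k * \<tau> ^ 4)"
      using \<tau> by (intro mult_left_mono) auto
    then show "(1 / \<tau> ^ 4) * (\<integral>\<omega>. ?G \<omega> ^ 4 \<partial>gauss) \<le> growth ^ k" using \<tau> by simp
    show "(\<integral>\<omega>. ?M \<omega> ^ 4 \<partial>gauss) \<le> 1024 * growth ^ k" using expectation_diag_sum4[OF k l(1-4)] .
  qed (use \<tau> in auto)
  finally show ?thesis by (simp add: algebra_simps)
qed

end

text \<open>
  The induction step of \<open>prefix_gram_mixed\<close> for one off-diagonal entry. Here \<open>D =
  1/d\<close>, and the hypotheses are the bounds after the previous layers. Every error term is at most a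
  constant times \<open>h \<tau> s\<close> or \<open>h \<tau> D\<close>.
\<close>

lemma mixed_recursion_arith:
  fixes h s \<tau> \<sigma> D \<alpha> y w x Y :: real
  assumes h: "0 \<le> h" and s: "0 \<le> s" "s \<le> \<sigma>" and \<sigma>: "\<sigma> \<le> \<tau>" "\<tau> \<le> 1" and D: "0 \<le> D" "D \<le> \<sigma>"
    and y: "y \<le> 1 + h * s" and w: "w \<le> \<alpha> + h * \<tau> * s" and x: "x \<le> 1025 * \<tau> * h" and Y: "Y \<le> 1024 * h"
  shows "w + (y + w + 10 * x) * D + 2 * 10 ^ 6 * Y * (D * D) \<le> ((1 + D) * \<alpha> + D) + growth * h * \<tau> * (s + D)"
proof -
  define A B where "A = h * \<tau> * s" and "B = h * \<tau> * D"
  have \<tau>0: "0 \<le> \<tau>" using s \<sigma> by linarith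
  have AB: "0 \<le> A" "0 \<le> B" using h \<tau>0 s D by (auto simp: A_def B_def)
  have D1: "D \<le> 1" using D \<sigma> by linarith
  have wD: "w * D \<le> \<alpha> * D + A"
  proof -
    have "w * D \<le> (\<alpha> + A) * D" using w D by (intro mult_right_mono) (auto simp: A_def)
    moreover have "A * D \<le> A * 1" using AB D1 by (intro mult_left_mono) auto
    ultimately show ?thesis by (simp add: algebra_simps)
  qed
  have yD: "y * D \<le> D + B"
  proof -
    have "y * D \<le> (1 + h * s) * D" using y D by (intro mult_right_mono) auto
    moreover have "h * s * D \<le> h * \<tau> * D" using h s \<sigma> D by (intro mult_right_mono mult_left_mono) auto
    ultimately show ?thesis by (simp add: algebra_simps B_def)
  qed
  have xD: "x * D \<le> 1025 * B"
  proof -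
    have "x * D \<le> 1025 * \<tau> * h * D" using x D by (intro mult_right_mono) auto
    then show ?thesis by (simp add: B_def mult.commute mult.left_commute)
  qed
  have YD: "Y * (D * D) \<le> 1024 * B"
  proof -
    have "Y * (D * D) \<le> 1024 * h * (D * D)" using Y D by (intro mult_right_mono) auto
    also have "\<dots> \<le> 1024 * h * (\<tau> * D)" using h D \<sigma> by (intro mult_left_mono mult_right_mono) auto
    finally show ?thesis by (simp add: B_def mult.assoc)
  qed
  have lin: "w + yD + wD + 10 * xD + 2000000 * YD \<le> \<alpha> + \<alpha>D + D + 10000000000 * A + 10000000000 * B"
    if "w \<le> \<alpha> + A" "wD \<le> \<alpha>D + A" "yD \<le> D + B" "xD \<le> 1025 * B" "YD \<le> 1024 * B" "0 \<le> A" "0 \<le> B"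
    for w yD wD xD YD \<alpha> \<alpha>D D A B :: real
    using that by linarith
  have "w \<le> \<alpha> + A" using w by (simp add: A_def)
  from lin[OF this wD yD xD YD AB] show ?thesis
    by (simp add: A_def B_def algebra_simps)
qed

text \<open>
  The same for two off-diagonal entries; the main terms add up to the square of \<open>(1 + D) \<alpha> +
  D\<close>, and the errors are of the order \<open>h \<tau> \<sigma> s\<close> or \<open>h \<tau> \<sigma>
  D\<close>.
\<close>

lemma off_recursion_arith:
  fixes h s \<tau> \<sigma> D \<alpha> y w1 w2 u ov x1 x2 Y :: real
  assumes h: "0 \<le> h" and s: "0 \<le> s" "s \<le> \<sigma>" and \<sigma>: "\<sigma> \<le> \<tau>" "\<tau> \<le> 1" and D: "0 \<le> D" "D \<le> \<sigma>"
    and y: "y \<le> 1 + h * s" and w: "w1 \<le> \<alpha> + h * \<tau> * s" "w2 \<le> \<alpha> + h * \<tau> * s" and u: "u \<le> \<alpha> * \<alpha> + h * \<tau> * \<sigma> * s"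
    and ov: "ov \<le> 6 * h * (s * s)" and x: "x1 \<le> 1025 * \<tau> * h" "x2 \<le> 1025 * \<tau> * h" and Y: "Y \<le> 1024 * h"
  shows "u + (w1 + u + w2 + u + 8 * ov) * D + (2 * 10 ^ 4 * (x1 + x2) + (y + w1 + w2 + u) + 2 * ov) * (D * D) + 10 ^ 6 * Y * (D * D * D)
    \<le> ((1 + D) * \<alpha> + D) * ((1 + D) * \<alpha> + D) + growth * h * \<tau> * \<sigma> * (s + D)"
proof -
  define A B where "A = h * \<tau> * \<sigma> * s" and "B = h * \<tau> * \<sigma> * D"
  have \<tau>0: "0 \<le> \<tau>" "0 \<le> \<sigma>" using s \<sigma> by linarith+
  have AB: "0 \<le> A" "0 \<le> B" using h \<tau>0 s D by (auto simp: A_def B_def)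
  have D1: "D \<le> 1" using D \<sigma> by linarith
  have DD: "0 \<le> D * D" "D * D \<le> D" "D * D \<le> \<sigma> * D" "D * D \<le> 1"
    using D D1 mult_mono[of D 1 D 1] by (auto intro: mult_right_mono mult_left_le)
  have hts: "h * \<tau> * s * D \<le> B"
    unfolding B_def using h \<tau>0 s D by (intro mult_right_mono mult_left_mono) auto
  have uu: "u \<le> \<alpha> * \<alpha> + A" using u by (simp add: A_def)
  have uD: "u * D \<le> \<alpha> * \<alpha> * D + A"
  proof -
    have "u * D \<le> (\<alpha> * \<alpha> + A) * D" using uu D by (intro mult_right_mono) auto
    moreover have "A * D \<le> A * 1" using AB D1 by (intro mult_left_mono) auto
    ultimately show ?thesis by (simp add: algebra_simps)
  qed
  have uDD: "u * (D * D) \<le> \<alpha> * \<alpha> * (D * D) + A"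
  proof -
    have "u * (D * D) \<le> (\<alpha> * \<alpha> + A) * (D * D)" using uu DD by (intro mult_right_mono) auto
    moreover have "A * (D * D) \<le> A * 1" using AB DD by (intro mult_left_mono) auto
    ultimately show ?thesis by (simp add: algebra_simps)
  qed
  have wD: "v * D \<le> \<alpha> * D + B" if "v \<le> \<alpha> + h * \<tau> * s" for v
  proof -
    have "v * D \<le> (\<alpha> + h * \<tau> * s) * D" using that D by (intro mult_right_mono) auto
    then show ?thesis using hts by (simp add: algebra_simps)
  qed
  have wDD: "v * (D * D) \<le> \<alpha> * (D * D) + B" if "v \<le> \<alpha> + h * \<tau> * s" for v
  proof -
    have "v * (D * D) \<le> (\<alpha> + h * \<tau> * s) * (D * D)" using that DD by (intro mult_right_mono) auto
    moreover have "h * \<tau> * s * (D * D) \<le> h * \<tau> * s * D" using h \<tau>0 s DD by (intro mult_left_mono) auto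
    ultimately show ?thesis using hts by (simp add: algebra_simps)
  qed
  have yDD: "y * (D * D) \<le> D * D + B"
  proof -
    have "y * (D * D) \<le> (1 + h * s) * (D * D)" using y DD by (intro mult_right_mono) auto
    moreover have "h * s * (D * D) \<le> h * \<tau> * (\<sigma> * D)"
    proof (rule mult_mono)
      show "h * s \<le> h * \<tau>" using h s \<sigma> by (intro mult_left_mono) auto
    qed (use DD h \<tau>0 in simp_all)
    ultimately show ?thesis by (simp add: algebra_simps B_def)
  qed
  have ss: "s * s * D \<le> \<tau> * \<sigma> * D" using s \<sigma> D by (intro mult_right_mono mult_mono) auto
  have oD: "ov * D \<le> 6 * B"
  proof -
    have "ov * D \<le> 6 * h * (s * s) * D" using ov D by (intro mult_right_mono) auto
    also have "\<dots> = 6 * h * (s * s * D)" by simp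
    also have "\<dots> \<le> 6 * h * (\<tau> * \<sigma> * D)" using ss h by (intro mult_left_mono) auto
    finally show ?thesis by (simp add: B_def mult.assoc)
  qed
  have oDD: "ov * (D * D) \<le> 6 * B"
  proof -
    have "ov * (D * D) \<le> 6 * h * (s * s) * (D * D)" using ov DD by (intro mult_right_mono) auto
    also have "\<dots> \<le> 6 * h * (s * s) * D" using h DD by (intro mult_left_mono) auto
    also have "\<dots> = 6 * h * (s * s * D)" by simp
    also have "\<dots> \<le> 6 * h * (\<tau> * \<sigma> * D)" using ss h by (intro mult_left_mono) auto
    finally show ?thesis by (simp add: B_def mult.assoc)
  qed
  have xDD: "v * (D * D) \<le> 1025 * B" if "v \<le> 1025 * \<tau> * h" for v
  proof -
    have "v * (D * D) \<le> 1025 * \<tau> * h * (D * D)" using that DD by (intro mult_right_mono) auto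
    also have "\<dots> \<le> 1025 * \<tau> * h * (\<sigma> * D)" using h \<tau>0 DD by (intro mult_left_mono) auto
    finally show ?thesis by (simp add: B_def mult.assoc mult.commute mult.left_commute)
  qed
  have YDDD: "Y * (D * D * D) \<le> 1024 * B"
  proof -
    have "Y * (D * D * D) \<le> 1024 * h * (D * D * D)" using Y D by (intro mult_right_mono) auto
    also have "\<dots> \<le> 1024 * h * (\<tau> * \<sigma> * D)"
    proof (rule mult_left_mono)
      have "D \<le> \<tau>" using D \<sigma> by linarith
      then show "D * D * D \<le> \<tau> * \<sigma> * D" using D \<tau>0 by (intro mult_right_mono mult_mono) auto
    qed (use h in simp)
    finally show ?thesis by (simp add: B_def mult.assoc)
  qed
  \<comment> \<open>Pure bookkeeping, with every product replaced by a variable.\<close>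
  have lin: "u + (w1D + uD + w2D + uD + 8 * oD) + (20000 * (x1 + x2) + (y + w1 + w2 + uDD) + 2 * oDD) + 1000000 * YD
     \<le> (aa + aD + aD + aaD + aaD + (DD + aDD + aDD + aaDD)) + 10000000000 * A + 10000000000 * B"
    if "u \<le> aa + A" "uD \<le> aaD + A" "uDD \<le> aaDD + A" "w1D \<le> aD + B" "w2D \<le> aD + B" "w1 \<le> aDD + B" "w2 \<le> aDD + B"
      "y \<le> DD + B" "oD \<le> 6 * B" "oDD \<le> 6 * B" "x1 \<le> 1025 * B" "x2 \<le> 1025 * B" "YD \<le> 1024 * B" "0 \<le> A" "0 \<le> B"
    for u w1D w2D uD oD x1 x2 y w1 w2 uDD oDD YD aa aD aaD DD aDD aaDD A B :: real
  proof -
    have "u + (w1D + uD + w2D + uD + 8 * oD) + (20000 * (x1 + x2) + (y + w1 + w2 + uDD) + 2 * oDD) + 1000000 * YD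
      \<le> (aa + A) + ((aD + B) + (aaD + A) + (aD + B) + (aaD + A) + 8 * (6 * B))
        + (20000 * (1025 * B + 1025 * B) + ((DD + B) + (aDD + B) + (aDD + B) + (aaDD + A)) + 2 * (6 * B)) + 1000000 * (1024 * B)"
      by (intro add_mono mult_left_mono that) simp_all
    also have "\<dots> = (aa + aD + aD + aaD + aaD + (DD + aDD + aDD + aaDD)) + 4 * A + 1065000065 * B"
      by (simp add: algebra_simps)
    also have "\<dots> \<le> (aa + aD + aD + aaD + aaD + (DD + aDD + aDD + aaDD)) + 10000000000 * A + 10000000000 * B"
      by (intro add_mono mult_right_mono that order_refl) simp_all
    finally show ?thesis .
  qed
  from lin[OF uu uD uDD wD[OF w(1)] wD[OF w(2)] wDD[OF w(1)] wDD[OF w(2)] yDD oD oDD xDD[OF x(1)] xDD[OF x(2)] YDDD AB]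
  show ?thesis by (simp add: A_def B_def algebra_simps)
qed

text \<open>
  Entries with four distinct labels are nearly uncorrelated. The bound for \<open>E S\<^sub>a\<^sub>b\<^sup>2
  S\<^sub>c\<^sub>e\<^sup>2\<close> has to start with \<open>(off_level d k)\<^sup>2\<close> with constant 1,
  because \<open>off_level d k\<close> is also the lower bound of \<open>prefix_gram_second\<close> and the
  two cancel in the variance of the test statistic. Each moment feeds the next one through the terms of order
  \<open>1/d\<close>, so three moments are carried through the induction.
\<close>

lemma prefix_gram_mixed:
  fixes d :: "nat \<Rightarrow> nat" and K :: nat
  assumes pos: "\<And>i. i \<le> K \<Longrightarrow> d i > 0" and k: "k \<le> K"
    and \<tau>: "0 < \<tau>" "\<tau> \<le> 1" and \<sigma>: "inv_sum d K = \<sigma>" "\<sigma> = \<tau> * \<tau>"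
  shows "\<forall>a<d 0. \<forall>b<d 0. \<forall>c<d 0. \<forall>e<d 0. distinct [a, b, c, e] \<longrightarrow>
    (\<integral>\<omega>. prefix_gram d k \<omega> a a * prefix_gram d k \<omega> b b * prefix_gram d k \<omega> c c * prefix_gram d k \<omega> e e \<partial>gauss) \<le> 1 + growth ^ k * inv_sum d k \<and>
    (\<integral>\<omega>. prefix_gram d k \<omega> a b * prefix_gram d k \<omega> a b * prefix_gram d k \<omega> c c * prefix_gram d k \<omega> e e \<partial>gauss) \<le> off_level d k + growth ^ k * \<tau> * inv_sum d k \<and>
    (\<integral>\<omega>. prefix_gram d k \<omega> a b * prefix_gram d k \<omega> a b * prefix_gram d k \<omega> c e * prefix_gram d k \<omega> c e \<partial>gauss)
      \<le> off_level d k * off_level d k + growth ^ k * \<tau> * \<sigma> * inv_sum d k"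
  using k
proof (induction k)
  case 0
  then show ?case by (simp add: prefix_gram_0)
next
  case (Suc k)
  have kK: "k \<le> K" using Suc.prems by simp
  let ?D = "real (d (Suc k))" and ?G = "prefix_gram d k"
  define D where "D = 1 / ?D"
  define H where "H = growth ^ k"
  define s where "s = inv_sum d k"
  define \<alpha> where "\<alpha> = off_level d k"
  have dpos: "d (Suc k) > 0" using pos Suc.prems by simp
  have H0: "0 \<le> H" by (simp add: H_def)
  have s0: "0 \<le> s" unfolding s_def by (rule inv_sum_nonneg)
  have sD: "s + D \<le> \<sigma>" using inv_sum_mono[OF Suc.prems, of d] by (simp add: s_def D_def inv_sum_Suc \<sigma>(1))
  have D0: "0 \<le> D" by (simp add: D_def)
  have s\<sigma>: "s \<le> \<sigma>" "D \<le> \<sigma>" using sD s0 D0 by linarith+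
  have \<sigma>\<tau>: "\<sigma> \<le> \<tau>" using \<tau> \<sigma>(2) by (simp add: mult_left_le)
  have sSuc: "inv_sum d (Suc k) = s + D" by (simp add: s_def D_def inv_sum_Suc)
  have \<alpha>Suc: "off_level d (Suc k) = (1 + D) * \<alpha> + D" by (simp add: \<alpha>_def D_def)
  have HSuc: "growth ^ Suc k = growth * H" by (simp add: H_def)
  note am = all_moments_prefix_gram all_moments_diag_sum
  have fourth: "(\<integral>\<omega>. ?G \<omega> i j ^ 4 \<partial>gauss) \<le> H * s\<^sup>2" if "i < d 0" "j < d 0" "i \<noteq> j" for i j
    using prefix_gram_fourth[where d = d and K = K, OF pos kK] that by (simp add: H_def s_def)
  show ?case
  proof (intro allI impI)
    fix a b c e assume l: "a < d 0" "b < d 0" "c < d 0" "e < d 0" and dist: "distinct [a, b, c, e]"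
    let ?M = "\<lambda>\<omega>. diag_sum (d k) (prefix_product d k \<omega>) a b c e"
    define y where "y = (\<integral>\<omega>. ?G \<omega> a a * ?G \<omega> b b * ?G \<omega> c c * ?G \<omega> e e \<partial>gauss)"
    define w1 where "w1 = (\<integral>\<omega>. ?G \<omega> a b * ?G \<omega> a b * ?G \<omega> c c * ?G \<omega> e e \<partial>gauss)"
    define w2 where "w2 = (\<integral>\<omega>. ?G \<omega> c e * ?G \<omega> c e * ?G \<omega> a a * ?G \<omega> b b \<partial>gauss)"
    define u where "u = (\<integral>\<omega>. ?G \<omega> a b * ?G \<omega> a b * ?G \<omega> c e * ?G \<omega> c e \<partial>gauss)"
    define Y where "Y = (\<integral>\<omega>. ?M \<omega> ^ 4 \<partial>gauss)"
    define x1 where "x1 = (\<integral>\<omega>. \<bar>?G \<omega> a b\<bar> * ?M \<omega> ^ 3 \<partial>gauss)"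
    define x2 where "x2 = (\<integral>\<omega>. \<bar>?G \<omega> c e\<bar> * ?M \<omega> ^ 3 \<partial>gauss)"
    define ov where "ov = (\<integral>\<omega>. ?G \<omega> a c ^ 4 + ?G \<omega> a e ^ 4 + ?G \<omega> b c ^ 4 + ?G \<omega> b e ^ 4 + ?G \<omega> a b ^ 4 + ?G \<omega> c e ^ 4 \<partial>gauss)"
    have dist': "distinct [c, e, a, b]" using dist by auto
    have y: "y \<le> 1 + H * s" unfolding y_def H_def s_def using Suc.IH[OF kK] l dist by blast
    have w1: "w1 \<le> \<alpha> + H * \<tau> * s" unfolding w1_def H_def s_def \<alpha>_def using Suc.IH[OF kK] l dist by blast
    have w2: "w2 \<le> \<alpha> + H * \<tau> * s" unfolding w2_def H_def s_def \<alpha>_def using Suc.IH[OF kK] l dist' by blast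
    have u: "u \<le> \<alpha> * \<alpha> + H * \<tau> * \<sigma> * s" unfolding u_def H_def s_def \<alpha>_def using Suc.IH[OF kK] l dist by blast
    have Y: "Y \<le> 1024 * H" unfolding Y_def H_def by (rule expectation_diag_sum4[where d = d and K = K, OF pos kK l])
    have \<sigma>': "inv_sum d K \<le> \<tau> * \<tau>" using \<sigma> by simp
    have x1: "x1 \<le> 1025 * \<tau> * H" unfolding x1_def H_def using dist by (intro expectation_off_diag3[where d = d and K = K, OF pos kK l l(1,2) _ \<tau>(1) \<sigma>']) auto
    have x2: "x2 \<le> 1025 * \<tau> * H" unfolding x2_def H_def using dist by (intro expectation_off_diag3[where d = d and K = K, OF pos kK l l(3,4) _ \<tau>(1) \<sigma>']) auto
    have int4: "integrable gauss (\<lambda>\<omega>. ?G \<omega> i j ^ 4)" for i j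
      by (intro all_moments_integrable all_moments_power am)
    have ov: "ov \<le> 6 * H * (s * s)"
    proof -
      have "ov = (\<integral>\<omega>. ?G \<omega> a c ^ 4 \<partial>gauss) + (\<integral>\<omega>. ?G \<omega> a e ^ 4 \<partial>gauss) + (\<integral>\<omega>. ?G \<omega> b c ^ 4 \<partial>gauss) + (\<integral>\<omega>. ?G \<omega> b e ^ 4 \<partial>gauss)
         + (\<integral>\<omega>. ?G \<omega> a b ^ 4 \<partial>gauss) + (\<integral>\<omega>. ?G \<omega> c e ^ 4 \<partial>gauss)"
        unfolding ov_def using int4 by simp
      also have "\<dots> \<le> H * s\<^sup>2 + H * s\<^sup>2 + H * s\<^sup>2 + H * s\<^sup>2 + H * s\<^sup>2 + H * s\<^sup>2"
        using l dist by (intro add_mono fourth) auto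
      finally show ?thesis by (simp add: power2_eq_square)
    qed
    have imonos: "integrable gauss (\<lambda>\<omega>. ?G \<omega> i1 j1 * ?G \<omega> i2 j2 * ?G \<omega> i3 j3 * ?G \<omega> i4 j4)" for i1 j1 i2 j2 i3 j3 i4 j4
      by (intro all_moments_integrable all_moments_mult am)
    have iM: "integrable gauss (\<lambda>\<omega>. ?M \<omega> ^ 4)" "integrable gauss (\<lambda>\<omega>. \<bar>?G \<omega> i j\<bar> * ?M \<omega> ^ 3)" for i j
      by (intro all_moments_integrable all_moments_intros am)+
    have io: "integrable gauss (\<lambda>\<omega>. ?G \<omega> a c ^ 4 + ?G \<omega> a e ^ 4 + ?G \<omega> b c ^ 4 + ?G \<omega> b e ^ 4 + ?G \<omega> a b ^ 4 + ?G \<omega> c e ^ 4)"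
      by (intro all_moments_integrable all_moments_intros am)
    have amS: "all_moments gauss (\<lambda>\<omega>. next_gram (d (Suc k)) (d k) (prefix_product d k \<omega>) (layer (Suc k) \<omega>) i1 j1
       * next_gram (d (Suc k)) (d k) (prefix_product d k \<omega>) (layer (Suc k) \<omega>) i2 j2
       * next_gram (d (Suc k)) (d k) (prefix_product d k \<omega>) (layer (Suc k) \<omega>) i3 j3
       * next_gram (d (Suc k)) (d k) (prefix_product d k \<omega>) (layer (Suc k) \<omega>) i4 j4)" for i1 j1 i2 j2 i3 j3 i4 j4
      unfolding prefix_gram_Suc[symmetric] by (intro all_moments_mult am)
    have "(\<integral>\<omega>. prefix_gram d (Suc k) \<omega> a a * prefix_gram d (Suc k) \<omega> b b * prefix_gram d (Suc k) \<omega> c c * prefix_gram d (Suc k) \<omega> e e \<partial>gauss)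
        \<le> (\<integral>\<omega>. ?G \<omega> a a * ?G \<omega> b b * ?G \<omega> c c * ?G \<omega> e e + 2 * 10 ^ 6 * ?M \<omega> ^ 4 * D \<partial>gauss)"
      unfolding prefix_gram_Suc
    proof (rule expectation_next_layer_le[OF amS])
      show "all_moments gauss (\<lambda>\<omega>. ?G \<omega> a a * ?G \<omega> b b * ?G \<omega> c c * ?G \<omega> e e + 2 * 10 ^ 6 * ?M \<omega> ^ 4 * D)"
        by (intro all_moments_intros am)
      show "(\<integral>\<eta>. next_gram (d (Suc k)) (d k) (prefix_product d k \<omega>) \<eta> a a * next_gram (d (Suc k)) (d k) (prefix_product d k \<omega>) \<eta> b b *
          next_gram (d (Suc k)) (d k) (prefix_product d k \<omega>) \<eta> c c * next_gram (d (Suc k)) (d k) (prefix_product d k \<omega>) \<eta> e e \<partial>gauss)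
          \<le> ?G \<omega> a a * ?G \<omega> b b * ?G \<omega> c c * ?G \<omega> e e + 2 * 10 ^ 6 * ?M \<omega> ^ 4 * D" for \<omega>
        using next_gram_diag4[OF dpos, of "d k" "prefix_product d k \<omega>" a b c e] by (simp add: prefix_gram_def D_def)
    qed
    also have "\<dots> = y + 2 * 10 ^ 6 * Y * D" using imonos iM by (simp add: y_def Y_def)
    also have "\<dots> \<le> 1 + H * s + 2 * 10 ^ 6 * (1024 * H) * D"
      using y Y D0 by (intro add_mono mult_right_mono mult_left_mono) auto
    also have "\<dots> \<le> 1 + growth * (H * s) + growth * (H * D)"
      using mult_right_mono[of 1 growth "H * s"] mult_right_mono[of "2 * 10 ^ 6 * 1024" growth "H * D"] H0 s0 D0 by simp
    also have "\<dots> = 1 + growth ^ Suc k * inv_sum d (Suc k)" unfolding sSuc HSuc by (simp add: algebra_simps)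
    finally have 1: "(\<integral>\<omega>. prefix_gram d (Suc k) \<omega> a a * prefix_gram d (Suc k) \<omega> b b * prefix_gram d (Suc k) \<omega> c c * prefix_gram d (Suc k) \<omega> e e \<partial>gauss)
        \<le> 1 + growth ^ Suc k * inv_sum d (Suc k)" .
    have dv: "x / ?D = x * D" "x / ?D\<^sup>2 = x * (D * D)" "x / ?D ^ 3 = x * (D * D * D)" for x
      by (simp_all add: D_def power2_eq_square power3_eq_cube)
    let ?R1 = "\<lambda>\<omega>. ?G \<omega> a b * ?G \<omega> a b * ?G \<omega> c c * ?G \<omega> e e
        + (?G \<omega> a a * ?G \<omega> b b * ?G \<omega> c c * ?G \<omega> e e + ?G \<omega> a b * ?G \<omega> a b * ?G \<omega> c c * ?G \<omega> e e + 10 * (\<bar>?G \<omega> a b\<bar> * ?M \<omega> ^ 3)) * D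
        + 2 * 10 ^ 6 * ?M \<omega> ^ 4 * (D * D)"
    have "(\<integral>\<omega>. prefix_gram d (Suc k) \<omega> a b * prefix_gram d (Suc k) \<omega> a b * prefix_gram d (Suc k) \<omega> c c * prefix_gram d (Suc k) \<omega> e e \<partial>gauss)
        \<le> (\<integral>\<omega>. ?R1 \<omega> \<partial>gauss)"
      unfolding prefix_gram_Suc
    proof (rule expectation_next_layer_le[OF amS])
      show "all_moments gauss ?R1" by (intro all_moments_intros am)
      show "(\<integral>\<eta>. next_gram (d (Suc k)) (d k) (prefix_product d k \<omega>) \<eta> a b * next_gram (d (Suc k)) (d k) (prefix_product d k \<omega>) \<eta> a b *
          next_gram (d (Suc k)) (d k) (prefix_product d k \<omega>) \<eta> c c * next_gram (d (Suc k)) (d k) (prefix_product d k \<omega>) \<eta> e e \<partial>gauss) \<le> ?R1 \<omega>" for \<omega>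
        by (rule order_trans[OF next_gram_mixed4[OF dpos]])
          (simp only: prefix_gram_def dv add_divide_distrib, simp add: power2_eq_square algebra_simps)
    qed
    also have "\<dots> = w1 + (y + w1 + 10 * x1) * D + 2 * 10 ^ 6 * Y * (D * D)"
      using imonos iM by (simp add: y_def w1_def x1_def Y_def)
    also have "\<dots> \<le> ((1 + D) * \<alpha> + D) + growth * H * \<tau> * (s + D)"
      by (rule mixed_recursion_arith[OF H0 s0 s\<sigma>(1) \<sigma>\<tau> \<tau>(2) D0 s\<sigma>(2) y w1 x1 Y])
    finally have 2: "(\<integral>\<omega>. prefix_gram d (Suc k) \<omega> a b * prefix_gram d (Suc k) \<omega> a b * prefix_gram d (Suc k) \<omega> c c * prefix_gram d (Suc k) \<omega> e e \<partial>gauss)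
        \<le> off_level d (Suc k) + growth ^ Suc k * \<tau> * inv_sum d (Suc k)" unfolding sSuc \<alpha>Suc HSuc .
    let ?O = "\<lambda>\<omega>. ?G \<omega> a c ^ 4 + ?G \<omega> a e ^ 4 + ?G \<omega> b c ^ 4 + ?G \<omega> b e ^ 4 + ?G \<omega> a b ^ 4 + ?G \<omega> c e ^ 4"
    let ?y = "\<lambda>\<omega>. ?G \<omega> a a * ?G \<omega> b b * ?G \<omega> c c * ?G \<omega> e e" and ?w1 = "\<lambda>\<omega>. ?G \<omega> a b * ?G \<omega> a b * ?G \<omega> c c * ?G \<omega> e e"
      and ?w2 = "\<lambda>\<omega>. ?G \<omega> c e * ?G \<omega> c e * ?G \<omega> a a * ?G \<omega> b b" and ?u = "\<lambda>\<omega>. ?G \<omega> a b * ?G \<omega> a b * ?G \<omega> c e * ?G \<omega> c e"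
    let ?R2 = "\<lambda>\<omega>. ?u \<omega> + (?w1 \<omega> + ?u \<omega> + ?w2 \<omega> + ?u \<omega> + 8 * ?O \<omega>) * D
       + (2 * 10 ^ 4 * (\<bar>?G \<omega> a b\<bar> * ?M \<omega> ^ 3 + \<bar>?G \<omega> c e\<bar> * ?M \<omega> ^ 3) + (?y \<omega> + ?w1 \<omega> + ?w2 \<omega> + ?u \<omega>) + 2 * ?O \<omega>) * (D * D) + 10 ^ 6 * ?M \<omega> ^ 4 * (D * D * D)"
    have lin: "(\<integral>\<omega>. f1 \<omega> + (f2 \<omega> + f1 \<omega> + f3 \<omega> + f1 \<omega> + 8 * f4 \<omega>) * D
         + (2 * 10 ^ 4 * (f5 \<omega> + f6 \<omega>) + (f7 \<omega> + f2 \<omega> + f3 \<omega> + f1 \<omega>) + 2 * f4 \<omega>) * (D * D) + 10 ^ 6 * f8 \<omega> * (D * D * D) \<partial>gauss)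
      = integral\<^sup>L gauss f1 + (integral\<^sup>L gauss f2 + integral\<^sup>L gauss f1 + integral\<^sup>L gauss f3 + integral\<^sup>L gauss f1 + 8 * integral\<^sup>L gauss f4) * D
         + (2 * 10 ^ 4 * (integral\<^sup>L gauss f5 + integral\<^sup>L gauss f6) + (integral\<^sup>L gauss f7 + integral\<^sup>L gauss f2 + integral\<^sup>L gauss f3 + integral\<^sup>L gauss f1)
         + 2 * integral\<^sup>L gauss f4) * (D * D) + 10 ^ 6 * integral\<^sup>L gauss f8 * (D * D * D)"
      if "integrable gauss f1" "integrable gauss f2" "integrable gauss f3" "integrable gauss f4" "integrable gauss f5" "integrable gauss f6" "integrable gauss f7" "integrable gauss f8"
      for f1 f2 f3 f4 f5 f6 f7 f8 :: "(nat \<times> nat \<times> nat \<Rightarrow> real) \<Rightarrow> real"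
      using that by simp
    have "(\<integral>\<omega>. prefix_gram d (Suc k) \<omega> a b * prefix_gram d (Suc k) \<omega> a b * prefix_gram d (Suc k) \<omega> c e * prefix_gram d (Suc k) \<omega> c e \<partial>gauss)
        \<le> (\<integral>\<omega>. ?R2 \<omega> \<partial>gauss)"
      unfolding prefix_gram_Suc
    proof (rule expectation_next_layer_le[OF amS])
      show "all_moments gauss ?R2" by (intro all_moments_intros am)
      show "(\<integral>\<eta>. next_gram (d (Suc k)) (d k) (prefix_product d k \<omega>) \<eta> a b * next_gram (d (Suc k)) (d k) (prefix_product d k \<omega>) \<eta> a b *
          next_gram (d (Suc k)) (d k) (prefix_product d k \<omega>) \<eta> c e * next_gram (d (Suc k)) (d k) (prefix_product d k \<omega>) \<eta> c e \<partial>gauss) \<le> ?R2 \<omega>" for \<omega>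
        by (rule order_trans[OF next_gram_off4[OF dpos]])
          (simp only: prefix_gram_def dv add_divide_distrib, simp add: power2_eq_square algebra_simps)
    qed
    also have "\<dots> = u + (w1 + u + w2 + u + 8 * ov) * D + (2 * 10 ^ 4 * (x1 + x2) + (y + w1 + w2 + u) + 2 * ov) * (D * D) + 10 ^ 6 * Y * (D * D * D)"
      unfolding ov_def y_def w1_def w2_def u_def x1_def x2_def Y_def by (rule lin) (rule imonos iM io)+
    also have "\<dots> \<le> ((1 + D) * \<alpha> + D) * ((1 + D) * \<alpha> + D) + growth * H * \<tau> * \<sigma> * (s + D)"
      by (rule off_recursion_arith[OF H0 s0 s\<sigma>(1) \<sigma>\<tau> \<tau>(2) D0 s\<sigma>(2) y w1 w2 u ov x1 x2 Y])
    finally have 3: "(\<integral>\<omega>. prefix_gram d (Suc k) \<omega> a b * prefix_gram d (Suc k) \<omega> a b * prefix_gram d (Suc k) \<omega> c e * prefix_gram d (Suc k) \<omega> c e \<partial>gauss)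
        \<le> off_level d (Suc k) * off_level d (Suc k) + growth ^ Suc k * \<tau> * \<sigma> * inv_sum d (Suc k)" unfolding sSuc \<alpha>Suc HSuc .
    show "(\<integral>\<omega>. prefix_gram d (Suc k) \<omega> a a * prefix_gram d (Suc k) \<omega> b b * prefix_gram d (Suc k) \<omega> c c * prefix_gram d (Suc k) \<omega> e e \<partial>gauss)
        \<le> 1 + growth ^ Suc k * inv_sum d (Suc k) \<and>
      (\<integral>\<omega>. prefix_gram d (Suc k) \<omega> a b * prefix_gram d (Suc k) \<omega> a b * prefix_gram d (Suc k) \<omega> c c * prefix_gram d (Suc k) \<omega> e e \<partial>gauss)
        \<le> off_level d (Suc k) + growth ^ Suc k * \<tau> * inv_sum d (Suc k) \<and>
      (\<integral>\<omega>. prefix_gram d (Suc k) \<omega> a b * prefix_gram d (Suc k) \<omega> a b * prefix_gram d (Suc k) \<omega> c e * prefix_gram d (Suc k) \<omega> c e \<partial>gauss)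
        \<le> off_level d (Suc k) * off_level d (Suc k) + growth ^ Suc k * \<tau> * \<sigma> * inv_sum d (Suc k)"
      using 1 2 3 by blast
  qed
qed

section \<open>A statistic that detects correlated rows\<close>

lemma expectation_column_blocks:
  fixes P :: "(nat \<times> nat \<Rightarrow> real) \<Rightarrow> real"
  assumes P: "all_moments gauss P"
    and cols: "\<And>\<eta> \<eta>'. (\<And>s t. t < N \<Longrightarrow> \<eta> (s, t) = \<eta>' (s, t)) \<Longrightarrow> P \<eta> = P \<eta>'"
  shows "(\<integral>\<eta>. P \<eta> * P (\<lambda>(s, t). \<eta> (s, N + t)) \<partial>gauss) = (\<integral>\<eta>. P \<eta> \<partial>gauss)\<^sup>2"
proof -
  define h where "h x = (case x of (s, t) \<Rightarrow> (s, N + t))" for x :: "nat \<times> nat"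
  have h: "inj h" by (auto simp: inj_on_def h_def)
  have indep: "P (graft h \<omega> \<zeta>) = P \<omega>" for \<omega> \<zeta>
    by (rule cols, rule graft_other) (auto simp: h_def)
  have eq: "(\<lambda>x. \<eta> (h x)) = (\<lambda>(s, t). \<eta> (s, N + t))" for \<eta> :: "nat \<times> nat \<Rightarrow> real"
    by (auto simp: h_def)
  have "(\<integral>\<eta>. P \<eta> * P (\<lambda>x. \<eta> (h x)) \<partial>gauss) = (\<integral>\<eta>. P \<eta> \<partial>gauss) * (\<integral>\<eta>. P (\<lambda>x. \<eta> (h x)) \<partial>gauss)"
    by (rule expectation_indep[OF h P all_moments_reindex[OF h P] all_moments_measurable[OF P] indep])
  also have "(\<integral>\<eta>. P (\<lambda>x. \<eta> (h x)) \<partial>gauss) = (\<integral>\<eta>. P \<eta> \<partial>gauss)"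
    by (rule integral_reindex[OF h all_moments_measurable[OF P]])
  finally show ?thesis by (simp add: eq power2_eq_square)
qed

text \<open>
  The two indices come from disjoint ranges, so that no diagonal entry of the Gram matrix occurs and two pairs
  that share no index involve four distinct rows.
\<close>

definition row_pairs :: "nat \<Rightarrow> (nat \<times> nat) set" where
  "row_pairs m = {..<m} \<times> {m..<2 * m}"

text \<open>
  For \<open>W = B \<eta>\<close> with \<open>\<eta>\<close> Gaussian, the columns below \<open>N\<close> and
  the next \<open>N\<close> columns give two conditionally independent estimates of \<open>N\<close> times the
  entry \<open>(i, j)\<close> of the Gram matrix of \<open>B\<close>. Their product estimates the square of
  that entry without bias, and has mean 0 if the rows of \<open>B\<close> are orthogonal.
\<close>

definition cross_stat :: "nat \<Rightarrow> nat \<Rightarrow> (nat \<times> nat \<Rightarrow> real) \<Rightarrow> real" where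
  "cross_stat m N W = (\<Sum>(i, j)\<in>row_pairs m. gram N W i j * gram N (\<lambda>(i, t). W (i, N + t)) i j)"

lemma gram_mat_scale: "gram N (mat_scale c A) i j = c * c * gram N A i j"
  by (simp add: gram_def mat_scale_def sum_distrib_left mult.left_commute mult.assoc)

lemma all_moments_mat_prod: "all_moments gauss (\<lambda>\<eta>. mat_prod n B \<eta> x)"
  unfolding mat_prod_def split_beta' by (intro all_moments_intros)

lemma all_moments_gram_mat_prod: "all_moments gauss (\<lambda>\<eta>. gram N (mat_prod n B \<eta>) i j)"
  unfolding gram_def by (intro all_moments_intros all_moments_mat_prod)

lemma mat_prod_shift: "(\<lambda>(i, t). mat_prod n B \<eta> (i, N + t)) = mat_prod n B (\<lambda>(s, t). \<eta> (s, N + t))"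
  by (auto simp: mat_prod_def)

lemma gram_mat_prod_cong:
  assumes "\<And>s t. t < N \<Longrightarrow> \<eta> (s, t) = \<eta>' (s, t)"
  shows "gram N (mat_prod n B \<eta>) i j = gram N (mat_prod n B \<eta>') i j"
  using assms by (simp add: gram_def mat_prod_def)

lemma expectation_gram_mat_prod:
  assumes N: "N > 0"
  shows "(\<integral>\<eta>. gram N (mat_prod n B \<eta>) i j \<partial>gauss) = real N * gram n B i j"
    and "(\<integral>\<eta>. gram N (mat_prod n B \<eta>) i j * gram N (mat_prod n B \<eta>) k l \<partial>gauss) =
      (real N)\<^sup>2 * (gram n B i j * gram n B k l) + real N * gram_cov n B i j k l"
proof -
  have next_gram: "gram N (mat_prod n B \<eta>) i j = real N * next_gram N n B \<eta> i j" for \<eta> i j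
    using N by (simp add: gram_mat_scale)
  have int: "integrable gauss (column_sum (centered_product n B i j) N)"
    by (intro all_moments_integrable all_moments_column_sum all_moments_centered_product)
  have "(\<integral>\<eta>. next_gram N n B \<eta> i j \<partial>gauss) = gram n B i j"
    unfolding next_gram_eq[OF N] using int
      expectation_column_sum[OF all_moments_centered_product expectation_centered_product]
    by simp
  then show "(\<integral>\<eta>. gram N (mat_prod n B \<eta>) i j \<partial>gauss) = real N * gram n B i j"
    unfolding next_gram by simp
  have "(\<integral>\<eta>. gram N (mat_prod n B \<eta>) i j * gram N (mat_prod n B \<eta>) k l \<partial>gauss) =
      (\<integral>\<eta>. (real N)\<^sup>2 * (next_gram N n B \<eta> i j * next_gram N n B \<eta> k l) \<partial>gauss)"
    unfolding next_gram by (intro Bochner_Integration.integral_cong refl) (simp only: power2_eq_square mult_ac)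
  also have "\<dots> = (real N)\<^sup>2 * (gram n B i j * gram n B k l + gram_cov n B i j k l / real N)"
    by (simp only: integral_mult_right_zero expectation_next_gram2[OF N])
  also have "\<dots> = (real N)\<^sup>2 * (gram n B i j * gram n B k l) + real N * gram_cov n B i j k l"
    using N by (simp add: field_simps power2_eq_square)
  finally show "(\<integral>\<eta>. gram N (mat_prod n B \<eta>) i j * gram N (mat_prod n B \<eta>) k l \<partial>gauss) =
      (real N)\<^sup>2 * (gram n B i j * gram n B k l) + real N * gram_cov n B i j k l" .
qed

lemma all_moments_cross_stat: "all_moments gauss (\<lambda>\<omega>. cross_stat m N (W \<omega>))"
  if "\<And>x. all_moments gauss (\<lambda>\<omega>. W \<omega> x)" for W :: "('i \<Rightarrow> real) \<Rightarrow> nat \<times> nat \<Rightarrow> real"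
  unfolding cross_stat_def gram_def split_beta by (intro all_moments_intros) (simp_all add: that)

lemma expectation_cross_stat:
  assumes N: "N > 0"
  shows "(\<integral>\<eta>. cross_stat m N (mat_prod n B \<eta>) \<partial>gauss) = (\<Sum>(i, j)\<in>row_pairs m. (real N * gram n B i j)\<^sup>2)"
proof -
  define U where "U e \<eta> = gram N (mat_prod n B \<eta>) (fst e) (snd e)" for e \<eta>
  define sh where "sh \<eta> = (\<lambda>(s, t). \<eta> (s, N + t))" for \<eta> :: "nat \<times> nat \<Rightarrow> real"
  have am: "all_moments gauss (U e)" for e unfolding U_def[abs_def] by (rule all_moments_gram_mat_prod)
  have "inj (\<lambda>x :: nat \<times> nat. (fst x, N + snd x))" by (auto simp: inj_on_def)
  from all_moments_reindex[OF this am]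
  have ams: "all_moments gauss (\<lambda>\<eta>. U e (sh \<eta>))" for e by (simp add: sh_def split_beta')
  have int: "integrable gauss (\<lambda>\<eta>. U e \<eta> * U e (sh \<eta>))" for e
    by (intro all_moments_integrable all_moments_mult am ams)
  have "(\<integral>\<eta>. cross_stat m N (mat_prod n B \<eta>) \<partial>gauss) = (\<integral>\<eta>. (\<Sum>e\<in>row_pairs m. U e \<eta> * U e (sh \<eta>)) \<partial>gauss)"
    unfolding cross_stat_def mat_prod_shift U_def sh_def by (intro Bochner_Integration.integral_cong sum.cong refl) (simp only: split_beta)
  also have "\<dots> = (\<Sum>e\<in>row_pairs m. \<integral>\<eta>. U e \<eta> * U e (sh \<eta>) \<partial>gauss)"
    using int by (rule Bochner_Integration.integral_sum)
  also have "\<dots> = (\<Sum>e\<in>row_pairs m. (\<integral>\<eta>. U e \<eta> \<partial>gauss)\<^sup>2)"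
    unfolding sh_def by (intro sum.cong refl expectation_column_blocks am) (auto simp: U_def intro: gram_mat_prod_cong)
  also have "\<dots> = (\<Sum>(i, j)\<in>row_pairs m. (real N * gram n B i j)\<^sup>2)"
    unfolding U_def expectation_gram_mat_prod[OF N] split_beta ..
  finally show ?thesis .
qed

text \<open>
  By the independence of the two groups of columns, the expectation of a product of two summands is the square
  of a second moment of one group.
\<close>

lemma expectation_cross_stat_square:
  assumes N: "N > 0"
  shows "(\<integral>\<eta>. (cross_stat m N (mat_prod n B \<eta>))\<^sup>2 \<partial>gauss) =
    (\<Sum>(i, j)\<in>row_pairs m. \<Sum>(k, l)\<in>row_pairs m. ((real N)\<^sup>2 * (gram n B i j * gram n B k l) + real N * gram_cov n B i j k l)\<^sup>2)"
proof -
  define U where "U e \<eta> = gram N (mat_prod n B \<eta>) (fst e) (snd e)" for e \<eta>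
  define P where "P e f \<eta> = U e \<eta> * U f \<eta>" for e f \<eta>
  define sh where "sh \<eta> = (\<lambda>(s, t). \<eta> (s, N + t))" for \<eta> :: "nat \<times> nat \<Rightarrow> real"
  have am: "all_moments gauss (P e f)" for e f
    unfolding P_def[abs_def] U_def by (intro all_moments_mult all_moments_gram_mat_prod)
  have "inj (\<lambda>x :: nat \<times> nat. (fst x, N + snd x))" by (auto simp: inj_on_def)
  from all_moments_reindex[OF this am]
  have ams: "all_moments gauss (\<lambda>\<eta>. P e f (sh \<eta>))" for e f by (simp add: sh_def split_beta')
  have int: "integrable gauss (\<lambda>\<eta>. P e f \<eta> * P e f (sh \<eta>))" for e f
    by (intro all_moments_integrable all_moments_mult am ams)
  have "(cross_stat m N (mat_prod n B \<eta>))\<^sup>2 = (\<Sum>e\<in>row_pairs m. \<Sum>f\<in>row_pairs m. P e f \<eta> * P e f (sh \<eta>))" for \<eta>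
  proof -
    have "cross_stat m N (mat_prod n B \<eta>) = (\<Sum>e\<in>row_pairs m. U e \<eta> * U e (sh \<eta>))"
      unfolding cross_stat_def mat_prod_shift U_def sh_def by (intro sum.cong refl) (simp only: split_beta)
    then show ?thesis unfolding power2_eq_square P_def
      by (simp only: sum_product) (intro sum.cong refl, simp only: mult_ac)
  qed
  then have "(\<integral>\<eta>. (cross_stat m N (mat_prod n B \<eta>))\<^sup>2 \<partial>gauss) =
      (\<integral>\<eta>. (\<Sum>e\<in>row_pairs m. \<Sum>f\<in>row_pairs m. P e f \<eta> * P e f (sh \<eta>)) \<partial>gauss)" by simp
  also have "\<dots> = (\<Sum>e\<in>row_pairs m. \<Sum>f\<in>row_pairs m. \<integral>\<eta>. P e f \<eta> * P e f (sh \<eta>) \<partial>gauss)"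
    using int by (subst Bochner_Integration.integral_sum) (auto intro!: sum.cong Bochner_Integration.integral_sum)
  also have "\<dots> = (\<Sum>e\<in>row_pairs m. \<Sum>f\<in>row_pairs m. (\<integral>\<eta>. P e f \<eta> \<partial>gauss)\<^sup>2)"
    unfolding sh_def by (intro sum.cong refl expectation_column_blocks am) (auto simp: P_def U_def intro!: arg_cong2[of _ _ _ _ times] gram_mat_prod_cong)
  also have "\<dots> = (\<Sum>(i, j)\<in>row_pairs m. \<Sum>(k, l)\<in>row_pairs m. ((real N)\<^sup>2 * (gram n B i j * gram n B k l) + real N * gram_cov n B i j k l)\<^sup>2)"
    unfolding P_def U_def expectation_gram_mat_prod(2)[OF N] split_beta ..
  finally show ?thesis .
qed

lemma sum_row_pairs: "(\<Sum>e\<in>row_pairs m. f e) = (\<Sum>i<m. \<Sum>j=m..<2 * m. f (i, j))"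
  unfolding row_pairs_def by (simp add: sum.cartesian_product split_beta)

lemma sum_row_pairs_pairs:
  fixes b x y :: real
  shows "(\<Sum>(i, j)\<in>row_pairs m. \<Sum>(k, l)\<in>row_pairs m. b + (if i = k then x else 0) + (if j = l then x else 0) + (if i = k \<and> j = l then y else 0))
    = real m ^ 4 * b + 2 * real m ^ 3 * x + real m ^ 2 * y"
proof -
  have "(\<Sum>(k, l)\<in>row_pairs m. b + (if i = k then x else 0) + (if j = l then x else 0) + (if i = k \<and> j = l then y else 0))
      = real m ^ 2 * b + 2 * real m * x + y" if e: "(i, j) \<in> row_pairs m" for i j
  proof -
    have ij: "i < m" "j \<in> {m..<2 * m}" using e by (auto simp: row_pairs_def)
    have "(\<Sum>(k, l)\<in>row_pairs m. (if i = k then x else 0)) = real m * x"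
      unfolding sum_row_pairs using ij by (simp add: sum_distrib_left[symmetric])
    moreover have "(\<Sum>(k, l)\<in>row_pairs m. (if j = l then x else 0)) = real m * x"
      unfolding sum_row_pairs using ij by simp
    moreover have "(\<Sum>(k, l)\<in>row_pairs m. (if i = k \<and> j = l then y else 0)) = y"
    proof -
      have "(\<Sum>(k, l)\<in>row_pairs m. (if i = k \<and> j = l then y else 0)) = (\<Sum>f\<in>row_pairs m. if (i, j) = f then y else 0)"
        by (intro sum.cong refl) (simp add: split_beta prod_eq_iff)
      also have "\<dots> = y" using e by (simp add: row_pairs_def)
      finally show ?thesis .
    qed
    moreover have "(\<Sum>(k, l)\<in>row_pairs m. b) = real m ^ 2 * b"
      unfolding sum_row_pairs by (simp add: power2_eq_square)
    ultimately show ?thesis by (simp add: sum.distrib split_beta)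
  qed
  then have "(\<Sum>(i, j)\<in>row_pairs m. \<Sum>(k, l)\<in>row_pairs m. b + (if i = k then x else 0) + (if j = l then x else 0) + (if i = k \<and> j = l then y else 0))
      = (\<Sum>(i, j)\<in>row_pairs m. real m ^ 2 * b + 2 * real m * x + y)"
    by (intro sum.cong refl) (auto split: prod.splits)
  also have "\<dots> = real m ^ 4 * b + 2 * real m ^ 3 * x + real m ^ 2 * y"
    unfolding sum_row_pairs by (simp add: power2_eq_square power3_eq_cube power4_eq_xxxx algebra_simps)
  finally show ?thesis .
qed


section \<open>Mean and second moment of the statistic\<close>

lemma all_moments_prefix_stat:
  "all_moments gauss (\<lambda>\<omega>. cross_stat m N (mat_prod (d k) (prefix_product d k \<omega>) (layer (Suc k) \<omega>)))"
  unfolding mat_prod_def split_beta'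
  by (intro all_moments_cross_stat all_moments_intros all_moments_layer all_moments_prefix_product)

text \<open>
  For pairs that share an index; the weight \<open>c\<close> balances a diagonal entry \<open>x\<close>
  against an off-diagonal entry \<open>y\<close>.
\<close>

lemma overlap_bound:
  fixes a b x y z w c N :: real
  assumes c: "c > 0"
  shows "(N\<^sup>2 * (a * b) + N * (x * y + z * w))\<^sup>2 \<le> N ^ 4 * (a ^ 4 + b ^ 4) + 2 * N\<^sup>2 * (c * x ^ 4 + y ^ 4 / c + z ^ 4 + w ^ 4)"
proof -
  have square_sum: "(u + v)\<^sup>2 \<le> 2 * u\<^sup>2 + 2 * v\<^sup>2" for u v :: real
    using sum_squares_bound[of u v] by (simp add: power2_sum)
  have prod: "2 * (u * v)\<^sup>2 \<le> u ^ 4 + v ^ 4" for u v :: real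
    using sum_squares_bound[of "u\<^sup>2" "v\<^sup>2"] by (simp add: power_mult_distrib power_mult[symmetric])
  have weighted: "2 * (x * y)\<^sup>2 \<le> c * x ^ 4 + y ^ 4 / c"
  proof -
    have "0 \<le> (c * x\<^sup>2 - y\<^sup>2)\<^sup>2 / c" using c by simp
    also have "\<dots> = c * x ^ 4 + y ^ 4 / c - 2 * (x * y)\<^sup>2"
      using c by (simp add: power2_eq_square power4_eq_xxxx field_simps)
    finally show ?thesis by simp
  qed
  have "(N\<^sup>2 * (a * b) + N * (x * y + z * w))\<^sup>2 \<le> 2 * (N\<^sup>2 * (a * b))\<^sup>2 + 2 * (N * (x * y + z * w))\<^sup>2"
    by (rule square_sum)
  also have "\<dots> = N ^ 4 * (2 * (a * b)\<^sup>2) + 2 * N\<^sup>2 * (x * y + z * w)\<^sup>2"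
    by (simp add: power_mult_distrib power_mult[symmetric])
  also have "\<dots> \<le> N ^ 4 * (a ^ 4 + b ^ 4) + 2 * N\<^sup>2 * ((c * x ^ 4 + y ^ 4 / c) + (z ^ 4 + w ^ 4))"
  proof (intro add_mono mult_left_mono prod)
    have "(x * y + z * w)\<^sup>2 \<le> 2 * (x * y)\<^sup>2 + 2 * (z * w)\<^sup>2" by (rule square_sum)
    also have "\<dots> \<le> (c * x ^ 4 + y ^ 4 / c) + (z ^ 4 + w ^ 4)" by (intro add_mono weighted prod)
    finally show "(x * y + z * w)\<^sup>2 \<le> (c * x ^ 4 + y ^ 4 / c) + (z ^ 4 + w ^ 4)" .
  qed simp_all
  finally show ?thesis by (simp add: add.assoc)
qed

text \<open>
  For pairs without a common index; the main term keeps the constant 1.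
\<close>

lemma disjoint_bound:
  fixes a b x y z w N :: real
  assumes N: "N \<ge> 1"
  shows "(N\<^sup>2 * (a * b) + N * (x * y + z * w))\<^sup>2 \<le>
    N ^ 4 * (a * a * b * b) + N ^ 3 * (2 * (x ^ 4 + y ^ 4 + z ^ 4 + w ^ 4) + (a ^ 4 + b ^ 4))"
proof -
  define \<kappa> where "\<kappa> = x * y + z * w"
  have prod: "2 * (u * v)\<^sup>2 \<le> u ^ 4 + v ^ 4" for u v :: real
    using sum_squares_bound[of "u\<^sup>2" "v\<^sup>2"] by (simp add: power_mult_distrib power_mult[symmetric])
  have \<kappa>: "\<kappa>\<^sup>2 \<le> x ^ 4 + y ^ 4 + z ^ 4 + w ^ 4"
  proof -
    have "\<kappa>\<^sup>2 \<le> 2 * (x * y)\<^sup>2 + 2 * (z * w)\<^sup>2"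
      using sum_squares_bound[of "x * y" "z * w"] by (simp add: \<kappa>_def power2_sum)
    also have "\<dots> \<le> (x ^ 4 + y ^ 4) + (z ^ 4 + w ^ 4)" by (intro add_mono prod)
    finally show ?thesis by (simp add: add.assoc)
  qed
  have ab: "(a * b)\<^sup>2 \<le> a ^ 4 + b ^ 4" using prod[of a b] zero_le_power2[of "a * b"] by argo
  have "N\<^sup>2 \<le> N ^ 3" using N by (intro power_increasing) auto
  then have N23: "N\<^sup>2 * \<kappa>\<^sup>2 \<le> N ^ 3 * \<kappa>\<^sup>2" by (intro mult_right_mono) auto
  have "(N\<^sup>2 * (a * b) + N * \<kappa>)\<^sup>2 = N ^ 4 * (a * a * b * b) + N ^ 3 * (2 * (a * b) * \<kappa>) + N\<^sup>2 * \<kappa>\<^sup>2"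
    by (simp add: power2_eq_square power3_eq_cube power4_eq_xxxx algebra_simps)
  also have "\<dots> \<le> N ^ 4 * (a * a * b * b) + N ^ 3 * ((a * b)\<^sup>2 + \<kappa>\<^sup>2) + N ^ 3 * \<kappa>\<^sup>2"
    using sum_squares_bound[of "a * b" \<kappa>] N by (intro add_mono[OF add_mono[OF order_refl mult_left_mono] N23]) auto
  also have "\<dots> = N ^ 4 * (a * a * b * b) + N ^ 3 * (2 * \<kappa>\<^sup>2 + (a * b)\<^sup>2)"
    by (simp add: algebra_simps)
  also have "\<dots> \<le> N ^ 4 * (a * a * b * b) + N ^ 3 * (2 * (x ^ 4 + y ^ 4 + z ^ 4 + w ^ 4) + (a ^ 4 + b ^ 4))"
    using N by (intro add_mono[OF order_refl mult_left_mono] add_mono mult_left_mono \<kappa> ab) auto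
  finally show ?thesis by (simp add: \<kappa>_def)
qed

context
  fixes d :: "nat \<Rightarrow> nat" and K m N :: nat
  assumes pos: "\<And>i. i \<le> K \<Longrightarrow> d i > 0" and N: "N > 0" and m: "2 * m \<le> d 0"
begin

abbreviation stat :: "layers \<Rightarrow> real" where
  "stat \<omega> \<equiv> cross_stat m N (mat_prod (d K) (prefix_product d K \<omega>) (layer (Suc K) \<omega>))"

lemma row_pairs_less: "(i, j) \<in> row_pairs m \<Longrightarrow> i < d 0 \<and> j < d 0 \<and> i \<noteq> j"
  using m by (auto simp: row_pairs_def)

lemma expectation_stat_ge: "(real m)\<^sup>2 * (real N)\<^sup>2 * off_level d K \<le> (\<integral>\<omega>. stat \<omega> \<partial>gauss)"
proof -
  let ?S = "prefix_gram d K"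
  have int: "integrable gauss (\<lambda>\<omega>. (real N * ?S \<omega> i j)\<^sup>2)" for i j
    by (intro all_moments_integrable all_moments_intros all_moments_prefix_gram)
  have "(real m)\<^sup>2 * (real N)\<^sup>2 * off_level d K = (\<Sum>(i, j)\<in>row_pairs m. (real N)\<^sup>2 * off_level d K)"
    unfolding sum_row_pairs by (simp add: power2_eq_square)
  also have "\<dots> \<le> (\<Sum>(i, j)\<in>row_pairs m. \<integral>\<omega>. (real N * ?S \<omega> i j)\<^sup>2 \<partial>gauss)"
  proof (intro sum_mono, clarify)
    fix i j assume e: "(i, j) \<in> row_pairs m"
    have "off_level d K \<le> (\<integral>\<omega>. ?S \<omega> i j * ?S \<omega> i j \<partial>gauss)"
      using prefix_gram_second[where d = d and K = K, OF pos order_refl] row_pairs_less[OF e] by blast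
    then have "(real N)\<^sup>2 * off_level d K \<le> (real N)\<^sup>2 * (\<integral>\<omega>. ?S \<omega> i j * ?S \<omega> i j \<partial>gauss)" by (intro mult_left_mono) auto
    then show "(real N)\<^sup>2 * off_level d K \<le> (\<integral>\<omega>. (real N * ?S \<omega> i j)\<^sup>2 \<partial>gauss)"
      by (simp add: power_mult_distrib power2_eq_square[of "prefix_gram d K _ i j"])
  qed
  also have "\<dots> = (\<integral>\<omega>. (\<Sum>(i, j)\<in>row_pairs m. (real N * ?S \<omega> i j)\<^sup>2) \<partial>gauss)"
    using int by (subst Bochner_Integration.integral_sum) (auto simp: split_beta)
  also have "\<dots> = (\<integral>\<omega>. (\<integral>\<eta>. cross_stat m N (mat_prod (d K) (prefix_product d K \<omega>) \<eta>) \<partial>gauss) \<partial>gauss)"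
    unfolding expectation_cross_stat[OF N] prefix_gram_def ..
  also have "\<dots> = (\<integral>\<omega>. stat \<omega> \<partial>gauss)"
    by (rule expectation_next_layer(1)[symmetric, OF all_moments_integrable[OF all_moments_prefix_stat]])
  finally show ?thesis .
qed

text \<open>
  The conditional expectation of the product of the summands \<open>(i, j)\<close> and \<open>(k, l)\<close>
  of the statistic, given all layers but the last.
\<close>

definition pair_moment :: "nat \<Rightarrow> nat \<Rightarrow> nat \<Rightarrow> nat \<Rightarrow> layers \<Rightarrow> real" where
  "pair_moment i j k l \<omega> = ((real N)\<^sup>2 * (prefix_gram d K \<omega> i j * prefix_gram d K \<omega> k l)
     + real N * (prefix_gram d K \<omega> i k * prefix_gram d K \<omega> j l + prefix_gram d K \<omega> i l * prefix_gram d K \<omega> j k))\<^sup>2"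

lemma all_moments_pair_moment: "all_moments gauss (pair_moment i j k l)"
  unfolding pair_moment_def[abs_def] by (intro all_moments_intros all_moments_prefix_gram)

lemma expectation_stat_square:
  "(\<integral>\<omega>. (stat \<omega>)\<^sup>2 \<partial>gauss) = (\<Sum>(i, j)\<in>row_pairs m. \<Sum>(k, l)\<in>row_pairs m. \<integral>\<omega>. pair_moment i j k l \<omega> \<partial>gauss)"
proof -
  have int: "integrable gauss (pair_moment i j k l)" for i j k l
    by (rule all_moments_integrable[OF all_moments_pair_moment])
  have int2: "integrable gauss (\<lambda>\<omega>. \<Sum>f\<in>row_pairs m. pair_moment i j (fst f) (snd f) \<omega>)" for i j
    using int by (rule Bochner_Integration.integrable_sum)
  have "(\<integral>\<omega>. (stat \<omega>)\<^sup>2 \<partial>gauss) =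
      (\<integral>\<omega>. (\<integral>\<eta>. (cross_stat m N (mat_prod (d K) (prefix_product d K \<omega>) \<eta>))\<^sup>2 \<partial>gauss) \<partial>gauss)"
    by (rule expectation_next_layer(1)[OF all_moments_integrable[OF all_moments_power[OF all_moments_prefix_stat]]])
  also have "\<dots> = (\<integral>\<omega>. (\<Sum>e\<in>row_pairs m. \<Sum>f\<in>row_pairs m. pair_moment (fst e) (snd e) (fst f) (snd f) \<omega>) \<partial>gauss)"
    unfolding expectation_cross_stat_square[OF N] pair_moment_def prefix_gram_def gram_cov_def split_beta ..
  also have "\<dots> = (\<Sum>e\<in>row_pairs m. \<Sum>f\<in>row_pairs m. \<integral>\<omega>. pair_moment (fst e) (snd e) (fst f) (snd f) \<omega> \<partial>gauss)"
    using int int2 by (subst Bochner_Integration.integral_sum) (auto intro!: sum.cong Bochner_Integration.integral_sum)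
  finally show ?thesis by (simp only: split_beta')
qed

context
  fixes \<tau> \<sigma> :: real
  assumes \<tau>: "0 < \<tau>" "\<tau> \<le> 1" and \<sigma>: "inv_sum d K = \<sigma>" "\<sigma> = \<tau> * \<tau>"
begin

lemma fourth_le:
  assumes "i < d 0" "j < d 0"
  shows "(\<integral>\<omega>. prefix_gram d K \<omega> i i ^ 4 \<partial>gauss) \<le> growth ^ K"
    and "i \<noteq> j \<Longrightarrow> (\<integral>\<omega>. prefix_gram d K \<omega> i j ^ 4 \<partial>gauss) \<le> growth ^ K * \<sigma>\<^sup>2"
  using prefix_gram_fourth[where d = d and K = K, OF pos order_refl] assms \<sigma>(1) by auto

lemma expectation_pair_moment_overlap:
  assumes c: "c > 0" and perm: "\<And>\<omega>. prefix_gram d K \<omega> i k * prefix_gram d K \<omega> j l + prefix_gram d K \<omega> i l * prefix_gram d K \<omega> j k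
      = X \<omega> * Y \<omega> + Z \<omega> * W \<omega>"
    and am: "all_moments gauss X" "all_moments gauss Y" "all_moments gauss Z" "all_moments gauss W"
    and le: "(\<integral>\<omega>. prefix_gram d K \<omega> i j ^ 4 \<partial>gauss) \<le> s" "(\<integral>\<omega>. prefix_gram d K \<omega> k l ^ 4 \<partial>gauss) \<le> s"
      "(\<integral>\<omega>. X \<omega> ^ 4 \<partial>gauss) \<le> x" "(\<integral>\<omega>. Y \<omega> ^ 4 \<partial>gauss) \<le> y" "(\<integral>\<omega>. Z \<omega> ^ 4 \<partial>gauss) \<le> s" "(\<integral>\<omega>. W \<omega> ^ 4 \<partial>gauss) \<le> s"
  shows "(\<integral>\<omega>. pair_moment i j k l \<omega> \<partial>gauss) \<le> real N ^ 4 * (s + s) + 2 * (real N)\<^sup>2 * (c * x + y / c + s + s)"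
proof -
  let ?S = "prefix_gram d K"
  note am' = am all_moments_prefix_gram
  have i: "integrable gauss (\<lambda>\<omega>. ?S \<omega> i j ^ 4)" "integrable gauss (\<lambda>\<omega>. ?S \<omega> k l ^ 4)" "integrable gauss (\<lambda>\<omega>. X \<omega> ^ 4)"
      "integrable gauss (\<lambda>\<omega>. Y \<omega> ^ 4)" "integrable gauss (\<lambda>\<omega>. Z \<omega> ^ 4)" "integrable gauss (\<lambda>\<omega>. W \<omega> ^ 4)"
    by (intro all_moments_integrable all_moments_power am')+
  have "(\<integral>\<omega>. pair_moment i j k l \<omega> \<partial>gauss) \<le> (\<integral>\<omega>. real N ^ 4 * (?S \<omega> i j ^ 4 + ?S \<omega> k l ^ 4)
      + 2 * (real N)\<^sup>2 * (c * X \<omega> ^ 4 + Y \<omega> ^ 4 / c + Z \<omega> ^ 4 + W \<omega> ^ 4) \<partial>gauss)"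
  proof (intro integral_mono)
    show "integrable gauss (pair_moment i j k l)" by (rule all_moments_integrable[OF all_moments_pair_moment])
    show "integrable gauss (\<lambda>\<omega>. real N ^ 4 * (?S \<omega> i j ^ 4 + ?S \<omega> k l ^ 4)
      + 2 * (real N)\<^sup>2 * (c * X \<omega> ^ 4 + Y \<omega> ^ 4 / c + Z \<omega> ^ 4 + W \<omega> ^ 4))"
      by (intro all_moments_integrable all_moments_intros am')
    show "pair_moment i j k l \<omega> \<le> real N ^ 4 * (?S \<omega> i j ^ 4 + ?S \<omega> k l ^ 4)
      + 2 * (real N)\<^sup>2 * (c * X \<omega> ^ 4 + Y \<omega> ^ 4 / c + Z \<omega> ^ 4 + W \<omega> ^ 4)" for \<omega>
      unfolding pair_moment_def perm by (rule overlap_bound[OF c])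
  qed
  also have "\<dots> = real N ^ 4 * ((\<integral>\<omega>. ?S \<omega> i j ^ 4 \<partial>gauss) + (\<integral>\<omega>. ?S \<omega> k l ^ 4 \<partial>gauss))
      + 2 * (real N)\<^sup>2 * (c * (\<integral>\<omega>. X \<omega> ^ 4 \<partial>gauss) + (\<integral>\<omega>. Y \<omega> ^ 4 \<partial>gauss) / c + (\<integral>\<omega>. Z \<omega> ^ 4 \<partial>gauss) + (\<integral>\<omega>. W \<omega> ^ 4 \<partial>gauss))"
    using i by simp
  also have "\<dots> \<le> real N ^ 4 * (s + s) + 2 * (real N)\<^sup>2 * (c * x + y / c + s + s)"
    using c by (intro add_mono mult_left_mono divide_right_mono le) auto
  finally show ?thesis .
qed

lemma expectation_pair_moment_disjoint:
  assumes e: "(i, j) \<in> row_pairs m" "(k, l) \<in> row_pairs m" and ne: "i \<noteq> k" "j \<noteq> l"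
  shows "(\<integral>\<omega>. pair_moment i j k l \<omega> \<partial>gauss) \<le>
    real N ^ 4 * ((off_level d K)\<^sup>2 + growth ^ K * \<tau> * \<sigma>\<^sup>2) + real N ^ 3 * (10 * (growth ^ K * \<sigma>\<^sup>2))"
proof -
  let ?S = "prefix_gram d K"
  have lt: "i < d 0" "j < d 0" "k < d 0" "l < d 0" using row_pairs_less[OF e(1)] row_pairs_less[OF e(2)] by auto
  have dist: "distinct [i, j, k, l]" using e ne by (auto simp: row_pairs_def)
  have i: "integrable gauss (\<lambda>\<omega>. ?S \<omega> i j ^ 4)" for i j
    by (intro all_moments_integrable all_moments_power all_moments_prefix_gram)
  have u: "integrable gauss (\<lambda>\<omega>. ?S \<omega> i j * ?S \<omega> i j * ?S \<omega> k l * ?S \<omega> k l)"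
    by (intro all_moments_integrable all_moments_mult all_moments_prefix_gram)
  have "(\<integral>\<omega>. pair_moment i j k l \<omega> \<partial>gauss) \<le> (\<integral>\<omega>. real N ^ 4 * (?S \<omega> i j * ?S \<omega> i j * ?S \<omega> k l * ?S \<omega> k l)
      + real N ^ 3 * (2 * (?S \<omega> i k ^ 4 + ?S \<omega> j l ^ 4 + ?S \<omega> i l ^ 4 + ?S \<omega> j k ^ 4) + (?S \<omega> i j ^ 4 + ?S \<omega> k l ^ 4)) \<partial>gauss)"
  proof (intro integral_mono)
    show "integrable gauss (pair_moment i j k l)" by (rule all_moments_integrable[OF all_moments_pair_moment])
    show "integrable gauss (\<lambda>\<omega>. real N ^ 4 * (?S \<omega> i j * ?S \<omega> i j * ?S \<omega> k l * ?S \<omega> k l)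
      + real N ^ 3 * (2 * (?S \<omega> i k ^ 4 + ?S \<omega> j l ^ 4 + ?S \<omega> i l ^ 4 + ?S \<omega> j k ^ 4) + (?S \<omega> i j ^ 4 + ?S \<omega> k l ^ 4)))"
      by (intro all_moments_integrable all_moments_intros all_moments_prefix_gram)
    show "pair_moment i j k l \<omega> \<le> real N ^ 4 * (?S \<omega> i j * ?S \<omega> i j * ?S \<omega> k l * ?S \<omega> k l)
      + real N ^ 3 * (2 * (?S \<omega> i k ^ 4 + ?S \<omega> j l ^ 4 + ?S \<omega> i l ^ 4 + ?S \<omega> j k ^ 4) + (?S \<omega> i j ^ 4 + ?S \<omega> k l ^ 4))" for \<omega>
      unfolding pair_moment_def by (rule disjoint_bound) (use N in simp)
  qed
  also have "\<dots> = real N ^ 4 * (\<integral>\<omega>. ?S \<omega> i j * ?S \<omega> i j * ?S \<omega> k l * ?S \<omega> k l \<partial>gauss)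
      + real N ^ 3 * (2 * ((\<integral>\<omega>. ?S \<omega> i k ^ 4 \<partial>gauss) + (\<integral>\<omega>. ?S \<omega> j l ^ 4 \<partial>gauss) + (\<integral>\<omega>. ?S \<omega> i l ^ 4 \<partial>gauss) + (\<integral>\<omega>. ?S \<omega> j k ^ 4 \<partial>gauss))
        + ((\<integral>\<omega>. ?S \<omega> i j ^ 4 \<partial>gauss) + (\<integral>\<omega>. ?S \<omega> k l ^ 4 \<partial>gauss)))"
    using i u by simp
  also have "\<dots> \<le> real N ^ 4 * (off_level d K * off_level d K + growth ^ K * \<tau> * \<sigma> * inv_sum d K)
      + real N ^ 3 * (2 * (growth ^ K * \<sigma>\<^sup>2 + growth ^ K * \<sigma>\<^sup>2 + growth ^ K * \<sigma>\<^sup>2 + growth ^ K * \<sigma>\<^sup>2) + (growth ^ K * \<sigma>\<^sup>2 + growth ^ K * \<sigma>\<^sup>2))"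
  proof (intro add_mono mult_left_mono fourth_le(2) lt)
    show "(\<integral>\<omega>. ?S \<omega> i j * ?S \<omega> i j * ?S \<omega> k l * ?S \<omega> k l \<partial>gauss) \<le> off_level d K * off_level d K + growth ^ K * \<tau> * \<sigma> * inv_sum d K"
      using prefix_gram_mixed[where d = d and K = K, OF pos order_refl \<tau> \<sigma>] lt dist by blast
  qed (use dist in auto)
  finally show ?thesis by (simp add: \<sigma>(1) power2_eq_square algebra_simps)
qed

text \<open>
  A shared index puts one diagonal Gram entry into the covariance, which costs one of the two factors
  \<open>\<sigma>\<close>; equal pairs put in two diagonal entries, which costs both. The number of such pairs
  of pairs is smaller by a factor \<open>m\<close> for each shared index, see
  \<open>sum_row_pairs_pairs\<close>.
\<close>

lemma expectation_pair_moment_le: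
  assumes e: "(i, j) \<in> row_pairs m" "(k, l) \<in> row_pairs m"
  defines "b \<equiv> real N ^ 4 * ((off_level d K)\<^sup>2 + growth ^ K * \<tau> * \<sigma>\<^sup>2) + real N ^ 3 * (10 * (growth ^ K * \<sigma>\<^sup>2))"
    and "x \<equiv> 2 * real N ^ 4 * (growth ^ K * \<sigma>\<^sup>2) + 8 * (real N)\<^sup>2 * (growth ^ K * \<sigma>)"
    and "y \<equiv> 8 * (real N)\<^sup>2 * growth ^ K"
  shows "(\<integral>\<omega>. pair_moment i j k l \<omega> \<partial>gauss) \<le>
    b + (if i = k then x else 0) + (if j = l then x else 0) + (if i = k \<and> j = l then y else 0)"
proof -
  let ?S = "prefix_gram d K"
  define H where "H = growth ^ K"
  have lt: "i < d 0" "j < d 0" "k < d 0" "l < d 0" using row_pairs_less[OF e(1)] row_pairs_less[OF e(2)] by auto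
  have ne: "i \<noteq> j" "k \<noteq> l" "i \<noteq> l" "j \<noteq> k" using e by (auto simp: row_pairs_def)
  have H0: "0 \<le> H" by (simp add: H_def)
  have \<sigma>01: "0 < \<sigma>" "\<sigma> \<le> 1" using \<tau> \<sigma>(2) by (simp_all add: mult_le_one)
  have \<sigma>\<sigma>: "H * \<sigma>\<^sup>2 \<le> H * \<sigma>" "H * \<sigma>\<^sup>2 \<le> H"
    using \<sigma>01 H0 by (auto simp: power2_eq_square mult_left_le mult_le_one intro!: mult_left_mono)
  have b0: "0 \<le> b" unfolding b_def using \<tau> \<sigma>01 by (intro add_nonneg_nonneg mult_nonneg_nonneg) auto
  have x0: "2 * real N ^ 4 * (H * \<sigma>\<^sup>2) \<le> x" unfolding x_def H_def using \<sigma>01 by simp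
  have x0': "0 \<le> x" unfolding x_def using \<sigma>01 by simp
  have diag: "(\<integral>\<omega>. ?S \<omega> a a ^ 4 \<partial>gauss) \<le> H" if "a < d 0" for a using fourth_le(1)[OF that that] by (simp add: H_def)
  have off: "(\<integral>\<omega>. ?S \<omega> a c ^ 4 \<partial>gauss) \<le> H * \<sigma>\<^sup>2" if "a < d 0" "c < d 0" "a \<noteq> c" for a c
    using fourth_le(2)[OF that] by (simp add: H_def)
  note am = all_moments_prefix_gram
  have sh: "real N ^ 4 * (H * \<sigma>\<^sup>2 + H * \<sigma>\<^sup>2) + 2 * (real N)\<^sup>2 * (\<sigma> * H + (H * \<sigma>\<^sup>2) / \<sigma> + H * \<sigma>\<^sup>2 + H * \<sigma>\<^sup>2) \<le> x"
  proof -
    have "2 * (real N)\<^sup>2 * (\<sigma> * H + (H * \<sigma>\<^sup>2) / \<sigma> + H * \<sigma>\<^sup>2 + H * \<sigma>\<^sup>2) \<le> 2 * (real N)\<^sup>2 * (H * \<sigma> + H * \<sigma> + H * \<sigma> + H * \<sigma>)"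
      using \<sigma>01 \<sigma>\<sigma> H0 by (intro mult_left_mono add_mono) (simp_all add: power2_eq_square)
    then show ?thesis by (simp add: x_def H_def algebra_simps)
  qed
  consider "i \<noteq> k" "j \<noteq> l" | "i = k" "j \<noteq> l" | "i \<noteq> k" "j = l" | "i = k" "j = l" by blast
  then show ?thesis
  proof cases
    case 1
    then show ?thesis using expectation_pair_moment_disjoint[OF e 1] by (simp add: b_def)
  next
    case 2
    have "(\<integral>\<omega>. pair_moment i j k l \<omega> \<partial>gauss) \<le>
        real N ^ 4 * (H * \<sigma>\<^sup>2 + H * \<sigma>\<^sup>2) + 2 * (real N)\<^sup>2 * (\<sigma> * H + (H * \<sigma>\<^sup>2) / \<sigma> + H * \<sigma>\<^sup>2 + H * \<sigma>\<^sup>2)"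
      by (rule expectation_pair_moment_overlap[where X = "\<lambda>\<omega>. ?S \<omega> i i" and Y = "\<lambda>\<omega>. ?S \<omega> j l" and Z = "\<lambda>\<omega>. ?S \<omega> i l" and W = "\<lambda>\<omega>. ?S \<omega> j k"])
        (use 2 lt ne \<sigma>01 in \<open>auto intro: am diag off\<close>)
    then show ?thesis using 2 b0 sh by simp
  next
    case 3
    have "(\<integral>\<omega>. pair_moment i j k l \<omega> \<partial>gauss) \<le>
        real N ^ 4 * (H * \<sigma>\<^sup>2 + H * \<sigma>\<^sup>2) + 2 * (real N)\<^sup>2 * (\<sigma> * H + (H * \<sigma>\<^sup>2) / \<sigma> + H * \<sigma>\<^sup>2 + H * \<sigma>\<^sup>2)"
      by (rule expectation_pair_moment_overlap[where X = "\<lambda>\<omega>. ?S \<omega> j j" and Y = "\<lambda>\<omega>. ?S \<omega> i k" and Z = "\<lambda>\<omega>. ?S \<omega> i l" and W = "\<lambda>\<omega>. ?S \<omega> j k"])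
        (use 3 lt ne \<sigma>01 in \<open>auto intro: am diag off\<close>)
    then show ?thesis using 3 b0 sh by simp
  next
    case 4
    have "(\<integral>\<omega>. pair_moment i j k l \<omega> \<partial>gauss) \<le>
        real N ^ 4 * (H * \<sigma>\<^sup>2 + H * \<sigma>\<^sup>2) + 2 * (real N)\<^sup>2 * (1 * H + H / 1 + H * \<sigma>\<^sup>2 + H * \<sigma>\<^sup>2)"
      by (rule expectation_pair_moment_overlap[where X = "\<lambda>\<omega>. ?S \<omega> i i" and Y = "\<lambda>\<omega>. ?S \<omega> j j" and Z = "\<lambda>\<omega>. ?S \<omega> i l" and W = "\<lambda>\<omega>. ?S \<omega> j k"])
        (use 4 lt ne \<sigma>01 in \<open>auto intro: am diag off\<close>)
    also have "\<dots> \<le> 2 * real N ^ 4 * (H * \<sigma>\<^sup>2) + 2 * (real N)\<^sup>2 * (1 * H + H / 1 + H + H)"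
      using \<sigma>\<sigma> by (intro add_mono mult_left_mono) auto
    also have "\<dots> \<le> x + y" using x0 by (simp add: y_def H_def)
    finally show ?thesis using 4 b0 x0' by simp
  qed
qed

lemma expectation_stat_square_le:
  "(\<integral>\<omega>. (stat \<omega>)\<^sup>2 \<partial>gauss) \<le>
    real m ^ 4 * (real N ^ 4 * ((off_level d K)\<^sup>2 + growth ^ K * \<tau> * \<sigma>\<^sup>2) + real N ^ 3 * (10 * (growth ^ K * \<sigma>\<^sup>2)))
    + 2 * real m ^ 3 * (2 * real N ^ 4 * (growth ^ K * \<sigma>\<^sup>2) + 8 * (real N)\<^sup>2 * (growth ^ K * \<sigma>))
    + real m ^ 2 * (8 * (real N)\<^sup>2 * growth ^ K)"
  unfolding expectation_stat_square sum_row_pairs_pairs[symmetric]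
  by (intro sum_mono, clarify, intro sum_mono, clarify) (rule expectation_pair_moment_le)

end

end

section \<open>The lower bound\<close>

lemma mat_scale_mat_prod_left: "mat_prod n (mat_scale c A) B = mat_scale c (mat_prod n A B)"
  by (auto simp: mat_prod_def mat_scale_def fun_eq_iff sum_distrib_left mult.assoc)

lemma mat_prod_identity:
  assumes "i < n"
  shows "mat_prod n (prefix_product d 0 \<omega>) B (i, t) = B (i, t)"
proof -
  have "mat_prod n (prefix_product d 0 \<omega>) B (i, t) = (\<Sum>s<n. if s = i then B (s, t) else 0)"
    unfolding mat_prod_def prod.case prefix_product.simps by (intro sum.cong refl) auto
  then show ?thesis using assms by simp
qed

text \<open>
  Matrix multiplication may start from the left as in \<open>prefix_product\<close> or from the right as in
  \<open>chain\<close>. The identity matrix is cut off after \<open>d 0\<close> rows, whence the condition on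
  \<open>i\<close>.
\<close>

lemma prefix_product_chain:
  assumes "i < d 0"
  shows "mat_prod (d k) (prefix_product d k \<omega>) (chain d j (Suc k) \<omega>) (i, t) = chain d (k + j) (Suc 0) \<omega> (i, t)"
proof (induction k arbitrary: j)
  case 0
  then show ?case using mat_prod_identity[OF assms] by simp
next
  case (Suc k)
  have "mat_prod (d (Suc k)) (prefix_product d (Suc k) \<omega>) (chain d j (Suc (Suc k)) \<omega>) =
      mat_prod (d k) (prefix_product d k \<omega>) (chain d (Suc j) (Suc k) \<omega>)"
    by (simp only: prefix_product.simps chain.simps mat_scale_mat_prod mat_scale_mat_prod_left mat_prod_assoc)
  then show ?case using Suc[of "Suc j"] by simp
qed

lemma block_cross_stat:
  assumes "2 * m \<le> p" "2 * N \<le> q"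
  shows "block p q (cross_stat m N)"
  unfolding block_def cross_stat_def
proof (intro allI impI sum.cong refl, clarify)
  fix W W' :: "nat \<times> nat \<Rightarrow> real" and i j
  assume eq: "\<forall>i<p. \<forall>k<q. W (i, k) = W' (i, k)" and e: "(i, j) \<in> row_pairs m"
  have "i < p" "j < p" using e assms by (auto simp: row_pairs_def)
  then have "W (i, t) = W' (i, t)" "W (j, t) = W' (j, t)" if "t < 2 * N" for t
    using eq that assms by auto
  then show "gram N W i j * gram N (\<lambda>(i, t). W (i, N + t)) i j = gram N W' i j * gram N (\<lambda>(i, t). W' (i, N + t)) i j"
    by (simp add: gram_def)
qed

definition exceeds :: "('a \<Rightarrow> real) \<Rightarrow> real \<Rightarrow> 'a \<Rightarrow> real" where
  "exceeds F \<theta> x = (if F x > \<theta> then 1 else 0)"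

lemma measurable_exceeds:
  assumes [measurable]: "F \<in> borel_measurable M"
  shows "exceeds F \<theta> \<in> borel_measurable M"
proof -
  have "(\<lambda>x. if F x > \<theta> then 1 else 0 :: real) \<in> borel_measurable M" by measurable
  then show ?thesis by (simp add: exceeds_def[abs_def])
qed

lemma test_le_tv_dist:
  fixes F :: "(nat \<times> nat \<Rightarrow> real) \<Rightarrow> real"
  assumes r: "r \<ge> 1" and d: "d 1 > 0" and F: "F \<in> borel_measurable gauss" and bl: "block (d 0) (d r) F"
  shows "(\<integral>\<omega>. exceeds F \<theta> (chain d (r - 1) 1 \<omega>) \<partial>gauss) - (\<integral>\<omega>. exceeds F \<theta> \<omega> \<partial>gauss) \<le>
    tv_dist (mat_borel (d 0) (d r)) (std_gaussian (chain_index r d)) (\<lambda>\<omega>. chain_product r d (chain_factor d \<omega>))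
      (std_gaussian ({..<d 0} \<times> {..<d r})) (scaled_gaussian (d 0) (d r) (d 1))"
proof -
  let ?B = "mat_borel (d 0) (d r)" and ?c = "1 / sqrt (real (d 1))"
  \<comment> \<open>The factor \<open>\<surd>d\<^sub>1\<close> undoes the final scaling.\<close>
  define entries where "entries A = (\<lambda>(i, t). if i < d 0 \<and> t < d r then sqrt (real (d 1)) * A $$ (i, t) else 0)" for A :: "real mat"
  define S where "S = {A \<in> space ?B. F (entries A) > \<theta>}"
  have "entries \<in> measurable ?B gauss"
  proof (rule measurable_into_gauss)
    fix x :: "nat \<times> nat"
    obtain i t where x: "x = (i, t)" by (cases x)
    have "(\<lambda>A. A $$ (i, t)) \<in> borel_measurable ?B" if "i < d 0" "t < d r"
      using measurable_mat_borel_entry[OF measurable_ident that] by simp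
    then show "(\<lambda>A. entries A x) \<in> borel_measurable ?B" unfolding x entries_def by (cases "i < d 0 \<and> t < d r") auto
  qed
  then have "(\<lambda>A. F (entries A)) \<in> borel_measurable ?B" by (rule measurable_compose[OF _ F])
  then have S: "S \<in> sets ?B" unfolding S_def by measurable
  have eq: "block_event ?c (d 0) (d r) S = exceeds F \<theta>"
  proof
    fix W :: "nat \<times> nat \<Rightarrow> real"
    have "F (entries (mat (d 0) (d r) (mat_scale ?c W))) = F W"
      using d by (intro blockD[OF bl]) (simp add: entries_def mat_scale_def)
    then show "block_event ?c (d 0) (d r) S W = exceeds F \<theta> W"
      by (simp add: block_event_def exceeds_def S_def indicator_def)
  qed
  let ?D = "\<lambda>S. \<bar>(\<integral>\<omega>. block_event ?c (d 0) (d r) S (chain d (r - 1) 1 \<omega>) \<partial>gauss) - (\<integral>\<omega>. block_event ?c (d 0) (d r) S \<omega> \<partial>gauss)\<bar>"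
  have "bdd_above (?D ` sets ?B)" by (intro bdd_aboveI[of _ 1]) (auto simp: block_event_diff_le_1)
  from cSUP_upper[OF S this] show ?thesis
    unfolding tv_dist_chain[where d = d, OF r] eq by linarith
qed

text \<open>
  Chebyshev's inequality on both sides: the first variable is rarely below half its mean, and the second is
  rarely above that threshold.
\<close>

lemma second_moment_test:
  fixes f :: "('i \<Rightarrow> real) \<Rightarrow> real" and g :: "('j \<Rightarrow> real) \<Rightarrow> real"
  assumes f: "all_moments gauss f" and g: "all_moments gauss g" and D: "(\<integral>\<omega>. f \<omega> \<partial>gauss) = D" "D > 0"
    and f2: "(\<integral>\<omega>. (f \<omega>)\<^sup>2 \<partial>gauss) \<le> (1 + \<delta>) * D\<^sup>2" and g2: "(\<integral>\<omega>. (g \<omega>)\<^sup>2 \<partial>gauss) \<le> \<epsilon> * D\<^sup>2"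
  shows "1 - 4 * \<delta> - 4 * \<epsilon> \<le> (\<integral>\<omega>. exceeds f (D / 2) \<omega> \<partial>gauss) - (\<integral>\<omega>. exceeds g (D / 2) \<omega> \<partial>gauss)"
proof -
  have indint: "integrable gauss (exceeds h \<theta>)" if "all_moments gauss h" for h :: "('k \<Rightarrow> real) \<Rightarrow> real" and \<theta>
    using measurable_exceeds[OF all_moments_measurable[OF that]]
    by (intro G.integrable_const_bound[of _ 1]) (auto simp: exceeds_def)
  have fi: "integrable gauss f" "integrable gauss (\<lambda>\<omega>. (f \<omega>)\<^sup>2)" "integrable gauss (\<lambda>\<omega>. (g \<omega>)\<^sup>2)"
    by (intro all_moments_integrable all_moments_power f g)+
  have "(\<integral>\<omega>. 1 - exceeds f (D / 2) \<omega> \<partial>gauss) \<le> (\<integral>\<omega>. 4 / D\<^sup>2 * ((f \<omega>)\<^sup>2 - 2 * D * f \<omega> + D\<^sup>2) \<partial>gauss)"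
  proof (intro integral_mono)
    show "integrable gauss (\<lambda>\<omega>. 1 - exceeds f (D / 2) \<omega>)" using indint[OF f] by simp
    show "integrable gauss (\<lambda>\<omega>. 4 / D\<^sup>2 * ((f \<omega>)\<^sup>2 - 2 * D * f \<omega> + D\<^sup>2))" using fi by simp
    fix \<omega>
    show "1 - exceeds f (D / 2) \<omega> \<le> 4 / D\<^sup>2 * ((f \<omega>)\<^sup>2 - 2 * D * f \<omega> + D\<^sup>2)"
    proof -
      have sq: "(f \<omega>)\<^sup>2 - 2 * D * f \<omega> + D\<^sup>2 = (D - f \<omega>)\<^sup>2" by (simp add: power2_diff)
      show ?thesis
      proof (cases "f \<omega> > D / 2")
        case True
        then show ?thesis unfolding sq by (simp add: exceeds_def)
      next
        case False
        then have "(D / 2)\<^sup>2 \<le> (D - f \<omega>)\<^sup>2" using D by (intro power_mono) auto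
        then show ?thesis unfolding sq using D False by (simp add: exceeds_def power_divide field_simps)
      qed
    qed
  qed
  also have "\<dots> = 4 / D\<^sup>2 * ((\<integral>\<omega>. (f \<omega>)\<^sup>2 \<partial>gauss) - 2 * D * D + D\<^sup>2)"
    using fi D(1) by simp
  also have "\<dots> \<le> 4 / D\<^sup>2 * ((1 + \<delta>) * D\<^sup>2 - 2 * D * D + D\<^sup>2)"
    by (intro mult_left_mono[OF add_right_mono[OF diff_right_mono[OF f2]]]) simp
  also have "\<dots> = 4 * \<delta>" using D by (simp add: field_simps power2_eq_square)
  finally have 1: "1 - (\<integral>\<omega>. exceeds f (D / 2) \<omega> \<partial>gauss) \<le> 4 * \<delta>" using indint[OF f] by simp
  have "(\<integral>\<omega>. exceeds g (D / 2) \<omega> \<partial>gauss) \<le> (\<integral>\<omega>. 4 / D\<^sup>2 * (g \<omega>)\<^sup>2 \<partial>gauss)"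
  proof (intro integral_mono)
    show "integrable gauss (exceeds g (D / 2))" using indint[OF g] .
    show "integrable gauss (\<lambda>\<omega>. 4 / D\<^sup>2 * (g \<omega>)\<^sup>2)" using fi by simp
    show "exceeds g (D / 2) \<omega> \<le> 4 / D\<^sup>2 * (g \<omega>)\<^sup>2" for \<omega>
    proof (cases "g \<omega> > D / 2")
      case True
      then have "(D / 2)\<^sup>2 \<le> (g \<omega>)\<^sup>2" using D by (intro power_mono) auto
      then show ?thesis using D True by (simp add: exceeds_def power_divide field_simps)
    qed (simp add: exceeds_def)
  qed
  also have "\<dots> = 4 / D\<^sup>2 * (\<integral>\<omega>. (g \<omega>)\<^sup>2 \<partial>gauss)" by simp
  also have "\<dots> \<le> 4 / D\<^sup>2 * (\<epsilon> * D\<^sup>2)" using g2 by (intro mult_left_mono) auto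
  also have "\<dots> = 4 * \<epsilon>" using D by simp
  finally show ?thesis using 1 by linarith
qed

text \<open>
  Written as the product of the identity matrix and a Gaussian matrix, the null case has an identity Gram
  matrix, which leaves only the summands with equal pairs.
\<close>

lemma expectation_null_stat_square:
  assumes N: "N > 0" and m: "2 * m \<le> p"
  shows "(\<integral>\<omega>. (cross_stat m N \<omega>)\<^sup>2 \<partial>gauss) = (real m)\<^sup>2 * (real N)\<^sup>2"
proof -
  define I where "I = prefix_product (\<lambda>_. p) 0 (\<lambda>_. 0)"
  have S: "gram p I i j = (if i = j then 1 else 0)" if "i < p" for i j
    using prefix_gram_0[of i "\<lambda>_. p" "\<lambda>_. 0" j] that by (simp add: prefix_gram_def I_def)
  have "cross_stat m N (mat_prod p I \<omega>) = cross_stat m N \<omega>" for \<omega>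
    using m mat_prod_identity[of _ p "\<lambda>_. p" "\<lambda>_. 0" \<omega>]
    by (intro blockD[OF block_cross_stat[OF order_refl order_refl]]) (simp add: I_def)
  then have "(\<integral>\<omega>. (cross_stat m N \<omega>)\<^sup>2 \<partial>gauss) = (\<integral>\<omega>. (cross_stat m N (mat_prod p I \<omega>))\<^sup>2 \<partial>gauss)" by simp
  also have "\<dots> = (\<Sum>(i, j)\<in>row_pairs m. \<Sum>(k, l)\<in>row_pairs m. ((real N)\<^sup>2 * (gram p I i j * gram p I k l) + real N * gram_cov p I i j k l)\<^sup>2)"
    by (rule expectation_cross_stat_square[OF N])
  also have "\<dots> = (\<Sum>(i, j)\<in>row_pairs m. \<Sum>(k, l)\<in>row_pairs m. 0 + (if i = k then 0 else 0) + (if j = l then 0 else 0) + (if i = k \<and> j = l then (real N)\<^sup>2 else 0))"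
  proof (intro sum.cong refl, clarify, intro sum.cong refl, clarify)
    fix i j k l assume e: "(i, j) \<in> row_pairs m" "(k, l) \<in> row_pairs m"
    then have "i < p" "j < p" "k < p" "i \<noteq> j" "k \<noteq> l" "i \<noteq> l" "j \<noteq> k" using m by (auto simp: row_pairs_def)
    then show "((real N)\<^sup>2 * (gram p I i j * gram p I k l) + real N * gram_cov p I i j k l)\<^sup>2 =
        0 + (if i = k then 0 else 0) + (if j = l then 0 else 0) + (if i = k \<and> j = l then (real N)\<^sup>2 else 0)"
      by (auto simp: gram_cov_def S)
  qed
  also have "\<dots> = (real m)\<^sup>2 * (real N)\<^sup>2" unfolding sum_row_pairs_pairs by simp
  finally show ?thesis .
qed

text \<open>
  The second moment of the statistic against its squared mean. Relative to \<open>m\<^sup>4 N\<^sup>4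
  \<sigma>\<^sup>2\<close>, the errors are \<open>H\<close> times \<open>\<tau>\<close>, \<open>1/N\<close>,
  \<open>1/m\<close>, \<open>1/(m N\<^sup>2 \<sigma>)\<close> and \<open>1/(m N \<sigma>)\<^sup>2\<close>, all
  of which are \<open>O(y)\<close>.
\<close>

lemma stat_variance_arith:
  fixes m N H \<tau> \<sigma> y \<alpha> D :: real
  assumes m: "m \<ge> 1" "1 \<le> 3 * y * m" and N: "N \<ge> 1" "1 \<le> 3 * y * N" and \<sigma>: "\<sigma> > 0" "1 \<le> 9 * y * (m * N * \<sigma>)" "\<sigma> \<le> \<alpha>"
    and \<tau>: "\<tau> \<le> y" and y: "0 < y" "y \<le> 1" and H: "H \<ge> 1" and D: "m\<^sup>2 * N\<^sup>2 * \<alpha> \<le> D"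
  shows "m ^ 4 * (N ^ 4 * (\<alpha>\<^sup>2 + H * \<tau> * \<sigma>\<^sup>2) + N ^ 3 * (10 * (H * \<sigma>\<^sup>2)))
      + 2 * m ^ 3 * (2 * N ^ 4 * (H * \<sigma>\<^sup>2) + 8 * N\<^sup>2 * (H * \<sigma>)) + m ^ 2 * (8 * N\<^sup>2 * H) \<le> (1 + 835 * (H * y)) * D\<^sup>2"
    and "m\<^sup>2 * N\<^sup>2 \<le> 81 * y * D\<^sup>2"
proof -
  define Q where "Q = m ^ 4 * N ^ 4 * \<sigma>\<^sup>2"
  have \<alpha>0: "0 < \<alpha>" using \<sigma> by linarith
  have D0: "m\<^sup>2 * N\<^sup>2 * \<sigma> \<le> D" using D mult_left_mono[OF \<sigma>(3), of "m\<^sup>2 * N\<^sup>2"] by simp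
  have QD: "Q \<le> D\<^sup>2"
  proof -
    have "(m\<^sup>2 * N\<^sup>2 * \<sigma>)\<^sup>2 \<le> D\<^sup>2" using D0 \<sigma>(1) by (intro power_mono) auto
    then show ?thesis by (simp add: Q_def power_mult_distrib power_mult[symmetric])
  qed
  have AD: "m ^ 4 * N ^ 4 * \<alpha>\<^sup>2 \<le> D\<^sup>2"
  proof -
    have "(m\<^sup>2 * N\<^sup>2 * \<alpha>)\<^sup>2 \<le> D\<^sup>2" using D \<alpha>0 by (intro power_mono) auto
    then show ?thesis by (simp add: power_mult_distrib power_mult[symmetric])
  qed
  have Q0: "0 \<le> Q" unfolding Q_def using \<sigma> by simp
  define z where "z = m * N * \<sigma>"
  have z0: "0 < z" unfolding z_def using m N \<sigma> by simp
  have z: "1 \<le> 9 * y * z" using \<sigma>(2) by (simp add: z_def)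
  have one_le: "v \<le> v * w" if "1 \<le> w" "0 \<le> v" for v w :: real using mult_left_mono[of 1 w v] that by simp
  have t1: "m ^ 4 * N ^ 4 * (H * \<tau> * \<sigma>\<^sup>2) \<le> H * y * Q"
  proof -
    have "m ^ 4 * N ^ 4 * (H * \<tau> * \<sigma>\<^sup>2) = H * Q * \<tau>" by (simp add: Q_def)
    also have "\<dots> \<le> H * Q * y" using \<tau> H Q0 by (intro mult_left_mono) auto
    finally show ?thesis by (simp add: mult_ac)
  qed
  have t2: "m ^ 4 * (N ^ 3 * (10 * (H * \<sigma>\<^sup>2))) \<le> 30 * (H * y * Q)"
  proof -
    have "m ^ 4 * (N ^ 3 * (10 * (H * \<sigma>\<^sup>2))) \<le> m ^ 4 * (N ^ 3 * (10 * (H * \<sigma>\<^sup>2))) * (3 * y * N)"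
      using m N H by (intro one_le) auto
    also have "\<dots> = 30 * (H * y * Q)" by (simp add: Q_def power4_eq_xxxx power3_eq_cube)
    finally show ?thesis .
  qed
  have t3: "4 * m ^ 3 * (N ^ 4 * (H * \<sigma>\<^sup>2)) \<le> 12 * (H * y * Q)"
  proof -
    have "4 * m ^ 3 * (N ^ 4 * (H * \<sigma>\<^sup>2)) \<le> 4 * m ^ 3 * (N ^ 4 * (H * \<sigma>\<^sup>2)) * (3 * y * m)"
      using m N H by (intro one_le) auto
    also have "\<dots> = 12 * (H * y * Q)" by (simp add: Q_def power4_eq_xxxx power3_eq_cube)
    finally show ?thesis .
  qed
  have t4: "16 * m ^ 3 * (N\<^sup>2 * (H * \<sigma>)) \<le> 144 * (H * y * Q)"
  proof -
    have "16 * m ^ 3 * (N\<^sup>2 * (H * \<sigma>)) \<le> 16 * m ^ 3 * (N\<^sup>2 * (H * \<sigma>)) * (9 * y * z)"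
      using m N H \<sigma> by (intro one_le z) auto
    also have "\<dots> \<le> 16 * m ^ 3 * (N\<^sup>2 * (H * \<sigma>)) * (9 * y * z) * N"
      using m N H \<sigma> y z0 by (intro one_le) auto
    also have "\<dots> = 144 * (H * y * Q)" by (simp add: Q_def z_def power4_eq_xxxx power3_eq_cube power2_eq_square)
    finally show ?thesis .
  qed
  have t5: "m\<^sup>2 * N\<^sup>2 \<le> 81 * (y * Q)"
  proof -
    have "m\<^sup>2 * N\<^sup>2 \<le> m\<^sup>2 * N\<^sup>2 * (9 * y * z)" by (intro one_le z) auto
    also have "\<dots> \<le> m\<^sup>2 * N\<^sup>2 * (9 * y * z) * (9 * y * z)" using y z0 by (intro one_le z) auto
    also have "\<dots> = 81 * (y * Q) * y" by (simp add: Q_def z_def power4_eq_xxxx power2_eq_square)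
    also have "\<dots> \<le> 81 * (y * Q) * 1" using y Q0 by (intro mult_left_mono) auto
    finally show ?thesis by simp
  qed
  have t6: "8 * H * (m\<^sup>2 * N\<^sup>2) \<le> 648 * (H * y * Q)"
    using mult_left_mono[OF t5, of "8 * H"] H by (simp add: mult_ac)
  have "m ^ 4 * (N ^ 4 * (\<alpha>\<^sup>2 + H * \<tau> * \<sigma>\<^sup>2) + N ^ 3 * (10 * (H * \<sigma>\<^sup>2)))
      + 2 * m ^ 3 * (2 * N ^ 4 * (H * \<sigma>\<^sup>2) + 8 * N\<^sup>2 * (H * \<sigma>)) + m ^ 2 * (8 * N\<^sup>2 * H)
      = m ^ 4 * N ^ 4 * \<alpha>\<^sup>2 + m ^ 4 * N ^ 4 * (H * \<tau> * \<sigma>\<^sup>2) + m ^ 4 * (N ^ 3 * (10 * (H * \<sigma>\<^sup>2)))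
        + 4 * m ^ 3 * (N ^ 4 * (H * \<sigma>\<^sup>2)) + 16 * m ^ 3 * (N\<^sup>2 * (H * \<sigma>)) + 8 * H * (m\<^sup>2 * N\<^sup>2)"
    by (simp add: algebra_simps)
  also have "\<dots> \<le> D\<^sup>2 + H * y * Q + 30 * (H * y * Q) + 12 * (H * y * Q) + 144 * (H * y * Q) + 648 * (H * y * Q)"
    by (intro add_mono AD t1 t2 t3 t4 t6)
  also have "\<dots> = D\<^sup>2 + 835 * (H * y) * Q" by simp
  also have "\<dots> \<le> D\<^sup>2 + 835 * (H * y) * D\<^sup>2" using H y by (intro add_mono mult_left_mono QD) auto
  finally show "m ^ 4 * (N ^ 4 * (\<alpha>\<^sup>2 + H * \<tau> * \<sigma>\<^sup>2) + N ^ 3 * (10 * (H * \<sigma>\<^sup>2)))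
      + 2 * m ^ 3 * (2 * N ^ 4 * (H * \<sigma>\<^sup>2) + 8 * N\<^sup>2 * (H * \<sigma>)) + m ^ 2 * (8 * N\<^sup>2 * H) \<le> (1 + 835 * (H * y)) * D\<^sup>2"
    by (simp add: distrib_right)
  have "81 * (y * Q) \<le> 81 * y * D\<^sup>2" using y QD by simp
  then show "m\<^sup>2 * N\<^sup>2 \<le> 81 * y * D\<^sup>2" using t5 by linarith
qed

text \<open>
  The condition of the lower bound forces all error terms to be small. With \<open>M\<close> and
  \<open>n\<close> the larger and the smaller of \<open>p\<close> and \<open>q\<close>, and
  \<open>\<Lambda>\<close> the power of the constant, it reads \<open>\<Lambda> \<le> \<sigma> n \<surd>(n
  M)\<close>. As \<open>\<sigma> \<le> 2\<^sup>r/M\<close>, both \<open>n\<close> and \<open>n M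
  \<sigma>\<close> are large and \<open>\<sigma>\<close> is small. The constant is chosen such that
  \<open>\<Lambda> y\<^sup>2 = 4\<^sup>r\<close> for \<open>y = 10\<close> to the power \<open>-13 r\<close>,
  so that \<open>growth ^ r * y\<close> is small.
\<close>

lemma inv_sum_condition:
  fixes r p q :: nat and \<sigma> :: real
  assumes r: "r \<ge> 2" and p: "p > 0" and q: "q > 0"
    and \<sigma>: "(4 * 10 ^ 26) ^ r / (real (max p q) powr (1/2) * real (min p q) powr (3/2)) \<le> \<sigma>"
      "\<sigma> \<le> 2 ^ r / real (max p q)"
  defines "y \<equiv> 1 / (10 ^ 13) ^ r :: real"
  shows "1 \<le> y * real (min p q)" and "\<sigma> \<le> y * y" and "1 \<le> y * (real p * real q * \<sigma>)"
proof -
  define M n where "M = real (max p q)" and "n = real (min p q)"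
  define \<Lambda> :: real where "\<Lambda> = (4 * 10 ^ 26) ^ r"
  have n: "1 \<le> n" "n \<le> M" using p q by (auto simp: M_def n_def)
  have pq: "real p * real q = n * M" by (cases "p \<le> q") (auto simp: n_def M_def max_def min_def)
  have y0: "0 < y" by (simp add: y_def)
  have \<Lambda>y: "\<Lambda> * y * y = 4 ^ r"
  proof -
    have "\<Lambda> * y * y = (4 * 10 ^ 26 * (1 / 10 ^ 13) * (1 / 10 ^ 13)) ^ r"
      unfolding \<Lambda>_def y_def by (simp only: power_mult_distrib power_one_over)
    then show ?thesis by simp
  qed
  have y1: "y \<le> 1" unfolding y_def by simp
  have pow2: "(4::real) ^ r = 2 ^ r * 2 ^ r" by (simp add: power_mult_distrib[symmetric])
  have n32: "n powr (3/2) = n * sqrt n"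
  proof -
    have "n powr (3/2) = n powr (1 + 1/2)" by simp
    then show ?thesis using n by (subst (asm) powr_add) (simp add: powr_half_sqrt)
  qed
  have M12: "M powr (1/2) = sqrt M" using n by (simp add: powr_half_sqrt)
  have sM: "0 < sqrt M" "0 < sqrt n" "sqrt n \<le> sqrt M" using n by auto
  have sqM: "sqrt M * sqrt M = M" using n by simp
  have base: "\<Lambda> \<le> \<sigma> * (sqrt M * (n * sqrt n))"
    using \<sigma>(1)[folded \<Lambda>_def M_def n_def] n sM by (simp add: n32 M12 divide_le_eq)
  have \<Lambda>0: "0 < \<Lambda>" by (simp add: \<Lambda>_def)
  have \<sigma>0: "0 < \<sigma>"
  proof -
    have "0 < \<sigma> * (sqrt M * (n * sqrt n))" using base \<Lambda>0 by linarith
    then show ?thesis by (rule zero_less_mult_pos2) (use n sM in simp)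
  qed
  have "sqrt M * (n * sqrt n) \<le> sqrt M * (n * sqrt M)" using n sM by (intro mult_left_mono) auto
  also have "\<dots> = n * M" using sqM by (simp add: mult.left_commute)
  finally have "\<sigma> * (sqrt M * (n * sqrt n)) \<le> \<sigma> * (n * M)" using \<sigma>0 by (intro mult_left_mono) auto
  with base have nM: "\<Lambda> \<le> n * M * \<sigma>" by (simp add: mult_ac)
  have \<sigma>M: "\<sigma> * M \<le> 2 ^ r" using \<sigma>(2) n by (simp add: M_def[symmetric] le_divide_eq)
  have "\<Lambda> \<le> n * 2 ^ r"
  proof -
    have "n * M * \<sigma> = n * (\<sigma> * M)" by simp
    also have "\<dots> \<le> n * 2 ^ r" using \<sigma>M n by (intro mult_left_mono) auto
    finally show ?thesis using nM by linarith
  qed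
  note \<Lambda>n = this
  have one: "1 \<le> \<Lambda> * y / 2 ^ r"
  proof -
    have "y * 1 \<le> 1 * 2 ^ r" using y1 y0 by (intro mult_mono) auto
    then have "y \<le> 2 ^ r" by simp
    then have "y * 2 ^ r \<le> 4 ^ r" unfolding pow2 by (intro mult_right_mono) auto
    then have "y * 2 ^ r \<le> y * (\<Lambda> * y)" using \<Lambda>y by (simp add: mult_ac)
    then show ?thesis using y0 by (simp add: le_divide_eq)
  qed
  have "\<Lambda> * y / 2 ^ r \<le> y * n" using mult_left_mono[OF \<Lambda>n, of y] y0 by (simp add: divide_le_eq mult_ac)
  from order_trans[OF one this] show "1 \<le> y * real (min p q)" by (simp only: n_def)
  have "\<Lambda> * \<sigma> \<le> 4 ^ r"
  proof -
    have "\<Lambda> * \<sigma> \<le> n * 2 ^ r * \<sigma>" using \<Lambda>n \<sigma>0 by (intro mult_right_mono) auto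
    also have "\<dots> \<le> M * 2 ^ r * \<sigma>" using n \<sigma>0 by (intro mult_right_mono) auto
    also have "\<dots> = 2 ^ r * (\<sigma> * M)" by simp
    also have "\<dots> \<le> 2 ^ r * 2 ^ r" using \<sigma>M by (intro mult_left_mono) auto
    finally show ?thesis by (simp add: pow2)
  qed
  then have "\<Lambda> * \<sigma> \<le> \<Lambda> * (y * y)" using \<Lambda>y by (simp add: mult_ac)
  then show "\<sigma> \<le> y * y" using \<Lambda>0 by simp
  have "1 \<le> \<Lambda> * y"
  proof -
    have "\<Lambda> * y / 2 ^ r \<le> \<Lambda> * y / 1" using \<Lambda>0 y0 by (intro divide_left_mono) auto
    from order_trans[OF one this] show ?thesis by simp
  qed
  also have "\<Lambda> * y \<le> n * M * \<sigma> * y" using nM y0 by (intro mult_right_mono) auto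
  finally show "1 \<le> y * (real p * real q * \<sigma>)" unfolding pq by (simp add: mult_ac)
qed

text \<open>
  The event is that \<open>cross_stat\<close> exceeds half its mean under the chain, with half of the rows on
  each side of a pair and half of the columns in each group.
\<close>

lemma tv_dist_lower_bound:
  assumes r: "r \<ge> 2" and pos: "\<And>i. i \<le> r \<Longrightarrow> d i > 0" and wide: "\<And>i. i \<in> {1..r - 1} \<Longrightarrow> max (d 0) (d r) \<le> d i"
    and cond: "(4 * 10 ^ 26) ^ r / (real (max (d 0) (d r)) powr (1/2) * real (min (d 0) (d r)) powr (3/2)) \<le> (\<Sum>j=1..r - 1. 1 / real (d j))"
  shows "2 / 3 \<le> tv_dist (mat_borel (d 0) (d r)) (std_gaussian (chain_index r d)) (\<lambda>\<omega>. chain_product r d (chain_factor d \<omega>))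
      (std_gaussian ({..<d 0} \<times> {..<d r})) (scaled_gaussian (d 0) (d r) (d 1))"
proof -
  define p q K where "p = d 0" and "q = d r" and "K = r - 1"
  define m N where "m = p div 2" and "N = q div 2"
  define \<sigma> where "\<sigma> = inv_sum d K"
  define \<tau> where "\<tau> = sqrt \<sigma>"
  define y :: real where "y = 1 / (10 ^ 13) ^ r"
  have pq0: "p > 0" "q > 0" using pos[of 0] pos[of r] by (simp_all add: p_def q_def)
  have posK: "d i > 0" if "i \<le> K" for i using pos that by (simp add: K_def)
  have \<sigma>_eq: "\<sigma> = (\<Sum>j=1..r - 1. 1 / real (d j))" by (simp add: \<sigma>_def inv_sum_def K_def)
  have "\<sigma> \<le> (\<Sum>j=1..r - 1. 1 / real (max p q))"
    unfolding \<sigma>_eq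
  proof (intro sum_mono)
    fix j assume "j \<in> {1..r - 1}"
    then have "real (max p q) \<le> real (d j)" using wide[of j] unfolding p_def q_def of_nat_le_iff by simp
    then show "1 / real (d j) \<le> 1 / real (max p q)" using pq0 by (intro divide_left_mono) auto
  qed
  also have "\<dots> = real (r - 1) / real (max p q)" by simp
  also have "\<dots> \<le> 2 ^ r / real (max p q)"
  proof (intro divide_right_mono)
    have "r - 1 \<le> 2 ^ r" using less_exp[of r] by linarith
    then have "real (r - 1) \<le> real (2 ^ r)" unfolding of_nat_le_iff .
    then show "real (r - 1) \<le> 2 ^ r" by simp
  qed simp
  finally have \<sigma>up: "\<sigma> \<le> 2 ^ r / real (max p q)" .
  have \<sigma>low: "(4 * 10 ^ 26) ^ r / (real (max p q) powr (1/2) * real (min p q) powr (3/2)) \<le> \<sigma>"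
    using cond by (simp only: \<sigma>_eq p_def q_def)
  note ic = inv_sum_condition[OF r pq0 \<sigma>low \<sigma>up, folded y_def]
  have y: "0 < y" "y \<le> 1" unfolding y_def by simp_all
  have "1 / real (d 1) \<le> \<sigma>" unfolding \<sigma>_eq using r by (intro member_le_sum) auto
  moreover have "0 < 1 / real (d 1)" using pos[of 1] r by simp
  ultimately have \<sigma>0: "0 < \<sigma>" by linarith
  have \<tau>0: "0 < \<tau>" using \<sigma>0 by (simp add: \<tau>_def)
  have \<tau>\<sigma>: "\<sigma> = \<tau> * \<tau>" using \<sigma>0 by (simp add: \<tau>_def)
  have \<tau>y: "\<tau> \<le> y" using real_sqrt_le_mono[OF ic(2)] y by (simp add: \<tau>_def)
  then have \<tau>1: "\<tau> \<le> 1" using y by linarith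
  have y2: "2 * y \<le> 1"
  proof -
    have "(10 ^ 13 :: real) ^ 1 \<le> (10 ^ 13) ^ r" using r by (intro power_increasing) auto
    then show ?thesis by (simp add: y_def)
  qed
  have big: "2 \<le> p" "2 \<le> q"
  proof -
    have "2 * (y * 1) \<le> y * real (min p q)" using ic(1) y2 by linarith
    then have "2 \<le> real (min p q)" using y by simp
    then show "2 \<le> p" "2 \<le> q" by auto
  qed
  have half: "1 \<le> real (k div 2)" "real k \<le> 3 * real (k div 2)" "2 * (k div 2) \<le> k" if "2 \<le> k" for k :: nat
  proof -
    have "1 \<le> k div 2" "k \<le> 3 * (k div 2)" "2 * (k div 2) \<le> k" using that by linarith+
    then show "1 \<le> real (k div 2)" "real k \<le> 3 * real (k div 2)" "2 * (k div 2) \<le> k" by linarith+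
  qed
  note m = half[OF big(1), folded m_def] and N = half[OF big(2), folded N_def]
  have ym: "1 \<le> 3 * y * real m"
  proof -
    have "y * real (min p q) \<le> y * (3 * real m)" using y m(2) by (intro mult_left_mono) auto
    then show ?thesis using ic(1) by simp
  qed
  have yN: "1 \<le> 3 * y * real N"
  proof -
    have "y * real (min p q) \<le> y * (3 * real N)" using y N(2) by (intro mult_left_mono) auto
    then show ?thesis using ic(1) by simp
  qed
  have ymN: "1 \<le> 9 * y * (real m * real N * \<sigma>)"
  proof -
    have "real p * real q \<le> 3 * real m * (3 * real N)" using m N by (intro mult_mono) auto
    then have "y * (real p * real q * \<sigma>) \<le> y * (3 * real m * (3 * real N) * \<sigma>)"
      using y \<sigma>0 by (intro mult_left_mono mult_right_mono) auto
    then show ?thesis using ic(3) by (simp add: mult_ac)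
  qed
  have N0: "N > 0" using N(1) by simp
  let ?f = "\<lambda>\<omega>. cross_stat m N (mat_prod (d K) (prefix_product d K \<omega>) (layer (Suc K) \<omega>))"
  define D where "D = (\<integral>\<omega>. ?f \<omega> \<partial>gauss)"
  define H where "H = growth ^ K"
  have m0: "2 * m \<le> d 0" using m(3) by (simp add: p_def)
  note prem = posK N0 m0 \<tau>0 \<tau>1 \<sigma>_def[symmetric] \<tau>\<sigma>
  have Dge: "(real m)\<^sup>2 * (real N)\<^sup>2 * off_level d K \<le> D"
    unfolding D_def by (rule expectation_stat_ge[where d = d and K = K and m = m and N = N, OF posK N0 m0])
  have \<sigma>\<alpha>: "\<sigma> \<le> off_level d K" unfolding \<sigma>_def by (rule inv_sum_le_off_level)
  have D0: "0 < D"
  proof -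
    have "0 < (real m)\<^sup>2 * (real N)\<^sup>2 * off_level d K" using m N \<sigma>0 \<sigma>\<alpha> by (intro mult_pos_pos) auto
    then show ?thesis using Dge by linarith
  qed
  have H1: "1 \<le> H" unfolding H_def by (rule one_le_power) simp
  note ar = stat_variance_arith[OF m(1) ym N(1) yN \<sigma>0 ymN \<sigma>\<alpha> \<tau>y y H1 Dge]
  have f2: "(\<integral>\<omega>. (?f \<omega>)\<^sup>2 \<partial>gauss) \<le> (1 + 835 * (H * y)) * D\<^sup>2"
    by (rule order_trans[OF expectation_stat_square_le[where d = d and K = K and m = m and N = N, OF prem] ar(1)[unfolded H_def], folded H_def])
  have g2: "(\<integral>\<omega>. (cross_stat m N \<omega>)\<^sup>2 \<partial>gauss) \<le> 81 * y * D\<^sup>2"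
    unfolding expectation_null_stat_square[OF N0 m(3)] by (rule ar(2))
  have amg: "all_moments gauss (cross_stat m N)"
    by (rule all_moments_cross_stat) (rule all_moments_coord)
  have Hy: "H * y \<le> 1 / 10 ^ 6"
  proof -
    have "H \<le> growth ^ r" unfolding H_def K_def by (rule power_increasing) auto
    then have "H * y \<le> growth ^ r * y" using y by (intro mult_right_mono) auto
    also have "\<dots> = (1 / 10 ^ 3) ^ r"
      unfolding y_def by (simp add: power_divide[symmetric])
    also have "\<dots> \<le> (1 / 10 ^ 3) ^ 2" using r by (intro power_decreasing) auto
    finally show ?thesis by (simp add: power_divide)
  qed
  have yHy: "y \<le> H * y" using mult_right_mono[OF H1, of y] y by simp
  have "2 / 3 \<le> 1 - 4 * (835 * (H * y)) - 4 * (81 * y)" using Hy yHy by simp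
  also have "\<dots> \<le> (\<integral>\<omega>. exceeds ?f (D / 2) \<omega> \<partial>gauss) - (\<integral>\<omega>. exceeds (cross_stat m N) (D / 2) \<omega> \<partial>gauss)"
    by (rule second_moment_test[OF all_moments_prefix_stat amg D_def[symmetric] D0 f2 g2])
  also have "(\<integral>\<omega>. exceeds ?f (D / 2) \<omega> \<partial>gauss) = (\<integral>\<omega>. exceeds (cross_stat m N) (D / 2) (chain d (r - 1) 1 \<omega>) \<partial>gauss)"
  proof (intro Bochner_Integration.integral_cong refl)
    fix \<omega> :: layers
    have "?f \<omega> = cross_stat m N (chain d (r - 1) 1 \<omega>)"
      using prefix_product_chain[where d = d and k = K and j = 0 and \<omega> = \<omega>] m(3) N(3)
      by (intro blockD[OF block_cross_stat[OF m(3) N(3)]]) (simp add: p_def K_def One_nat_def)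
    then show "exceeds ?f (D / 2) \<omega> = exceeds (cross_stat m N) (D / 2) (chain d (r - 1) 1 \<omega>)" by (simp add: exceeds_def)
  qed
  also have "(\<integral>\<omega>. exceeds (cross_stat m N) (D / 2) (chain d (r - 1) 1 \<omega>) \<partial>gauss) - (\<integral>\<omega>. exceeds (cross_stat m N) (D / 2) \<omega> \<partial>gauss)
      \<le> tv_dist (mat_borel (d 0) (d r)) (std_gaussian (chain_index r d)) (\<lambda>\<omega>. chain_product r d (chain_factor d \<omega>))
        (std_gaussian ({..<d 0} \<times> {..<d r})) (scaled_gaussian (d 0) (d r) (d 1))"
    using r pos[of 1] m(3) N(3) unfolding p_def q_def
    by (intro test_le_tv_dist all_moments_measurable[OF amg] block_cross_stat) auto
  finally show ?thesis .
qed

theorem theorem1: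
  shows "\<exists>C1 C2 :: real. C1 > 0 \<and> C2 > 0 \<and>
    (\<forall>(r::nat) (d :: nat \<Rightarrow> nat) (p::nat) (q::nat).
       r \<ge> 2 \<longrightarrow> d 0 = p \<longrightarrow> d r = q \<longrightarrow> (\<forall>i\<le>r. d i > 0) \<longrightarrow> d (r - 1) = d 1 \<longrightarrow>
       (\<forall>i\<in>{1..r - 1}. d i \<ge> max p q) \<longrightarrow>
       (let dTV = tv_dist (mat_borel p q)
              (std_gaussian (chain_index r d)) (\<lambda>\<omega>. chain_product r d (chain_factor d \<omega>))
              (std_gaussian ({..<p} \<times> {..<q})) (scaled_gaussian p q (d 1))
        in dTV \<le> C1 * (\<Sum>i=1..r - 1. sqrt (real (p * q) / real (d i))) \<and>
           ((\<Sum>j=1..r - 1. 1 / real (d j))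
                \<ge> C2 ^ r / (real (max p q) powr (1/2) * real (min p q) powr (3/2))
              \<longrightarrow> dTV \<ge> 2/3)))"
proof (rule exI[of _ 25], rule exI[of _ "4 * 10 ^ 26"], intro conjI allI impI)
  fix r :: nat and d :: "nat \<Rightarrow> nat" and p q :: nat
  assume r: "r \<ge> 2" and p: "d 0 = p" and q: "d r = q" and pos: "\<forall>i\<le>r. d i > 0"
    and wide: "\<forall>i\<in>{1..r - 1}. d i \<ge> max p q"
  note upper = tv_dist_upper_bound[where d = d, OF r, unfolded p q]
    and lower = tv_dist_lower_bound[where d = d, OF r, unfolded p q]
  show "let dTV = tv_dist (mat_borel p q)
              (std_gaussian (chain_index r d)) (\<lambda>\<omega>. chain_product r d (chain_factor d \<omega>))
              (std_gaussian ({..<p} \<times> {..<q})) (scaled_gaussian p q (d 1))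
        in dTV \<le> 25 * (\<Sum>i=1..r - 1. sqrt (real (p * q) / real (d i))) \<and>
           ((\<Sum>j=1..r - 1. 1 / real (d j))
                \<ge> (4 * 10 ^ 26) ^ r / (real (max p q) powr (1/2) * real (min p q) powr (3/2))
              \<longrightarrow> dTV \<ge> 2/3)"
    unfolding Let_def using upper lower pos wide by blast
qed simp_all

end
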